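(* Let $p$ be a prime. The limit $$\lim_{n\to\infty}\mathbb{E}\left[Z_{\overline{\mathbb{Q}}_p\setminus\mathbb{Q}_p^{\mathrm{un}},n}\right]=\lim_{n\to\infty}\left(n-\mathbb{E}\left[Z_{\mathbb{Q}_p^{\mathrm{un}},n}\right]\right)$$ exists. Moreover, this limit is positive and no larger than $\frac{p(4p-3)}{(p-1)^3}$.
   Context: $\overline{\mathbb{Q}}_p$ is a fixed algebraic closure of $\mathbb{Q}_p$, and $\mathbb{Q}_p^{\mathrm{un}}\subset\overline{\mathbb{Q}}_p$ is the maximal unramified extension of $\mathbb{Q}_p$. $\mathrm{Mat}_n(\mathbb{Z}_p)$ is the space of $n\times n$ matrices over $\mathbb{Z}_p$, regarded as a probability space with the additive Haar probability measure. For $U\subset\overline{\mathbb{Q}}_p$ and $A\in\mathrm{Mat}_n(\mathbb{Z}_p)$, $Z_{U,n}=Z_{U,n}(A)$ denotes the number of eigenvalues of $A$ (in $\overline{\mathbb{Q}}_p$, counted with multiplicity) that lie in $U$; $\mathbb{E}$ is expectation over Haar-distributed $A$. *)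

theory Defs
  imports
    "HOL-Probability.Probability"
    "HOL-Algebra.Algebraic_Closure_Type"
    "Jordan_Normal_Form.Spectral_Radius"
    "Berlekamp_Zassenhaus.Finite_Field"
begin

section \<open>The ring of p-adic integers\<close>

text \<open>
  The prime is \<open>p = CARD('p)\<close> for a type \<open>'p\<close> of class \<open>prime_card\<close>.
  \<open>\<int>\<^sub>p\<close> is the inverse limit of the rings \<open>\<int>/p\<^sup>k\<int>\<close>; an element is its coherent
  sequence of least nonnegative residues modulo \<open>p\<^sup>k\<close>.
\<close>

typedef 'p padic_int =
  "{x :: nat \<Rightarrow> int. \<forall>k. x k \<in> {0..<int CARD('p::prime_card) ^ k} \<and>
      x (Suc k) mod int CARD('p) ^ k = x k}"
  morphisms residue Abs_padic_int
  by (rule exI[of _ "\<lambda>_. 0"]) (use prime_card_int[where 'a='p] in \<open>auto simp: prime_gt_0_int\<close>)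

setup_lifting type_definition_padic_int

lemma p_pos: "int CARD('p::prime_card) > 0"
  using prime_card_int[where 'a='p] prime_gt_0_int by blast

lemma coherentI:
  assumes "f (Suc k) mod int CARD('p::prime_card) ^ k = f k mod int CARD('p) ^ k"
  shows "f k mod int CARD('p) ^ k \<in> {0..<int CARD('p) ^ k} \<and>
      f (Suc k) mod int CARD('p) ^ Suc k mod int CARD('p) ^ k = f k mod int CARD('p) ^ k"
proof -
  have "f (Suc k) mod int CARD('p) ^ Suc k mod int CARD('p) ^ k = f (Suc k) mod int CARD('p) ^ k"
    by (rule mod_mod_cancel) simp
  then show "f k mod int CARD('p) ^ k \<in> {0..<int CARD('p) ^ k} \<and>
      f (Suc k) mod int CARD('p) ^ Suc k mod int CARD('p) ^ k = f k mod int CARD('p) ^ k"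
    using assms p_pos[where 'p='p] by simp
qed

lemma coherentD:
  assumes "\<And>k. x k \<in> {0..<int CARD('p::prime_card) ^ k} \<and>
      x (Suc k) mod int CARD('p) ^ k = x k"
  shows "x (Suc k) mod int CARD('p) ^ k = x k mod int CARD('p) ^ k"
  using conjunct2[OF assms, of k] by (metis mod_mod_trivial)

lemma residue_bounds: "0 \<le> residue (x :: 'p::prime_card padic_int) k" "residue x k < int CARD('p) ^ k"
  using residue[of x] by auto

lemma residue_mod_self: "residue (x :: 'p::prime_card padic_int) k mod int CARD('p) ^ k = residue x k"
  using residue_bounds[of x k] by simp

lemma residue_Suc: "residue (x :: 'p::prime_card padic_int) (Suc k) mod int CARD('p) ^ k = residue x k"
  using residue[of x] by auto

lemma residue_mono:
  "j \<le> k \<Longrightarrow> residue (x :: 'p::prime_card padic_int) k mod int CARD('p) ^ j = residue x j"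
proof (induction k rule: dec_induct)
  case base
  show ?case by (rule residue_mod_self)
next
  case (step k)
  have "residue x (Suc k) mod int CARD('p) ^ j
      = residue x (Suc k) mod int CARD('p) ^ k mod int CARD('p) ^ j"
    using step.hyps by (simp add: mod_mod_cancel le_imp_power_dvd)
  then show ?case using step residue_Suc by metis
qed

lemma residue_eq_mono:
  fixes x y :: "'p::prime_card padic_int"
  assumes "residue x l = residue y l" "k \<le> l"
  shows "residue x k = residue y k"
  by (metis assms residue_mono)

instantiation padic_int :: (prime_card) comm_ring_1
begin

lift_definition zero_padic_int :: "'a padic_int" is "\<lambda>_. 0"
  using p_pos[where 'p='a] by auto

lift_definition one_padic_int :: "'a padic_int" is "\<lambda>k. 1 mod int CARD('a) ^ k"
  by (intro coherentI refl)

lift_definition plus_padic_int :: "'a padic_int \<Rightarrow> 'a padic_int \<Rightarrow> 'a padic_int"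
  is "\<lambda>x y k. (x k + y k) mod int CARD('a) ^ k"
  by (intro coherentI mod_add_cong coherentD)

lift_definition minus_padic_int :: "'a padic_int \<Rightarrow> 'a padic_int \<Rightarrow> 'a padic_int"
  is "\<lambda>x y k. (x k - y k) mod int CARD('a) ^ k"
  by (intro coherentI mod_diff_cong coherentD)

lift_definition uminus_padic_int :: "'a padic_int \<Rightarrow> 'a padic_int"
  is "\<lambda>x k. (- x k) mod int CARD('a) ^ k"
  by (intro coherentI mod_minus_cong coherentD)

lift_definition times_padic_int :: "'a padic_int \<Rightarrow> 'a padic_int \<Rightarrow> 'a padic_int"
  is "\<lambda>x y k. (x k * y k) mod int CARD('a) ^ k"
  by (intro coherentI mod_mult_cong coherentD)

instance
proof
  fix a b c :: "'a padic_int"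
  show "a * b * c = a * (b * c)"
    by transfer (simp add: mod_simps mult.assoc)
  show "a * b = b * a"
    by transfer (simp add: mult.commute)
  show "1 * a = a"
    by transfer (auto simp: mod_simps)
  show "a + b + c = a + (b + c)"
    by transfer (simp add: mod_simps add.assoc)
  show "a + b = b + a"
    by transfer (simp add: add.commute)
  show "0 + a = a"
    by transfer auto
  show "- a + a = 0"
    by transfer (simp add: mod_simps)
  show "a - b = a + - b"
    by transfer (simp add: mod_simps)
  show "(a + b) * c = a * c + b * c"
    by transfer (simp add: mod_simps distrib_right)
  show "(0 :: 'a padic_int) \<noteq> 1"
  proof
    assume "(0 :: 'a padic_int) = 1"
    then have "residue (0 :: 'a padic_int) 1 = residue (1 :: 'a padic_int) 1" by simp
    then show False
      using prime_gt_1_int[OF prime_card_int[where 'a='a]]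
      by (simp add: zero_padic_int.rep_eq one_padic_int.rep_eq)
  qed
qed

end

instance padic_int :: (prime_card) idom
proof
  fix a b :: "'a padic_int"
  let ?p = "int CARD('a)"
  assume "a \<noteq> 0" "b \<noteq> 0"
  then obtain i j where ij: "residue a i \<noteq> 0" "residue b j \<noteq> 0"
    by (metis residue_inject zero_padic_int.rep_eq ext)
  define u v where "u = residue a (i + j)" and "v = residue b (i + j)"
  have u: "\<not> ?p ^ i dvd u" and v: "\<not> ?p ^ j dvd v"
    using residue_mono[of i "i + j" a] residue_mono[of j "i + j" b] ij
    by (auto simp: u_def v_def mod_eq_0_iff_dvd[symmetric])
  have "u \<noteq> 0" "v \<noteq> 0" using u v by auto
  have "\<not> is_unit ?p" "?p \<noteq> 0"
    using prime_card_int[where 'a='a] by (auto simp: not_prime_unit)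
  have "multiplicity ?p u < i" "multiplicity ?p v < j"
    using u v \<open>u \<noteq> 0\<close> \<open>v \<noteq> 0\<close> \<open>\<not> is_unit ?p\<close>
    by (simp_all add: power_dvd_iff_le_multiplicity)
  then have "multiplicity ?p (u * v) < i + j"
    using prime_card_int[where 'a='a] \<open>u \<noteq> 0\<close> \<open>v \<noteq> 0\<close>
    by (simp add: prime_elem_multiplicity_mult_distrib)
  then have "\<not> ?p ^ (i + j) dvd u * v"
    using \<open>u \<noteq> 0\<close> \<open>v \<noteq> 0\<close> \<open>\<not> is_unit ?p\<close> by (simp add: power_dvd_iff_le_multiplicity)
  then have "residue (a * b) (i + j) \<noteq> 0"
    by (simp add: times_padic_int.rep_eq u_def v_def mod_eq_0_iff_dvd)
  then show "a * b \<noteq> 0" by (auto simp: zero_padic_int.rep_eq)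
qed

text \<open>The p-adic topology: the residue classes modulo \<open>p\<^sup>k\<close> form a basis.\<close>

instantiation padic_int :: (prime_card) topological_space
begin

definition open_padic_int :: "'a padic_int set \<Rightarrow> bool" where
  "open_padic_int U \<longleftrightarrow> (\<forall>x\<in>U. \<exists>k. {y :: 'a padic_int. residue y k = residue x k} \<subseteq> U)"

instance
proof
  show "open (UNIV :: 'a padic_int set)"
    by (simp add: open_padic_int_def)
  fix S T :: "'a padic_int set"
  assume ST: "open S" "open T"
  show "open (S \<inter> T)"
    unfolding open_padic_int_def
  proof
    fix x assume "x \<in> S \<inter> T"
    then obtain k l where kl: "{y. residue y k = residue x k} \<subseteq> S" "{y. residue y l = residue x l} \<subseteq> T"
      using ST unfolding open_padic_int_def by blast
    have "{y. residue y (max k l) = residue x (max k l)} \<subseteq> S \<inter> T"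
    proof
      fix y :: "'a padic_int"
      assume "y \<in> {y. residue y (max k l) = residue x (max k l)}"
      then have "residue y k = residue x k" "residue y l = residue x l"
        using residue_eq_mono[of y "max k l" x] by simp_all
      with kl show "y \<in> S \<inter> T" by blast
    qed
    then show "\<exists>k. {y. residue y k = residue x k} \<subseteq> S \<inter> T" by blast
  qed
next
  fix K :: "'a padic_int set set"
  assume "\<forall>S\<in>K. open S"
  then show "open (\<Union>K)"
    unfolding open_padic_int_def by (meson Union_iff Union_upper order_trans)
qed

end

section \<open>The field of p-adic numbers and its algebraic closure\<close>

type_synonym 'p padic = "'p padic_int fract"
type_synonym 'p padic_closure = "'p padic alg_closure"

abbreviation of_padic_int :: "'p::prime_card padic_int \<Rightarrow> 'p padic_closure" where
  "of_padic_int x \<equiv> to_ac (to_fract x)"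

section \<open>The maximal unramified extension\<close>

definition finite_extension :: "'p::prime_card padic_closure set \<Rightarrow> bool" where
  "finite_extension K \<longleftrightarrow>
     range to_ac \<subseteq> K \<and>
     (\<forall>x\<in>K. \<forall>y\<in>K. x - y \<in> K \<and> x * y \<in> K) \<and>
     (\<forall>x\<in>K. inverse x \<in> K) \<and>
     (\<exists>B. finite B \<and> (\<forall>x\<in>K. \<exists>c. x = (\<Sum>b\<in>B. to_ac (c b) * b)))"

text \<open>The integral closure of \<open>\<int>\<^sub>p\<close> in \<open>K\<close>.\<close>

definition ring_of_integers :: "'p::prime_card padic_closure set \<Rightarrow> 'p padic_closure set" where
  "ring_of_integers K =
     {x \<in> K. \<exists>f. Polynomial.lead_coeff f = 1 \<and> poly (map_poly of_padic_int f) x = 0}"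

text \<open>
  Ramification index 1: \<open>p\<close> generates the maximal ideal of the local ring \<open>R\<close>, which consists
  of the nonunits. Separability of the residue field extension is automatic, as residue
  fields are finite.
\<close>

definition unramified :: "'p::prime_card padic_closure set \<Rightarrow> bool" where
  "unramified K \<longleftrightarrow>
     (let R = ring_of_integers K in
       (\<lambda>x. of_nat CARD('p) * x) ` R = {x \<in> R. \<forall>y\<in>R. x * y \<noteq> 1})"

definition maximal_unramified :: "'p::prime_card padic_closure set" where
  "maximal_unramified = \<Union>{K. finite_extension K \<and> unramified K}"

section \<open>Haar measure on matrices over the p-adic integers\<close>

definition mat_topology :: "nat \<Rightarrow> 'p::prime_card padic_int mat topology" where
  "mat_topology n =
     pullback_topology (carrier_mat n n) (\<lambda>A. \<lambda>ij\<in>{..<n} \<times> {..<n}. A $$ ij)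
       (product_topology (\<lambda>_. euclidean) ({..<n} \<times> {..<n}))"

definition is_haar_prob :: "nat \<Rightarrow> 'p::prime_card padic_int mat measure \<Rightarrow> bool" where
  "is_haar_prob n M \<longleftrightarrow>
     prob_space M \<and> space M = carrier_mat n n \<and>
     sets M = sigma_sets (carrier_mat n n) {U. openin (mat_topology n) U} \<and>
     (\<forall>B\<in>carrier_mat n n. \<forall>S\<in>sets M. emeasure M ((\<lambda>A. B + A) ` S) = emeasure M S)"

definition haar_mat :: "nat \<Rightarrow> 'p::prime_card padic_int mat measure" where
  "haar_mat n = (THE M. is_haar_prob n M)"

subsection \<open>Existence and uniqueness of Haar measure\<close>

definition mat_ball :: "nat \<Rightarrow> nat \<Rightarrow> 'p::prime_card padic_int mat \<Rightarrow> 'p padic_int mat set" where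
  "mat_ball n k A = {B \<in> carrier_mat n n.
     \<forall>i<n. \<forall>j<n. residue (B $$ (i, j)) k = residue (A $$ (i, j)) k}"

lemma mat_ball_subset: "mat_ball n k A \<subseteq> carrier_mat n n"
  by (auto simp: mat_ball_def)

lemma mat_ball_self: "A \<in> carrier_mat n n \<Longrightarrow> A \<in> mat_ball n k A"
  by (auto simp: mat_ball_def)

lemma mat_ball_0: "mat_ball n 0 A = carrier_mat n n"
proof -
  have "residue (x :: 'a padic_int) 0 = 0" for x
    using residue_bounds[of x 0] by simp
  then show ?thesis by (simp add: mat_ball_def)
qed

lemma mat_ball_mono: "k \<le> l \<Longrightarrow> mat_ball n l A \<subseteq> mat_ball n k A"
  by (auto simp: mat_ball_def intro: residue_eq_mono)

lemma mat_ball_eq: "B \<in> mat_ball n k A \<Longrightarrow> mat_ball n k B = mat_ball n k A"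
  by (auto simp: mat_ball_def)

lemma openin_mat_topology_subset: "openin (mat_topology n) U \<Longrightarrow> U \<subseteq> carrier_mat n n"
  by (auto simp: mat_topology_def openin_pullback_topology)

lemma openin_mat_ball:
  fixes A :: "'p::prime_card padic_int mat"
  shows "openin (mat_topology n) (mat_ball n k A)"
proof -
  let ?I = "{..<n} \<times> {..<n}"
  let ?V = "PiE ?I (\<lambda>ij. {y :: 'p padic_int. residue y k = residue (A $$ ij) k})"
  have "open {y :: 'p padic_int. residue y k = residue (A $$ ij) k}" for ij
    unfolding open_padic_int_def by (intro ballI exI[of _ k]) auto
  then have "openin (product_topology (\<lambda>_. euclidean) ?I) ?V"
    unfolding openin_PiE[OF finite_cartesian_product[OF finite_lessThan finite_lessThan]]
    by (intro disjI2 ballI) (simp only: open_openin)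
  moreover have "mat_ball n k A = (\<lambda>A. \<lambda>ij\<in>?I. A $$ ij) -` ?V \<inter> carrier_mat n n"
  proof -
    have "(\<lambda>ij\<in>?I. B $$ ij) \<in> ?V \<longleftrightarrow> (\<forall>i<n. \<forall>j<n. residue (B $$ (i, j)) k = residue (A $$ (i, j)) k)"
      for B
    proof
      assume *: "(\<lambda>ij\<in>?I. B $$ ij) \<in> ?V"
      show "\<forall>i<n. \<forall>j<n. residue (B $$ (i, j)) k = residue (A $$ (i, j)) k"
      proof (intro allI impI)
        fix i j assume "i < n" "j < n"
        then show "residue (B $$ (i, j)) k = residue (A $$ (i, j)) k"
          using PiE_mem[OF *, of "(i, j)"] by simp
      qed
    next
      assume *: "\<forall>i<n. \<forall>j<n. residue (B $$ (i, j)) k = residue (A $$ (i, j)) k"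
      show "(\<lambda>ij\<in>?I. B $$ ij) \<in> ?V"
      proof (rule PiE_I)
        fix ij assume "ij \<in> ?I"
        then show "(\<lambda>ij\<in>?I. B $$ ij) ij \<in> {y. residue y k = residue (A $$ ij) k}"
          using * by (cases ij) simp
      qed simp
    qed
    then show ?thesis unfolding mat_ball_def by blast
  qed
  ultimately show ?thesis
    unfolding mat_topology_def openin_pullback_topology by blast
qed

lemma openin_mat_topology_ball:
  assumes U: "openin (mat_topology n) U" and A: "A \<in> U"
  obtains k where "mat_ball n k A \<subseteq> U"
proof -
  let ?I = "{..<n} \<times> {..<n}"
  let ?f = "\<lambda>A. \<lambda>ij\<in>?I. A $$ ij"
  obtain W where W: "openin (product_topology (\<lambda>_. euclidean) ?I) W"
      "U = ?f -` W \<inter> carrier_mat n n"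
    using U unfolding mat_topology_def openin_pullback_topology by blast
  obtain V where V: "\<And>ij. ij \<in> ?I \<Longrightarrow> open (V ij)" "?f A \<in> PiE ?I V" "PiE ?I V \<subseteq> W"
  proof -
    have "?f A \<in> W" using W(2) A by blast
    with W(1) have "\<exists>V. finite {ij \<in> ?I. V ij \<noteq> topspace euclidean} \<and>
        (\<forall>ij\<in>?I. openin euclidean (V ij)) \<and> ?f A \<in> PiE ?I V \<and> PiE ?I V \<subseteq> W"
      unfolding openin_product_topology_alt by (rule bspec)
    then obtain V where "\<forall>ij\<in>?I. openin euclidean (V ij)" "?f A \<in> PiE ?I V" "PiE ?I V \<subseteq> W"
      by (elim exE conjE)
    then show thesis by (intro that[of V]) (simp_all only: open_openin)
  qed
  have "\<forall>ij\<in>?I. \<exists>k. {y. residue y k = residue (A $$ ij) k} \<subseteq> V ij"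
  proof
    fix ij assume ij: "ij \<in> ?I"
    have "?f A ij \<in> V ij" using V(2) ij by (rule PiE_mem)
    then have "A $$ ij \<in> V ij" using ij by simp
    then show "\<exists>k. {y. residue y k = residue (A $$ ij) k} \<subseteq> V ij"
      using V(1)[OF ij] unfolding open_padic_int_def by blast
  qed
  then obtain K where K: "\<And>ij. ij \<in> ?I \<Longrightarrow> {y. residue y (K ij) = residue (A $$ ij) (K ij)} \<subseteq> V ij"
    by metis
  define k where "k = Max (insert 0 (K ` ?I))"
  have k: "K ij \<le> k" if "ij \<in> ?I" for ij
    using that by (auto simp: k_def intro!: Max_ge)
  have "mat_ball n k A \<subseteq> U"
  proof
    fix B assume B: "B \<in> mat_ball n k A"
    have "B $$ ij \<in> V ij" if "ij \<in> ?I" for ij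
      using K[OF that] k[OF that] B that residue_eq_mono[of "B $$ ij" k "A $$ ij" "K ij"]
      by (auto simp: mat_ball_def)
    then have "?f B \<in> PiE ?I V" by auto
    then have "?f B \<in> W" using V(3) by blast
    moreover have "B \<in> carrier_mat n n" using B by (simp add: mat_ball_def)
    ultimately show "B \<in> U" unfolding W(2) by blast
  qed
  then show thesis by (rule that)
qed

definition mat_balls :: "nat \<Rightarrow> 'p::prime_card padic_int mat set set" where
  "mat_balls n = (\<Union>k. mat_ball n k ` carrier_mat n n)"

lemma finite_mat_balls_level:
  "finite (mat_ball n k ` (carrier_mat n n :: 'p::prime_card padic_int mat set))"
proof -
  let ?I = "{..<n} \<times> {..<n}"
  define g where "g = (\<lambda>A :: 'p padic_int mat. \<lambda>ij\<in>?I. residue (A $$ ij) k)"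
  define h where "h = (\<lambda>r. {B \<in> carrier_mat n n. g B = r})"
  have g: "g A \<in> PiE ?I (\<lambda>_. {0..<int CARD('p) ^ k})" for A
    using residue_bounds by (auto simp: g_def)
  have "mat_ball n k A = h (g A)" for A
    by (auto simp: mat_ball_def h_def g_def fun_eq_iff restrict_def)
  then have "mat_ball n k ` carrier_mat n n \<subseteq> h ` PiE ?I (\<lambda>_. {0..<int CARD('p) ^ k})"
    using g by auto
  then show ?thesis
    by (rule finite_subset) (intro finite_imageI finite_PiE; simp)
qed

lemma countable_mat_balls: "countable (mat_balls n)"
  unfolding mat_balls_def
  by (intro countable_UN) (auto intro: countable_finite finite_mat_balls_level)

lemma sigma_mat_topology_eq:
  "sigma_sets (carrier_mat n n) {U. openin (mat_topology n) U}
     = sigma_sets (carrier_mat n n) (mat_balls n)"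
proof (rule sigma_sets_eqI)
  fix U :: "'a padic_int mat set"
  assume "U \<in> {U. openin (mat_topology n) U}"
  then have U: "openin (mat_topology n) U" by simp
  have "U = \<Union>{S \<in> mat_balls n. S \<subseteq> U}"
  proof (intro equalityI subsetI)
    fix A assume "A \<in> U"
    moreover from this have "A \<in> carrier_mat n n" using openin_mat_topology_subset[OF U] by blast
    moreover obtain k where "mat_ball n k A \<subseteq> U"
      using openin_mat_topology_ball[OF U \<open>A \<in> U\<close>] .
    ultimately show "A \<in> \<Union>{S \<in> mat_balls n. S \<subseteq> U}"
      unfolding mat_balls_def using mat_ball_self by blast
  qed auto
  moreover have "countable {S \<in> mat_balls n. S \<subseteq> U}"
    by (rule countable_subset[OF _ countable_mat_balls]) auto
  ultimately show "U \<in> sigma_sets (carrier_mat n n) (mat_balls n)"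
    by (metis (no_types, lifting) sigma_sets_UNION mem_Collect_eq sigma_sets.Basic)
next
  fix S :: "'a padic_int mat set"
  assume "S \<in> mat_balls n"
  then show "S \<in> sigma_sets (carrier_mat n n) {U. openin (mat_topology n) U}"
    using openin_mat_ball by (auto simp: mat_balls_def intro!: sigma_sets.Basic)
qed

lemma mat_measure_eqI:
  fixes M N :: "'p::prime_card padic_int mat measure"
  assumes M: "prob_space M" "sets M = sigma_sets (carrier_mat n n) (mat_balls n)"
    and N: "sets N = sigma_sets (carrier_mat n n) (mat_balls n)"
    and eq: "\<And>k A. A \<in> carrier_mat n n \<Longrightarrow> emeasure M (mat_ball n k A) = emeasure N (mat_ball n k A)"
  shows "M = N"
proof -
  interpret prob_space M by fact
  let ?E = "insert {} (mat_balls n) :: 'p padic_int mat set set"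
  have sub: "mat_balls n \<subseteq> Pow (carrier_mat n n)"
    unfolding mat_balls_def using mat_ball_subset by auto
  have E: "sigma_sets (carrier_mat n n) (mat_balls n) = sigma_sets (carrier_mat n n) ?E"
    by (rule sigma_sets_eqI) (auto intro: sigma_sets.intros)
  have int: "mat_ball n k A \<inter> mat_ball n l B \<in> ?E"
    if "A \<in> carrier_mat n n" "B \<in> carrier_mat n n" "k \<le> l" for k l and A B :: "'p padic_int mat"
  proof (cases "mat_ball n k A \<inter> mat_ball n l B = {}")
    case False
    then obtain C where C: "C \<in> mat_ball n k A" "C \<in> mat_ball n l B" by blast
    then have "mat_ball n k A = mat_ball n k C" "mat_ball n l B = mat_ball n l C"
      using mat_ball_eq by metis+
    then have "mat_ball n k A \<inter> mat_ball n l B = mat_ball n l C"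
      using mat_ball_mono[OF \<open>k \<le> l\<close>, of n C] by blast
    moreover have "C \<in> carrier_mat n n" using C mat_ball_subset by blast
    ultimately show ?thesis by (auto simp: mat_balls_def)
  qed simp
  have "Int_stable ?E"
  proof (rule Int_stableI)
    fix S T assume "S \<in> ?E" "T \<in> ?E"
    then consider "S = {} \<or> T = {}"
      | k A l B where "S = mat_ball n k A" "T = mat_ball n l B" "A \<in> carrier_mat n n" "B \<in> carrier_mat n n"
      unfolding mat_balls_def by blast
    then show "S \<inter> T \<in> ?E"
    proof cases
      case 2
      then show ?thesis using int[of A B k l] int[of B A l k]
        by (metis Int_commute nle_le)
    qed auto
  qed
  then show ?thesis
  proof (rule measure_eqI_generator_eq[where A = "\<lambda>_. carrier_mat n n" and \<Omega> = "carrier_mat n n"])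
    show "?E \<subseteq> Pow (carrier_mat n n)" using sub by auto
    show "sets M = sigma_sets (carrier_mat n n) ?E" "sets N = sigma_sets (carrier_mat n n) ?E"
      using M N E by simp_all
    show "emeasure M S = emeasure N S" if "S \<in> ?E" for S
      using that eq by (auto simp: mat_balls_def)
    have "carrier_mat n n \<in> mat_ball n 0 ` (carrier_mat n n :: 'p padic_int mat set)"
      by (intro image_eqI[where x = "0\<^sub>m n n"]) (auto simp: mat_ball_0)
    then show "range (\<lambda>_. carrier_mat n n) \<subseteq> ?E"
      by (auto simp: mat_balls_def)
    show "emeasure M (carrier_mat n n) \<noteq> \<infinity>" by simp
  qed auto
qed

lemma mat_ball_translate:
  assumes "A \<in> carrier_mat n n" "B \<in> carrier_mat n n"
  shows "(\<lambda>A. B + A) ` mat_ball n k A = mat_ball n k (B + A)"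
proof -
  have res: "residue (x + y) k = residue (x + z) k \<longleftrightarrow> residue y k = residue z k"
    for x y z :: "'a padic_int"
  proof
    assume "residue (x + y) k = residue (x + z) k"
    then have "residue (- x + (x + y)) k = residue (- x + (x + z)) k"
      by (simp only: plus_padic_int.rep_eq)
    then show "residue y k = residue z k" by simp
  next
    assume "residue y k = residue z k"
    then show "residue (x + y) k = residue (x + z) k"
      by (simp only: plus_padic_int.rep_eq)
  qed
  show ?thesis
  proof (intro equalityI subsetI)
    fix C assume "C \<in> (\<lambda>A. B + A) ` mat_ball n k A"
    then show "C \<in> mat_ball n k (B + A)"
      using assms by (auto simp: mat_ball_def res)
  next
    fix C assume C: "C \<in> mat_ball n k (B + A)"
    then have "C = B + (C - B)"
      using assms by (intro eq_matI) (auto simp: mat_ball_def)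
    moreover have "C - B \<in> mat_ball n k A"
    proof -
      have "residue (C $$ (i, j) - B $$ (i, j)) k = residue (A $$ (i, j)) k" if "i < n" "j < n" for i j
        using that C assms res[of "B $$ (i, j)" "C $$ (i, j) - B $$ (i, j)" "A $$ (i, j)"]
        by (auto simp: mat_ball_def)
      then show ?thesis using C assms by (auto simp: mat_ball_def)
    qed
    ultimately show "C \<in> (\<lambda>A. B + A) ` mat_ball n k A" by blast
  qed
qed

lemma is_haar_prob_ball:
  fixes M :: "'p::prime_card padic_int mat measure"
  assumes M: "is_haar_prob n M" and A: "A \<in> carrier_mat n n"
  shows "emeasure M (mat_ball n k A)
           = 1 / of_nat (card (mat_ball n k ` (carrier_mat n n :: 'p padic_int mat set)))"
proof -
  interpret prob_space M using M by (simp add: is_haar_prob_def)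
  have sets: "mat_ball n k B \<in> sets M" for B
    using M openin_mat_ball[of n k B] by (auto simp: is_haar_prob_def)
  have eq: "emeasure M (mat_ball n k B) = emeasure M (mat_ball n k A)" if "B \<in> carrier_mat n n" for B
  proof -
    have "B = (B - A) + A" using A that by (intro eq_matI) auto
    then have "mat_ball n k B = (\<lambda>C. (B - A) + C) ` mat_ball n k A"
      using mat_ball_translate[OF A, of "B - A" k] A that by (metis minus_carrier_mat)
    moreover have "B - A \<in> carrier_mat n n" using A by auto
    ultimately show ?thesis using M sets[of A] by (simp add: is_haar_prob_def)
  qed
  let ?L = "mat_ball n k ` (carrier_mat n n :: 'p padic_int mat set)"
  have "1 = emeasure M (\<Union>?L)"
  proof -
    have "\<Union>?L = space M"
    proof -
      have "\<Union>?L = carrier_mat n n" using mat_ball_self mat_ball_subset by blast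
      then show ?thesis using M by (simp add: is_haar_prob_def)
    qed
    then show ?thesis by (simp add: emeasure_space_1)
  qed
  also have "\<dots> = (\<Sum>S\<in>?L. emeasure M S)"
  proof -
    have "disjoint ?L"
      unfolding disjoint_def using mat_ball_eq by blast
    then have "disjoint_family_on (\<lambda>S. S) ?L"
      by (auto simp: disjoint_family_on_def disjoint_def)
    then have "(\<Sum>S\<in>?L. emeasure M S) = emeasure M (\<Union>S\<in>?L. S)"
      using sets finite_mat_balls_level[of n k] by (intro sum_emeasure) auto
    then show ?thesis by simp
  qed
  also have "\<dots> = (\<Sum>S\<in>?L. emeasure M (mat_ball n k A))"
    by (rule sum.cong) (use eq in auto)
  also have "\<dots> = of_nat (card ?L) * emeasure M (mat_ball n k A)" by simp
  finally have 1: "of_nat (card ?L) * emeasure M (mat_ball n k A) = 1" by simp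
  have "card ?L \<noteq> 0" using A finite_mat_balls_level[of n k] by (auto simp: card_eq_0_iff)
  then have "emeasure M (mat_ball n k A) = emeasure M (mat_ball n k A) * of_nat (card ?L) / of_nat (card ?L)"
    by (intro ennreal_mult_divide_eq[symmetric]) auto
  then show ?thesis using 1 by (simp only: mult.commute)
qed

lemma is_haar_prob_unique: "is_haar_prob n M \<Longrightarrow> is_haar_prob n N \<Longrightarrow> M = N"
  by (rule mat_measure_eqI[of _ n])
     (auto simp: is_haar_prob_ball, auto simp: is_haar_prob_def sigma_mat_topology_eq)

text \<open>Existence: matrices whose entries have independent uniform base-p digits.\<close>

definition digit :: "'p::prime_card padic_int \<Rightarrow> nat \<Rightarrow> int" where
  "digit x l = residue x (Suc l) div int CARD('p) ^ l"

lemma residue_Suc_digit: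
  "residue (x :: 'p::prime_card padic_int) (Suc l) = digit x l * int CARD('p) ^ l + residue x l"
  using residue_Suc[of x l] by (metis digit_def div_mult_mod_eq)

lemma digit_bounds: "digit (x :: 'p::prime_card padic_int) l \<in> {0..<int CARD('p)}"
proof -
  have "digit x l * int CARD('p) ^ l < int CARD('p) * int CARD('p) ^ l"
    using residue_Suc_digit[of x l] residue_bounds(2)[of x "Suc l", unfolded power_Suc]
      residue_bounds(1)[of x l] by linarith
  then have "digit x l < int CARD('p)"
    using p_pos[where 'p='p] by (simp only: mult_less_cancel_right) auto
  moreover have "0 \<le> digit x l"
    unfolding digit_def using residue_bounds(1)[of x "Suc l"] p_pos[where 'p='p]
    by (intro div_int_pos_iff[THEN iffD2]) auto
  ultimately show ?thesis by simp
qed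

lemma residue_eq_iff_digit:
  fixes x y :: "'p::prime_card padic_int"
  shows "residue x k = residue y k \<longleftrightarrow> (\<forall>l<k. digit x l = digit y l)"
proof
  assume *: "residue x k = residue y k"
  show "\<forall>l<k. digit x l = digit y l"
  proof (intro allI impI)
    fix l assume "l < k"
    then have "residue x (Suc l) = residue y (Suc l)" using residue_eq_mono[OF *] by simp
    then show "digit x l = digit y l" by (simp add: digit_def)
  qed
next
  assume "\<forall>l<k. digit x l = digit y l"
  then show "residue x k = residue y k"
  proof (induction k)
    case 0
    then show ?case using residue_bounds[of x 0] residue_bounds[of y 0] by simp
  next
    case (Suc k)
    then show ?case by (simp add: residue_Suc_digit)
  qed
qed

lift_definition from_digits :: "(nat \<Rightarrow> int) \<Rightarrow> 'p::prime_card padic_int"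
  is "\<lambda>d k. \<Sum>l<k. d l mod int CARD('p) * int CARD('p) ^ l"
proof -
  fix d :: "nat \<Rightarrow> int" and k
  let ?p = "int CARD('p)"
  let ?s = "\<lambda>k. \<Sum>l<k. d l mod ?p * ?p ^ l"
  have b: "?s k \<in> {0..<?p ^ k}" for k
  proof (induction k)
    case (Suc k)
    have "d k mod ?p * ?p ^ k \<le> (?p - 1) * ?p ^ k"
      using p_pos[where 'p='p] pos_mod_bound[of ?p "d k"] by (intro mult_right_mono) auto
    moreover have "0 \<le> d k mod ?p * ?p ^ k" using p_pos[where 'p='p] by simp
    ultimately show ?case using Suc by (simp add: left_diff_distrib)
  qed simp
  moreover have "?s (Suc k) mod ?p ^ k = ?s k"
    using b[of k] by simp
  ultimately show "?s k \<in> {0..<?p ^ k} \<and> ?s (Suc k) mod ?p ^ k = ?s k" by blast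
qed

lemma digit_from_digits: "digit (from_digits d :: 'p::prime_card padic_int) l = d l mod int CARD('p)"
proof -
  have "digit (from_digits d :: 'p padic_int) l * int CARD('p) ^ l
      = d l mod int CARD('p) * int CARD('p) ^ l"
    using residue_Suc_digit[of "from_digits d :: 'p padic_int" l] by (simp add: from_digits.rep_eq)
  then show ?thesis using p_pos[where 'p='p] by simp
qed

lemma ex_is_haar_prob: "\<exists>M :: 'p::prime_card padic_int mat measure. is_haar_prob n M"
proof -
  let ?p = "int CARD('p)"
  let ?C = "carrier_mat n n :: 'p padic_int mat set"
  define D where "D = measure_pmf (pmf_of_set {0..<?p})"
  define P where "P = Pi\<^sub>M (UNIV :: (nat \<times> nat \<times> nat) set) (\<lambda>_. D)"
  interpret D: prob_space D by (simp add: D_def prob_space_measure_pmf)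
  interpret P: product_prob_space "\<lambda>_. D" "UNIV :: (nat \<times> nat \<times> nat) set" by unfold_locales
  have P: "prob_space P" unfolding P_def by (rule P.prob_space_axioms)
  have D1: "emeasure D {d. d mod ?p = c} = ennreal (1 / ?p)" if "c \<in> {0..<?p}" for c
  proof -
    have "{0..<?p} \<inter> {d. d mod ?p = c} = {c}" using that by auto
    then show ?thesis using p_pos[where 'p='p] unfolding D_def
      by (subst emeasure_pmf_of_set) auto
  qed
  define N where "N = sigma ?C (mat_balls n)"
  have sub: "mat_balls n \<subseteq> Pow ?C"
    unfolding mat_balls_def using mat_ball_subset by auto
  have N: "space N = ?C" "sets N = sigma_sets ?C (mat_balls n)"
    using sub by (simp_all add: N_def)
  define mk :: "(nat \<times> nat \<times> nat \<Rightarrow> int) \<Rightarrow> 'p padic_int mat"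
    where "mk = (\<lambda>\<omega>. mat n n (\<lambda>(i, j). from_digits (\<lambda>l. \<omega> (i, j, l))))"
  define J where "J = (\<lambda>k. {..<n} \<times> {..<n} \<times> {..<k::nat})"
  have vim: "mk -` mat_ball n k A \<inter> space P
      = {\<omega> \<in> space P. \<forall>t\<in>J k. \<omega> t \<in> (case t of (i, j, l) \<Rightarrow> {d. d mod ?p = digit (A $$ (i, j)) l})}"
    for k A
    by (auto simp: mat_ball_def mk_def J_def residue_eq_iff_digit digit_from_digits)
  have Ps: "{\<omega> \<in> space P. \<forall>t\<in>J k. \<omega> t \<in> F t} \<in> sets P" for k F
  proof (rule sets.sets_Collect_finite_All)
    fix t
    have "(\<lambda>\<omega>. \<omega> t) \<in> measurable P D" unfolding P_def by simp
    then have "(\<lambda>\<omega>. \<omega> t) -` F t \<inter> space P \<in> sets P"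
      by (rule measurable_sets) (simp add: D_def)
    moreover have "(\<lambda>\<omega>. \<omega> t) -` F t \<inter> space P = {\<omega> \<in> space P. \<omega> t \<in> F t}" by auto
    ultimately show "{\<omega> \<in> space P. \<omega> t \<in> F t} \<in> sets P" by simp
  qed (simp add: J_def)
  have mk: "mk \<in> measurable P N"
    unfolding N_def
  proof (rule measurable_sigma_sets)
    show "sets (sigma ?C (mat_balls n)) = sigma_sets ?C (mat_balls n)" using sub by simp
    show "mk \<in> space P \<rightarrow> ?C" by (auto simp: mk_def)
    show "mk -` S \<inter> space P \<in> sets P" if "S \<in> mat_balls n" for S
      using that vim Ps by (auto simp: mat_balls_def)
  qed (use sub in auto)
  define M where "M = distr P N mk"
  have M: "prob_space M" "space M = ?C" "sets M = sigma_sets ?C (mat_balls n)"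
    using prob_space.prob_space_distr[OF P mk] N by (simp_all add: M_def)
  have ball_in: "mat_ball n k A \<in> sets M" if "A \<in> ?C" for k A
    using that by (auto simp: M mat_balls_def)
  have ball: "emeasure M (mat_ball n k A) = ennreal (1 / ?p) ^ card (J k)" if "A \<in> ?C" for k A
  proof -
    have "emeasure M (mat_ball n k A) = emeasure P (mk -` mat_ball n k A \<inter> space P)"
      using ball_in[OF that] M N unfolding M_def by (intro emeasure_distr[OF mk]) auto
    also have "\<dots> = (\<Prod>t\<in>J k. emeasure D (case t of (i, j, l) \<Rightarrow> {d. d mod ?p = digit (A $$ (i, j)) l}))"
      unfolding vim unfolding P_def
      by (rule P.emeasure_PiM_Collect) (auto simp: J_def D_def)
    also have "\<dots> = (\<Prod>t\<in>J k. ennreal (1 / ?p))"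
    proof (rule prod.cong)
      fix t :: "nat \<times> nat \<times> nat"
      obtain i j l where t: "t = (i, j, l)" by (metis surj_pair)
      show "emeasure D (case t of (i, j, l) \<Rightarrow> {d. d mod ?p = digit (A $$ (i, j)) l}) = ennreal (1 / ?p)"
        unfolding t prod.case by (rule D1[OF digit_bounds])
    qed simp
    finally show ?thesis by simp
  qed
  have "emeasure M ((\<lambda>A. B + A) ` S) = emeasure M S" if B: "B \<in> ?C" and S: "S \<in> sets M" for B S
  proof -
    let ?t = "\<lambda>A. - B + A"
    have vimt: "?t -` S \<inter> ?C = (\<lambda>A. B + A) ` S" if "S \<subseteq> ?C" for S
    proof (intro equalityI subsetI)
      fix A assume A: "A \<in> ?t -` S \<inter> ?C"
      then have "A = B + ?t A" using B by (intro eq_matI) auto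
      then show "A \<in> (\<lambda>A. B + A) ` S" using A by blast
    next
      fix A assume "A \<in> (\<lambda>A. B + A) ` S"
      then obtain A' where A': "A' \<in> S" "A = B + A'" by blast
      then have "A' \<in> ?C" using that by blast
      then have "?t A = A'" "A \<in> ?C" using A' B by (auto intro!: eq_matI)
      then show "A \<in> ?t -` S \<inter> ?C" using A' by auto
    qed
    have vb: "?t -` mat_ball n k A \<inter> ?C = mat_ball n k (B + A)" if "A \<in> ?C" for k A
      using vimt[OF mat_ball_subset] mat_ball_translate[OF that B] by metis
    have t: "?t \<in> measurable M M"
    proof (rule measurable_sigma_sets[OF M(3) sub])
      show "?t \<in> space M \<rightarrow> ?C" using B by (auto simp: M)
      show "?t -` S \<inter> space M \<in> sets M" if "S \<in> mat_balls n" for S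
        using that vb B ball_in by (auto simp: M mat_balls_def)
    qed
    have "M = distr M M ?t"
    proof (rule mat_measure_eqI[OF M(1,3)])
      show "sets (distr M M ?t) = sigma_sets ?C (mat_balls n)" using M by simp
      show "emeasure M (mat_ball n k A) = emeasure (distr M M ?t) (mat_ball n k A)" if "A \<in> ?C" for k A
        using that B by (simp add: emeasure_distr[OF t ball_in] M vb ball)
    qed
    then have "emeasure M S = emeasure M (?t -` S \<inter> space M)"
      using emeasure_distr[OF t S] by simp
    moreover have "S \<subseteq> ?C" using sets.sets_into_space[OF S] M by simp
    ultimately show ?thesis using vimt by (simp add: M)
  qed
  then have "is_haar_prob n M"
    using M by (simp add: is_haar_prob_def sigma_mat_topology_eq)
  then show ?thesis by blast
qed

lemma is_haar_prob_haar_mat: "is_haar_prob n (haar_mat n)"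
  unfolding haar_mat_def using ex_is_haar_prob is_haar_prob_unique by (metis theI)

section \<open>Counting eigenvalues\<close>

definition eigenvalue_count :: "'p::prime_card padic_closure set \<Rightarrow> 'p padic_int mat \<Rightarrow> nat" where
  "eigenvalue_count U A =
     (let A' = map_mat of_padic_int A in \<Sum>x \<in> spectrum A' \<inter> U. Polynomial.order x (char_poly A'))"

definition expected_count :: "nat \<Rightarrow> 'p::prime_card padic_closure set \<Rightarrow> real" where
  "expected_count n U = (\<integral>A. real (eigenvalue_count U A) \<partial>haar_mat n)"

end

theory Submission
  imports Defs
begin

text \<open>
  Split the Haar measure on \<open>n \<times> n\<close> matrices according to the characteristic polynomial \<open>f\<close> of the reduction
  modulo \<open>p\<close>. If \<open>f = g h\<close> with \<open>g\<close> and \<open>h\<close> coprime, block diagonalisation over \<open>\<int>\<^sub>p\<close> is a measure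
  preserving isometry of the residue class, so the number of eigenvalues outside \<open>\<rat>\<^sub>p\<^sup>u\<^sup>n\<close> splits as a sum over the
  two blocks. With suitable normalisations, the mass \<open>w f\<close> of the class and the contribution \<open>z f\<close> to the expectation
  satisfy \<open>w (g h) = w g w h\<close> and \<open>z (g h) = z g w h + w g z h\<close>. The expectation therefore is a sum over the powers
  \<open>\<phi>\<^sup>m\<close> of irreducible polynomials of \<open>z (\<phi>\<^sup>m)\<close> times a factor that converges as \<open>n\<close> tends to infinity. Here
  \<open>z \<phi> = 0\<close> because a root with irreducible reduction is unramified, and \<open>w (\<phi>\<^sup>m) \<le> (p\<^sup>d - 1)\<^sup>-\<^sup>m\<close> for
  \<open>d = deg \<phi>\<close>, so that Tannery's theorem gives the limit and summation of the majorant gives the bound. The limit is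
  positive because matrices close to the companion matrix of the Eisenstein polynomial \<open>X\<^sup>2 - p\<close> contribute to
  \<open>z (X\<^sup>2)\<close>.
\<close>

hide_const (open) Polynomials.degree Polynomials.lead_coeff Coset.order up_ring.coeff up_ring.monom
  Divisibility.irreducible Divisibility.prime

no_notation vec_nth (infixl "$" 90)
no_notation fps_nth (infixl "$" 75)

section \<open>Matrices over a field\<close>

text \<open>The normalisation divides counts by \<open>card (GL n)\<close>: a conjugacy class then
  weighs the inverse order of its centraliser, and centralisers of coprime blocks are products. The
  total weight in degree \<open>n\<close> is \<open>p ^ (n * n) / card (GL n)\<close>, which is
  bounded, and the expectation is a quotient by it. The product rule for \<open>z\<close> isolates
  one prime power at a time and leaves a cofactor prime to \<open>\<phi>\<close>. The total weight
  of such cofactors is exactly 1 for linear \<open>\<phi>\<close>; for higher degree its convergence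
  has to be extracted from a convolution identity. Linear factors also get sharper individual
  bounds, which the final constant needs when \<open>p = 2\<close>. Two obstacles shape the rest.
  The eigenvalue count has to be measurable: the integers of the maximal unramified extension are a
  directed union of compact rings \<open>Wit q\<close>, and having \<open>k\<close> roots in one
  such ring is a closed condition. Valuations on the algebraic closure are replaced throughout by
  the integral closure \<open>IC\<close>, its units and divisibility by \<open>PP\<close>.\<close>

definition GL :: "nat \<Rightarrow> 'a::field mat set" where
  "GL n = {G \<in> carrier_mat n n. det G \<noteq> 0}"

definition minv :: "'a::field mat \<Rightarrow> 'a mat" where
  "minv G = inverse (det G) \<cdot>\<^sub>m adj_mat G"

lemma mult_mat_vec_sum:
  assumes "A \<in> carrier_mat m n" "v \<in> carrier_vec n" "i < m"
  shows "(A *\<^sub>v v) $ i = (\<Sum>k<n. A $$ (i, k) * v $ k)"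
  using assms by (simp add: scalar_prod_def lessThan_atLeast0)

lemma mult_mat_sum:
  assumes "A \<in> carrier_mat m n" "B \<in> carrier_mat n l" "i < m" "j < l"
  shows "(A * B) $$ (i, j) = (\<Sum>k<n. A $$ (i, k) * B $$ (k, j))"
  using assms by (simp add: scalar_prod_def lessThan_atLeast0)

lemma smult_one_mult_vec: "(v :: 'a::comm_ring_1 vec) \<in> carrier_vec n \<Longrightarrow> (a \<cdot>\<^sub>m 1\<^sub>m n) *\<^sub>v v = a \<cdot>\<^sub>v v"
proof (rule eq_vecI)
  fix i assume v: "v \<in> carrier_vec n" and "i < dim_vec (a \<cdot>\<^sub>v v)"
  then have i: "i < n" by simp
  have "((a \<cdot>\<^sub>m 1\<^sub>m n) *\<^sub>v v) $ i = (\<Sum>k<n. (a \<cdot>\<^sub>m 1\<^sub>m n) $$ (i, k) * v $ k)"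
    by (rule mult_mat_vec_sum[OF _ v i]) simp
  also have "\<dots> = (\<Sum>k<n. if k = i then a * v $ k else 0)"
    using i by (intro sum.cong) auto
  finally show "((a \<cdot>\<^sub>m 1\<^sub>m n) *\<^sub>v v) $ i = (a \<cdot>\<^sub>v v) $ i" using i v by simp
qed auto

lemma GL_carrier: "G \<in> GL n \<Longrightarrow> G \<in> carrier_mat n n"
  by (simp add: GL_def)

lemma minv:
  assumes "G \<in> GL n"
  shows "minv G \<in> carrier_mat n n" "G * minv G = 1\<^sub>m n" "minv G * G = 1\<^sub>m n"
proof -
  have G: "G \<in> carrier_mat n n" "det G \<noteq> 0" using assms by (auto simp: GL_def)
  note adj = adj_mat[OF G(1)]
  show "minv G \<in> carrier_mat n n" using adj by (simp add: minv_def)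
  have "G * minv G = inverse (det G) \<cdot>\<^sub>m (G * adj_mat G)"
    unfolding minv_def using adj G by (intro mult_smult_distrib) auto
  also have "\<dots> = 1\<^sub>m n" unfolding adj(2) using G(2) by (intro eq_matI) auto
  finally show "G * minv G = 1\<^sub>m n" .
  have "minv G * G = inverse (det G) \<cdot>\<^sub>m (adj_mat G * G)"
    unfolding minv_def using adj G by (intro mult_smult_assoc_mat) auto
  also have "\<dots> = 1\<^sub>m n" unfolding adj(3) using G(2) by (intro eq_matI) auto
  finally show "minv G * G = 1\<^sub>m n" .
qed

lemma GL_I:
  assumes "G \<in> carrier_mat n n" "Y \<in> carrier_mat n n" "G * Y = 1\<^sub>m n"
  shows "G \<in> GL n"
proof -
  have "det G * det Y = 1" using det_mult[OF assms(1,2)] assms(3) by simp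
  then show ?thesis using assms(1) by (auto simp: GL_def)
qed

lemma minv_GL: "G \<in> GL n \<Longrightarrow> minv G \<in> GL n"
  using minv GL_carrier GL_I by metis

lemma GL_mult: "G \<in> GL n \<Longrightarrow> Y \<in> GL n \<Longrightarrow> G * Y \<in> GL n"
  by (auto simp: GL_def det_mult[of G n])

lemma GL_one: "1\<^sub>m n \<in> GL n"
  by (simp add: GL_def)

lemma minv_cancel:
  assumes "G \<in> GL n" "M \<in> carrier_mat n m"
  shows "minv G * (G * M) = M" "G * (minv G * M) = M"
  using assms minv[OF assms(1)] GL_carrier[OF assms(1)]
  by (auto simp: assoc_mult_mat[symmetric, of _ n n _ n _ m])

lemma minv_cancel_right:
  assumes "G \<in> GL n" "M \<in> carrier_mat m n"
  shows "M * G * minv G = M" "M * minv G * G = M"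
  using assms minv[OF assms(1)] GL_carrier[OF assms(1)]
  by (auto simp: assoc_mult_mat[of _ m n _ n _ n])

lemma GL_left_cancel:
  assumes "G \<in> GL n" "M \<in> carrier_mat n m" "N \<in> carrier_mat n m" "G * M = G * N"
  shows "M = N"
  using assms minv_cancel(1) by metis

lemma GL_right_cancel:
  assumes "G \<in> GL n" "M \<in> carrier_mat m n" "N \<in> carrier_mat m n" "M * G = N * G"
  shows "M = N"
  using assms minv_cancel_right(1) by metis

text \<open>Similarity is carried in the form \<open>A * G = G * B\<close> throughout: it composes
  without inverses, makes sense for rectangular \<open>G\<close>, where it describes invariant
  subspaces, and survives reduction modulo \<open>p\<close>.\<close>

lemma similar_mat_intertwine:
  assumes "G \<in> GL n" "A \<in> carrier_mat n n" "B \<in> carrier_mat n n" "A * G = G * B"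
  shows "similar_mat A B"
proof -
  note m = minv[OF assms(1)] GL_carrier[OF assms(1)]
  have "A = G * B * minv G"
    using minv_cancel_right(1)[OF assms(1,2)] assms(4) by simp
  then have "similar_mat_wit A B G (minv G)"
    using m assms by (intro similar_mat_witI[of _ _ n]) auto
  then show ?thesis unfolding similar_mat_def by blast
qed

lemma char_poly_intertwine:
  assumes "G \<in> GL n" "A \<in> carrier_mat n n" "B \<in> carrier_mat n n" "A * G = G * B"
  shows "char_poly A = char_poly B"
  using char_poly_similar[OF similar_mat_intertwine[OF assms]] .

lemma char_poly_four_block_upper:
  fixes A :: "'a::idom mat"
  assumes "A \<in> carrier_mat a a" "B \<in> carrier_mat a b" "D \<in> carrier_mat b b"
  shows "char_poly (four_block_mat A B (0\<^sub>m b a) D) = char_poly A * char_poly D"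
proof -
  have "char_poly_matrix (four_block_mat A B (0\<^sub>m b a) D)
      = four_block_mat (char_poly_matrix A) (map_mat (\<lambda>x. [:- x:]) B) (0\<^sub>m b a) (char_poly_matrix D)"
    using assms by (intro eq_matI) (auto simp: char_poly_matrix_def)
  moreover have "char_poly_matrix A \<in> carrier_mat a a" "char_poly_matrix D \<in> carrier_mat b b"
    "map_mat (\<lambda>x. [:- x:]) B \<in> carrier_mat a b"
    using assms by auto
  ultimately show ?thesis
    unfolding char_poly_def by (simp add: det_four_block_mat_lower_left_zero[of _ a _ b])
qed

lemma degree_char_poly: "A \<in> carrier_mat n n \<Longrightarrow> degree (char_poly A) = n"
  using degree_monic_char_poly by blast

lemma monic_char_poly: "A \<in> carrier_mat n n \<Longrightarrow> monic (char_poly A)"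
  using degree_monic_char_poly by metis

lemma char_poly_nonzero: "A \<in> carrier_mat n n \<Longrightarrow> char_poly A \<noteq> (0 :: 'a::idom poly)"
  using monic_char_poly by force

lemma assoc4_mat:
  fixes A B V D :: "'a::semiring_0 mat"
  assumes "A \<in> carrier_mat k n" "B \<in> carrier_mat n l" "V \<in> carrier_mat l m" "D \<in> carrier_mat m r"
  shows "A * (B * V) * D = (A * B) * (V * D)"
proof -
  have "A * (B * V) * D = A * ((B * V) * D)"
    using assms by (intro assoc_mult_mat[of _ k n _ m _ r]) auto
  also have "(B * V) * D = B * (V * D)"
    using assms by (intro assoc_mult_mat[of _ n l _ m _ r]) auto
  also have "A * (B * (V * D)) = A * B * (V * D)"
    using assms by (intro assoc_mult_mat[of _ k n _ l _ r, symmetric]) auto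
  finally show ?thesis .
qed

text \<open>
  From \<open>A V = V C\<close> one gets \<open>(t - A) V = V (t - C)\<close>; multiplying by both adjugates,
  \<open>det (t - C)\<close> divides \<open>V adj (t - C)\<close>, hence \<open>V = W (t - C)\<close>, which by degrees forces
  \<open>W = 0\<close>.
\<close>

lemma sylvester_unique:
  fixes A :: "'a::{field_gcd} mat"
  assumes A: "A \<in> carrier_mat n n" and C: "C \<in> carrier_mat m m" and V: "V \<in> carrier_mat n m"
    and eq: "A * V = V * C" and cop: "coprime (char_poly A) (char_poly C)"
  shows "V = 0\<^sub>m n m"
proof -
  let ?c = "map_mat (\<lambda>x. [:x:]) :: 'a mat \<Rightarrow> 'a poly mat"
  interpret c: comm_ring_hom "\<lambda>x::'a. [:x:]" by unfold_locales auto
  let ?MA = "char_poly_matrix A" and ?MC = "char_poly_matrix C"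
  have cp: "char_poly_matrix M = [:0,1:] \<cdot>\<^sub>m 1\<^sub>m k - ?c M" if "M \<in> carrier_mat k k" for M k
    using that by (intro eq_matI) (auto simp: char_poly_matrix_def)
  have cA: "?c A \<in> carrier_mat n n" "?c C \<in> carrier_mat m m" "?c V \<in> carrier_mat n m"
    using A C V by auto
  have M: "?MA \<in> carrier_mat n n" "?MC \<in> carrier_mat m m" using A C by auto
  have "?MA * ?c V = ?c V * ?MC"
  proof -
    have "?c A * ?c V = ?c V * ?c C"
      using eq c.mat_hom_mult[OF A V] c.mat_hom_mult[OF V C] by simp
    moreover have "([:0,1:] \<cdot>\<^sub>m 1\<^sub>m n) * ?c V = ?c V * ([:0,1:] \<cdot>\<^sub>m 1\<^sub>m m)"
      using mult_smult_assoc_mat[OF one_carrier_mat cA(3)] mult_smult_distrib[OF cA(3) one_carrier_mat] cA(3)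
      by auto
    ultimately show ?thesis
      unfolding cp[OF A] cp[OF C] using cA
      by (simp add: minus_mult_distrib_mat[of _ n n _ _ m] mult_minus_distrib_mat[of _ n m _ m])
  qed
  note adjA = adj_mat[OF M(1)] and adjC = adj_mat[OF M(2)]
  let ?P = "?c V * adj_mat ?MC" and ?Q = "adj_mat ?MA * ?c V"
  have PQ: "?P \<in> carrier_mat n m" "?Q \<in> carrier_mat n m" using cA adjA adjC by auto
  have "char_poly A \<cdot>\<^sub>m ?P = (adj_mat ?MA * ?MA) * ?P"
    unfolding adjA(3) char_poly_def using PQ
    by (simp add: mult_smult_assoc_mat[of _ n n _ m] left_mult_one_mat[of _ n m])
  also have "\<dots> = adj_mat ?MA * (?MA * ?c V) * adj_mat ?MC"
    using assoc4_mat[OF adjA(1) M(1) cA(3) adjC(1)] by simp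
  also have "\<dots> = ?Q * (?MC * adj_mat ?MC)"
    unfolding \<open>?MA * ?c V = ?c V * ?MC\<close> using assoc4_mat[OF adjA(1) cA(3) M(2) adjC(1)] .
  also have "\<dots> = char_poly C \<cdot>\<^sub>m ?Q"
    unfolding adjC(2) char_poly_def using PQ
    by (simp add: mult_smult_distrib[of _ n m _ m] right_mult_one_mat[of _ n m])
  finally have eqPQ: "char_poly A \<cdot>\<^sub>m ?P = char_poly C \<cdot>\<^sub>m ?Q" .
  have "char_poly C dvd ?P $$ (i, j)" if "i < n" "j < m" for i j
  proof -
    have "char_poly A * ?P $$ (i, j) = char_poly C * ?Q $$ (i, j)"
      using arg_cong[OF eqPQ, of "\<lambda>M. M $$ (i, j)"] that carrier_matD[OF PQ(1)] carrier_matD[OF PQ(2)]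
      by (simp only: index_smult_mat)
    then have "char_poly C dvd char_poly A * ?P $$ (i, j)" by simp
    then show ?thesis using cop by (simp add: coprime_commute coprime_dvd_mult_right_iff)
  qed
  then obtain w where w: "\<And>i j. i < n \<Longrightarrow> j < m \<Longrightarrow> ?P $$ (i, j) = char_poly C * w i j"
    unfolding dvd_def by metis
  define W where "W = mat n m (\<lambda>(i, j). w i j)"
  have W: "W \<in> carrier_mat n m" by (simp add: W_def)
  have PW: "?P = char_poly C \<cdot>\<^sub>m W" using PQ w by (intro eq_matI) (auto simp: W_def)
  have "char_poly C \<cdot>\<^sub>m ?c V = ?c V * (adj_mat ?MC * ?MC)"
    unfolding adjC(3) char_poly_def using cA by (simp add: mult_smult_distrib[of _ n m _ m] right_mult_one_mat[of _ n m])
  also have "\<dots> = ?P * ?MC" using cA adjC M by (simp add: assoc_mult_mat[of _ n m _ m _ m])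
  also have "\<dots> = char_poly C \<cdot>\<^sub>m (W * ?MC)"
    unfolding PW using W M by (simp add: mult_smult_assoc_mat[of _ n m _ m])
  finally have eqV: "char_poly C \<cdot>\<^sub>m ?c V = char_poly C \<cdot>\<^sub>m (W * ?MC)" .
  have VW: "[:V $$ (i, j):] = [:0,1:] * w i j - (W * ?c C) $$ (i, j)" if "i < n" "j < m" for i j
  proof -
    have "char_poly C * [:V $$ (i, j):] = char_poly C * (W * ?MC) $$ (i, j)"
      using arg_cong[OF eqV, of "\<lambda>M. M $$ (i, j)"] that carrier_matD[OF cA(3)]
        carrier_matD[OF mult_carrier_mat[OF W M(2)]] V
      by (simp only: index_smult_mat index_map_mat carrier_matD)
    then have "[:V $$ (i, j):] = (W * ?MC) $$ (i, j)" using char_poly_nonzero[OF C] mult_left_cancel by blast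
    also have "W * ?MC = [:0,1:] \<cdot>\<^sub>m W - W * ?c C"
      unfolding cp[OF C] using W cA
      by (simp add: mult_minus_distrib_mat[of _ n m _ m] mult_smult_distrib[of _ n m _ m])
    also have "\<dots> $$ (i, j) = [:0,1:] * w i j - (W * ?c C) $$ (i, j)"
      using that W cA by (auto simp: W_def)
    finally show ?thesis .
  qed
  have sum: "(W * ?c C) $$ (i, j) = (\<Sum>k<m. w i k * [:C $$ (k, j):])" if "i < n" "j < m" for i j
    using that C by (auto simp: W_def scalar_prod_def times_mat_def lessThan_atLeast0)
  \<comment> \<open>If \<open>N\<close> bounds all degrees, the entries of \<open>W * ?c C\<close>
    have degree at most \<open>N\<close>, so the coefficient of degree \<open>N + 1\<close> in
    \<open>VW\<close> kills the coefficient of degree \<open>N\<close> of \<open>w i j\<close>.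
    Every bound can thus be lowered by one.\<close>
  have deg: "degree (w i j) < N" if "\<And>i j. i < n \<Longrightarrow> j < m \<Longrightarrow> w i j \<noteq> 0 \<Longrightarrow> degree (w i j) \<le> N"
     "i < n" "j < m" "w i j \<noteq> 0" for i j N
  proof (rule ccontr)
    assume "\<not> degree (w i j) < N"
    then have N: "degree (w i j) = N" using that(1)[OF that(2-4)] by simp
    have "coeff ((W * ?c C) $$ (i, j)) (Suc N) = 0"
      unfolding sum[OF that(2,3)] coeff_sum
    proof (rule sum.neutral, rule ballI)
      fix k assume "k \<in> {..<m}"
      then have "degree (w i k) < Suc N" using that(1)[OF that(2), of k] by (cases "w i k = 0") auto
      then have "coeff (w i k) (Suc N) = 0" by (rule coeff_eq_0)
      then show "coeff (w i k * [:C $$ (k, j):]) (Suc N) = 0" by (simp add: mult.commute)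
    qed
    then have "0 = coeff (w i j) N"
      using arg_cong[OF VW[OF that(2,3)], of "\<lambda>p. coeff p (Suc N)"] by simp
    then show False using N that(4) by auto
  qed
  have w0: "w i j = 0" if ij: "i < n" "j < m" for i j
  proof (rule ccontr)
    assume nz: "w i j \<noteq> 0"
    define B where "B N \<longleftrightarrow> (\<forall>i<n. \<forall>j<m. w i j \<noteq> 0 \<longrightarrow> degree (w i j) \<le> N)" for N
    have "B (Max ((\<lambda>(i, j). degree (w i j)) ` ({..<n} \<times> {..<m})))"
      unfolding B_def by (auto intro!: Max_ge)
    then have BL: "B (LEAST N. B N)" by (rule LeastI)
    define N where "N = (LEAST N. B N)"
    have BN: "degree (w i j) \<le> N" if "i < n" "j < m" "w i j \<noteq> 0" for i j
      using BL[folded N_def] that unfolding B_def by blast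
    have lt: "degree (w i j) < N" if "i < n" "j < m" "w i j \<noteq> 0" for i j
      by (rule deg[OF BN that])
    then have "B (N - 1)" unfolding B_def by (metis Suc_leI Suc_pred' less_Suc_eq_le not_gr_zero not_less_zero)
    moreover have "N - 1 < N" using lt[OF ij nz] by simp
    ultimately show False unfolding N_def using not_less_Least by metis
  qed
  show ?thesis
  proof (rule eq_matI)
    fix i j assume "i < dim_row (0\<^sub>m n m :: 'a mat)" "j < dim_col (0\<^sub>m n m :: 'a mat)"
    then have ij: "i < n" "j < m" by auto
    have "[:V $$ (i, j):] = 0" using VW[OF ij] sum[OF ij] w0 ij by simp
    then show "V $$ (i, j) = 0\<^sub>m n m $$ (i, j)" using ij by simp
  qed (use V in auto)
qed

section \<open>Counting, and solving linear equations by counting, over finite fields\<close>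

lemma card_carrier_mat: "card (carrier_mat m n :: 'a::finite mat set) = CARD('a) ^ (m * n)"
  and finite_carrier_mat: "finite (carrier_mat m n :: 'a::finite mat set)"
proof -
  let ?I = "{..<m} \<times> {..<n}"
  have bij: "bij_betw (\<lambda>A. \<lambda>ij\<in>?I. A $$ ij) (carrier_mat m n :: 'a mat set) (PiE ?I (\<lambda>_. UNIV))"
  proof (rule bij_betwI[where g = "\<lambda>f. mat m n f"])
    fix A :: "'a mat" assume A: "A \<in> carrier_mat m n"
    show "mat m n (\<lambda>ij\<in>?I. A $$ ij) = A" using A by (intro eq_matI) auto
  next
    fix f :: "nat \<times> nat \<Rightarrow> 'a" assume f: "f \<in> PiE ?I (\<lambda>_. UNIV)"
    show "(\<lambda>ij\<in>?I. mat m n f $$ ij) = f"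
    proof
      fix ij show "(\<lambda>ij\<in>?I. mat m n f $$ ij) ij = f ij"
        using PiE_arb[OF f, of ij] by (cases ij) (auto simp: restrict_def)
    qed
  qed auto
  have "card (PiE ?I (\<lambda>_. UNIV :: 'a set)) = CARD('a) ^ (m * n)"
    by (simp add: card_PiE card_cartesian_product)
  then show "card (carrier_mat m n :: 'a mat set) = CARD('a) ^ (m * n)"
    using bij_betw_same_card[OF bij] by simp
  show "finite (carrier_mat m n :: 'a mat set)"
    using bij_betw_finite[OF bij] finite_PiE[of ?I "\<lambda>_. UNIV :: 'a set"] by auto
qed

lemma card_carrier_vec: "card (carrier_vec n :: 'a::finite vec set) = CARD('a) ^ n"
  and finite_carrier_vec: "finite (carrier_vec n :: 'a::finite vec set)"
proof -
  have bij: "bij_betw (\<lambda>A. col A 0) (carrier_mat n 1 :: 'a mat set) (carrier_vec n)"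
  proof (rule bij_betwI[where g = "\<lambda>v. mat n 1 (\<lambda>(i, j). v $ i)"])
  qed (auto intro!: eq_matI eq_vecI)
  show "card (carrier_vec n :: 'a vec set) = CARD('a) ^ n"
    using bij_betw_same_card[OF bij] by (simp add: card_carrier_mat)
  show "finite (carrier_vec n :: 'a vec set)"
    using bij_betw_finite[OF bij] by (simp add: finite_carrier_mat)
qed

text \<open>Existence comes from uniqueness: \<open>V \<mapsto> A * V - V * C\<close> is injective
  by \<open>sylvester_unique\<close> and maps a finite set of matrices into itself, hence onto
  itself.\<close>

lemma sylvester_solve:
  fixes A :: "'a::{field_gcd,finite} mat"
  assumes A: "A \<in> carrier_mat n n" and C: "C \<in> carrier_mat m m" and S: "S \<in> carrier_mat n m"
    and cop: "coprime (char_poly A) (char_poly C)"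
  obtains V where "V \<in> carrier_mat n m" "A * V = V * C + S"
proof -
  let ?L = "\<lambda>V. A * V - V * C" and ?E = "carrier_mat n m :: 'a mat set"
  have "inj_on ?L ?E"
  proof (rule inj_onI)
    fix V W assume V: "V \<in> ?E" and W: "W \<in> ?E" and eq: "?L V = ?L W"
    have "A * (V - W) = (V - W) * C"
    proof (rule eq_matI)
      fix i j assume "i < dim_row ((V - W) * C)" "j < dim_col ((V - W) * C)"
      then have ij: "i < n" "j < m" using V W C by auto
      have "(A * V) $$ (i, j) - (V * C) $$ (i, j) = (A * W) $$ (i, j) - (W * C) $$ (i, j)"
        using arg_cong[OF eq, of "\<lambda>M. M $$ (i, j)"] ij A V W C by auto
      then have "(A * V) $$ (i, j) - (A * W) $$ (i, j) = (V * C) $$ (i, j) - (W * C) $$ (i, j)"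
        by (simp add: algebra_simps)
      then show "(A * (V - W)) $$ (i, j) = ((V - W) * C) $$ (i, j)"
        using ij A V W C
        by (simp add: mult_minus_distrib_mat[of _ n n _ m] minus_mult_distrib_mat[of _ n m _ _ m] del: index_mult_mat(1))
    qed (use A V W C in auto)
    then have "V - W = 0\<^sub>m n m" using V W by (intro sylvester_unique[OF A C _ _ cop]) auto
    then have *: "(V - W) $$ (i, j) = 0" if "i < n" "j < m" for i j using that by simp
    show "V = W"
    proof (rule eq_matI)
      fix i j assume "i < dim_row W" "j < dim_col W"
      then show "V $$ (i, j) = W $$ (i, j)" using *[of i j] V W by simp
    qed (use V W in auto)
  qed
  moreover have "?L ` ?E \<subseteq> ?E" using A C by auto
  ultimately have "?L ` ?E = ?E"
    using endo_inj_surj[OF finite_carrier_mat] by blast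
  then obtain V where V: "V \<in> ?E" "S = A * V - V * C" using S by blast
  then have "A * V = V * C + S" using A C by (intro eq_matI) auto
  then show thesis using that V by blast
qed

section \<open>Invariant subspaces and cyclic vectors\<close>

text \<open>The matrix \<open>f(A)\<close>, evaluated by Horner's scheme. Scalars enter as multiples
  of an identity matrix of explicit size, as the type does not record dimensions.\<close>

definition pm :: "'a::comm_ring_1 poly \<Rightarrow> 'a mat \<Rightarrow> 'a mat" where
  "pm f A = fold_coeffs (\<lambda>a M. a \<cdot>\<^sub>m 1\<^sub>m (dim_row A) + A * M) f (0\<^sub>m (dim_row A) (dim_row A))"

lemma pm_0: "A \<in> carrier_mat n n \<Longrightarrow> pm 0 A = 0\<^sub>m n n"
  by (simp add: pm_def)

lemma pm_pCons:
  assumes "A \<in> carrier_mat n n"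
  shows "pm (pCons a f) A = a \<cdot>\<^sub>m 1\<^sub>m n + A * pm f A"
proof (cases "a = 0 \<and> f = 0")
  case True
  then show ?thesis using assms by (auto simp: pm_0 intro!: eq_matI)
next
  case False
  then show ?thesis using assms unfolding pm_def
    by (cases "f = 0") auto
qed

lemma pm_carrier[simp]: "A \<in> carrier_mat n n \<Longrightarrow> pm f A \<in> carrier_mat n n"
  by (induction f) (auto simp: pm_0 pm_pCons)

lemma pm_dim[simp]: "A \<in> carrier_mat n n \<Longrightarrow> dim_row (pm f A) = n"
  "A \<in> carrier_mat n n \<Longrightarrow> dim_col (pm f A) = n"
  by (simp_all add: carrier_matD[OF pm_carrier])

lemma pm_pCons_0: "A \<in> carrier_mat n n \<Longrightarrow> pm (pCons 0 f) A = A * pm f A"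
  unfolding pm_pCons by (intro eq_matI) (auto simp del: index_mult_mat(1))

lemma pm_one: "A \<in> carrier_mat n n \<Longrightarrow> pm 1 A = 1\<^sub>m n"
  unfolding one_pCons by (auto simp: pm_0 pm_pCons intro!: eq_matI)

lemma pm_add:
  assumes A: "A \<in> carrier_mat n n"
  shows "pm (f + g) A = pm f A + pm g A"
proof (induction f g rule: poly_induct2)
  case 0
  then show ?case using A by (simp add: pm_0)
next
  case (pCons a p b q)
  have "A * (pm p A + pm q A) = A * pm p A + A * pm q A"
    using A by (intro mult_add_distrib_mat[of _ n n _ n]) auto
  then show ?case using A pCons
    by (intro eq_matI) (auto simp: pm_pCons algebra_simps simp del: index_mult_mat(1))
qed

lemma pm_smult:
  assumes A: "A \<in> carrier_mat n n"
  shows "pm (Polynomial.smult c f) A = c \<cdot>\<^sub>m pm f A"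
proof (induction f)
  case 0
  then show ?case using A by (auto simp: pm_0)
next
  case (pCons a p)
  have "A * (c \<cdot>\<^sub>m pm p A) = c \<cdot>\<^sub>m (A * pm p A)"
    using A by (intro mult_smult_distrib[of _ n n _ n]) auto
  then show ?case using A pCons
    by (intro eq_matI) (auto simp: pm_pCons algebra_simps simp del: index_mult_mat(1))
qed

lemma pm_mult:
  assumes A: "A \<in> carrier_mat n n"
  shows "pm (f * g) A = pm f A * pm g A"
proof (induction f)
  case 0
  then show ?case using A by (simp add: pm_0 left_mult_zero_mat[of _ n n])
next
  case (pCons a p)
  have c: "pm p A \<in> carrier_mat n n" "pm g A \<in> carrier_mat n n" using A by auto
  have "(a \<cdot>\<^sub>m 1\<^sub>m n + A * pm p A) * pm g A = (a \<cdot>\<^sub>m 1\<^sub>m n) * pm g A + (A * pm p A) * pm g A"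
    using A c by (intro add_mult_distrib_mat[of _ n n _ _ n]) auto
  also have "(a \<cdot>\<^sub>m 1\<^sub>m n) * pm g A = a \<cdot>\<^sub>m pm g A"
    using c by (subst mult_smult_assoc_mat[of _ n n _ n]) auto
  also have "(A * pm p A) * pm g A = A * (pm p A * pm g A)"
    using A c by (intro assoc_mult_mat[of _ n n _ n _ n]) auto
  finally have *: "(a \<cdot>\<^sub>m 1\<^sub>m n + A * pm p A) * pm g A = a \<cdot>\<^sub>m pm g A + A * (pm p A * pm g A)" .
  have "pm (pCons a p * g) A = a \<cdot>\<^sub>m pm g A + pm (pCons 0 (p * g)) A"
    using A by (simp add: pm_add pm_smult)
  also have "pm (pCons 0 (p * g)) A = A * (pm p A * pm g A)"
    using A pCons by (simp add: pm_pCons_0)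
  finally show ?case using A * by (simp add: pm_pCons)
qed

lemma pm_intertwine:
  assumes A: "A \<in> carrier_mat n n" and C: "C \<in> carrier_mat m m" and V: "V \<in> carrier_mat n m"
    and eq: "A * V = V * C"
  shows "pm f A * V = V * pm f C"
proof (induction f)
  case 0
  then show ?case using A C V by (simp add: pm_0 left_mult_zero_mat[of _ n m] right_mult_zero_mat[of _ n m])
next
  case (pCons a p)
  have c: "pm p A \<in> carrier_mat n n" "pm p C \<in> carrier_mat m m" using A C by auto
  have "(a \<cdot>\<^sub>m 1\<^sub>m n + A * pm p A) * V = (a \<cdot>\<^sub>m 1\<^sub>m n) * V + (A * pm p A) * V"
    using A V c by (intro add_mult_distrib_mat[of _ n n _ _ m]) auto
  also have "(a \<cdot>\<^sub>m 1\<^sub>m n) * V = a \<cdot>\<^sub>m V"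
    using V by (subst mult_smult_assoc_mat[of _ n n _ m]) auto
  also have "(A * pm p A) * V = A * (pm p A * V)"
    using A V c by (intro assoc_mult_mat[of _ n n _ n _ m]) auto
  also have "\<dots> = A * V * pm p C"
    using A V c unfolding pCons by (intro assoc_mult_mat[of _ n n _ m _ m, symmetric]) auto
  also have "\<dots> = V * (C * pm p C)"
    unfolding eq using C V c by (intro assoc_mult_mat[of _ n m _ m _ m]) auto
  also have "a \<cdot>\<^sub>m V = V * (a \<cdot>\<^sub>m 1\<^sub>m m)"
    using V by (subst mult_smult_distrib[of _ n m _ m]) auto
  also have "V * (a \<cdot>\<^sub>m 1\<^sub>m m) + V * (C * pm p C) = V * (a \<cdot>\<^sub>m 1\<^sub>m m + C * pm p C)"
    using C V c by (intro mult_add_distrib_mat[of _ n m _ m, symmetric]) auto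
  finally show ?case using A C by (simp add: pm_pCons)
qed

lemma pm_self_commute:
  assumes "A \<in> carrier_mat n n"
  shows "pm f A * A = A * pm f A"
  using pm_intertwine[OF assms assms assms] by simp

lemma mult_mat_zero_vec:
  fixes A :: "'a::semiring_1 mat"
  shows "A \<in> carrier_mat m n \<Longrightarrow> A *\<^sub>v 0\<^sub>v n = 0\<^sub>v m"
  by (intro eq_vecI) (simp_all add: mult_mat_vec_sum[of _ m n] del: index_mult_mat_vec)

lemma pow_mat_commute:
  assumes A: "A \<in> carrier_mat n n"
  shows "A * A ^\<^sub>m j = A ^\<^sub>m j * A"
proof (induction j)
  case (Suc j)
  have Aj: "A ^\<^sub>m j \<in> carrier_mat n n" using A by simp
  have "A * (A ^\<^sub>m j * A) = A * A ^\<^sub>m j * A"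
    using assoc_mult_mat[OF A Aj A] by simp
  then show ?case using Suc by simp
qed (use A in simp)

lemma pm_hom:
  assumes "comm_ring_hom h" and A: "A \<in> carrier_mat n n"
  shows "map_mat h (pm f A) = pm (map_poly h f) (map_mat h A)"
proof -
  interpret comm_ring_hom h by fact
  have A': "map_mat h A \<in> carrier_mat n n" using A by simp
  show ?thesis
  proof (induction f)
    case 0
    show ?case using A A' by (auto simp: pm_0)
  next
    case (pCons a p)
    have "map_mat h (a \<cdot>\<^sub>m 1\<^sub>m n + A * pm p A) = h a \<cdot>\<^sub>m 1\<^sub>m n + map_mat h (A * pm p A)"
      using A by (intro eq_matI) (auto simp: hom_distribs simp del: index_mult_mat(1))
    then have "map_mat h (a \<cdot>\<^sub>m 1\<^sub>m n + A * pm p A) = h a \<cdot>\<^sub>m 1\<^sub>m n + map_mat h A * map_mat h (pm p A)"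
      using mat_hom_mult[OF A pm_carrier[OF A]] by simp
    then show ?case using pCons A A' by (simp add: pm_pCons map_poly_pCons_hom)
  qed
qed

lemma pm_eigenvector:
  fixes A :: "'a::field mat"
  assumes A: "A \<in> carrier_mat n n" and u: "u \<in> carrier_vec n" and eq: "A *\<^sub>v u = c \<cdot>\<^sub>v u"
  shows "pm f A *\<^sub>v u = poly f c \<cdot>\<^sub>v u"
proof (induction f)
  case 0
  show ?case using A u by (auto simp: pm_0 intro!: eq_vecI)
next
  case (pCons a p)
  have "(a \<cdot>\<^sub>m 1\<^sub>m n + A * pm p A) *\<^sub>v u = (a \<cdot>\<^sub>m 1\<^sub>m n) *\<^sub>v u + (A * pm p A) *\<^sub>v u"
    using A u by (intro add_mult_distrib_mat_vec[of _ n n]) auto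
  also have "(A * pm p A) *\<^sub>v u = A *\<^sub>v (pm p A *\<^sub>v u)"
    using A u by (intro assoc_mult_mat_vec[of _ n n _ n]) auto
  also have "\<dots> = poly p c \<cdot>\<^sub>v (A *\<^sub>v u)"
    unfolding pCons using A u mult_mat_vec[OF A u, of "poly p c"] by auto
  also have "\<dots> = (poly p c * c) \<cdot>\<^sub>v u"
    unfolding eq by (simp add: smult_smult_assoc)
  also have "(a \<cdot>\<^sub>m 1\<^sub>m n) *\<^sub>v u = a \<cdot>\<^sub>v u"
    using u by (rule smult_one_mult_vec)
  finally show ?case using A u by (simp add: pm_pCons add_smult_distrib_vec mult.commute)
qed

text \<open>\<open>N\<close> is any bound beyond the degree, because the cyclic subspace argument
  applies this both to polynomials of degree below \<open>degree f\<close> and to \<open>f\<close>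
  itself with its leading term.\<close>

lemma pm_vec:
  assumes A: "A \<in> carrier_mat n n" and v: "v \<in> carrier_vec n" and f: "\<And>k. k \<ge> N \<Longrightarrow> coeff f k = 0"
    and i: "i < n"
  shows "(pm f A *\<^sub>v v) $ i = (\<Sum>k<N. coeff f k * ((A ^\<^sub>m k) *\<^sub>v v) $ i)"
  using v f
proof (induction N arbitrary: f v)
  case 0
  then have "f = 0" by (intro poly_eqI) auto
  then show ?case using A 0 i by (simp add: pm_0)
next
  case (Suc N)
  obtain a g where f: "f = pCons a g" by (cases f) auto
  have g: "coeff g k = 0" if "k \<ge> N" for k using Suc.prems(2)[of "Suc k"] that by (simp add: f)
  have Av: "A *\<^sub>v v \<in> carrier_vec n" using A Suc.prems by auto
  have IH: "(pm g A *\<^sub>v (A *\<^sub>v v)) $ i = (\<Sum>k<N. coeff g k * ((A ^\<^sub>m k) *\<^sub>v (A *\<^sub>v v)) $ i)"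
    using Suc.IH[OF Av g] by blast
  have "pm f A *\<^sub>v v = (a \<cdot>\<^sub>m 1\<^sub>m n) *\<^sub>v v + (pm g A * A) *\<^sub>v v"
    unfolding f pm_pCons[OF A] pm_self_commute[OF A] using A Suc.prems
    by (intro add_mult_distrib_mat_vec[of _ n n]) auto
  also have "(pm g A * A) *\<^sub>v v = pm g A *\<^sub>v (A *\<^sub>v v)"
    using A Suc.prems by (intro assoc_mult_mat_vec[of _ n n _ n]) auto
  also have "(a \<cdot>\<^sub>m 1\<^sub>m n) *\<^sub>v v = a \<cdot>\<^sub>v v"
    using Suc.prems by (simp add: smult_one_mult_vec)
  finally have "(pm f A *\<^sub>v v) $ i = a * v $ i + (pm g A *\<^sub>v (A *\<^sub>v v)) $ i"
    using i A Suc.prems by (simp del: index_mult_mat_vec)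
  also have "\<dots> = a * v $ i + (\<Sum>k<N. coeff g k * ((A ^\<^sub>m Suc k) *\<^sub>v v) $ i)"
    unfolding IH using A Suc.prems by (simp add: assoc_mult_mat_vec[of _ n n _ n] del: index_mult_mat_vec)
  also have "\<dots> = (\<Sum>k<Suc N. coeff f k * ((A ^\<^sub>m k) *\<^sub>v v) $ i)"
    unfolding sum.lessThan_Suc_shift f using A Suc.prems by simp
  finally show ?case .
qed

lemma ac_hom: "inj_comm_ring_hom (to_ac :: 'a::field \<Rightarrow> 'a alg_closure)"
  by unfold_locales auto

text \<open>Over the algebraic closure a root \<open>c\<close> of \<open>f\<close> is an eigenvalue
  of \<open>A\<close>, and \<open>f(A)\<close> multiplies its eigenvector by
  \<open>f(c) = 0\<close>. The determinant is compatible with the base change. This takes the place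
  of the Cayley-Hamilton theorem below.\<close>

lemma det_pm_zero:
  fixes A :: "'a::field_gcd mat"
  assumes A: "A \<in> carrier_mat n n" and f: "f dvd char_poly A" "degree f > 0"
  shows "det (pm f A) = 0"
proof -
  interpret h: inj_comm_ring_hom "to_ac :: 'a \<Rightarrow> 'a alg_closure" by (rule ac_hom)
  interpret m: map_poly_inj_comm_ring_hom "to_ac :: 'a \<Rightarrow> 'a alg_closure" ..
  let ?A = "map_mat to_ac A" and ?f = "map_poly to_ac f"
  have A': "?A \<in> carrier_mat n n" using A by simp
  have "degree ?f > 0" using f(2) by simp
  then obtain c where c: "poly ?f c = 0" using alg_closed_imp_poly_has_root by blast
  have "?f dvd map_poly to_ac (char_poly A)" using f(1) unfolding dvd_def by (metis m.hom_mult)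
  then have "?f dvd char_poly ?A" using h.char_poly_hom[OF A] by simp
  then have "poly (char_poly ?A) c = 0" using c by auto
  then have "eigenvalue ?A c" using eigenvalue_root_char_poly[OF A'] by simp
  then obtain u where u: "eigenvector ?A u c" unfolding eigenvalue_def by blast
  then have u': "u \<in> carrier_vec n" "u \<noteq> 0\<^sub>v n" "?A *\<^sub>v u = c \<cdot>\<^sub>v u"
    using A by (auto simp: eigenvector_def)
  have "pm ?f ?A *\<^sub>v u = 0\<^sub>v n"
    using pm_eigenvector[OF A' u'(1,3), of ?f] c u' by (auto intro!: eq_vecI)
  then have "det (pm ?f ?A) = 0"
    using det_0_iff_vec_prod_zero[OF pm_carrier[OF A']] u' by blast
  then have "det (map_mat to_ac (pm f A)) = 0"
    using pm_hom[OF h.comm_ring_hom_axioms A, of f] by simp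
  then show ?thesis by (simp add: h.hom_det)
qed

text \<open>A \<open>d\<close>-dimensional subspace is represented by the matrix of a basis;
  invariance then reads \<open>A * V = V * B\<close>, with \<open>B\<close> the matrix of the
  restriction.\<close>

definition inj_mat :: "'a::field mat \<Rightarrow> nat \<Rightarrow> nat \<Rightarrow> bool" where
  "inj_mat V n d \<longleftrightarrow> V \<in> carrier_mat n d \<and> (\<forall>c\<in>carrier_vec d. V *\<^sub>v c = 0\<^sub>v n \<longrightarrow> c = 0\<^sub>v d)"

lemma inj_mat_carrier: "inj_mat V n d \<Longrightarrow> V \<in> carrier_mat n d"
  by (simp add: inj_mat_def)

lemma inj_mat_GL: "inj_mat G n n \<longleftrightarrow> G \<in> GL n"
  unfolding inj_mat_def GL_def using det_0_iff_vec_prod_zero[of G n] by auto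

lemma inj_mat_mult:
  assumes "inj_mat V n d" "inj_mat W d e"
  shows "inj_mat (V * W) n e"
proof -
  have V: "V \<in> carrier_mat n d" and W: "W \<in> carrier_mat d e" using assms by (auto simp: inj_mat_def)
  have "c = 0\<^sub>v e" if c: "c \<in> carrier_vec e" "(V * W) *\<^sub>v c = 0\<^sub>v n" for c
  proof -
    have "V *\<^sub>v (W *\<^sub>v c) = 0\<^sub>v n" using V W c assoc_mult_mat_vec[OF V W c(1)] by simp
    then have "W *\<^sub>v c = 0\<^sub>v d" using assms(1) W c by (auto simp: inj_mat_def)
    then show ?thesis using assms(2) c by (auto simp: inj_mat_def)
  qed
  then show ?thesis using V W unfolding inj_mat_def by auto
qed

lemma inj_mat_cancel:
  assumes "inj_mat V n d" "M \<in> carrier_mat d m" "N \<in> carrier_mat d m" "V * M = V * N"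
  shows "M = N"
proof (rule eq_matI)
  have V: "V \<in> carrier_mat n d" using assms by (auto simp: inj_mat_def)
  fix i j assume "i < dim_row N" "j < dim_col N"
  then have ij: "i < d" "j < m" using assms by auto
  have cm: "col M j \<in> carrier_vec d" "col N j \<in> carrier_vec d" using assms(2,3) by auto
  have "V *\<^sub>v col M j = V *\<^sub>v col N j"
    using col_mult2[OF V assms(2) ij(2)] col_mult2[OF V assms(3) ij(2)] assms(4) by simp
  then have "V *\<^sub>v (col M j - col N j) = 0\<^sub>v n"
    using mult_minus_distrib_mat_vec[OF V cm] V cm by simp
  then have "col M j - col N j = 0\<^sub>v d" using assms(1) cm by (auto simp: inj_mat_def)
  then have "(col M j - col N j) $ i = 0" using ij by simp
  then show "M $$ (i, j) = N $$ (i, j)" using ij assms(2,3) by simp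
qed (use assms in auto)

lemma irreducible_degree_pos:
  fixes f :: "'a::field poly"
  assumes "irreducible f"
  shows "degree f > 0"
proof (rule ccontr)
  assume "\<not> degree f > 0"
  then have "is_unit f" using assms is_unit_iff_degree[of f] by auto
  then show False using assms irreducible_not_unit by blast
qed

text \<open>\<open>K\<close> is the Krylov matrix of \<open>v\<close> and \<open>C\<close> the
  companion matrix of \<open>f\<close>. A nonzero polynomial of smaller degree that kills
  \<open>v\<close> is coprime to \<open>f\<close>, so Bezout would give \<open>v = 0\<close>; hence
  \<open>K\<close> is injective. No determinant is expanded to find \<open>char_poly C\<close>:
  cancelling \<open>K\<close> gives \<open>pm f C = 0\<close>, this forces a common factor of
  \<open>f\<close> and \<open>char_poly C\<close>, and irreducibility, degrees and monicity do the
  rest.\<close>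

lemma cyclic_subspace:
  fixes A :: "'a::field_gcd mat"
  assumes A: "A \<in> carrier_mat n n" and f: "irreducible f" "monic f"
    and v: "v \<in> carrier_vec n" "v \<noteq> 0\<^sub>v n" "pm f A *\<^sub>v v = 0\<^sub>v n"
  defines "K \<equiv> mat n (degree f) (\<lambda>(i, j). ((A ^\<^sub>m j) *\<^sub>v v) $ i)"
    and "C \<equiv> mat (degree f) (degree f) (\<lambda>(i, j). if Suc j < degree f then (if i = Suc j then 1 else 0) else - coeff f i)"
  shows "inj_mat K n (degree f)" "A * K = K * C" "char_poly C = f" "pm f C = 0\<^sub>m (degree f) (degree f)"
proof -
  let ?d = "degree f"
  have d: "?d > 0" using f(1) by (rule irreducible_degree_pos)
  have K: "K \<in> carrier_mat n ?d" and C: "C \<in> carrier_mat ?d ?d" by (auto simp: K_def C_def)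
  have Kj: "K $$ (i, j) = ((A ^\<^sub>m j) *\<^sub>v v) $ i" if "i < n" "j < ?d" for i j
    using that by (simp add: K_def)
  have colK: "col K j = (A ^\<^sub>m j) *\<^sub>v v" if "j < ?d" for j
    using that A v by (intro eq_vecI) (auto simp: K_def)
  show inj: "inj_mat K n ?d"
    unfolding inj_mat_def
  proof (intro conjI ballI impI K)
    fix c assume c: "c \<in> carrier_vec ?d" "K *\<^sub>v c = 0\<^sub>v n"
    \<comment> \<open>\<open>K *\<^sub>v c\<close> is \<open>g(A)\<close> applied to
      \<open>v\<close>, where \<open>g\<close> has coefficient vector \<open>c\<close>.\<close>
    define g where "g = (\<Sum>k<?d. monom (c $ k) k)"
    have cg: "coeff g k = (if k < ?d then c $ k else 0)" for k
      by (auto simp: g_def coeff_sum sum.delta')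
    have gv: "pm g A *\<^sub>v v = 0\<^sub>v n"
    proof (rule eq_vecI)
      fix i assume "i < dim_vec (0\<^sub>v n :: 'a vec)"
      then have i: "i < n" by simp
      have "(pm g A *\<^sub>v v) $ i = (\<Sum>k<?d. coeff g k * ((A ^\<^sub>m k) *\<^sub>v v) $ i)"
        by (rule pm_vec[OF A v(1) _ i]) (simp add: cg)
      also have "\<dots> = (\<Sum>k<?d. K $$ (i, k) * c $ k)"
        by (rule sum.cong) (auto simp: cg Kj i mult.commute)
      also have "\<dots> = (K *\<^sub>v c) $ i"
        using mult_mat_vec_sum[OF K c(1) i] by simp
      finally show "(pm g A *\<^sub>v v) $ i = 0\<^sub>v n $ i" using c by simp
    qed (use A in auto)
    have "g = 0"
    proof (rule ccontr)
      assume g0: "g \<noteq> 0"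
      have "degree g < ?d" using d by (intro degree_lessI) (auto simp: cg)
      then have "\<not> f dvd g" using dvd_imp_degree_le[of f g] g0 by auto
      then have "coprime f g" using f(1) by (simp add: prime_elem_imp_coprime irreducible_imp_prime_elem)
      then have "fst (bezout_coefficients f g) * f + snd (bezout_coefficients f g) * g = 1"
        using bezout_coefficients_fst_snd[of f g] by simp
      then obtain a b where ab: "a * f + b * g = 1" by blast
      have cc: "pm a A \<in> carrier_mat n n" "pm b A \<in> carrier_mat n n" "pm f A \<in> carrier_mat n n" "pm g A \<in> carrier_mat n n"
        using A by auto
      have "v = pm (a * f + b * g) A *\<^sub>v v" using ab A v by (simp add: pm_one)
      also have "\<dots> = (pm a A * pm f A) *\<^sub>v v + (pm b A * pm g A) *\<^sub>v v"
        unfolding pm_add[OF A] pm_mult[OF A] using cc v by (intro add_mult_distrib_mat_vec[of _ n n]) auto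
      also have "(pm a A * pm f A) *\<^sub>v v = 0\<^sub>v n"
        using assoc_mult_mat_vec[OF cc(1,3) v(1)] v(3) cc by (auto intro!: eq_vecI)
      also have "(pm b A * pm g A) *\<^sub>v v = 0\<^sub>v n"
        using assoc_mult_mat_vec[OF cc(2,4) v(1)] gv cc by (auto intro!: eq_vecI)
      finally show False using v by simp
    qed
    then have "c $ k = 0" if "k < ?d" for k using cg[of k] that by simp
    then show "c = 0\<^sub>v ?d" using c by (intro eq_vecI) auto
  qed
  show eq: "A * K = K * C"
  proof (rule eq_matI)
    fix i j assume "i < dim_row (K * C)" "j < dim_col (K * C)"
    then have ij: "i < n" "j < ?d" using K C by auto
    have Ak: "(A * K) $$ (i, j) = ((A ^\<^sub>m Suc j) *\<^sub>v v) $ i"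
    proof -
      have Aj: "A ^\<^sub>m j \<in> carrier_mat n n" using A by simp
      have "A * A ^\<^sub>m j = A ^\<^sub>m j * A" by (rule pow_mat_commute[OF A])
      moreover have "(A * K) $$ (i, j) = (A *\<^sub>v col K j) $ i" using ij A K by auto
      moreover have "A *\<^sub>v ((A ^\<^sub>m j) *\<^sub>v v) = (A * A ^\<^sub>m j) *\<^sub>v v"
        using assoc_mult_mat_vec[OF A Aj v(1)] by simp
      ultimately show ?thesis using colK[OF ij(2)] by simp
    qed
    have KC: "(K * C) $$ (i, j) = (\<Sum>k<?d. ((A ^\<^sub>m k) *\<^sub>v v) $ i * C $$ (k, j))"
      using mult_mat_sum[OF K C ij] Kj ij by (simp del: index_mult_mat_vec)
    show "(A * K) $$ (i, j) = (K * C) $$ (i, j)"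
    proof (cases "Suc j < ?d")
      case True
      have "(\<Sum>k<?d. ((A ^\<^sub>m k) *\<^sub>v v) $ i * C $$ (k, j))
          = (\<Sum>k<?d. if k = Suc j then ((A ^\<^sub>m k) *\<^sub>v v) $ i else 0)"
        using True ij by (intro sum.cong) (auto simp: C_def)
      then show ?thesis unfolding Ak KC using True by simp
    next
      case False
      then have j: "Suc j = ?d" using ij by simp
      have "(pm f A *\<^sub>v v) $ i = (\<Sum>k<Suc ?d. coeff f k * ((A ^\<^sub>m k) *\<^sub>v v) $ i)"
        by (rule pm_vec[OF A v(1) _ ij(1)]) (simp add: coeff_eq_0)
      then have "((A ^\<^sub>m ?d) *\<^sub>v v) $ i = - (\<Sum>k<?d. coeff f k * ((A ^\<^sub>m k) *\<^sub>v v) $ i)"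
        using v(3) ij f(2) by (simp add: eq_neg_iff_add_eq_0 add.commute del: index_mult_mat_vec)
      also have "\<dots> = (\<Sum>k<?d. ((A ^\<^sub>m k) *\<^sub>v v) $ i * C $$ (k, j))"
        unfolding sum_negf[symmetric] using False ij by (intro sum.cong) (auto simp: C_def simp del: index_mult_mat_vec)
      finally show ?thesis unfolding Ak KC j .
    qed
  qed (use A K C in auto)
  have "pm f A * K = 0\<^sub>m n ?d"
  proof (rule eq_matI)
    fix i j assume "i < dim_row (0\<^sub>m n ?d :: 'a mat)" "j < dim_col (0\<^sub>m n ?d :: 'a mat)"
    then have ij: "i < n" "j < ?d" by auto
    have Aj: "A ^\<^sub>m j \<in> carrier_mat n n" "pm f A \<in> carrier_mat n n" using A by auto
    have "pm f A * A ^\<^sub>m j = A ^\<^sub>m j * pm f A"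
    proof (induction j)
      case (Suc j)
      have Aj: "A ^\<^sub>m j \<in> carrier_mat n n" "pm f A \<in> carrier_mat n n" using A by auto
      have "pm f A * (A ^\<^sub>m j * A) = A ^\<^sub>m j * pm f A * A"
        using Suc assoc_mult_mat[OF Aj(2,1) A] by simp
      also have "\<dots> = A ^\<^sub>m j * (pm f A * A)" using assoc_mult_mat[OF Aj A] by simp
      also have "\<dots> = A ^\<^sub>m j * (A * pm f A)" using pm_self_commute[OF A] by simp
      also have "\<dots> = A ^\<^sub>m j * A * pm f A" using assoc_mult_mat[OF Aj(1) A Aj(2)] by simp
      finally show ?case by simp
    qed (use A in \<open>simp add: right_mult_one_mat[of _ n n] left_mult_one_mat[of _ n n]\<close>)
    then have "pm f A *\<^sub>v ((A ^\<^sub>m j) *\<^sub>v v) = (A ^\<^sub>m j) *\<^sub>v (pm f A *\<^sub>v v)"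
      using assoc_mult_mat_vec[OF Aj(1,2) v(1)] assoc_mult_mat_vec[OF Aj(2,1) v(1)] by simp
    moreover have "(pm f A * K) $$ (i, j) = (pm f A *\<^sub>v col K j) $ i" using ij Aj K by auto
    moreover have "(A ^\<^sub>m j) *\<^sub>v 0\<^sub>v n = 0\<^sub>v n" using mult_mat_zero_vec[OF Aj(1)] .
    ultimately show "(pm f A * K) $$ (i, j) = 0\<^sub>m n ?d $$ (i, j)"
      using ij colK[OF ij(2)] v(3) by (simp del: index_mult_mat)
  qed (use A K in auto)
  then have "K * pm f C = K * 0\<^sub>m ?d ?d" using pm_intertwine[OF A C K eq, of f] K by simp
  then show fC: "pm f C = 0\<^sub>m ?d ?d" using inj_mat_cancel[OF inj pm_carrier[OF C] zero_carrier_mat] by blast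
  \<comment> \<open>Since \<open>pm f C = 0\<close>, coprimality would make
    \<open>pm (char_poly C) C\<close> invertible, but its determinant vanishes by
    \<open>det_pm_zero\<close>.\<close>
  have "\<not> coprime f (char_poly C)"
  proof
    assume "coprime f (char_poly C)"
    then have "fst (bezout_coefficients f (char_poly C)) * f + snd (bezout_coefficients f (char_poly C)) * char_poly C = 1"
      using bezout_coefficients_fst_snd[of f "char_poly C"] by simp
    then obtain a b where ab: "a * f + b * char_poly C = 1" by blast
    have cc: "pm a C \<in> carrier_mat ?d ?d" "pm b C \<in> carrier_mat ?d ?d" "pm (char_poly C) C \<in> carrier_mat ?d ?d"
      using C by auto
    have "1\<^sub>m ?d = pm a C * 0\<^sub>m ?d ?d + pm b C * pm (char_poly C) C"
      using ab pm_one[OF C] by (metis pm_add[OF C] pm_mult[OF C] fC)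
    also have "\<dots> = pm b C * pm (char_poly C) C"
      using cc by (simp add: right_mult_zero_mat[of _ ?d ?d] left_add_zero_mat[of _ ?d ?d])
    finally have "det (pm b C) * det (pm (char_poly C) C) = 1"
      using det_mult[OF cc(2,3)] by (metis det_one)
    moreover have "det (pm (char_poly C) C) = 0"
      using det_pm_zero[OF C dvd_refl] degree_char_poly[OF C] d by simp
    ultimately show False by simp
  qed
  then have "f dvd char_poly C" using f(1) by (meson prime_elem_imp_coprime irreducible_imp_prime_elem)
  then obtain g where g: "char_poly C = f * g" by (elim dvdE)
  then have "g \<noteq> 0" "f \<noteq> 0" using char_poly_nonzero[OF C] by auto
  then have "degree g = 0" using arg_cong[OF g, of degree] degree_char_poly[OF C] by (simp add: degree_mult_eq)
  then obtain c where "g = [:c:]" by (rule degree_eq_zeroE)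
  then show "char_poly C = f" using g f(2) monic_char_poly[OF C] \<open>g \<noteq> 0\<close> by auto
qed

lemma irreducible_invariant_subspace:
  fixes A :: "'a::field_gcd mat"
  assumes A: "A \<in> carrier_mat n n" and f: "irreducible f" "monic f" "f dvd char_poly A"
  obtains K C where "inj_mat K n (degree f)" "C \<in> carrier_mat (degree f) (degree f)"
    "A * K = K * C" "char_poly C = f" "pm f C = 0\<^sub>m (degree f) (degree f)"
proof -
  have d: "degree f > 0" using f(1) by (rule irreducible_degree_pos)
  then have "det (pm f A) = 0" using det_pm_zero[OF A f(3)] by simp
  then obtain v where "v \<in> carrier_vec n" "v \<noteq> 0\<^sub>v n" "pm f A *\<^sub>v v = 0\<^sub>v n"
    using det_0_iff_vec_prod_zero[OF pm_carrier[OF A]] by blast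
  note cs = cyclic_subspace[OF A f(1,2) this]
  show thesis by (rule that[OF cs(1) _ cs(2-4)]) simp
qed

text \<open>Basis extension by counting: \<open>d < n\<close> columns span fewer vectors than the
  whole space contains, so a vector outside the span can be appended.\<close>

lemma inj_mat_extend:
  fixes V :: "'a::{field,finite} mat"
  assumes "inj_mat V n d"
  shows "d \<le> n \<and> (\<exists>G\<in>GL n. \<forall>i<n. \<forall>j<d. G $$ (i, j) = V $$ (i, j))"
proof -
  have le: "d \<le> n" if "inj_mat V n d" for V :: "'a mat" and d
  proof -
    have V: "V \<in> carrier_mat n d" using that by (simp add: inj_mat_def)
    have "inj_on (\<lambda>c. V *\<^sub>v c) (carrier_vec d)"
    proof (rule inj_onI)
      fix c c' assume c: "c \<in> carrier_vec d" "c' \<in> carrier_vec d" "V *\<^sub>v c = V *\<^sub>v c'"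
      then have "V *\<^sub>v (c - c') = 0\<^sub>v n" using mult_minus_distrib_mat_vec[OF V c(1,2)] V by simp
      then have *: "c - c' = 0\<^sub>v d" using that c by (auto simp: inj_mat_def)
      show "c = c'"
      proof (rule eq_vecI)
        fix i assume "i < dim_vec c'"
        then show "c $ i = c' $ i" using arg_cong[OF *, of "\<lambda>v. v $ i"] c by auto
      qed (use c in auto)
    qed
    then have "card (carrier_vec d :: 'a vec set) \<le> card (carrier_vec n :: 'a vec set)"
      using V by (intro card_inj_on_le[of "\<lambda>c. V *\<^sub>v c"]) (auto simp: finite_carrier_vec)
    moreover have "CARD('a) > 1"
      using card_mono[of "UNIV :: 'a set" "{0, 1}"] by simp
    ultimately show ?thesis by (simp add: card_carrier_vec)
  qed
  have "\<exists>G\<in>GL n. \<forall>i<n. \<forall>j<d. G $$ (i, j) = V $$ (i, j)" using assms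
  proof (induction "n - d" arbitrary: V d)
    case 0
    then have "d = n" using le[of V d] by simp
    then show ?case using 0 inj_mat_GL by blast
  next
    case (Suc k)
    have V: "V \<in> carrier_mat n d" using Suc.prems by (simp add: inj_mat_def)
    have "d < n" using Suc.hyps(2) by simp
    have "card ((\<lambda>c. V *\<^sub>v c) ` carrier_vec d) \<le> CARD('a) ^ d"
      using card_image_le[OF finite_carrier_vec, of "\<lambda>c. V *\<^sub>v c" d] by (simp add: card_carrier_vec)
    also have "\<dots> < CARD('a) ^ n"
      using \<open>d < n\<close> card_mono[of "UNIV :: 'a set" "{0, 1}"] by (intro power_strict_increasing) auto
    also have "\<dots> = card (carrier_vec n :: 'a vec set)" by (simp add: card_carrier_vec)
    finally have "(\<lambda>c. V *\<^sub>v c) ` carrier_vec d \<noteq> carrier_vec n" by auto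
    moreover have "(\<lambda>c. V *\<^sub>v c) ` carrier_vec d \<subseteq> carrier_vec n" using V by auto
    ultimately obtain w where w: "w \<in> carrier_vec n" "w \<notin> (\<lambda>c. V *\<^sub>v c) ` carrier_vec d" by blast
    define W where "W = mat n (Suc d) (\<lambda>(i, j). if j < d then V $$ (i, j) else w $ i)"
    have W: "W \<in> carrier_mat n (Suc d)" by (simp add: W_def)
    have "inj_mat W n (Suc d)"
      unfolding inj_mat_def
    proof (intro conjI ballI impI W)
      fix c assume c: "c \<in> carrier_vec (Suc d)" "W *\<^sub>v c = 0\<^sub>v n"
      define c' where "c' = vec d (\<lambda>i. c $ i)"
      have c': "c' \<in> carrier_vec d" by (simp add: c'_def)
      have eq: "(V *\<^sub>v c') $ i + c $ d * w $ i = 0" if i: "i < n" for i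
      proof -
        have "(W *\<^sub>v c) $ i = (\<Sum>k<Suc d. W $$ (i, k) * c $ k)"
          using mult_mat_vec_sum[OF W c(1) i] by simp
        also have "\<dots> = (\<Sum>k<d. V $$ (i, k) * c' $ k) + w $ i * c $ d"
          using i by (simp add: W_def c'_def)
        also have "(\<Sum>k<d. V $$ (i, k) * c' $ k) = (V *\<^sub>v c') $ i"
          using mult_mat_vec_sum[OF V c' i] by simp
        finally show ?thesis using c i by (simp add: mult.commute)
      qed
      have cd: "c $ d = 0"
      proof (rule ccontr)
        assume nz: "c $ d \<noteq> 0"
        have "w = V *\<^sub>v (- inverse (c $ d) \<cdot>\<^sub>v c')"
        proof (rule eq_vecI)
          fix i assume "i < dim_vec (V *\<^sub>v (- inverse (c $ d) \<cdot>\<^sub>v c'))"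
          then have i: "i < n" using V by simp
          have "(V *\<^sub>v (- inverse (c $ d) \<cdot>\<^sub>v c')) $ i = - inverse (c $ d) * (V *\<^sub>v c') $ i"
            using mult_mat_vec[OF V c', of "- inverse (c $ d)"] V i by simp
          also have "(V *\<^sub>v c') $ i = - (c $ d * w $ i)" using eq[OF i] by (simp add: eq_neg_iff_add_eq_0)
          finally show "w $ i = (V *\<^sub>v (- inverse (c $ d) \<cdot>\<^sub>v c')) $ i" using nz by simp
        qed (use V w in auto)
        then show False using w(2) c' by auto
      qed
      then have "V *\<^sub>v c' = 0\<^sub>v n" using eq V by (intro eq_vecI) auto
      then have "c' = 0\<^sub>v d" using Suc.prems c' by (auto simp: inj_mat_def)
      then have "c $ i = 0" if "i < d" for i using that arg_cong[of c' "0\<^sub>v d" "\<lambda>v. v $ i"] index_vec[of i d "\<lambda>i. c $ i"] by (simp add: c'_def[symmetric])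
      then show "c = 0\<^sub>v (Suc d)" using cd c by (intro eq_vecI) (auto simp: less_Suc_eq)
    qed
    moreover have "k = n - Suc d" using Suc.hyps(2) by simp
    ultimately obtain G where "G \<in> GL n" "\<forall>i<n. \<forall>j<Suc d. G $$ (i, j) = W $$ (i, j)"
      using Suc.hyps(1) by blast
    then show ?case by (intro bexI[of _ G]) (auto simp: W_def)
  qed
  then show ?thesis using le[OF assms] by blast
qed

section \<open>Primary decomposition\<close>

lemma four_block_obtain:
  assumes "W \<in> carrier_mat (a + b) (c + d)"
  obtains P R S Q where "P \<in> carrier_mat a c" "R \<in> carrier_mat a d" "S \<in> carrier_mat b c" "Q \<in> carrier_mat b d"
    "W = four_block_mat P R S Q"
proof (rule that)
  let ?P = "mat a c (\<lambda>(i, j). W $$ (i, j))" and ?R = "mat a d (\<lambda>(i, j). W $$ (i, j + c))"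
  let ?S = "mat b c (\<lambda>(i, j). W $$ (i + a, j))" and ?Q = "mat b d (\<lambda>(i, j). W $$ (i + a, j + c))"
  show "W = four_block_mat ?P ?R ?S ?Q"
    using assms by (intro eq_matI) (auto simp: four_block_mat_def Let_def)
qed auto

lemma four_block_inject:
  assumes "P \<in> carrier_mat a c" "R \<in> carrier_mat a d" "S \<in> carrier_mat b c" "Q \<in> carrier_mat b d"
    "P' \<in> carrier_mat a c" "R' \<in> carrier_mat a d" "S' \<in> carrier_mat b c" "Q' \<in> carrier_mat b d"
    and eq: "four_block_mat P R S Q = four_block_mat P' R' S' Q'"
  shows "P = P'" "R = R'" "S = S'" "Q = Q'"
proof -
  have *: "four_block_mat P R S Q $$ (i, j) = four_block_mat P' R' S' Q' $$ (i, j)" for i j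
    using eq by simp
  show "P = P'"
  proof (rule eq_matI)
    fix i j assume "i < dim_row P'" "j < dim_col P'"
    then show "P $$ (i, j) = P' $$ (i, j)" using *[of i j] assms(1-8) by simp
  qed (use assms in auto)
  show "R = R'"
  proof (rule eq_matI)
    fix i j assume "i < dim_row R'" "j < dim_col R'"
    then show "R $$ (i, j) = R' $$ (i, j)" using *[of i "j + c"] assms(1-8) by simp
  qed (use assms in auto)
  show "S = S'"
  proof (rule eq_matI)
    fix i j assume "i < dim_row S'" "j < dim_col S'"
    then show "S $$ (i, j) = S' $$ (i, j)" using *[of "i + a" j] assms(1-8) by simp
  qed (use assms in auto)
  show "Q = Q'"
  proof (rule eq_matI)
    fix i j assume "i < dim_row Q'" "j < dim_col Q'"
    then show "Q $$ (i, j) = Q' $$ (i, j)" using *[of "i + a" "j + c"] assms(1-8) by simp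
  qed (use assms in auto)
qed

abbreviation diag2 :: "'a::zero mat \<Rightarrow> 'a mat \<Rightarrow> 'a mat" where
  "diag2 B C \<equiv> four_block_mat B (0\<^sub>m (dim_row B) (dim_col C)) (0\<^sub>m (dim_row C) (dim_col B)) C"

lemma block_upper_mult:
  fixes C R D :: "'a::semiring_0 mat"
  assumes "C \<in> carrier_mat a a" "R \<in> carrier_mat a b" "D \<in> carrier_mat b b"
    "C' \<in> carrier_mat a c" "R' \<in> carrier_mat a d" "D' \<in> carrier_mat b d"
  shows "four_block_mat C R (0\<^sub>m b a) D * four_block_mat C' R' (0\<^sub>m b c) D'
       = four_block_mat (C * C') (C * R' + R * D') (0\<^sub>m b c) (D * D')"
proof -
  have "C * C' + R * 0\<^sub>m b c = C * C'" "0\<^sub>m b a * C' + D * 0\<^sub>m b c = 0\<^sub>m b c"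
    "0\<^sub>m b a * R' + D * D' = D * D'"
    using assms by auto
  then show ?thesis
    using mult_four_block_mat[OF assms(1,2) zero_carrier_mat assms(3) assms(4,5) zero_carrier_mat assms(6)] by simp
qed

lemma GL_block_upper:
  assumes "P \<in> carrier_mat a a" "S \<in> carrier_mat a b" "Q \<in> carrier_mat b b"
  shows "four_block_mat P S (0\<^sub>m b a) Q \<in> GL (a + b) \<longleftrightarrow> P \<in> GL a \<and> Q \<in> GL b"
  using assms by (auto simp: GL_def det_four_block_mat_lower_left_zero[OF assms(1,2) refl assms(3)])

text \<open>Completing the columns of \<open>V\<close> to a basis makes \<open>C\<close> the upper
  left block and zero the block below it, while the other two blocks are arbitrary.\<close>

lemma block_form:
  fixes A :: "'a::{field,finite} mat"
  assumes A: "A \<in> carrier_mat n n" and V: "inj_mat V n d" and C: "C \<in> carrier_mat d d"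
    and eq: "A * V = V * C"
  obtains G R D where "G \<in> GL n" "R \<in> carrier_mat d (n - d)" "D \<in> carrier_mat (n - d) (n - d)"
    "A * G = G * four_block_mat C R (0\<^sub>m (n - d) d) D" "\<And>i j. i < n \<Longrightarrow> j < d \<Longrightarrow> G $$ (i, j) = V $$ (i, j)"
proof -
  obtain G where G: "G \<in> GL n" and GV: "\<And>i j. i < n \<Longrightarrow> j < d \<Longrightarrow> G $$ (i, j) = V $$ (i, j)" and dn: "d \<le> n"
    using inj_mat_extend[OF V] by blast
  note Gc = GL_carrier[OF G] and Gi = minv[OF G] and Vc = inj_mat_carrier[OF V]
  \<comment> \<open>\<open>E\<close> consists of the first \<open>d\<close> columns of the identity
    matrix, so that \<open>V = G * E\<close>, and \<open>M * E = E * C\<close> displays the first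
    \<open>d\<close> columns of \<open>M\<close>.\<close>
  define E where "E = mat n d (\<lambda>(i, j). if i = j then 1 else (0::'a))"
  have E: "E \<in> carrier_mat n d" by (simp add: E_def)
  define M where "M = minv G * (A * G)"
  have M: "M \<in> carrier_mat n n" using Gi Gc A by (simp add: M_def)
  have ME0: "(N * E) $$ (i, j) = N $$ (i, j)" if "N \<in> carrier_mat n n" "i < n" "j < d" for N i j
  proof -
    have "(N * E) $$ (i, j) = (\<Sum>k<n. if k = j then N $$ (i, k) else 0)"
      unfolding mult_mat_sum[OF that(1) E that(2,3)] using that dn by (intro sum.cong) (auto simp: E_def)
    then show ?thesis using that dn by simp
  qed
  have VG: "V = G * E"
    using Vc Gc E GV ME0[OF Gc] by (intro eq_matI) (auto simp del: index_mult_mat(1))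
  have "M * E = minv G * (A * G * E)"
    unfolding M_def using Gi Gc A E by (intro assoc_mult_mat[of _ n n _ n _ d]) auto
  also have "A * G * E = A * (G * E)" using Gc A E by (intro assoc_mult_mat[of _ n n _ n _ d]) auto
  also have "\<dots> = G * E * C" using eq unfolding VG .
  also have "\<dots> = G * (E * C)" using Gc C E by (intro assoc_mult_mat[of _ n n _ d _ d]) auto
  also have "minv G * \<dots> = E * C" using E C by (intro minv_cancel(1)[OF G, of _ d]) auto
  finally have MEC: "M * E = E * C" .
  have EC: "(E * C) $$ (i, j) = (if i < d then C $$ (i, j) else 0)" if "i < n" "j < d" for i j
  proof -
    have "(E * C) $$ (i, j) = (\<Sum>k<d. if k = i then C $$ (k, j) else 0)"
      unfolding mult_mat_sum[OF E C that] using that by (intro sum.cong) (auto simp: E_def)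
    then show ?thesis by simp
  qed
  have M1: "M $$ (i, j) = (if i < d then C $$ (i, j) else 0)" if "i < n" "j < d" for i j
    using ME0[OF M that] MEC EC[OF that] by simp
  have "M \<in> carrier_mat (d + (n - d)) (d + (n - d))" using M dn by simp
  then obtain C' R Z D where blocks: "C' \<in> carrier_mat d d" "R \<in> carrier_mat d (n - d)"
      "Z \<in> carrier_mat (n - d) d" "D \<in> carrier_mat (n - d) (n - d)" "M = four_block_mat C' R Z D"
    by (rule four_block_obtain)
  have "C' = C"
  proof (rule eq_matI)
    fix i j assume "i < dim_row C" "j < dim_col C"
    then show "C' $$ (i, j) = C $$ (i, j)" using M1[of i j] blocks C dn by simp
  qed (use blocks C in auto)
  moreover have "Z = 0\<^sub>m (n - d) d"
  proof (rule eq_matI)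
    fix i j assume "i < dim_row (0\<^sub>m (n - d) d :: 'a mat)" "j < dim_col (0\<^sub>m (n - d) d :: 'a mat)"
    then show "Z $$ (i, j) = 0\<^sub>m (n - d) d $$ (i, j)" using M1[of "i + d" j] blocks C dn by simp
  qed (use blocks in auto)
  moreover have "A * G = G * M"
    unfolding M_def using A Gc by (intro minv_cancel(2)[OF G, of _ n, symmetric]) auto
  ultimately show thesis using that[OF G blocks(2,4) _ GV] blocks(5) by simp
qed

lemma inj_mat_block_diag:
  fixes V :: "'a::field mat"
  assumes "inj_mat V m e"
  shows "inj_mat (four_block_mat (1\<^sub>m d) (0\<^sub>m d e) (0\<^sub>m m d) V) (d + m) (d + e)"
  unfolding inj_mat_def
proof (intro conjI ballI impI)
  have V: "V \<in> carrier_mat m e" using assms by (simp add: inj_mat_def)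
  let ?M = "four_block_mat (1\<^sub>m d) (0\<^sub>m d e) (0\<^sub>m m d) V"
  show M: "?M \<in> carrier_mat (d + m) (d + e)" using V by auto
  fix c :: "'a vec" assume c: "c \<in> carrier_vec (d + e)" "?M *\<^sub>v c = 0\<^sub>v (d + m)"
  have 1: "c $ i = 0" if i: "i < d" for i
  proof -
    have "(?M *\<^sub>v c) $ i = (\<Sum>k<d + e. ?M $$ (i, k) * c $ k)"
      using i by (intro mult_mat_vec_sum[OF M c(1)]) auto
    also have "\<dots> = (\<Sum>k<d + e. if k = i then c $ k else 0)"
      using i V by (intro sum.cong) auto
    finally show ?thesis using c i by simp
  qed
  define c' where "c' = vec e (\<lambda>i. c $ (i + d))"
  have c': "c' \<in> carrier_vec e" by (simp add: c'_def)
  have "V *\<^sub>v c' = 0\<^sub>v m"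
  proof (rule eq_vecI)
    fix i assume "i < dim_vec (0\<^sub>v m :: 'a vec)"
    then have i: "i < m" by simp
    have "(?M *\<^sub>v c) $ (i + d) = (\<Sum>k<d + e. ?M $$ (i + d, k) * c $ k)"
      using i by (intro mult_mat_vec_sum[OF M c(1)]) auto
    also have "\<dots> = (\<Sum>k<d. ?M $$ (i + d, k) * c $ k) + (\<Sum>k<e. ?M $$ (i + d, k + d) * c $ (k + d))"
      using sum.nat_group[of "\<lambda>_. 0"] sum.atLeastLessThan_concat[of 0 d "d + e" "\<lambda>k. ?M $$ (i + d, k) * c $ k"]
        sum.shift_bounds_nat_ivl[of "\<lambda>k. ?M $$ (i + d, k) * c $ k" 0 d e]
      by (simp add: lessThan_atLeast0 add.commute)
    also have "\<dots> = (\<Sum>k<e. V $$ (i, k) * c' $ k)"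
      using i V 1 by (auto simp: c'_def intro!: sum.cong)
    also have "\<dots> = (V *\<^sub>v c') $ i" using mult_mat_vec_sum[OF V c' i] by simp
    finally show "(V *\<^sub>v c') $ i = 0\<^sub>v m $ i" using i c by simp
  qed (use V in auto)
  then have c'0: "c' = 0\<^sub>v e" using assms c' by (auto simp: inj_mat_def)
  show "c = 0\<^sub>v (d + e)"
  proof (rule eq_vecI)
    fix i assume "i < dim_vec (0\<^sub>v (d + e) :: 'a vec)"
    then have i: "i < d + e" by simp
    show "c $ i = 0\<^sub>v (d + e) $ i"
    proof (cases "i < d")
      case False
      then have "i - d + d = i" "i - d < e" using i by arith+
      then have "c $ i = c' $ (i - d)" by (simp add: c'_def)
      then show ?thesis using c'0 i False by simp
    qed (use 1 i in simp)
  qed (use c in auto)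
qed

lemma monic_irreducible_factor:
  fixes f :: "'a::field_gcd poly"
  assumes "degree f > 0"
  obtains g where "irreducible g" "monic g" "g dvd f"
proof -
  have "f \<noteq> 0" "\<not> is_unit f" using assms by (auto simp: is_unit_iff_degree)
  then obtain p where p: "p dvd f" "prime p" using prime_divisor_exists by blast
  then have irr: "irreducible p" by (simp add: prime_elem_imp_irreducible)
  then have p0: "p \<noteq> 0" by auto
  let ?g = "Polynomial.smult (inverse (lead_coeff p)) p"
  have nz: "inverse (lead_coeff p) \<noteq> 0" using p0 by simp
  show thesis
  proof (rule that)
    show "?g dvd f" using p(1) nz by (simp add: smult_dvd)
    show "monic ?g" using p0 by simp
    show "irreducible ?g" using irr nz by (simp add: irreducible_smult_field)
  qed
qed

text \<open>Induction on \<open>degree f\<close>: an irreducible factor \<open>h\<close> of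
  \<open>f\<close> gives an invariant subspace, the quotient acts by \<open>D\<close> with
  characteristic polynomial \<open>f' * g\<close>, and a subspace for \<open>f'\<close> in the
  quotient is pulled back.\<close>

lemma invariant_subspace_factor:
  fixes A :: "'a::{field_gcd,finite} mat"
  assumes "A \<in> carrier_mat n n" "char_poly A = f * g" "monic f"
  shows "\<exists>V B. inj_mat V n (degree f) \<and> B \<in> carrier_mat (degree f) (degree f) \<and> A * V = V * B \<and> char_poly B = f"
  using assms
proof (induction "degree f" arbitrary: A f n rule: less_induct)
  case less
  note A = less.prems(1)
  show ?case
  proof (cases "degree f = 0")
    case True
    then have f1: "f = 1" using less.prems(3) by (metis degree_eq_zeroE lead_coeff_pCons(2) one_pCons coeff_pCons_0 degree_pCons_0)
    let ?V = "mat n 0 (\<lambda>_. 0::'a)" and ?B = "mat 0 0 (\<lambda>_. 0 :: 'a)"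
    have "inj_mat ?V n 0" by (auto simp: inj_mat_def)
    moreover have "A * ?V = ?V * ?B" using A by (intro eq_matI) auto
    moreover have "char_poly ?B = 1" by (simp add: char_poly_def char_poly_matrix_def)
    ultimately show ?thesis using f1 by (intro exI[of _ ?V] exI[of _ ?B]) auto
  next
    case False
    then obtain h where h: "irreducible h" "monic h" "h dvd f" using monic_irreducible_factor by blast
    then obtain f' where f': "f = h * f'" by (elim dvdE)
    have h0: "h \<noteq> 0" "f' \<noteq> 0" using f' less.prems(3) by auto
    have mf': "monic f'" using less.prems(3) h(2) by (simp add: f' lead_coeff_mult)
    have dh: "degree h > 0" using irreducible_degree_pos[OF h(1)] .
    have df: "degree f = degree h + degree f'" unfolding f' using h0 by (rule degree_mult_eq)
    have "h dvd char_poly A" using less.prems(2) by (simp add: f')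
    then obtain K C where KC: "inj_mat K n (degree h)" "C \<in> carrier_mat (degree h) (degree h)" "A * K = K * C" "char_poly C = h"
      using irreducible_invariant_subspace[OF A h(1,2)] by metis
    let ?d = "degree h"
    obtain G R D where G: "G \<in> GL n" and R: "R \<in> carrier_mat ?d (n - ?d)" and D: "D \<in> carrier_mat (n - ?d) (n - ?d)"
      and AG: "A * G = G * four_block_mat C R (0\<^sub>m (n - ?d) ?d) D"
      using block_form[OF A KC(1-3)] by metis
    have dn: "?d \<le> n" using inj_mat_extend[OF KC(1)] by blast
    let ?M = "four_block_mat C R (0\<^sub>m (n - ?d) ?d) D"
    have M: "?M \<in> carrier_mat n n" using KC D dn by auto
    have "char_poly A = h * char_poly D"
      using char_poly_intertwine[OF G A M AG] char_poly_four_block_upper[OF KC(2) R D] KC(4) by simp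
    then have "char_poly D = f' * g" using less.prems(2) h0 by (simp add: f' mult.assoc)
    moreover have "degree f' < degree f" using df dh by simp
    ultimately obtain V' B' where V': "inj_mat V' (n - ?d) (degree f')" and B': "B' \<in> carrier_mat (degree f') (degree f')"
      and DV: "D * V' = V' * B'" and cB: "char_poly B' = f'"
      using less.hyps[of f' D "n - ?d"] D mf' by blast
    let ?e = "degree f'"
    \<comment> \<open>In the basis \<open>G\<close>, the columns of \<open>?E\<close> are a basis of
      the first subspace followed by lifts of the columns of \<open>V'\<close> from the
      quotient.\<close>
    let ?E = "four_block_mat (1\<^sub>m ?d) (0\<^sub>m ?d ?e) (0\<^sub>m (n - ?d) ?d) V'"
    let ?B = "four_block_mat C (R * V') (0\<^sub>m ?e ?d) B'"
    have V'c: "V' \<in> carrier_mat (n - ?d) ?e" using V' by (rule inj_mat_carrier)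
    have E: "inj_mat ?E n (?d + ?e)" using inj_mat_block_diag[OF V', of ?d] dn by simp
    have B: "?B \<in> carrier_mat (?d + ?e) (?d + ?e)" using KC B' by auto
    have RV: "R * V' \<in> carrier_mat ?d ?e" using R V'c by auto
    have ME: "?M * ?E = ?E * ?B"
    proof -
      have "?M * ?E = four_block_mat (C * 1\<^sub>m ?d) (C * 0\<^sub>m ?d ?e + R * V') (0\<^sub>m (n - ?d) ?d) (D * V')"
        by (rule block_upper_mult[OF KC(2) R D]) (use V'c in auto)
      also have "\<dots> = four_block_mat C (R * V') (0\<^sub>m (n - ?d) ?d) (V' * B')"
        using KC(2) RV by (simp add: DV right_mult_one_mat[of _ ?d ?d] right_mult_zero_mat[of _ ?d ?d] left_add_zero_mat[of _ ?d ?e])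
      finally have 1: "?M * ?E = four_block_mat C (R * V') (0\<^sub>m (n - ?d) ?d) (V' * B')" .
      have "1\<^sub>m ?d * C + 0\<^sub>m ?d ?e * 0\<^sub>m ?e ?d = C" "1\<^sub>m ?d * (R * V') + 0\<^sub>m ?d ?e * B' = R * V'"
        "0\<^sub>m (n - ?d) ?d * C + V' * 0\<^sub>m ?e ?d = 0\<^sub>m (n - ?d) ?d" "0\<^sub>m (n - ?d) ?d * (R * V') + V' * B' = V' * B'"
        using KC(2) R V'c B' RV
        by (auto simp: left_mult_one_mat[of _ ?d ?d] left_mult_one_mat[of _ ?d ?e] left_mult_zero_mat[of _ ?e ?d]
            left_mult_zero_mat[of _ ?e ?e] left_mult_zero_mat[of _ ?d ?d] left_mult_zero_mat[of _ ?d ?e]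
            right_mult_zero_mat[of _ "n - ?d" ?e] right_add_zero_mat[of _ ?d ?d] right_add_zero_mat[of _ ?d ?e] left_add_zero_mat[of _ "n - ?d" ?e])
      then have "?E * ?B = four_block_mat C (R * V') (0\<^sub>m (n - ?d) ?d) (V' * B')"
        using mult_four_block_mat[OF one_carrier_mat[of ?d] zero_carrier_mat[of ?d ?e] zero_carrier_mat[of "n - ?d" ?d] V'c
            KC(2) RV zero_carrier_mat[of ?e ?d] B'] by simp
      then show ?thesis using 1 by simp
    qed
    let ?V = "G * ?E"
    note Ec = inj_mat_carrier[OF E] and Gc = GL_carrier[OF G]
    have "inj_mat ?V n (?d + ?e)" using inj_mat_mult[OF _ E] G inj_mat_GL by blast
    moreover have "A * ?V = ?V * ?B"
    proof -
      have "A * ?V = A * G * ?E" using assoc_mult_mat[OF A Gc Ec] by simp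
      also have "\<dots> = G * (?M * ?E)" unfolding AG using assoc_mult_mat[OF Gc M Ec] .
      also have "\<dots> = ?V * ?B" unfolding ME using assoc_mult_mat[OF Gc Ec B] by simp
      finally show ?thesis .
    qed
    moreover have "char_poly ?B = f" using char_poly_four_block_upper[OF KC(2) RV B'] KC(4) cB f' by simp
    ultimately show ?thesis using B df by (intro exI[of _ ?V] exI[of _ ?B]) simp
  qed
qed

text \<open>An invariant subspace for \<open>f\<close> gives a block triangular form. Its corner
  \<open>R\<close> is removed by a unipotent conjugation whose corner \<open>Y\<close> solves the
  Sylvester equation \<open>B * Y = Y * D - R\<close>, which is solvable because \<open>f\<close>
  and \<open>g\<close> are coprime.\<close>

lemma primary_decomposition:
  fixes A :: "'a::{field_gcd,finite} mat"
  assumes A: "A \<in> carrier_mat (a + b) (a + b)" and char: "char_poly A = f * g" and cop: "coprime f g"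
    and f: "monic f" "degree f = a"
  obtains G B C where "G \<in> GL (a + b)" "B \<in> carrier_mat a a" "C \<in> carrier_mat b b"
    "char_poly B = f" "char_poly C = g" "A * G = G * diag2 B C"
proof -
  obtain V B where V: "inj_mat V (a + b) a" and B: "B \<in> carrier_mat a a" "char_poly B = f" and AV: "A * V = V * B"
    using invariant_subspace_factor[OF A char f(1)] f(2) by auto
  obtain G R D where G: "G \<in> GL (a + b)" and R: "R \<in> carrier_mat a b" and D: "D \<in> carrier_mat b b"
    and AG: "A * G = G * four_block_mat B R (0\<^sub>m b a) D"
    using block_form[OF A V B(1) AV] by (metis add_diff_cancel_left')
  let ?M = "four_block_mat B R (0\<^sub>m b a) D"
  have M: "?M \<in> carrier_mat (a + b) (a + b)" using B D by auto
  have "f * char_poly D = f * g"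
    using char_poly_intertwine[OF G A M AG] char_poly_four_block_upper[OF B(1) R D] char B(2) by metis
  moreover have "f \<noteq> 0" using f by auto
  ultimately have D2: "char_poly D = g" using mult_left_cancel by metis
  obtain Y where Y: "Y \<in> carrier_mat a b" and eqY: "B * Y = Y * D + - R"
    using sylvester_solve[OF B(1) D _, of "- R"] R cop B(2) D2 by auto
  let ?T = "four_block_mat (1\<^sub>m a) Y (0\<^sub>m b a) (1\<^sub>m b)"
  have T: "?T \<in> GL (a + b)" using GL_block_upper[OF one_carrier_mat Y one_carrier_mat] GL_one by blast
  have "?M * ?T = four_block_mat (B * 1\<^sub>m a) (B * Y + R * 1\<^sub>m b) (0\<^sub>m b a) (D * 1\<^sub>m b)"
    by (rule block_upper_mult[OF B(1) R D one_carrier_mat Y one_carrier_mat])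
  also have "\<dots> = four_block_mat B (Y * D) (0\<^sub>m b a) D"
  proof -
    have "B * Y + R * 1\<^sub>m b = Y * D"
      unfolding eqY using Y D R by (intro eq_matI) (auto simp: right_mult_one_mat[of _ a b] simp del: index_mult_mat(1))
    then show ?thesis using B D by simp
  qed
  also have "\<dots> = ?T * diag2 B D"
  proof -
    have "?T * four_block_mat B (0\<^sub>m a b) (0\<^sub>m b a) D = four_block_mat (1\<^sub>m a * B) (1\<^sub>m a * 0\<^sub>m a b + Y * D) (0\<^sub>m b a) (1\<^sub>m b * D)"
      by (rule block_upper_mult[OF one_carrier_mat Y one_carrier_mat B(1) zero_carrier_mat D])
    then show ?thesis using B Y D by (auto simp: left_add_zero_mat[of _ a b])
  qed
  finally have MT: "?M * ?T = ?T * diag2 B D" .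
  have diag: "diag2 B D \<in> carrier_mat (a + b) (a + b)" using B D by auto
  show thesis
  proof (rule that[OF GL_mult[OF G T] B(1) D B(2) D2])
    note Gc = GL_carrier[OF G] and Tc = GL_carrier[OF T]
    have "A * (G * ?T) = A * G * ?T" using assoc_mult_mat[OF A Gc Tc] by simp
    also have "\<dots> = G * (?M * ?T)" unfolding AG using assoc_mult_mat[OF Gc M Tc] .
    also have "\<dots> = G * ?T * diag2 B D" unfolding MT using assoc_mult_mat[OF Gc Tc diag] by simp
    finally show "A * (G * ?T) = G * ?T * diag2 B D" .
  qed
qed

text \<open>The off-diagonal blocks of \<open>W\<close> solve homogeneous Sylvester equations with
  coprime characteristic polynomials, so they vanish. Two block diagonal forms of one matrix
  therefore differ only by conjugations inside the blocks.\<close>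

lemma diag_intertwine:
  fixes B0 :: "'a::field_gcd mat"
  assumes c: "B0 \<in> carrier_mat a a" "C0 \<in> carrier_mat b b" "B1 \<in> carrier_mat a a" "C1 \<in> carrier_mat b b"
    and W: "W \<in> carrier_mat (a + b) (a + b)" and eq: "diag2 B0 C0 * W = W * diag2 B1 C1"
    and cop: "coprime (char_poly B0) (char_poly C1)" "coprime (char_poly C0) (char_poly B1)"
  obtains P Q where "P \<in> carrier_mat a a" "Q \<in> carrier_mat b b" "W = diag2 P Q" "B0 * P = P * B1" "C0 * Q = Q * C1"
proof -
  obtain P R S Q where bl: "P \<in> carrier_mat a a" "R \<in> carrier_mat a b" "S \<in> carrier_mat b a" "Q \<in> carrier_mat b b"
    "W = four_block_mat P R S Q" using four_block_obtain[OF W] by metis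
  have 1: "diag2 B0 C0 * W = four_block_mat (B0 * P) (B0 * R) (C0 * S) (C0 * Q)"
  proof -
    have "four_block_mat B0 (0\<^sub>m a b) (0\<^sub>m b a) C0 * W
      = four_block_mat (B0 * P + 0\<^sub>m a b * S) (B0 * R + 0\<^sub>m a b * Q) (0\<^sub>m b a * P + C0 * S) (0\<^sub>m b a * R + C0 * Q)"
      unfolding bl(5) by (rule mult_four_block_mat[OF c(1) zero_carrier_mat zero_carrier_mat c(2) bl(1-4)])
    then show ?thesis using c bl by auto
  qed
  have 2: "W * diag2 B1 C1 = four_block_mat (P * B1) (R * C1) (S * B1) (Q * C1)"
  proof -
    have "W * four_block_mat B1 (0\<^sub>m a b) (0\<^sub>m b a) C1
      = four_block_mat (P * B1 + R * 0\<^sub>m b a) (P * 0\<^sub>m a b + R * C1) (S * B1 + Q * 0\<^sub>m b a) (S * 0\<^sub>m a b + Q * C1)"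
      unfolding bl(5) by (rule mult_four_block_mat[OF bl(1-4) c(3) zero_carrier_mat zero_carrier_mat c(4)])
    then show ?thesis using c bl by auto
  qed
  have "B0 * P = P * B1" "B0 * R = R * C1" "C0 * S = S * B1" "C0 * Q = Q * C1"
    using four_block_inject[of "B0 * P" a a "B0 * R" b "C0 * S" b "C0 * Q" "P * B1" "R * C1" "S * B1" "Q * C1"]
      1 2 eq c bl by auto
  moreover from this have "R = 0\<^sub>m a b" "S = 0\<^sub>m b a"
    using sylvester_unique[OF c(1,4) bl(2)] sylvester_unique[OF c(2,3) bl(3)] cop by auto
  ultimately show thesis using that[of P Q] bl by auto
qed

section \<open>Counting matrices by characteristic polynomial\<close>

definition Ch :: "nat \<Rightarrow> 'a::comm_ring_1 poly \<Rightarrow> 'a mat set" where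
  "Ch n f = {A \<in> carrier_mat n n. char_poly A = f}"

lemma finite_Ch: "finite (Ch n f :: 'a::{finite,comm_ring_1} mat set)"
  unfolding Ch_def by (rule finite_subset[OF _ finite_carrier_mat[of n n]]) auto

lemma finite_GL: "finite (GL n :: 'a::{finite,field} mat set)"
  unfolding GL_def by (rule finite_subset[OF _ finite_carrier_mat[of n n]]) auto

lemma card_GL_pos: "card (GL n :: 'a::{finite,field} mat set) > 0"
  using GL_one finite_GL by (metis card_gt_0_iff empty_iff)

lemma conj_Ch:
  assumes "G \<in> GL n" "M \<in> Ch n f"
  shows "G * M * minv G \<in> Ch n f" "(G * M * minv G) * G = G * M"
proof -
  have M: "M \<in> carrier_mat n n" "char_poly M = f" using assms by (auto simp: Ch_def)
  note Gc = GL_carrier[OF assms(1)] and Gi = minv[OF assms(1)]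
  have GM: "G * M \<in> carrier_mat n n" using Gc M by auto
  show eq: "(G * M * minv G) * G = G * M" using minv_cancel_right(2)[OF assms(1) GM] .
  have c: "G * M * minv G \<in> carrier_mat n n" using GM Gi by auto
  then show "G * M * minv G \<in> Ch n f"
    using char_poly_intertwine[OF assms(1) c M(1) eq] M by (simp add: Ch_def)
qed

lemma diag2_Ch: "B \<in> Ch a f \<Longrightarrow> C \<in> Ch b g \<Longrightarrow> diag2 B C \<in> Ch (a + b) (f * (g :: 'a::idom poly))"
  using char_poly_four_block_upper[of B a "0\<^sub>m a b" b C] by (auto simp: Ch_def)

lemma diag2_GL: "P \<in> GL a \<Longrightarrow> Q \<in> GL b \<Longrightarrow> diag2 P Q \<in> GL (a + b)"
  using GL_block_upper[of P a "0\<^sub>m a b" b Q] GL_carrier[of P a] GL_carrier[of Q b]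
  by (metis carrier_matD zero_carrier_mat)

lemma diag2_mult:
  fixes B C :: "'a::semiring_0 mat"
  assumes "B \<in> carrier_mat a a" "C \<in> carrier_mat b b" "P \<in> carrier_mat a a" "Q \<in> carrier_mat b b"
  shows "diag2 B C * diag2 P Q = diag2 (B * P) (C * Q)"
  using block_upper_mult[OF assms(1) zero_carrier_mat assms(2,3) zero_carrier_mat assms(4)] assms
  by (simp add: left_add_zero_mat[of _ a b])

lemma diag2_inject:
  assumes "B \<in> carrier_mat a a" "C \<in> carrier_mat b b" "P \<in> carrier_mat a a" "Q \<in> carrier_mat b b"
    "diag2 B C = diag2 P Q"
  shows "B = P" "C = Q"
  using four_block_inject[of B a a "0\<^sub>m a b" b "0\<^sub>m b a" b C P "0\<^sub>m a b" "0\<^sub>m b a" Q] assms by auto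

lemma intertwine_compose:
  fixes A :: "'a::field mat"
  assumes "A \<in> carrier_mat n n" "G \<in> GL n" "M \<in> carrier_mat n n" "A * G = G * M"
    "Y \<in> carrier_mat n n" "N \<in> carrier_mat n n" "M * Y = Y * N"
  shows "A * (G * Y) = (G * Y) * N"
proof -
  note Gc = GL_carrier[OF assms(2)]
  have "A * (G * Y) = A * G * Y" using assoc_mult_mat[OF assms(1) Gc assms(5)] by simp
  also have "\<dots> = G * (M * Y)" unfolding assms(4) using assoc_mult_mat[OF Gc assms(3,5)] .
  also have "\<dots> = G * Y * N" unfolding assms(7) using assoc_mult_mat[OF Gc assms(5,6)] by simp
  finally show ?thesis .
qed

text \<open>
  The map \<open>(G, B, C) \<mapsto> G diag(B, C) G\<^sup>-\<^sup>1\<close> onto the matrices with characteristic polynomial \<open>f g\<close>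
  is surjective, and its fibres are torsors under \<open>GL a \<times> GL b\<close>.
\<close>

lemma sum_coprime_product:
  fixes f g :: "'a::{field_gcd,finite} poly" and h :: "'a mat \<Rightarrow> real"
  assumes f: "monic f" "degree f = a" and cop: "coprime f g"
    and h: "\<And>G A B. G \<in> GL (a + b) \<Longrightarrow> A \<in> carrier_mat (a + b) (a + b) \<Longrightarrow> B \<in> carrier_mat (a + b) (a + b) \<Longrightarrow>
       A * G = G * B \<Longrightarrow> h A = h B"
  shows "real (card (GL a :: 'a mat set)) * real (card (GL b :: 'a mat set)) * (\<Sum>A\<in>Ch (a + b) (f * g). h A)
     = real (card (GL (a + b) :: 'a mat set)) * (\<Sum>B\<in>Ch a f. \<Sum>C\<in>Ch b g. h (diag2 B C))"
proof -
  let ?n = "a + b"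
  define S where "S = (GL ?n :: 'a mat set) \<times> Ch a f \<times> Ch b g"
  define \<pi> where "\<pi> = (\<lambda>(G, B, C). G * diag2 B C * minv (G :: 'a mat))"
  have fS: "finite S" unfolding S_def using finite_GL finite_Ch by blast
  have piS: "\<pi> s \<in> Ch ?n (f * g)" "h (\<pi> s) = h (diag2 (fst (snd s)) (snd (snd s)))" if "s \<in> S" for s
  proof -
    obtain G B C where s: "s = (G, B, C)" by (cases s)
    have G: "G \<in> GL ?n" and d: "diag2 B C \<in> Ch ?n (f * g)"
      using that diag2_Ch[of B a f C b g] by (auto simp: s S_def)
    show "\<pi> s \<in> Ch ?n (f * g)" using conj_Ch(1)[OF G d] by (simp add: \<pi>_def s)
    then show "h (\<pi> s) = h (diag2 (fst (snd s)) (snd (snd s)))"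
      using h[OF G _ _ conj_Ch(2)[OF G d]] d by (simp add: \<pi>_def s Ch_def)
  qed
  have fib: "card {s \<in> S. \<pi> s = A} = card (GL a :: 'a mat set) * card (GL b :: 'a mat set)" if A: "A \<in> Ch ?n (f * g)" for A
  proof -
    have Ac: "A \<in> carrier_mat ?n ?n" and "char_poly A = f * g" using A by (auto simp: Ch_def)
    then obtain G0 B0 C0 where 0: "G0 \<in> GL ?n" "B0 \<in> carrier_mat a a" "C0 \<in> carrier_mat b b"
      "char_poly B0 = f" "char_poly C0 = g" "A * G0 = G0 * diag2 B0 C0"
      using primary_decomposition[OF Ac _ cop f] by metis
    define \<tau> where "\<tau> = (\<lambda>(P, Q). (G0 * diag2 P Q, minv P * B0 * P, minv Q * C0 * (Q :: 'a mat)))"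
    have "bij_betw \<tau> (GL a \<times> GL b) {s \<in> S. \<pi> s = A}"
      unfolding bij_betw_def
    proof (intro conjI inj_onI equalityI subsetI)
      fix x y assume xy: "x \<in> GL a \<times> GL b" "y \<in> GL a \<times> GL b" and eq: "\<tau> x = \<tau> y"
      obtain P Q P' Q' where x: "x = (P, Q)" and y: "y = (P', Q')" by (metis surj_pair)
      have c: "P \<in> carrier_mat a a" "Q \<in> carrier_mat b b" "P' \<in> carrier_mat a a" "Q' \<in> carrier_mat b b"
        using xy GL_carrier by (auto simp: x y)
      have "diag2 P Q \<in> carrier_mat ?n ?n" "diag2 P' Q' \<in> carrier_mat ?n ?n" using c by auto
      then have "diag2 P Q = diag2 P' Q'"
        using GL_left_cancel[OF 0(1)] eq by (auto simp: \<tau>_def x y)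
      then show "x = y" using diag2_inject[OF c] by (simp add: x y)
    next
      fix s assume "s \<in> \<tau> ` (GL a \<times> GL b)"
      then obtain P Q where P: "P \<in> GL a" and Q: "Q \<in> GL b" and s: "s = \<tau> (P, Q)" by auto
      note Pc = GL_carrier[OF P] minv[OF P] and Qc = GL_carrier[OF Q] minv[OF Q]
      let ?B = "minv P * B0 * P" and ?C = "minv Q * C0 * Q"
      have BP: "P * ?B = B0 * P"
        using minv_cancel(2)[OF P, of "B0 * P" a] assoc_mult_mat[OF Pc(2) 0(2) Pc(1)] Pc 0 by simp
      have CQ: "Q * ?C = C0 * Q"
        using minv_cancel(2)[OF Q, of "C0 * Q" b] assoc_mult_mat[OF Qc(2) 0(3) Qc(1)] Qc 0 by simp
      have BC: "?B \<in> carrier_mat a a" "?C \<in> carrier_mat b b" using Pc Qc 0 by auto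
      have "char_poly ?B = f" "char_poly ?C = g"
        using char_poly_intertwine[OF P 0(2) BC(1)] char_poly_intertwine[OF Q 0(3) BC(2)] BP CQ 0 by auto
      then have BC': "?B \<in> Ch a f" "?C \<in> Ch b g" using BC by (auto simp: Ch_def)
      have d: "diag2 P Q \<in> GL ?n" using diag2_GL[OF P Q] .
      have G: "G0 * diag2 P Q \<in> GL ?n" using GL_mult[OF 0(1) d] .
      have "diag2 B0 C0 * diag2 P Q = diag2 P Q * diag2 ?B ?C"
        using diag2_mult[OF 0(2,3) Pc(1) Qc(1)] diag2_mult[OF Pc(1) Qc(1) BC] BP CQ by simp
      moreover have dd: "diag2 B0 C0 \<in> carrier_mat ?n ?n" "diag2 ?B ?C \<in> carrier_mat ?n ?n"
        using 0 BC by auto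
      ultimately have "A * (G0 * diag2 P Q) = (G0 * diag2 P Q) * diag2 ?B ?C"
        using intertwine_compose[OF Ac 0(1) _ 0(6) GL_carrier[OF d]] by blast
      then have "G0 * diag2 P Q * diag2 ?B ?C * minv (G0 * diag2 P Q) = A"
        using minv_cancel_right(1)[OF G Ac] by simp
      then show "s \<in> {s \<in> S. \<pi> s = A}"
        using G BC' by (simp add: s \<tau>_def S_def \<pi>_def)
    next
      fix s assume s: "s \<in> {s \<in> S. \<pi> s = A}"
      obtain G B C where sG: "s = (G, B, C)" by (cases s)
      have G: "G \<in> GL ?n" and B: "B \<in> carrier_mat a a" "char_poly B = f" and C: "C \<in> carrier_mat b b" "char_poly C = g"
        and piA: "G * diag2 B C * minv G = A"
        using s by (auto simp: sG S_def Ch_def \<pi>_def)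
      have dd: "diag2 B0 C0 \<in> carrier_mat ?n ?n" "diag2 B C \<in> carrier_mat ?n ?n" using 0 B C by auto
      note Gc = GL_carrier[OF G] and G0c = GL_carrier[OF 0(1)]
      have AG: "A * G = G * diag2 B C"
        using minv_cancel_right(2)[OF G, of "G * diag2 B C" ?n] Gc dd piA by auto
      \<comment> \<open>\<open>?W\<close> compares two diagonalisations of the same
        \<open>A\<close>; as an intertwiner of block diagonal matrices it is itself block diagonal,
        and its blocks are the preimage \<open>(P, Q)\<close> of \<open>s\<close>.\<close>
      let ?W = "minv G0 * G"
      have W: "?W \<in> GL ?n" using GL_mult[OF minv_GL[OF 0(1)] G] .
      note Wc = GL_carrier[OF W]
      have GW: "G0 * ?W = G" using minv_cancel(2)[OF 0(1) Gc] .
      have "G0 * (diag2 B0 C0 * ?W) = G0 * (?W * diag2 B C)"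
      proof -
        have "G0 * (diag2 B0 C0 * ?W) = A * G0 * ?W"
          unfolding 0(6) using assoc_mult_mat[OF G0c dd(1) Wc] by simp
        also have "\<dots> = A * G" using assoc_mult_mat[OF Ac G0c Wc] GW by simp
        also have "\<dots> = G0 * ?W * diag2 B C" unfolding AG GW ..
        also have "\<dots> = G0 * (?W * diag2 B C)" using assoc_mult_mat[OF G0c Wc dd(2)] .
        finally show ?thesis .
      qed
      moreover have "diag2 B0 C0 * ?W \<in> carrier_mat ?n ?n" "?W * diag2 B C \<in> carrier_mat ?n ?n"
        using dd Wc by (auto simp del: four_block_carrier_mat)
      ultimately have eqW: "diag2 B0 C0 * ?W = ?W * diag2 B C" using GL_left_cancel[OF 0(1)] by blast
      have cop': "coprime (char_poly B0) (char_poly C)" "coprime (char_poly C0) (char_poly B)"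
        using cop 0 B C by (auto simp: coprime_commute)
      obtain P Q where PQ: "P \<in> carrier_mat a a" "Q \<in> carrier_mat b b" "?W = diag2 P Q" "B0 * P = P * B" "C0 * Q = Q * C"
        using diag_intertwine[OF 0(2,3) B(1) C(1) Wc eqW cop'] by metis
      have PQ': "P \<in> GL a" "Q \<in> GL b" using W GL_block_upper[OF PQ(1) _ PQ(2), of "0\<^sub>m a b"] PQ by auto
      have "minv P * B0 * P = B"
        using minv_cancel(1)[OF PQ'(1) B(1)] assoc_mult_mat[OF minv(1)[OF PQ'(1)] 0(2) PQ(1)] PQ(4) by simp
      moreover have "minv Q * C0 * Q = C"
        using minv_cancel(1)[OF PQ'(2) C(1)] assoc_mult_mat[OF minv(1)[OF PQ'(2)] 0(3) PQ(2)] PQ(5) by simp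
      ultimately have "s = \<tau> (P, Q)" using GW PQ(3) by (simp add: sG \<tau>_def)
      then show "s \<in> \<tau> ` (GL a \<times> GL b)" using PQ' by blast
    qed
    then show ?thesis using bij_betw_same_card[of \<tau> "GL a \<times> GL b"] by (simp add: card_cartesian_product)
  qed
  have "(\<Sum>s\<in>S. h (\<pi> s)) = (\<Sum>A\<in>Ch ?n (f * g). \<Sum>s\<in>{s \<in> S. \<pi> s = A}. h (\<pi> s))"
    using piS(1) by (intro sum.group[symmetric] fS finite_Ch) auto
  also have "\<dots> = (\<Sum>A\<in>Ch ?n (f * g). real (card (GL a :: 'a mat set) * card (GL b :: 'a mat set)) * h A)"
  proof (rule sum.cong[OF refl])
    fix A assume A: "A \<in> Ch ?n (f * g)"
    have "(\<Sum>s\<in>{s \<in> S. \<pi> s = A}. h (\<pi> s)) = (\<Sum>s\<in>{s \<in> S. \<pi> s = A}. h A)" by (rule sum.cong) auto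
    then show "(\<Sum>s\<in>{s \<in> S. \<pi> s = A}. h (\<pi> s)) = real (card (GL a :: 'a mat set) * card (GL b :: 'a mat set)) * h A"
      using fib[OF A] by simp
  qed
  also have "\<dots> = real (card (GL a :: 'a mat set)) * real (card (GL b :: 'a mat set)) * (\<Sum>A\<in>Ch ?n (f * g). h A)"
    by (simp add: sum_distrib_left)
  finally have 1: "(\<Sum>s\<in>S. h (\<pi> s)) = real (card (GL a :: 'a mat set)) * real (card (GL b :: 'a mat set)) * (\<Sum>A\<in>Ch ?n (f * g). h A)" .
  have "(\<Sum>s\<in>S. h (\<pi> s)) = (\<Sum>s\<in>S. h (diag2 (fst (snd s)) (snd (snd s))))"
    using piS(2) by (intro sum.cong) auto
  also have "\<dots> = (\<Sum>G\<in>(GL ?n :: 'a mat set). \<Sum>B\<in>Ch a f. \<Sum>C\<in>Ch b g. h (diag2 B C))"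
    unfolding S_def sum.cartesian_product' by simp
  also have "\<dots> = real (card (GL ?n :: 'a mat set)) * (\<Sum>B\<in>Ch a f. \<Sum>C\<in>Ch b g. h (diag2 B C))"
    by simp
  finally show ?thesis using 1 by simp
qed

text \<open>Double counting of pairs \<open>(A, G)\<close> such that conjugation by \<open>G\<close>
  makes \<open>A\<close> block upper triangular with diagonal blocks in \<open>Ch d f\<close> and
  \<open>Ch e g\<close>. Right multiplication by invertible block triangular matrices yields many
  such \<open>G\<close> for each \<open>A\<close>, while \<open>G\<close> and the triangular form
  determine \<open>A\<close>. As \<open>g\<close> may contain \<open>f\<close> again, there can be
  further \<open>G\<close>, and only an inequality results.\<close>

lemma card_Ch_mult_le:
  fixes f g :: "'a::{field_gcd,finite} poly"
  assumes f: "irreducible f" "monic f" "degree f = d"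
  shows "card (Ch (d + e) (f * g)) * (card (GL d :: 'a mat set) * card (GL e :: 'a mat set))
      \<le> card (GL (d + e) :: 'a mat set) * (card (Ch d f) * card (Ch e g))"
proof -
  let ?n = "d + e"
  define T where "T = (GL ?n :: 'a mat set) \<times> Ch d f \<times> (carrier_mat d e :: 'a mat set) \<times> Ch e g"
  define F where "F A = {G \<in> GL ?n. \<exists>C\<in>Ch d f. \<exists>R\<in>carrier_mat d e. \<exists>D\<in>Ch e g. A * G = G * four_block_mat C R (0\<^sub>m e d) D}" for A :: "'a mat"
  have fT: "finite T" unfolding T_def using finite_GL finite_Ch finite_carrier_mat by blast
  have fF: "finite (F A)" for A unfolding F_def using finite_GL by (rule rev_finite_subset) auto
  have F: "card (GL d :: 'a mat set) * (card (carrier_mat d e :: 'a mat set) * card (GL e :: 'a mat set)) \<le> card (F A)"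
    if A: "A \<in> Ch ?n (f * g)" for A
  proof -
    have Ac: "A \<in> carrier_mat ?n ?n" "char_poly A = f * g" using A by (auto simp: Ch_def)
    obtain K C where KC: "inj_mat K ?n d" "C \<in> carrier_mat d d" "A * K = K * C" "char_poly C = f"
      using irreducible_invariant_subspace[OF Ac(1) f(1,2)] Ac(2) f(3) by (metis dvd_triv_left)
    obtain G R D where G: "G \<in> GL ?n" and R: "R \<in> carrier_mat d e" and D: "D \<in> carrier_mat e e"
      and AG: "A * G = G * four_block_mat C R (0\<^sub>m e d) D"
      using block_form[OF Ac(1) KC(1-3)] by (metis add_diff_cancel_left')
    have M: "four_block_mat C R (0\<^sub>m e d) D \<in> carrier_mat ?n ?n" using KC D by auto
    have "f * char_poly D = f * g"
      using char_poly_intertwine[OF G Ac(1) M AG] char_poly_four_block_upper[OF KC(2) R D] KC(4) Ac(2) by metis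
    moreover have "f \<noteq> 0" using f by auto
    ultimately have D2: "char_poly D = g" using mult_left_cancel by metis
    let ?\<tau> = "\<lambda>(P, S, Q). G * four_block_mat P S (0\<^sub>m e d) Q"
    let ?X = "(GL d :: 'a mat set) \<times> (carrier_mat d e :: 'a mat set) \<times> (GL e :: 'a mat set)"
    have "inj_on ?\<tau> ?X"
    proof (rule inj_onI)
      fix x y assume xy: "x \<in> ?X" "y \<in> ?X" and eq: "?\<tau> x = ?\<tau> y"
      obtain P S Q P' S' Q' where x: "x = (P, S, Q)" and y: "y = (P', S', Q')" by (metis surj_pair)
      have c: "P \<in> carrier_mat d d" "S \<in> carrier_mat d e" "Q \<in> carrier_mat e e"
         "P' \<in> carrier_mat d d" "S' \<in> carrier_mat d e" "Q' \<in> carrier_mat e e"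
        using xy GL_carrier by (auto simp: x y)
      have "four_block_mat P S (0\<^sub>m e d) Q = four_block_mat P' S' (0\<^sub>m e d) Q'"
        using GL_left_cancel[OF G, of "four_block_mat P S (0\<^sub>m e d) Q" ?n] eq c by (auto simp: x y)
      then show "x = y"
        using four_block_inject[OF c(1,2) zero_carrier_mat c(3) c(4,5) zero_carrier_mat c(6)] by (auto simp: x y)
    qed
    moreover have "?\<tau> ` ?X \<subseteq> F A"
    proof
      fix H assume "H \<in> ?\<tau> ` ?X"
      then obtain P S Q where P: "P \<in> GL d" and S: "S \<in> carrier_mat d e" and Q: "Q \<in> GL e"
        and H: "H = G * four_block_mat P S (0\<^sub>m e d) Q" by auto
      note Pc = GL_carrier[OF P] minv[OF P] and Qc = GL_carrier[OF Q] minv[OF Q]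
      let ?C = "minv P * (C * P)" and ?D = "minv Q * (D * Q)"
      \<comment> \<open>Forced by the upper right block of the relation between the old triangular
        form, \<open>?Y\<close> and the new triangular form.\<close>
      let ?R = "minv P * (C * S + R * Q - S * ?D)"
      have CC: "?C \<in> carrier_mat d d" "?D \<in> carrier_mat e e" "?R \<in> carrier_mat d e"
        using Pc Qc KC D S by auto
      have PC: "P * ?C = C * P" by (rule minv_cancel(2)[OF P]) (use KC Pc in auto)
      have QD: "Q * ?D = D * Q" by (rule minv_cancel(2)[OF Q]) (use D Qc in auto)
      have PR: "P * ?R = C * S + R * Q - S * ?D"
      proof (rule minv_cancel(2)[OF P])
        show "C * S + R * Q - S * ?D \<in> carrier_mat d e"
          using mult_carrier_mat[OF S CC(2)] by (rule minus_carrier_mat)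
      qed
      let ?Y = "four_block_mat P S (0\<^sub>m e d) Q"
      have Y: "?Y \<in> GL ?n" using GL_block_upper[OF Pc(1) S Qc(1)] P Q by simp
      have "four_block_mat C R (0\<^sub>m e d) D * ?Y = four_block_mat (C * P) (C * S + R * Q) (0\<^sub>m e d) (D * Q)"
        by (rule block_upper_mult[OF KC(2) R D Pc(1) S Qc(1)])
      also have "\<dots> = ?Y * four_block_mat ?C ?R (0\<^sub>m e d) ?D"
      proof -
        have "P * ?R + S * ?D = C * S + R * Q"
          unfolding PR using KC R S Qc CC by (intro eq_matI) (auto simp del: index_mult_mat(1))
        then show ?thesis using block_upper_mult[OF Pc(1) S Qc(1) CC(1,3,2)] PC QD by simp
      qed
      finally have MY: "four_block_mat C R (0\<^sub>m e d) D * ?Y = ?Y * four_block_mat ?C ?R (0\<^sub>m e d) ?D" .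
      have N: "four_block_mat ?C ?R (0\<^sub>m e d) ?D \<in> carrier_mat ?n ?n" using CC by auto
      have "A * H = H * four_block_mat ?C ?R (0\<^sub>m e d) ?D"
        unfolding H by (rule intertwine_compose[OF Ac(1) G M AG GL_carrier[OF Y] N MY])
      moreover have "?C \<in> Ch d f" "?D \<in> Ch e g"
        using char_poly_intertwine[OF P KC(2) CC(1)] char_poly_intertwine[OF Q D CC(2)] PC QD KC(4) D2 CC
        by (auto simp: Ch_def)
      ultimately show "H \<in> F A" using GL_mult[OF G Y] CC(3) unfolding F_def H by blast
    qed
    ultimately have "card ?X \<le> card (F A)" by (rule card_inj_on_le[OF _ _ fF])
    then show ?thesis by (simp add: card_cartesian_product)
  qed
  have "card (Ch ?n (f * g)) * (card (GL d :: 'a mat set) * (card (carrier_mat d e :: 'a mat set) * card (GL e :: 'a mat set)))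
      \<le> (\<Sum>A\<in>Ch ?n (f * g). card (F A))"
    using sum_mono[of "Ch ?n (f * g)" "\<lambda>_. card (GL d :: 'a mat set) * (card (carrier_mat d e :: 'a mat set) * card (GL e :: 'a mat set))" "\<lambda>A. card (F A)"] F
    by simp
  also have "\<dots> = card (SIGMA A:Ch ?n (f * g). F A)"
    using fF by (simp add: card_SigmaI finite_Ch)
  also have "\<dots> \<le> card T"
  proof (rule surj_card_le[OF fT])
    show "(SIGMA A:Ch ?n (f * g). F A) \<subseteq> (\<lambda>(G, C, R, D). (G * four_block_mat C R (0\<^sub>m e d) D * minv G, G)) ` T"
    proof
      fix x assume "x \<in> (SIGMA A:Ch ?n (f * g). F A)"
      then obtain A G where x: "x = (A, G)" and A: "A \<in> carrier_mat ?n ?n" and "G \<in> F A" by (auto simp: Ch_def)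
      then obtain C R D where G: "G \<in> GL ?n" and C: "C \<in> Ch d f" "R \<in> carrier_mat d e" "D \<in> Ch e g"
        and AG: "A * G = G * four_block_mat C R (0\<^sub>m e d) D" by (auto simp: F_def)
      have "G * four_block_mat C R (0\<^sub>m e d) D * minv G = A"
        using minv_cancel_right(1)[OF G A] unfolding AG .
      then show "x \<in> (\<lambda>(G, C, R, D). (G * four_block_mat C R (0\<^sub>m e d) D * minv G, G)) ` T"
        using G C by (intro image_eqI[of _ _ "(G, C, R, D)"]) (auto simp: T_def x)
    qed
  qed
  also have "card T = card (GL ?n :: 'a mat set) * (card (Ch d f) * (card (carrier_mat d e :: 'a mat set) * card (Ch e g)))"
    by (simp add: T_def card_cartesian_product)
  finally have "card (carrier_mat d e :: 'a mat set) * (card (Ch ?n (f * g)) * (card (GL d :: 'a mat set) * card (GL e :: 'a mat set)))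
     \<le> card (carrier_mat d e :: 'a mat set) * (card (GL ?n :: 'a mat set) * (card (Ch d f) * card (Ch e g)))"
    by (simp add: algebra_simps)
  moreover have "card (carrier_mat d e :: 'a mat set) > 0" by (simp add: card_carrier_mat card_gt_0_iff)
  ultimately show ?thesis by simp
qed

text \<open>A pair of \<open>A\<close> and a nonzero \<open>v\<close> can be recovered from its
  Krylov matrix \<open>K\<close>: the first column is \<open>v\<close>, and
  \<open>A * K = K * C\<close> determines \<open>A\<close>, because the companion matrix
  \<open>C\<close> depends on \<open>f\<close> only. This embeds the set of pairs into
  \<open>GL d\<close>.\<close>

lemma card_Ch_irreducible_le:
  fixes f :: "'a::{field_gcd,finite} poly"
  assumes f: "irreducible f" "monic f" "degree f = d"
  shows "card (Ch d f) * (CARD('a) ^ d - 1) \<le> card (GL d :: 'a mat set)"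
proof -
  let ?K = "\<lambda>(A, v). mat d (degree f) (\<lambda>(i, j). ((A ^\<^sub>m j) *\<^sub>v v) $ i) :: 'a mat"
  let ?C = "mat (degree f) (degree f) (\<lambda>(i, j). if Suc j < degree f then (if i = Suc j then 1 else 0) else - coeff f i)"
  let ?X = "Ch d f \<times> (carrier_vec d - {0\<^sub>v d} :: 'a vec set)"
  have d: "d > 0" using irreducible_degree_pos[OF f(1)] f(3) by simp
  have K: "?K (A, v) \<in> GL d" "A * ?K (A, v) = ?K (A, v) * ?C" if "(A, v) \<in> ?X" for A v
  proof -
    have A: "A \<in> carrier_mat d d" "char_poly A = f" and v: "v \<in> carrier_vec d" "v \<noteq> 0\<^sub>v d" using that by (auto simp: Ch_def)
    obtain K C where KC: "inj_mat K d d" "C \<in> carrier_mat d d" "A * K = K * C" "pm f C = 0\<^sub>m d d"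
      using irreducible_invariant_subspace[OF A(1) f(1,2)] A(2) f(3) by (metis dvd_refl)
    have KG: "K \<in> GL d" using KC(1) inj_mat_GL by blast
    \<comment> \<open>Here the cyclic subspace is the whole space, so \<open>f(A)\<close> vanishes
      entirely and every nonzero \<open>v\<close> is a cyclic vector.\<close>
    have "pm f A * K = 0\<^sub>m d d * K"
      using pm_intertwine[OF A(1) KC(2) GL_carrier[OF KG] KC(3), of f] KC(4) GL_carrier[OF KG]
      by (simp add: right_mult_zero_mat[of _ d d] left_mult_zero_mat[of _ d d])
    then have "pm f A = 0\<^sub>m d d" using GL_right_cancel[OF KG pm_carrier[OF A(1)] zero_carrier_mat] by blast
    then have "pm f A *\<^sub>v v = 0\<^sub>v d" using v by (auto intro!: eq_vecI)
    note cs = cyclic_subspace[OF A(1) f(1,2) v this]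
    show "?K (A, v) \<in> GL d" using cs(1) f(3) by (simp add: inj_mat_GL)
    show "A * ?K (A, v) = ?K (A, v) * ?C" using cs(2) by simp
  qed
  have "inj_on ?K ?X"
  proof (rule inj_onI)
    fix x y assume x: "x \<in> ?X" and y: "y \<in> ?X" and eq: "?K x = ?K y"
    obtain A v B w where xy: "x = (A, v)" "y = (B, w)" by (metis surj_pair)
    have c: "A \<in> carrier_mat d d" "B \<in> carrier_mat d d" "v \<in> carrier_vec d" "w \<in> carrier_vec d" using x y by (auto simp: xy Ch_def)
    have eq': "?K (A, v) = ?K (B, w)" using eq unfolding xy .
    have "A * ?K (A, v) = B * ?K (A, v)"
      using K(2)[of A v] K(2)[of B w] x y unfolding xy eq' by simp
    then have AB: "A = B" using GL_right_cancel[OF K(1)[of A v] c(1,2)] x xy by blast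
    have "v = w"
    proof (rule eq_vecI)
      fix i assume "i < dim_vec w"
      then have i: "i < d" using c by simp
      have "?K (A, v) $$ (i, 0) = ?K (B, w) $$ (i, 0)" unfolding eq' ..
      then show "v $ i = w $ i" using i d f(3) c by simp
    qed (use c in auto)
    then show "x = y" using AB xy by simp
  qed
  moreover have "?K ` ?X \<subseteq> GL d" using K(1) by auto
  ultimately have "card ?X \<le> card (GL d :: 'a mat set)" by (rule card_inj_on_le[OF _ _ finite_GL])
  moreover have "card (carrier_vec d - {0\<^sub>v d} :: 'a vec set) = CARD('a) ^ d - 1"
    by (subst card_Diff_subset) (auto simp: card_carrier_vec)
  ultimately show ?thesis by (simp only: card_cartesian_product)
qed

text \<open>A matrix with first column \<open>v\<close> is a fixed invertible matrix
  \<open>\<gamma> v\<close> with this column times a matrix whose first column is a unit vector; the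
  latter is given by a free row and an element of \<open>GL n\<close>.\<close>

lemma card_GL_Suc:
  "card (GL (Suc n) :: 'a::{field,finite} mat set) = (CARD('a) ^ Suc n - 1) * CARD('a) ^ n * card (GL n :: 'a mat set)"
proof -
  let ?N = "Suc n"
  let ?vs = "carrier_vec ?N - {0\<^sub>v ?N} :: 'a vec set"
  have ex: "\<exists>G\<in>GL ?N. \<forall>i<?N. G $$ (i, 0) = v $ i" if "v \<in> ?vs" for v
  proof -
    let ?V = "mat ?N 1 (\<lambda>(i, j). v $ i)"
    have V: "?V \<in> carrier_mat ?N 1" by simp
    have "inj_mat ?V ?N 1"
      unfolding inj_mat_def
    proof (intro conjI ballI impI V)
      fix c assume c: "c \<in> carrier_vec 1" "?V *\<^sub>v c = 0\<^sub>v ?N"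
      have "v $ i * c $ 0 = 0" if i: "i < ?N" for i
      proof -
        have "v $ i * c $ 0 = (?V *\<^sub>v c) $ i" unfolding mult_mat_vec_sum[OF V c(1) i] using i by simp
        then show ?thesis unfolding c(2) using i by simp
      qed
      moreover have "\<exists>i<?N. v $ i \<noteq> 0"
      proof (rule ccontr)
        assume "\<not> (\<exists>i<?N. v $ i \<noteq> 0)"
        then have "v = 0\<^sub>v ?N" using that by (intro eq_vecI) auto
        then show False using that by simp
      qed
      ultimately have "c $ 0 = 0" by (metis mult_eq_0_iff)
      then show "c = 0\<^sub>v 1" using c by (intro eq_vecI) auto
    qed
    then obtain G where "G \<in> GL ?N" "\<forall>i<?N. \<forall>j<1. G $$ (i, j) = ?V $$ (i, j)" using inj_mat_extend by blast
    then show ?thesis by (intro bexI[of _ G]) auto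
  qed
  define \<gamma> where "\<gamma> v = (SOME G. G \<in> GL ?N \<and> (\<forall>i<?N. G $$ (i, 0) = v $ i))" for v :: "'a vec"
  have \<gamma>: "\<gamma> v \<in> GL ?N" "\<And>i. i < ?N \<Longrightarrow> \<gamma> v $$ (i, 0) = v $ i" if "v \<in> ?vs" for v
  proof -
    have "\<exists>G. G \<in> GL ?N \<and> (\<forall>i<?N. G $$ (i, 0) = v $ i)" using ex[OF that] by blast
    from someI_ex[OF this] show "\<gamma> v \<in> GL ?N" "\<And>i. i < ?N \<Longrightarrow> \<gamma> v $$ (i, 0) = v $ i"
      unfolding \<gamma>_def[symmetric] by auto
  qed
  let ?U = "\<lambda>R Q. four_block_mat (1\<^sub>m 1) R (0\<^sub>m n 1) Q :: 'a mat"
  let ?\<tau> = "\<lambda>(v, R, Q). \<gamma> v * ?U R Q"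
  let ?X = "?vs \<times> (carrier_mat 1 n :: 'a mat set) \<times> (GL n :: 'a mat set)"
  have U: "?U R Q \<in> GL ?N" if "R \<in> carrier_mat 1 n" "Q \<in> GL n" for R Q
    using GL_block_upper[OF one_carrier_mat that(1) GL_carrier[OF that(2)]] that GL_one[of 1] by simp
  have col: "(G * M) $$ (i, 0) = G $$ (i, 0)"
    if "G \<in> carrier_mat ?N ?N" "M \<in> carrier_mat ?N ?N" "i < ?N" "\<And>k. k < ?N \<Longrightarrow> M $$ (k, 0) = (if k = 0 then 1 else 0)"
    for G M :: "'a mat" and i
  proof -
    have "(G * M) $$ (i, 0) = (\<Sum>k<?N. if k = 0 then G $$ (i, k) else 0)"
      unfolding mult_mat_sum[OF that(1,2,3) zero_less_Suc] using that(4) by (intro sum.cong) auto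
    then show ?thesis by simp
  qed
  have U0: "?U R Q $$ (k, 0) = (if k = 0 then 1 else 0)" if "R \<in> carrier_mat 1 n" "Q \<in> carrier_mat n n" "k < ?N" for R Q k
    using that by auto
  have "bij_betw ?\<tau> ?X (GL ?N)"
    unfolding bij_betw_def
  proof (intro conjI inj_onI equalityI subsetI)
    fix x y assume x: "x \<in> ?X" and y: "y \<in> ?X" and eq: "?\<tau> x = ?\<tau> y"
    obtain v R Q w S P where xy: "x = (v, R, Q)" "y = (w, S, P)" by (metis surj_pair)
    have c: "v \<in> ?vs" "w \<in> ?vs" "R \<in> carrier_mat 1 n" "S \<in> carrier_mat 1 n" "Q \<in> GL n" "P \<in> GL n" using x y xy by auto
    have eq': "\<gamma> v * ?U R Q = \<gamma> w * ?U S P" using eq by (simp add: xy)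
    note U1 = GL_carrier[OF U[OF c(3,5)]] and U2 = GL_carrier[OF U[OF c(4,6)]]
    have "v = w"
    proof (rule eq_vecI)
      fix i assume "i < dim_vec w"
      then have i: "i < ?N" using c by auto
      have "(\<gamma> v * ?U R Q) $$ (i, 0) = v $ i"
        using col[OF GL_carrier[OF \<gamma>(1)[OF c(1)]] U1 i] U0[OF c(3) GL_carrier[OF c(5)]] \<gamma>(2)[OF c(1) i] by simp
      moreover have "(\<gamma> w * ?U S P) $$ (i, 0) = w $ i"
        using col[OF GL_carrier[OF \<gamma>(1)[OF c(2)]] U2 i] U0[OF c(4) GL_carrier[OF c(6)]] \<gamma>(2)[OF c(2) i] by simp
      ultimately show "v $ i = w $ i" using eq' by simp
    qed (use c in auto)
    moreover from this have "?U R Q = ?U S P" using GL_left_cancel[OF \<gamma>(1)[OF c(1)] U1 U2] eq' by simp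
    then have "R = S" "Q = P"
      using four_block_inject[OF one_carrier_mat c(3) zero_carrier_mat GL_carrier[OF c(5)] one_carrier_mat c(4) zero_carrier_mat GL_carrier[OF c(6)]] by auto
    ultimately show "x = y" by (simp add: xy)
  next
    fix G assume "G \<in> ?\<tau> ` ?X"
    then show "G \<in> GL ?N" using GL_mult[OF \<gamma>(1) U] by auto
  next
    fix G :: "'a mat" assume G: "G \<in> GL ?N"
    note Gc = GL_carrier[OF G]
    define v where "v = col G 0"
    have v: "v \<in> carrier_vec ?N" using Gc unfolding v_def by (intro carrier_vecI) simp
    have vi: "\<And>i. i < ?N \<Longrightarrow> v $ i = G $$ (i, 0)" using Gc by (auto simp: v_def)
    have "v \<noteq> 0\<^sub>v ?N"
    proof
      assume v0: "v = 0\<^sub>v ?N"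
      have u: "unit_vec ?N 0 \<in> carrier_vec ?N" by simp
      have "G *\<^sub>v unit_vec ?N 0 = 0\<^sub>v ?N"
      proof (rule eq_vecI)
        fix i assume "i < dim_vec (0\<^sub>v ?N :: 'a vec)"
        then have i: "i < ?N" by simp
        have "(G *\<^sub>v unit_vec ?N 0) $ i = (\<Sum>k<?N. if k = 0 then G $$ (i, k) else 0)"
          unfolding mult_mat_vec_sum[OF Gc u i] by (intro sum.cong) auto
        also have "\<dots> = v $ i" using vi[OF i] by simp
        finally show "(G *\<^sub>v unit_vec ?N 0) $ i = 0\<^sub>v ?N $ i" using v0 by simp
      qed (use Gc in auto)
      moreover have "unit_vec ?N 0 \<noteq> (0\<^sub>v ?N :: 'a vec)" by simp
      ultimately show False using G inj_mat_GL[of G ?N] u unfolding inj_mat_def by blast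
    qed
    then have vs: "v \<in> ?vs" using v by simp
    note g = \<gamma>(1)[OF vs]
    let ?M = "minv (\<gamma> v) * G"
    have M: "?M \<in> GL ?N" using GL_mult[OF minv_GL[OF g] G] .
    have M0: "?M $$ (k, 0) = (if k = 0 then 1 else 0)" if k: "k < ?N" for k
    proof -
      have "?M $$ (k, 0) = (\<Sum>l<?N. minv (\<gamma> v) $$ (k, l) * G $$ (l, 0))"
        by (rule mult_mat_sum[OF minv(1)[OF g] Gc k]) simp
      also have "\<dots> = (\<Sum>l<?N. minv (\<gamma> v) $$ (k, l) * \<gamma> v $$ (l, 0))"
        using vi \<gamma>(2)[OF vs] by (intro sum.cong) auto
      also have "\<dots> = (minv (\<gamma> v) * \<gamma> v) $$ (k, 0)"
        by (rule mult_mat_sum[OF minv(1)[OF g] GL_carrier[OF g] k, symmetric]) simp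
      finally show ?thesis using k by (simp add: minv(3)[OF g])
    qed
    have "?M \<in> carrier_mat (1 + n) (1 + n)" using GL_carrier[OF M] by simp
    then obtain I R Z Q where bl: "I \<in> carrier_mat 1 1" "R \<in> carrier_mat 1 n" "Z \<in> carrier_mat n 1" "Q \<in> carrier_mat n n"
      "?M = four_block_mat I R Z Q" by (rule four_block_obtain)
    have "I = 1\<^sub>m 1"
    proof (rule eq_matI)
      fix i j assume "i < dim_row (1\<^sub>m 1 :: 'a mat)" "j < dim_col (1\<^sub>m 1 :: 'a mat)"
      then show "I $$ (i, j) = 1\<^sub>m 1 $$ (i, j)" using M0[of 0] bl(1-4) unfolding bl(5) by simp
    qed (use bl(1) in auto)
    moreover have "Z = 0\<^sub>m n 1"
    proof (rule eq_matI)
      fix i j assume "i < dim_row (0\<^sub>m n 1 :: 'a mat)" "j < dim_col (0\<^sub>m n 1 :: 'a mat)"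
      then show "Z $$ (i, j) = 0\<^sub>m n 1 $$ (i, j)" using M0[of "Suc i"] bl(1-4) unfolding bl(5) by simp
    qed (use bl(3) in auto)
    ultimately have MU: "?M = ?U R Q" using bl(5) by simp
    have "Q \<in> GL n" using M GL_block_upper[OF one_carrier_mat bl(2,4)] unfolding MU by simp
    moreover have "G = \<gamma> v * ?U R Q" unfolding MU[symmetric] using minv_cancel(2)[OF g Gc] by simp
    ultimately show "G \<in> ?\<tau> ` ?X" using vs bl(2) by (intro image_eqI[of _ _ "(v, R, Q)"]) auto
  qed
  from bij_betw_same_card[OF this] have "card (GL ?N :: 'a mat set) = card ?vs * (CARD('a) ^ n * card (GL n :: 'a mat set))"
    by (simp add: card_cartesian_product card_carrier_mat)
  moreover have "card ?vs = CARD('a) ^ ?N - 1"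
    by (subst card_Diff_subset) (auto simp: card_carrier_vec)
  ultimately show ?thesis by simp
qed

section \<open>Arithmetic of the p-adic integers\<close>

definition pp :: "'p::prime_card padic_int" where
  "pp = of_nat CARD('p)"

definition red :: "'p::prime_card padic_int \<Rightarrow> 'p mod_ring" where
  "red x = of_int (residue x 1)"

text \<open>A set-theoretic section of \<open>red\<close> by least nonnegative residues, not a
  homomorphism; it lifts matrices and polynomials entrywise.\<close>

definition lft :: "'p::prime_card mod_ring \<Rightarrow> 'p padic_int" where
  "lft a = of_int (to_int_mod_ring a)"

lemma residue_0[simp]: "residue (x :: 'p::prime_card padic_int) 0 = 0"
  using residue_bounds[of x 0] by simp

lemma padic_int_eqI: "(\<And>k. residue x k = residue y k) \<Longrightarrow> x = y"
  by (metis residue_inject ext)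

lemma residue_zero[simp]: "residue (0 :: 'p::prime_card padic_int) k = 0"
  by (simp add: zero_padic_int.rep_eq)

lemma residue_of_nat: "residue (of_nat m :: 'p::prime_card padic_int) k = int m mod int CARD('p) ^ k"
  by (induction m) (simp_all add: plus_padic_int.rep_eq one_padic_int.rep_eq mod_simps add.commute)

lemma residue_of_int: "residue (of_int m :: 'p::prime_card padic_int) k = m mod int CARD('p) ^ k"
proof (cases m rule: int_cases2)
  case (nonneg n)
  then show ?thesis by (simp add: residue_of_nat)
next
  case (nonpos n)
  then show ?thesis by (simp add: residue_of_nat uminus_padic_int.rep_eq mod_simps)
qed

lemma residue_sum_digits: "residue (x :: 'p::prime_card padic_int) n = (\<Sum>l<n. digit x l * int CARD('p) ^ l)"
  by (induction n) (simp_all add: residue_Suc_digit)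

text \<open>If the first \<open>k\<close> digits vanish, the remaining digits, moved down by
  \<open>k\<close> places, form the quotient \<open>y\<close>.\<close>

lemma pp_power_dvd_iff: "pp ^ k dvd (x :: 'p::prime_card padic_int) \<longleftrightarrow> residue x k = 0"
proof
  let ?p = "int CARD('p)"
  assume "pp ^ k dvd x"
  then obtain y where "x = of_nat (CARD('p) ^ k) * y" by (auto simp: pp_def dvd_def)
  then show "residue x k = 0"
    using p_pos[where 'p='p] by (simp only: times_padic_int.rep_eq residue_of_nat) simp
next
  let ?p = "int CARD('p)"
  assume 0: "residue x k = 0"
  define y where "y = (from_digits (\<lambda>l. digit x (l + k)) :: 'p padic_int)"
  have dk: "digit x l = 0" if "l < k" for l
  proof -
    have "residue x k = residue (0 :: 'p padic_int) k" using 0 by simp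
    then have "digit x l = digit (0 :: 'p padic_int) l" using residue_eq_iff_digit that by blast
    then show ?thesis by (simp add: digit_def)
  qed
  have y: "residue y j = (\<Sum>l<j. digit x (l + k) * ?p ^ l)" for j
  proof -
    have "digit y l = digit x (l + k)" for l
      using digit_bounds[of x "l + k"] by (simp add: y_def digit_from_digits)
    then show ?thesis by (simp add: residue_sum_digits)
  qed
  have shift: "residue x (k + j) = ?p ^ k * residue y j" for j
  proof (induction j)
    case (Suc j)
    have "residue x (k + Suc j) = digit x (k + j) * ?p ^ (k + j) + residue x (k + j)"
      by (simp add: residue_Suc_digit)
    also have "\<dots> = ?p ^ k * (digit x (j + k) * ?p ^ j + residue y j)"
      unfolding Suc by (simp add: algebra_simps power_add)
    finally show ?case by (simp add: y add.commute)
  qed (simp add: 0)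
  have "x = pp ^ k * y"
  proof (rule padic_int_eqI)
    fix j
    have "residue (pp ^ k * y) j = (?p ^ k * residue y j) mod ?p ^ j"
      unfolding pp_def of_nat_power[symmetric] times_padic_int.rep_eq residue_of_nat by (simp add: mod_simps)
    also have "\<dots> = residue x (k + j) mod ?p ^ j" by (simp add: shift)
    also have "\<dots> = residue x j" by (rule residue_mono) simp
    finally show "residue x j = residue (pp ^ k * y) j" by simp
  qed
  then show "pp ^ k dvd x" by simp
qed

lemma residue_eq_iff_dvd: "residue x k = residue y k \<longleftrightarrow> pp ^ k dvd (x - y :: 'p::prime_card padic_int)"
proof -
  have b: "residue x k mod int CARD('p) ^ k = residue x k" "residue y k mod int CARD('p) ^ k = residue y k"
    by (rule residue_mod_self)+
  have "residue (x - y) k = 0 \<longleftrightarrow> residue x k mod int CARD('p) ^ k = residue y k mod int CARD('p) ^ k"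
    by (simp add: minus_padic_int.rep_eq mod_eq_dvd_iff mod_eq_0_iff_dvd)
  then show ?thesis using b by (simp add: pp_power_dvd_iff)
qed

lemma pp_dvd_iff: "pp dvd (x :: 'p::prime_card padic_int) \<longleftrightarrow> residue x 1 = 0"
  using pp_power_dvd_iff[of 1 x] by simp

lemma pp_nonzero[simp]: "pp \<noteq> (0 :: 'p::prime_card padic_int)"
proof
  assume "pp = (0 :: 'p padic_int)"
  then have "residue (pp :: 'p padic_int) 2 = 0" by simp
  moreover have "int CARD('p) mod int CARD('p) ^ 2 = int CARD('p)"
    using prime_gt_1_int[OF prime_card_int[where 'a='p]] by (intro mod_pos_pos_trivial) (auto simp: power2_eq_square)
  ultimately show False by (simp add: pp_def residue_of_nat)
qed

lemma red_eq_0_iff: "red x = 0 \<longleftrightarrow> pp dvd (x :: 'p::prime_card padic_int)"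
proof -
  have "0 \<le> residue x 1" "residue x 1 < int CARD('p)" using residue_bounds[of x 1] by auto
  then have "(of_int (residue x 1) :: 'p mod_ring) = 0 \<longleftrightarrow> residue x 1 = 0"
    unfolding of_int_of_int_mod_ring
    by (metis of_int_of_int_mod_ring of_int_0 to_int_mod_ring_of_int_mod_ring to_int_mod_ring_hom.hom_zero)
  then show ?thesis by (simp add: red_def pp_dvd_iff)
qed

lemma of_int_mod_card: "(of_int (m mod int CARD('p)) :: 'p::prime_card mod_ring) = of_int m"
proof -
  have "(of_int m :: 'p mod_ring) = of_int (m mod int CARD('p) + int CARD('p) * (m div int CARD('p)))" by simp
  also have "\<dots> = of_int (m mod int CARD('p))" by (simp only: of_int_add of_int_mult of_int_of_nat_eq of_nat_card_eq_0) simp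
  finally show ?thesis by simp
qed

lemma red_of_int: "red (of_int m) = of_int m"
  unfolding red_def residue_of_int using of_int_mod_card[where 'p='a, of m] by simp

interpretation red: comm_ring_hom red
proof
  fix x y :: "'a padic_int"
  show "red (x + y) = red x + red y"
    using of_int_mod_card[of "residue x 1 + residue y 1"] by (simp add: red_def plus_padic_int.rep_eq)
  show "red (x * y) = red x * red y"
    using of_int_mod_card[of "residue x 1 * residue y 1"] by (simp add: red_def times_padic_int.rep_eq)
  show "red (0 :: 'a padic_int) = 0" by (simp add: red_def)
  show "red (1 :: 'a padic_int) = 1" using red_of_int[of 1, where 'a='a] by simp
qed

lemma red_lft[simp]: "red (lft a) = a"
  unfolding lft_def red_of_int of_int_of_int_mod_ring by simp

lemma red_eq_iff: "red x = red y \<longleftrightarrow> pp dvd (x - y)"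
  using red_eq_0_iff[of "x - y"] by (simp add: red.hom_minus)

lemma padic_complete:
  fixes y :: "nat \<Rightarrow> 'p::prime_card padic_int"
  assumes "\<And>k. pp ^ k dvd y (Suc k) - y k"
  obtains z where "\<And>k. pp ^ k dvd z - y k"
proof -
  have y: "residue (y (Suc k)) k = residue (y k) k" for k
    using assms residue_eq_iff_dvd by blast
  define z where "z = (Abs_padic_int (\<lambda>k. residue (y k) k) :: 'p padic_int)"
  have "residue z k = residue (y k) k" for k
  proof -
    have "residue (y (Suc k)) (Suc k) mod int CARD('p) ^ k = residue (y k) k" for k
      using residue_Suc[of "y (Suc k)" k] y[of k] by simp
    then have "residue z = (\<lambda>k. residue (y k) k)"
      unfolding z_def using residue_bounds by (intro Abs_padic_int_inverse) auto
    then show ?thesis by simp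
  qed
  then show thesis using that[of z] residue_eq_iff_dvd by blast
qed

lemma padic_separated: "(\<And>k. pp ^ k dvd x) \<Longrightarrow> x = (0 :: 'p::prime_card padic_int)"
  by (intro padic_int_eqI) (simp add: pp_power_dvd_iff)

text \<open>Bezout in the integers inverts \<open>x\<close> modulo every \<open>p ^ k\<close>.
  Inverses are unique modulo \<open>p ^ k\<close>, hence compatible with each other, and
  \<open>padic_complete\<close> glues them.\<close>

lemma padic_unit_iff: "(x :: 'p::prime_card padic_int) dvd 1 \<longleftrightarrow> red x \<noteq> 0"
proof
  assume "x dvd 1"
  then obtain y where "x * y = 1" by (metis dvdE)
  then have "red x * red y = 1" by (metis red.hom_mult red.hom_one)
  then show "red x \<noteq> 0" by auto
next
  assume nz: "red x \<noteq> 0"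
  let ?p = "int CARD('p)"
  have "\<exists>y. pp ^ k dvd x * y - 1" for k
  proof (cases k)
    case 0
    then show ?thesis by simp
  next
    case (Suc j)
    have "residue x 1 \<noteq> 0" using nz by (simp add: red_eq_0_iff pp_dvd_iff)
    then have "\<not> ?p dvd residue x k"
      using residue_mono[of 1 k x] by (auto simp: Suc mod_eq_0_iff_dvd[symmetric])
    then have "coprime (residue x k) (?p ^ k)"
      using prime_card_int[where 'a='p] by (metis coprime_commute coprime_power_right_iff prime_imp_coprime)
    then obtain a where "[residue x k * a = 1] (mod ?p ^ k)" using cong_solve_coprime_int by blast
    then have "residue (x * of_int a) k = residue (1 :: 'p padic_int) k"
      by (simp add: times_padic_int.rep_eq residue_of_int one_padic_int.rep_eq cong_def mod_simps)
    then show ?thesis using residue_eq_iff_dvd by blast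
  qed
  then obtain y where y: "\<And>k. pp ^ k dvd x * y k - 1" by metis
  have "pp ^ k dvd y (Suc k) - y k" for k
  proof -
    have 1: "pp ^ k dvd x * y (Suc k) - 1" using y[of "Suc k"] by (rule dvd_trans[rotated]) simp
    have "y (Suc k) - y k = (x * y (Suc k) - 1) * y k - (x * y k - 1) * y (Suc k)"
      by (simp add: algebra_simps)
    also have "pp ^ k dvd \<dots>"
      by (rule dvd_diff[OF dvd_mult2[OF 1] dvd_mult2[OF y[of k]]])
    finally show ?thesis .
  qed
  then obtain z where z: "\<And>k. pp ^ k dvd z - y k" using padic_complete by blast
  have "x * z - 1 = 0"
  proof (rule padic_separated)
    fix k
    have "x * z - 1 = x * (z - y k) + (x * y k - 1)" by (simp add: algebra_simps)
    also have "pp ^ k dvd \<dots>" using z y by (intro dvd_add dvd_mult)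
    finally show "pp ^ k dvd x * z - 1" .
  qed
  then show "x dvd 1" by (metis dvdI eq_iff_diff_eq_0)
qed

lemma padic_factor:
  assumes "(x :: 'p::prime_card padic_int) \<noteq> 0"
  obtains k u where "x = pp ^ k * u" "u dvd 1"
proof -
  obtain j where j: "\<not> pp ^ j dvd x" using padic_separated assms by blast
  define k where "k = (LEAST j. \<not> pp ^ Suc j dvd x)"
  have "j \<noteq> 0" using j by (metis one_dvd power_0)
  then have ex: "\<not> pp ^ Suc (j - 1) dvd x" using j by simp
  have k: "\<not> pp ^ Suc k dvd x" unfolding k_def by (rule LeastI[where P = "\<lambda>j. \<not> pp ^ Suc j dvd x", OF ex])
  have "pp ^ k dvd x"
  proof (cases k)
    case (Suc i)
    then have "i < k" by simp
    then have "\<not> \<not> pp ^ Suc i dvd x" unfolding k_def by (rule not_less_Least)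
    then show ?thesis using Suc by simp
  qed simp
  then obtain u where u: "x = pp ^ k * u" by (elim dvdE)
  have "\<not> pp dvd u" using k u by (auto simp: mult_dvd_mono mult.commute)
  then show thesis using that[OF u] by (simp add: padic_unit_iff red_eq_0_iff)
qed

section \<open>Congruences between matrices\<close>

text \<open>The modulus is an arbitrary ring element, so that the same notion serves characteristic
  matrices with the constant polynomial \<open>[:d:]\<close>. Shapes are part of the relation, so
  congruent matrices inherit each other's carrier.\<close>

definition mcong :: "'a::comm_ring_1 \<Rightarrow> 'a mat \<Rightarrow> 'a mat \<Rightarrow> bool" where
  "mcong d A B \<longleftrightarrow> dim_row A = dim_row B \<and> dim_col A = dim_col B \<and>
     (\<forall>i<dim_row A. \<forall>j<dim_col A. d dvd A $$ (i, j) - B $$ (i, j))"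

lemma mcong_refl[simp]: "mcong d A A"
  by (simp add: mcong_def)

lemma mcong_sym: "mcong d A B \<Longrightarrow> mcong d B A"
  unfolding mcong_def by (metis dvd_minus_iff minus_diff_eq)

lemma mcong_trans: "mcong d A B \<Longrightarrow> mcong d B C \<Longrightarrow> mcong d A C"
proof -
  assume 1: "mcong d A B" and 2: "mcong d B C"
  have "d dvd A $$ (i, j) - C $$ (i, j)" if "i < dim_row A" "j < dim_col A" for i j
  proof -
    have "d dvd A $$ (i, j) - B $$ (i, j)" "d dvd B $$ (i, j) - C $$ (i, j)"
      using 1 2 that by (auto simp: mcong_def)
    from dvd_add[OF this] show ?thesis by simp
  qed
  then show "mcong d A C" using 1 2 by (simp add: mcong_def)
qed

lemma mcong_I:
  assumes "A \<in> carrier_mat m n" "B \<in> carrier_mat m n" "\<And>i j. i < m \<Longrightarrow> j < n \<Longrightarrow> d dvd A $$ (i, j) - B $$ (i, j)"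
  shows "mcong d A B"
  using assms by (auto simp: mcong_def)

lemma mcong_D:
  assumes "mcong d A B" "A \<in> carrier_mat m n" "i < m" "j < n"
  shows "d dvd A $$ (i, j) - B $$ (i, j)"
  using assms by (auto simp: mcong_def)

lemma mcong_dvd: "mcong d A B \<Longrightarrow> e dvd d \<Longrightarrow> mcong e A B"
  unfolding mcong_def using dvd_trans by blast

lemma mcong_mult:
  assumes "mcong d A A'" "mcong d B B'" and A: "A \<in> carrier_mat m n" and B: "B \<in> carrier_mat n l"
  shows "mcong d (A * B) (A' * B')"
proof (rule mcong_I)
  have A': "A' \<in> carrier_mat m n" and B': "B' \<in> carrier_mat n l" using assms by (auto simp: mcong_def)
  show "A * B \<in> carrier_mat m l" "A' * B' \<in> carrier_mat m l" using A B A' B' by auto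
  fix i j assume ij: "i < m" "j < l"
  have "(A * B) $$ (i, j) - (A' * B') $$ (i, j) = (\<Sum>k<n. A $$ (i, k) * B $$ (k, j) - A' $$ (i, k) * B' $$ (k, j))"
    unfolding mult_mat_sum[OF A B ij] mult_mat_sum[OF A' B' ij] by (simp add: sum_subtractf)
  also have "\<dots> = (\<Sum>k<n. (A $$ (i, k) - A' $$ (i, k)) * B $$ (k, j) + A' $$ (i, k) * (B $$ (k, j) - B' $$ (k, j)))"
    by (simp add: algebra_simps)
  also have "d dvd \<dots>"
    using mcong_D[OF assms(1) A ij(1)] mcong_D[OF assms(2) B _ ij(2)] by (intro dvd_sum dvd_add dvd_mult dvd_mult2) auto
  finally show "d dvd (A * B) $$ (i, j) - (A' * B') $$ (i, j)" .
qed

lemma dvd_prod_diff: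
  fixes f g :: "'b \<Rightarrow> 'a::comm_ring_1"
  assumes "\<And>x. x \<in> S \<Longrightarrow> d dvd f x - g x"
  shows "d dvd prod f S - prod g S"
  using assms
proof (induction S rule: infinite_finite_induct)
  case (insert x S)
  have "prod f (insert x S) - prod g (insert x S) = (f x - g x) * prod f S + g x * (prod f S - prod g S)"
    using insert by (simp add: algebra_simps)
  also have "d dvd \<dots>" using insert by (intro dvd_add dvd_mult dvd_mult2) auto
  finally show ?case .
qed auto

lemma mcong_det:
  assumes "mcong d A B" and A: "A \<in> carrier_mat n n"
  shows "d dvd det A - det B"
proof -
  have B: "B \<in> carrier_mat n n" using assms by (auto simp: mcong_def)
  have "det A - det B = (\<Sum>p | p permutes {0..<n}. signof p * ((\<Prod>i = 0..<n. A $$ (i, p i)) - (\<Prod>i = 0..<n. B $$ (i, p i))))"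
    unfolding det_def'[OF A] det_def'[OF B] by (simp add: sum_subtractf algebra_simps)
  also have "d dvd \<dots>"
    using mcong_D[OF assms] by (intro dvd_sum dvd_mult dvd_prod_diff) (auto simp: permutes_def intro: permutes_nat_less)
  finally show ?thesis .
qed

lemma mcong_char_poly:
  assumes "mcong d A B" and A: "A \<in> carrier_mat n n"
  shows "[:d:] dvd char_poly A - char_poly B"
proof -
  have B: "B \<in> carrier_mat n n" using assms by (auto simp: mcong_def)
  have "mcong [:d:] (char_poly_matrix A) (char_poly_matrix B)"
  proof (rule mcong_I)
    fix i j assume ij: "i < n" "j < n"
    have "char_poly_matrix A $$ (i, j) - char_poly_matrix B $$ (i, j) = [:- (A $$ (i, j) - B $$ (i, j)):]"
      using ij A B by (simp add: char_poly_matrix_def)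
    moreover have "d dvd - (A $$ (i, j) - B $$ (i, j))" using mcong_D[OF assms ij] by (simp only: dvd_minus_iff)
    then obtain c where "- (A $$ (i, j) - B $$ (i, j)) = d * c" by (elim dvdE)
    ultimately have "char_poly_matrix A $$ (i, j) - char_poly_matrix B $$ (i, j) = [:d:] * [:c:]" by simp
    then show "[:d:] dvd char_poly_matrix A $$ (i, j) - char_poly_matrix B $$ (i, j)" by (rule dvdI)
  qed (use A B in auto)
  then show ?thesis unfolding char_poly_def using A by (intro mcong_det[of _ _ _ n]) auto
qed

abbreviation redm :: "'p::prime_card padic_int mat \<Rightarrow> 'p mod_ring mat" where
  "redm \<equiv> map_mat red"

lemma redm_eq_iff: "redm A = redm B \<longleftrightarrow> mcong pp A B"
proof
  assume eq: "redm A = redm B"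
  then have d: "dim_row A = dim_row B" "dim_col A = dim_col B"
    by (metis index_map_mat(2), metis index_map_mat(3))
  have "red (A $$ (i, j)) = red (B $$ (i, j))" if "i < dim_row A" "j < dim_col A" for i j
    using arg_cong[OF eq, of "\<lambda>M. M $$ (i, j)"] that d by simp
  then show "mcong pp A B" using d by (simp add: mcong_def red_eq_iff)
next
  assume "mcong pp A B"
  then show "redm A = redm B" by (intro eq_matI) (auto simp: mcong_def red_eq_iff)
qed

lemma mat_ball_iff_mcong:
  assumes "A \<in> carrier_mat n n"
  shows "B \<in> mat_ball n k A \<longleftrightarrow> mcong (pp ^ k) B A"
  using assms by (auto simp: mat_ball_def mcong_def residue_eq_iff_dvd)

text \<open>The group of invertible matrices over \<open>\<int>\<^sub>p\<close>: a determinant is a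
  unit exactly when its reduction is nonzero.\<close>

definition ZGL :: "nat \<Rightarrow> 'p::prime_card padic_int mat set" where
  "ZGL n = {G \<in> carrier_mat n n. red (det G) \<noteq> 0}"

lemma ZGL_carrier: "G \<in> ZGL n \<Longrightarrow> G \<in> carrier_mat n n"
  by (simp add: ZGL_def)

lemma ZGL_iff: "G \<in> carrier_mat n n \<Longrightarrow> G \<in> ZGL n \<longleftrightarrow> redm G \<in> GL n"
  by (simp add: ZGL_def GL_def red.hom_det)

lemma ZGL_inverse:
  fixes G :: "'p::prime_card padic_int mat"
  assumes "G \<in> ZGL n"
  obtains H where "H \<in> carrier_mat n n" "G * H = 1\<^sub>m n" "H * G = 1\<^sub>m n"
proof -
  have G: "G \<in> carrier_mat n n" and "det G dvd 1" using assms by (auto simp: ZGL_def padic_unit_iff)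
  then obtain u where u: "u * det G = 1" by (metis dvdE mult.commute)
  note adj = adj_mat[OF G]
  show thesis
  proof (rule that)
    show "u \<cdot>\<^sub>m adj_mat G \<in> carrier_mat n n" using adj by simp
    have "G * (u \<cdot>\<^sub>m adj_mat G) = u \<cdot>\<^sub>m (G * adj_mat G)" using adj G by (intro mult_smult_distrib) auto
    then show "G * (u \<cdot>\<^sub>m adj_mat G) = 1\<^sub>m n" unfolding adj(2) using u by (auto intro!: eq_matI)
    have "(u \<cdot>\<^sub>m adj_mat G) * G = u \<cdot>\<^sub>m (adj_mat G * G)" using adj G by (intro mult_smult_assoc_mat) auto
    then show "(u \<cdot>\<^sub>m adj_mat G) * G = 1\<^sub>m n" unfolding adj(3) using u by (auto intro!: eq_matI)
  qed
qed

lemma mcong_padic_complete: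
  fixes T :: "nat \<Rightarrow> 'p::prime_card padic_int mat"
  assumes T: "\<And>k. T k \<in> carrier_mat m n" and c: "\<And>k. mcong (pp ^ k) (T (Suc k)) (T k)"
  obtains Z where "Z \<in> carrier_mat m n" "\<And>k. mcong (pp ^ k) Z (T k)"
proof -
  have "\<exists>z. \<forall>k. pp ^ k dvd z - T k $$ (i, j)" if "i < m" "j < n" for i j
    using padic_complete[of "\<lambda>k. T k $$ (i, j)"] mcong_D[OF c T that] by blast
  then obtain z where z: "\<And>i j k. i < m \<Longrightarrow> j < n \<Longrightarrow> pp ^ k dvd z i j - T k $$ (i, j)" by metis
  show thesis
  proof (rule that)
    show Z: "mat m n (\<lambda>(i, j). z i j) \<in> carrier_mat m n" by simp
    show "mcong (pp ^ k) (mat m n (\<lambda>(i, j). z i j)) (T k)" for k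
      by (rule mcong_I[OF Z T]) (simp add: z)
  qed
qed

lemma mcong_separated:
  fixes A :: "'p::prime_card padic_int mat"
  assumes "\<And>k. mcong (pp ^ k) A B"
  shows "A = B"
proof (rule eq_matI)
  fix i j assume ij: "i < dim_row B" "j < dim_col B"
  have "A $$ (i, j) - B $$ (i, j) = 0" using assms ij by (intro padic_separated) (auto simp: mcong_def)
  then show "A $$ (i, j) = B $$ (i, j)" by simp
qed (use assms[of 0] in \<open>auto simp: mcong_def\<close>)

section \<open>Isometries of the space of matrices\<close>

text \<open>From right to left this is uniform continuity, from left to right injectivity modulo
  every \<open>p ^ k\<close>. With finitely many balls of each level, surjectivity and invariance of
  the Haar measure follow.\<close>

definition isometry :: "nat \<Rightarrow> ('p::prime_card padic_int mat \<Rightarrow> 'p padic_int mat) \<Rightarrow> bool" where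
  "isometry n \<Psi> \<longleftrightarrow> (\<forall>T\<in>carrier_mat n n. \<Psi> T \<in> carrier_mat n n) \<and>
     (\<forall>k. \<forall>T\<in>carrier_mat n n. \<forall>T'\<in>carrier_mat n n. mcong (pp ^ k) (\<Psi> T) (\<Psi> T') \<longleftrightarrow> mcong (pp ^ k) T T')"

text \<open>At level \<open>k\<close> the map \<open>\<Psi>\<close> induces an injective map
  \<open>f\<close> on the finite set of balls, which is therefore onto.\<close>

lemma isometry_approx:
  fixes A :: "'p::prime_card padic_int mat"
  assumes iso: "isometry n \<Psi>" and A: "A \<in> carrier_mat n n"
  shows "\<exists>T\<in>carrier_mat n n. mcong (pp ^ k) (\<Psi> T) A"
proof -
  let ?C = "carrier_mat n n :: 'p padic_int mat set"
  have I: "\<Psi> T \<in> ?C" if "T \<in> ?C" for T using iso that by (simp add: isometry_def)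
  have I2: "mcong (pp ^ k) (\<Psi> T) (\<Psi> T') \<longleftrightarrow> mcong (pp ^ k) T T'" if "T \<in> ?C" "T' \<in> ?C" for T T'
    using iso that by (simp add: isometry_def)
  have ball: "mat_ball n k T = mat_ball n k T' \<longleftrightarrow> mcong (pp ^ k) T T'" if "T \<in> ?C" "T' \<in> ?C" for T T'
    using that mat_ball_iff_mcong mat_ball_eq mat_ball_self by metis
  let ?L = "mat_ball n k ` ?C"
  define f where "f S = mat_ball n k (\<Psi> (SOME T. T \<in> ?C \<and> S = mat_ball n k T))" for S
  have f: "f (mat_ball n k T) = mat_ball n k (\<Psi> T)" if T: "T \<in> ?C" for T
  proof -
    let ?T = "SOME T'. T' \<in> ?C \<and> mat_ball n k T = mat_ball n k T'"
    have s: "?T \<in> ?C \<and> mat_ball n k T = mat_ball n k ?T" by (rule someI[of _ T]) (use T in simp)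
    have T'1: "?T \<in> ?C" by (rule conjunct1[OF s])
    have "mcong (pp ^ k) T ?T" using conjunct2[OF s] ball[OF T T'1] by simp
    note T' = T'1 this
    have "mcong (pp ^ k) (\<Psi> T) (\<Psi> ?T)" using I2[OF T T'1] T'(2) by simp
    then show ?thesis unfolding f_def using ball[OF I[OF T] I[OF T'(1)]] by simp
  qed
  have "inj_on f ?L" using f ball I I2 by (auto simp: inj_on_def)
  moreover have "f ` ?L \<subseteq> ?L" using f I by auto
  ultimately have "f ` ?L = ?L" by (intro endo_inj_surj[OF finite_mat_balls_level])
  then have "mat_ball n k A \<in> f ` ?L" using A by simp
  then obtain T where "T \<in> ?C" "mat_ball n k A = f (mat_ball n k T)" by blast
  then have "T \<in> ?C" "mat_ball n k (\<Psi> T) = mat_ball n k A" using f by simp_all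
  then show ?thesis using ball I A by blast
qed

text \<open>The approximate preimages of all levels form a Cauchy sequence, again because
  \<open>\<Psi>\<close> reflects congruences, and the limit is an exact preimage.\<close>

lemma isometry_surj:
  fixes A :: "'p::prime_card padic_int mat"
  assumes iso: "isometry n \<Psi>" and A: "A \<in> carrier_mat n n"
  obtains T where "T \<in> carrier_mat n n" "\<Psi> T = A"
proof -
  have I: "\<Psi> T \<in> carrier_mat n n" if "T \<in> carrier_mat n n" for T using iso that by (simp add: isometry_def)
  have I2: "mcong (pp ^ k) (\<Psi> T) (\<Psi> T') \<longleftrightarrow> mcong (pp ^ k) T T'" if "T \<in> carrier_mat n n" "T' \<in> carrier_mat n n" for k T T'
    using iso that by (simp add: isometry_def)
  obtain T where T: "\<And>k. T k \<in> carrier_mat n n" "\<And>k. mcong (pp ^ k) (\<Psi> (T k)) A"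
    using isometry_approx[OF iso A] by metis
  have "mcong (pp ^ k) (T (Suc k)) (T k)" for k
  proof -
    have "mcong (pp ^ k) (\<Psi> (T (Suc k))) A" using T(2)[of "Suc k"] by (rule mcong_dvd) simp
    then have "mcong (pp ^ k) (\<Psi> (T (Suc k))) (\<Psi> (T k))" using T(2)[of k] mcong_sym mcong_trans by blast
    then show ?thesis using I2 T(1) by blast
  qed
  then obtain Z where Z: "Z \<in> carrier_mat n n" "\<And>k. mcong (pp ^ k) Z (T k)"
    using mcong_padic_complete T(1) by metis
  have "mcong (pp ^ k) (\<Psi> Z) A" for k
    using I2[OF Z(1) T(1)[of k]] Z(2) T(2) mcong_trans by blast
  then have "\<Psi> Z = A" by (rule mcong_separated)
  then show thesis using that Z by blast
qed

section \<open>Isometries preserve Haar measure\<close>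

lemma haar_mat_facts:
  "prob_space (haar_mat n :: 'p::prime_card padic_int mat measure)"
  "space (haar_mat n :: 'p padic_int mat measure) = carrier_mat n n"
  "sets (haar_mat n :: 'p padic_int mat measure) = sigma_sets (carrier_mat n n) (mat_balls n)"
proof -
  have "is_haar_prob n (haar_mat n :: 'p padic_int mat measure)" by (rule is_haar_prob_haar_mat)
  then show "prob_space (haar_mat n :: 'p padic_int mat measure)"
    "space (haar_mat n :: 'p padic_int mat measure) = carrier_mat n n"
    "sets (haar_mat n :: 'p padic_int mat measure) = sigma_sets (carrier_mat n n) (mat_balls n)"
    by (auto simp: is_haar_prob_def sigma_mat_topology_eq)
qed

lemma mat_ball_in_sets: "A \<in> carrier_mat n n \<Longrightarrow> mat_ball n k A \<in> sets (haar_mat n)"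
  by (auto simp: haar_mat_facts mat_balls_def)

lemma mat_balls_Pow: "mat_balls n \<subseteq> Pow (carrier_mat n n)"
  using mat_ball_subset by (auto simp: mat_balls_def)

lemma isometry_measurable:
  fixes \<Psi> :: "'p::prime_card padic_int mat \<Rightarrow> 'p padic_int mat"
  assumes iso: "isometry n \<Psi>"
  shows "\<Psi> \<in> measurable (haar_mat n) (haar_mat n)"
    and "A \<in> carrier_mat n n \<Longrightarrow> \<exists>T\<in>carrier_mat n n. \<Psi> -` mat_ball n k A \<inter> carrier_mat n n = mat_ball n k T"
proof -
  have vim: "\<exists>T\<in>carrier_mat n n. \<Psi> -` mat_ball n k A \<inter> carrier_mat n n = mat_ball n k T"
    if A: "A \<in> carrier_mat n n" for k A
  proof -
    obtain T where T: "T \<in> carrier_mat n n" "\<Psi> T = A" using isometry_surj[OF iso A] .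
    have "\<Psi> -` mat_ball n k A \<inter> carrier_mat n n = mat_ball n k T"
    proof (rule Set.set_eqI)
      fix W show "W \<in> \<Psi> -` mat_ball n k A \<inter> carrier_mat n n \<longleftrightarrow> W \<in> mat_ball n k T"
        using T A iso mat_ball_iff_mcong[OF A] mat_ball_iff_mcong[OF T(1)] mat_ball_subset[of n k T]
        by (auto simp: isometry_def)
    qed
    then show ?thesis using T by blast
  qed
  then show "A \<in> carrier_mat n n \<Longrightarrow> \<exists>T\<in>carrier_mat n n. \<Psi> -` mat_ball n k A \<inter> carrier_mat n n = mat_ball n k T" .
  show "\<Psi> \<in> measurable (haar_mat n) (haar_mat n)"
  proof (rule measurable_sigma_sets[OF haar_mat_facts(3) mat_balls_Pow])
    show "\<Psi> \<in> space (haar_mat n) \<rightarrow> carrier_mat n n" using iso by (auto simp: haar_mat_facts isometry_def)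
    fix S :: "'p padic_int mat set" assume "S \<in> mat_balls n"
    then obtain k A where "A \<in> carrier_mat n n" "S = mat_ball n k A" by (auto simp: mat_balls_def)
    then show "\<Psi> -` S \<inter> space (haar_mat n) \<in> sets (haar_mat n)"
      using vim[of A k] mat_ball_in_sets by (auto simp: haar_mat_facts(2))
  qed
qed

text \<open>Preimages of balls are balls of the same level, and the Haar measure of a ball depends
  on its level only.\<close>

lemma isometry_distr:
  fixes \<Psi> :: "'p::prime_card padic_int mat \<Rightarrow> 'p padic_int mat"
  assumes iso: "isometry n \<Psi>"
  shows "distr (haar_mat n) (haar_mat n) \<Psi> = haar_mat n"
proof (rule mat_measure_eqI[symmetric, OF haar_mat_facts(1,3)])
  show "sets (distr (haar_mat n) (haar_mat n) \<Psi>) = sigma_sets (carrier_mat n n) (mat_balls n)"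
    by (simp add: haar_mat_facts)
  fix k and A :: "'p padic_int mat" assume A: "A \<in> carrier_mat n n"
  obtain T where T: "T \<in> carrier_mat n n" "\<Psi> -` mat_ball n k A \<inter> carrier_mat n n = mat_ball n k T"
    using isometry_measurable(2)[OF iso A] by blast
  have "emeasure (distr (haar_mat n) (haar_mat n) \<Psi>) (mat_ball n k A) = emeasure (haar_mat n) (mat_ball n k T)"
    using emeasure_distr[OF isometry_measurable(1)[OF iso] mat_ball_in_sets[OF A]] T by (simp add: haar_mat_facts(2))
  also have "\<dots> = emeasure (haar_mat n) (mat_ball n k A)"
    using is_haar_prob_ball[OF is_haar_prob_haar_mat T(1)] is_haar_prob_ball[OF is_haar_prob_haar_mat A] by metis
  finally show "emeasure (haar_mat n) (mat_ball n k A) = emeasure (distr (haar_mat n) (haar_mat n) \<Psi>) (mat_ball n k A)" ..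
qed

lemma isometry_integral:
  fixes F :: "'p::prime_card padic_int mat \<Rightarrow> real"
  assumes iso: "isometry n \<Psi>" and F: "F \<in> borel_measurable (haar_mat n)"
  shows "(\<integral>T. F (\<Psi> T) \<partial>haar_mat n) = (\<integral>T. F T \<partial>haar_mat n)"
  using integral_distr[OF isometry_measurable(1)[OF iso] F] isometry_distr[OF iso] by simp

lemma zmult_cancel:
  fixes G H :: "'a::comm_ring_1 mat"
  assumes "G \<in> carrier_mat n n" "H \<in> carrier_mat n n" "G * H = 1\<^sub>m n" "M \<in> carrier_mat n m" "N \<in> carrier_mat m n"
  shows "G * (H * M) = M" "N * G * H = N"
  using assms by (simp_all add: assoc_mult_mat[symmetric, of G n n H n M m] assoc_mult_mat[of N m n G n H n])

lemma redm_mult: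
  fixes A B :: "'p::prime_card padic_int mat"
  assumes "A \<in> carrier_mat m n" "B \<in> carrier_mat n l"
  shows "redm (A * B) = redm A * redm B"
  using red.mat_hom_mult[OF assms] .

lemma isometry_conj:
  fixes G H :: "'p::prime_card padic_int mat"
  assumes G: "G \<in> carrier_mat n n" and H: "H \<in> carrier_mat n n" and GH: "G * H = 1\<^sub>m n" "H * G = 1\<^sub>m n"
  shows "isometry n (\<lambda>T. G * T * H)"
  unfolding isometry_def
proof (intro conjI ballI allI)
  fix T :: "'p padic_int mat" assume T: "T \<in> carrier_mat n n"
  show "G * T * H \<in> carrier_mat n n" using G H T by auto
next
  fix k and T T' :: "'p padic_int mat" assume T: "T \<in> carrier_mat n n" and T': "T' \<in> carrier_mat n n"
  have bk: "H * (G * T * H) * G = T" if T: "T \<in> carrier_mat n n" for T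
  proof -
    have GT: "G * T \<in> carrier_mat n n" using G T by auto
    have "H * (G * T * H) = H * (G * T) * H" using assoc_mult_mat[OF H GT H] by simp
    also have "H * (G * T) = T" using zmult_cancel(1)[OF H G GH(2) T T] .
    also have "T * H * G = T" using zmult_cancel(2)[OF H G GH(2) T T] .
    finally show ?thesis .
  qed
  show "mcong (pp ^ k) (G * T * H) (G * T' * H) \<longleftrightarrow> mcong (pp ^ k) T T'"
  proof
    assume c: "mcong (pp ^ k) (G * T * H) (G * T' * H)"
    have GTH: "G * T * H \<in> carrier_mat n n" using G H T by auto
    have "mcong (pp ^ k) (H * (G * T * H) * G) (H * (G * T' * H) * G)"
      by (rule mcong_mult[OF mcong_mult[OF mcong_refl c H GTH] mcong_refl mult_carrier_mat[OF H GTH] G])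
    then show "mcong (pp ^ k) T T'" using bk[OF T] bk[OF T'] by simp
  next
    assume c: "mcong (pp ^ k) T T'"
    show "mcong (pp ^ k) (G * T * H) (G * T' * H)"
      by (rule mcong_mult[OF mcong_mult[OF mcong_refl c G T] mcong_refl mult_carrier_mat[OF G T] H])
  qed
qed

text \<open>Induction on \<open>k\<close>: once \<open>P = p ^ k * Q\<close>, the congruence can be
  divided by \<open>p ^ k\<close>, and modulo \<open>p\<close> the remaining equation for
  \<open>Q\<close> falls under \<open>sylvester_unique\<close>.\<close>

lemma sylvester_mod:
  fixes B C :: "'p::prime_card padic_int mat"
  assumes B: "B \<in> carrier_mat a a" and C: "C \<in> carrier_mat b b" and P: "P \<in> carrier_mat a b"
    and cop: "coprime (char_poly (redm B)) (char_poly (redm C))" and eq: "mcong (pp ^ k) (B * P) (P * C)"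
  shows "mcong (pp ^ k) P (0\<^sub>m a b)"
  using eq
proof (induction k)
  case 0
  show ?case using P by (auto simp: mcong_def)
next
  case (Suc k)
  have "mcong (pp ^ k) (B * P) (P * C)" using Suc.prems by (rule mcong_dvd) simp
  then have "mcong (pp ^ k) P (0\<^sub>m a b)" by (rule Suc.IH)
  then have "\<exists>q. P $$ (i, j) = pp ^ k * q" if "i < a" "j < b" for i j
    using mcong_D[OF _ P that] that by (fastforce simp: dvd_def)
  then obtain q where q: "\<And>i j. i < a \<Longrightarrow> j < b \<Longrightarrow> P $$ (i, j) = pp ^ k * q i j" by metis
  define Q where "Q = mat a b (\<lambda>(i, j). q i j)"
  have Q: "Q \<in> carrier_mat a b" by (simp add: Q_def)
  have PQ: "P = pp ^ k \<cdot>\<^sub>m Q" using P q by (intro eq_matI) (auto simp: Q_def)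
  have "B * P = pp ^ k \<cdot>\<^sub>m (B * Q)" "P * C = pp ^ k \<cdot>\<^sub>m (Q * C)"
    unfolding PQ using mult_smult_distrib[OF B Q] mult_smult_assoc_mat[OF Q C] by auto
  then have c: "mcong (pp ^ Suc k) (pp ^ k \<cdot>\<^sub>m (B * Q)) (pp ^ k \<cdot>\<^sub>m (Q * C))" using Suc.prems by simp
  have BQ: "B * Q \<in> carrier_mat a b" "Q * C \<in> carrier_mat a b" using B Q C by auto
  have "mcong pp (B * Q) (Q * C)"
  proof (rule mcong_I[OF BQ])
    fix i j assume ij: "i < a" "j < b"
    have "pp ^ Suc k dvd (pp ^ k \<cdot>\<^sub>m (B * Q)) $$ (i, j) - (pp ^ k \<cdot>\<^sub>m (Q * C)) $$ (i, j)"
      by (rule mcong_D[OF c _ ij]) (use BQ in auto)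
    also have "(pp ^ k \<cdot>\<^sub>m (B * Q)) $$ (i, j) - (pp ^ k \<cdot>\<^sub>m (Q * C)) $$ (i, j) = pp ^ k * ((B * Q) $$ (i, j) - (Q * C) $$ (i, j))"
      using ij carrier_matD[OF BQ(1)] carrier_matD[OF BQ(2)] by (simp only: index_smult_mat right_diff_distrib)
    finally have "pp ^ k * pp dvd pp ^ k * ((B * Q) $$ (i, j) - (Q * C) $$ (i, j))" by (simp only: power_Suc2)
    then show "pp dvd (B * Q) $$ (i, j) - (Q * C) $$ (i, j)"
      using dvd_times_left_cancel_iff[of "pp ^ k :: 'p padic_int"] by simp
  qed
  then have "redm B * redm Q = redm Q * redm C"
    using redm_eq_iff redm_mult[OF B Q] redm_mult[OF Q C] by metis
  then have "redm Q = 0\<^sub>m a b"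
    by (intro sylvester_unique[OF _ _ _ _ cop]) (use B C Q in auto)
  then have "red (Q $$ (i, j)) = 0" if "i < a" "j < b" for i j
    using arg_cong[of "redm Q" _ "\<lambda>M. M $$ (i, j)"] that Q by (metis carrier_matD index_map_mat(1) index_zero_mat(1))
  then have "pp dvd Q $$ (i, j)" if "i < a" "j < b" for i j using that by (simp add: red_eq_0_iff)
  then show ?case
    unfolding PQ using Q by (intro mcong_I[of _ a b]) (auto simp: mult.commute intro: mult_dvd_mono)
qed

section \<open>Blocks of a matrix and congruences between them\<close>

definition blk :: "nat \<Rightarrow> nat \<Rightarrow> nat \<Rightarrow> nat \<Rightarrow> 'a mat \<Rightarrow> 'a mat" where
  "blk r c m n T = mat m n (\<lambda>(i, j). T $$ (i + r, j + c))"

lemma blk_carrier[simp]: "blk r c m n T \<in> carrier_mat m n"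
  by (simp add: blk_def)

lemma blk_dim[simp]: "dim_row (blk r c m n T) = m" "dim_col (blk r c m n T) = n"
  by (simp_all add: blk_def)

lemma blk_four_block:
  assumes "T \<in> carrier_mat (a + b) (a + b)"
  shows "T = four_block_mat (blk 0 0 a a T) (blk 0 a a b T) (blk a 0 b a T) (blk a a b b T)"
  using assms by (intro eq_matI) (auto simp: blk_def)

lemma mcong_blk:
  assumes "mcong d T T'" "T \<in> carrier_mat k l" "r + m \<le> k" "c + n \<le> l"
  shows "mcong d (blk r c m n T) (blk r c m n T')"
  using assms by (intro mcong_I[of _ m n]) (auto simp: blk_def intro!: mcong_D[OF assms(1,2)])

lemma mcong_four_block:
  assumes "mcong d A A'" "mcong d B B'" "mcong d C C'" "mcong d D D'"
    and c: "A \<in> carrier_mat a a'" "B \<in> carrier_mat a b'" "C \<in> carrier_mat b a'" "D \<in> carrier_mat b b'"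
  shows "mcong d (four_block_mat A B C D) (four_block_mat A' B' C' D')"
proof -
  have c': "A' \<in> carrier_mat a a'" "B' \<in> carrier_mat a b'" "C' \<in> carrier_mat b a'" "D' \<in> carrier_mat b b'"
    using assms by (auto simp: mcong_def)
  show ?thesis
    using assms c c' by (intro mcong_I[of _ "a + b" "a' + b'"]) (auto simp: mcong_def)
qed

lemma mcong_four_blockD:
  assumes "mcong d (four_block_mat A B C D) (four_block_mat A' B' C' D')"
    and c: "A \<in> carrier_mat a a'" "B \<in> carrier_mat a b'" "C \<in> carrier_mat b a'" "D \<in> carrier_mat b b'"
    and c': "A' \<in> carrier_mat a a'" "B' \<in> carrier_mat a b'" "C' \<in> carrier_mat b a'" "D' \<in> carrier_mat b b'"
  shows "mcong d A A'" "mcong d B B'" "mcong d C C'" "mcong d D D'"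
proof -
  have F: "four_block_mat A B C D \<in> carrier_mat (a + b) (a' + b')" using c by auto
  note D = mcong_D[OF assms(1) F]
  show "mcong d A A'"
  proof (rule mcong_I[OF c(1) c'(1)])
    fix i j assume "i < a" "j < a'"
    then show "d dvd A $$ (i, j) - A' $$ (i, j)" using D[of i j] c c' by simp
  qed
  show "mcong d B B'"
  proof (rule mcong_I[OF c(2) c'(2)])
    fix i j assume "i < a" "j < b'"
    then show "d dvd B $$ (i, j) - B' $$ (i, j)" using D[of i "j + a'"] c c' by simp
  qed
  show "mcong d C C'"
  proof (rule mcong_I[OF c(3) c'(3)])
    fix i j assume "i < b" "j < a'"
    then show "d dvd C $$ (i, j) - C' $$ (i, j)" using D[of "i + a" j] c c' by simp
  qed
  show "mcong d D D'"
  proof (rule mcong_I[OF c(4) c'(4)])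
    fix i j assume "i < b" "j < b'"
    then show "d dvd D $$ (i, j) - D' $$ (i, j)" using D[of "i + a" "j + a'"] c c' by simp
  qed
qed

lemma redm_four_block:
  assumes "A \<in> carrier_mat a a'" "B \<in> carrier_mat a b'" "C \<in> carrier_mat b a'" "D \<in> carrier_mat b b'"
  shows "redm (four_block_mat A B C D) = four_block_mat (redm A) (redm B) (redm C) (redm D)"
  by (rule map_four_block_mat[OF assms])

text \<open>
  A matrix \<open>T = ((B, Y), (Z, C))\<close> with \<open>T mod p = diag(B\<^sub>0, C\<^sub>0)\<close> is sent to
  \<open>U diag(B, C) U\<^sup>-\<^sup>1\<close> where \<open>U = ((1, Y), (Z, 1))\<close>. Modulo every power of \<open>p\<close> this map is injective
  by Sylvester's theorem, so it is an isometry, hence onto: this replaces Hensel's lemma.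
\<close>

definition blockU :: "nat \<Rightarrow> nat \<Rightarrow> 'a::comm_ring_1 mat \<Rightarrow> 'a mat" where
  "blockU a b T = four_block_mat (1\<^sub>m a) (blk 0 a a b T) (blk a 0 b a T) (1\<^sub>m b)"

definition blockD :: "nat \<Rightarrow> nat \<Rightarrow> 'a::comm_ring_1 mat \<Rightarrow> 'a mat" where
  "blockD a b T = diag2 (blk 0 0 a a T) (blk a a b b T)"

definition blockV :: "nat \<Rightarrow> nat \<Rightarrow> 'a::comm_ring_1 mat \<Rightarrow> 'a mat" where
  "blockV a b T = (SOME V. V \<in> carrier_mat (a + b) (a + b) \<and> blockU a b T * V = 1\<^sub>m (a + b) \<and> V * blockU a b T = 1\<^sub>m (a + b))"

text \<open>The identity outside the residue class of \<open>M0\<close> makes this a map of the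
  whole space, to which the results on isometries apply directly.\<close>

definition blockPsi :: "nat \<Rightarrow> nat \<Rightarrow> 'p::prime_card mod_ring mat \<Rightarrow> 'p padic_int mat \<Rightarrow> 'p padic_int mat" where
  "blockPsi a b M0 T = (if redm T = M0 then blockU a b T * blockD a b T * blockV a b T else T)"

context
  fixes a b :: nat and B0 C0 :: "'p::prime_card mod_ring mat"
  assumes B0: "B0 \<in> carrier_mat a a" and C0: "C0 \<in> carrier_mat b b"
    and cop: "coprime (char_poly B0) (char_poly C0)"
begin

lemma blockUD_carrier:
  "blockU a b T \<in> carrier_mat (a + b) (a + b)" "blockD a b T \<in> carrier_mat (a + b) (a + b)"
  by (auto simp: blockU_def blockD_def)

lemma redm_blocks:
  assumes T: "T \<in> carrier_mat (a + b) (a + b)" "redm T = diag2 B0 C0"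
  shows "redm (blk 0 0 a a T) = B0" "redm (blk a a b b T) = C0"
    "redm (blk 0 a a b T) = 0\<^sub>m a b" "redm (blk a 0 b a T) = 0\<^sub>m b a"
proof -
  have "four_block_mat (redm (blk 0 0 a a T)) (redm (blk 0 a a b T)) (redm (blk a 0 b a T)) (redm (blk a a b b T))
    = redm T"
    by (subst (5) blk_four_block[OF T(1)]) (rule redm_four_block[symmetric], auto)
  then have eq: "four_block_mat (redm (blk 0 0 a a T)) (redm (blk 0 a a b T)) (redm (blk a 0 b a T)) (redm (blk a a b b T))
    = four_block_mat B0 (0\<^sub>m a b) (0\<^sub>m b a) C0" using T B0 C0 by simp
  show "redm (blk 0 0 a a T) = B0" "redm (blk a a b b T) = C0"
    "redm (blk 0 a a b T) = 0\<^sub>m a b" "redm (blk a 0 b a T) = 0\<^sub>m b a"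
    using four_block_inject[OF _ _ _ _ B0 zero_carrier_mat zero_carrier_mat C0 eq] by auto
qed

lemma redm_blockUD:
  assumes T: "T \<in> carrier_mat (a + b) (a + b)" "redm T = diag2 B0 C0"
  shows "redm (blockU a b T) = 1\<^sub>m (a + b)" "redm (blockD a b T) = diag2 B0 C0"
proof -
  have "redm (blockU a b T) = four_block_mat (redm (1\<^sub>m a)) (redm (blk 0 a a b T)) (redm (blk a 0 b a T)) (redm (1\<^sub>m b))"
    unfolding blockU_def by (rule redm_four_block) auto
  moreover have "redm (1\<^sub>m a) = (1\<^sub>m a :: 'p mod_ring mat)" "redm (1\<^sub>m b) = (1\<^sub>m b :: 'p mod_ring mat)" by (auto intro!: eq_matI)
  ultimately show "redm (blockU a b T) = 1\<^sub>m (a + b)" using redm_blocks[OF T] by simp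
  have "redm (blockD a b T) = four_block_mat (redm (blk 0 0 a a T)) (redm (0\<^sub>m a b)) (redm (0\<^sub>m b a)) (redm (blk a a b b T))"
    unfolding blockD_def by (subst redm_four_block[of _ a a _ b _ b]) auto
  moreover have "redm (0\<^sub>m a b) = (0\<^sub>m a b :: 'p mod_ring mat)" "redm (0\<^sub>m b a) = (0\<^sub>m b a :: 'p mod_ring mat)" by (auto intro!: eq_matI)
  ultimately show "redm (blockD a b T) = diag2 B0 C0" using redm_blocks[OF T] B0 C0 by simp
qed

lemma blockU_ZGL:
  assumes T: "T \<in> carrier_mat (a + b) (a + b)" "redm T = diag2 B0 C0"
  shows "blockU a b T \<in> ZGL (a + b)"
  using ZGL_iff[OF blockUD_carrier(1)] redm_blockUD(1)[OF T] GL_one by metis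

lemma blockV:
  assumes T: "T \<in> carrier_mat (a + b) (a + b)" "redm T = diag2 B0 C0"
  shows "blockV a b T \<in> carrier_mat (a + b) (a + b)" "blockU a b T * blockV a b T = 1\<^sub>m (a + b)"
    "blockV a b T * blockU a b T = 1\<^sub>m (a + b)"
proof -
  obtain H where "H \<in> carrier_mat (a + b) (a + b)" "blockU a b T * H = 1\<^sub>m (a + b)" "H * blockU a b T = 1\<^sub>m (a + b)"
    using ZGL_inverse[OF blockU_ZGL[OF T]] by blast
  then have ex: "\<exists>V. V \<in> carrier_mat (a + b) (a + b) \<and> blockU a b T * V = 1\<^sub>m (a + b) \<and> V * blockU a b T = 1\<^sub>m (a + b)" by blast
  from someI_ex[OF this] show "blockV a b T \<in> carrier_mat (a + b) (a + b)" "blockU a b T * blockV a b T = 1\<^sub>m (a + b)"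
    "blockV a b T * blockU a b T = 1\<^sub>m (a + b)" unfolding blockV_def[symmetric] by auto
qed

lemma blockPsi_eq:
  assumes T: "T \<in> carrier_mat (a + b) (a + b)" "redm T = diag2 B0 C0"
  defines "M \<equiv> blockPsi a b (diag2 B0 C0) T"
  shows "M \<in> carrier_mat (a + b) (a + b)" "redm M = diag2 B0 C0" "M * blockU a b T = blockU a b T * blockD a b T"
proof -
  note UD = blockUD_carrier[of T] and V = blockV[OF T] and r = redm_blockUD[OF T]
  have M: "M = blockU a b T * blockD a b T * blockV a b T" using T by (simp add: M_def blockPsi_def)
  have UDc: "blockU a b T * blockD a b T \<in> carrier_mat (a + b) (a + b)" using UD by (rule mult_carrier_mat)
  show "M \<in> carrier_mat (a + b) (a + b)" unfolding M using UDc V(1) by (rule mult_carrier_mat)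
  show "M * blockU a b T = blockU a b T * blockD a b T"
    unfolding M by (rule zmult_cancel(2)[OF V(1) UD(1) V(3) UD(1) UDc])
  have "redm (blockV a b T) = redm (blockU a b T) * redm (blockV a b T)"
    unfolding r(1) using left_mult_one_mat[of "redm (blockV a b T)" "a + b" "a + b"] V(1) by simp
  also have "\<dots> = redm (1\<^sub>m (a + b))" using redm_mult[OF UD(1) V(1)] V(2) by simp
  also have "\<dots> = 1\<^sub>m (a + b)" by (intro eq_matI) auto
  finally have rV: "redm (blockV a b T) = 1\<^sub>m (a + b)" .
  have d: "diag2 B0 C0 \<in> carrier_mat (a + b) (a + b)" using B0 C0 by auto
  show "redm M = diag2 B0 C0"
    unfolding M redm_mult[OF UDc V(1)] redm_mult[OF UD] rV r
    using left_mult_one_mat[OF d] right_mult_one_mat[OF d] by simp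
qed

text \<open>\<open>?W\<close>, the quotient of the two conjugating matrices, intertwines the block
  diagonal parts of \<open>T\<close> and \<open>T'\<close> modulo \<open>p ^ k\<close>, so
  \<open>sylvester_mod\<close> removes its off-diagonal blocks. As \<open>?U\<close> and
  \<open>?U'\<close> have identity matrices as diagonal blocks, \<open>?U' * ?W = ?U\<close> makes
  the diagonal blocks of \<open>?W\<close> trivial modulo \<open>p ^ k\<close> too. Then all four
  blocks of \<open>T\<close> and \<open>T'\<close> can be compared.\<close>

lemma blockPsi_inj_mod:
  assumes T: "T \<in> carrier_mat (a + b) (a + b)" "redm T = diag2 B0 C0"
    and T': "T' \<in> carrier_mat (a + b) (a + b)" "redm T' = diag2 B0 C0"
    and c: "mcong (pp ^ k) (blockPsi a b (diag2 B0 C0) T) (blockPsi a b (diag2 B0 C0) T')"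
  shows "mcong (pp ^ k) T T'"
proof -
  let ?n = "a + b"
  let ?M = "blockPsi a b (diag2 B0 C0) T" and ?M' = "blockPsi a b (diag2 B0 C0) T'"
  let ?U = "blockU a b T" and ?U' = "blockU a b T'" and ?V' = "blockV a b T'" and ?D = "blockD a b T" and ?D' = "blockD a b T'"
  note U = blockUD_carrier(1)[of T] and U' = blockUD_carrier(1)[of T'] and D = blockUD_carrier(2)[of T] and D' = blockUD_carrier(2)[of T']
  note V' = blockV[OF T'] and M = blockPsi_eq[OF T] and M' = blockPsi_eq[OF T']
  let ?W = "?V' * ?U"
  have W: "?W \<in> carrier_mat ?n ?n" using V'(1) U by (rule mult_carrier_mat)
  have UW: "?U' * ?W = ?U" by (rule zmult_cancel(1)[OF U' V'(1) V'(2) U U])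
  have 1: "?W * ?D = ?V' * (?M * ?U)"
    unfolding M(3) by (rule assoc_mult_mat[OF V'(1) U D])
  have 2: "?D' * ?W = ?V' * (?M' * ?U)"
  proof -
    have "?U' * (?D' * ?W) = ?U' * ?D' * ?W" using assoc_mult_mat[OF U' D' W] by simp
    also have "\<dots> = ?M' * (?U' * ?W)" unfolding M'(3)[symmetric] by (rule assoc_mult_mat[OF M'(1) U' W])
    finally have "?U' * (?D' * ?W) = ?M' * ?U" unfolding UW .
    then have "?V' * (?U' * (?D' * ?W)) = ?V' * (?M' * ?U)" by simp
    moreover have "?D' * ?W \<in> carrier_mat ?n ?n" using D' W by (rule mult_carrier_mat)
    ultimately show ?thesis using zmult_cancel(1)[OF V'(1) U' V'(3) _ U] by metis
  qed
  have "mcong (pp ^ k) (?V' * (?M * ?U)) (?V' * (?M' * ?U))"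
    by (rule mcong_mult[OF mcong_refl mcong_mult[OF c mcong_refl M(1) U] V'(1)]) (use M(1) U in \<open>rule mult_carrier_mat\<close>)
  then have WD: "mcong (pp ^ k) (?D' * ?W) (?W * ?D)" unfolding 1 2 by (rule mcong_sym)
  obtain P R S Q where bl: "P \<in> carrier_mat a a" "R \<in> carrier_mat a b" "S \<in> carrier_mat b a" "Q \<in> carrier_mat b b"
    "?W = four_block_mat P R S Q" using four_block_obtain[OF W] by metis
  let ?B = "blk 0 0 a a T" and ?C = "blk a a b b T" and ?B' = "blk 0 0 a a T'" and ?C' = "blk a a b b T'"
  let ?Y = "blk 0 a a b T" and ?Z = "blk a 0 b a T" and ?Y' = "blk 0 a a b T'" and ?Z' = "blk a 0 b a T'"
  have e1: "?D' * ?W = four_block_mat (?B' * P) (?B' * R) (?C' * S) (?C' * Q)"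
  proof -
    have "?D' * ?W = four_block_mat (?B' * P + 0\<^sub>m a b * S) (?B' * R + 0\<^sub>m a b * Q) (0\<^sub>m b a * P + ?C' * S) (0\<^sub>m b a * R + ?C' * Q)"
      unfolding bl(5) blockD_def blk_dim by (rule mult_four_block_mat[OF blk_carrier zero_carrier_mat zero_carrier_mat blk_carrier bl(1-4)])
    then show ?thesis using bl(1-4)
      by (simp add: left_mult_zero_mat[of _ _ _] left_add_zero_mat[of _ a b] left_add_zero_mat[of _ b a] left_add_zero_mat[of _ b b]
          right_add_zero_mat[of _ a a] right_add_zero_mat[of _ a b] mult_carrier_mat[of _ a a] mult_carrier_mat[of _ b b])
  qed
  have e2: "?W * ?D = four_block_mat (P * ?B) (R * ?C) (S * ?B) (Q * ?C)"
  proof -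
    have "?W * ?D = four_block_mat (P * ?B + R * 0\<^sub>m b a) (P * 0\<^sub>m a b + R * ?C) (S * ?B + Q * 0\<^sub>m b a) (S * 0\<^sub>m a b + Q * ?C)"
      unfolding bl(5) blockD_def blk_dim by (rule mult_four_block_mat[OF bl(1-4) blk_carrier zero_carrier_mat zero_carrier_mat blk_carrier])
    then show ?thesis using bl(1-4)
      by (simp add: right_mult_zero_mat[of _ _ _] left_add_zero_mat[of _ a b] left_add_zero_mat[of _ b b]
          right_add_zero_mat[of _ a a] right_add_zero_mat[of _ b a] mult_carrier_mat[of _ a b] mult_carrier_mat[of _ a a] mult_carrier_mat[of _ b a] mult_carrier_mat[of _ b b])
  qed
  note m = mult_carrier_mat
  note WD' = mcong_four_blockD[OF WD[unfolded e1 e2] m[OF blk_carrier bl(1)] m[OF blk_carrier bl(2)] m[OF blk_carrier bl(3)]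
      m[OF blk_carrier bl(4)] m[OF bl(1) blk_carrier] m[OF bl(2) blk_carrier] m[OF bl(3) blk_carrier] m[OF bl(4) blk_carrier]]
  note cR = WD'(2) and cS = WD'(3)
  have R0: "mcong (pp ^ k) R (0\<^sub>m a b)"
    by (rule sylvester_mod[OF blk_carrier blk_carrier bl(2) _ cR]) (simp add: redm_blocks[OF T] redm_blocks[OF T'] cop)
  have S0: "mcong (pp ^ k) S (0\<^sub>m b a)"
    by (rule sylvester_mod[OF blk_carrier blk_carrier bl(3) _ cS])
       (simp add: redm_blocks[OF T] redm_blocks[OF T'] coprime_commute cop)
  have UW': "four_block_mat (1\<^sub>m a) ?Y ?Z (1\<^sub>m b) = four_block_mat (P + ?Y' * S) (R + ?Y' * Q) (?Z' * P + S) (?Z' * R + Q)"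
  proof -
    have "?U = four_block_mat (1\<^sub>m a * P + ?Y' * S) (1\<^sub>m a * R + ?Y' * Q) (?Z' * P + 1\<^sub>m b * S) (?Z' * R + 1\<^sub>m b * Q)"
      unfolding trans[OF UW[unfolded bl(5), symmetric] refl] unfolding blockU_def
      by (rule mult_four_block_mat[OF one_carrier_mat blk_carrier blk_carrier one_carrier_mat bl(1-4)])
    then show ?thesis using bl(1-4) by (simp add: blockU_def)
  qed
  have pc: "P + ?Y' * S \<in> carrier_mat a a" "R + ?Y' * Q \<in> carrier_mat a b" "?Z' * P + S \<in> carrier_mat b a" "?Z' * R + Q \<in> carrier_mat b b"
    using bl(1-4) mult_carrier_mat[OF blk_carrier bl(3)] mult_carrier_mat[OF blk_carrier bl(4)]
      mult_carrier_mat[OF blk_carrier bl(1)] mult_carrier_mat[OF blk_carrier bl(2)] by auto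
  note I = four_block_inject[OF one_carrier_mat blk_carrier blk_carrier one_carrier_mat pc UW']
  have mz: "mcong (pp ^ k) (N * E) (0\<^sub>m u w)" if "mcong (pp ^ k) E (0\<^sub>m v w)" "E \<in> carrier_mat v w" "N \<in> carrier_mat u v"
    for N E :: "'p padic_int mat" and u v w
    using mcong_mult[OF mcong_refl that(1,3,2)] right_mult_zero_mat[OF that(3)] by simp
  have madd: "mcong (pp ^ k) (E + F) F" "mcong (pp ^ k) (F + E) F" if "mcong (pp ^ k) E (0\<^sub>m u v)" "E \<in> carrier_mat u v" "F \<in> carrier_mat u v"
    for E F :: "'p padic_int mat" and u v
    using that by (auto simp: mcong_def)
  have P1: "mcong (pp ^ k) P (1\<^sub>m a)"
    unfolding I(1) using madd(2)[OF mz[OF S0 bl(3) blk_carrier] mult_carrier_mat[OF blk_carrier bl(3)] bl(1)] mcong_sym by blast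
  have Q1: "mcong (pp ^ k) Q (1\<^sub>m b)"
    unfolding I(4) using madd(1)[OF mz[OF R0 bl(2) blk_carrier] mult_carrier_mat[OF blk_carrier bl(2)] bl(4)] mcong_sym by blast
  have mone: "mcong (pp ^ k) (N * E) N" "mcong (pp ^ k) (E * N') N'" if "mcong (pp ^ k) E (1\<^sub>m v)" "E \<in> carrier_mat v v" "N \<in> carrier_mat u v" "N' \<in> carrier_mat v u"
    for N N' E :: "'p padic_int mat" and u v
    using mcong_mult[OF mcong_refl that(1,3,2)] right_mult_one_mat[OF that(3)]
      mcong_mult[OF that(1) mcong_refl that(2,4)] left_mult_one_mat[OF that(4)] by simp_all
  have Yc: "mcong (pp ^ k) ?Y ?Y'"
    unfolding I(2) using madd(1)[OF R0 bl(2) mult_carrier_mat[OF blk_carrier bl(4)]] mone(1)[OF Q1 bl(4) blk_carrier] mcong_trans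
    by (metis blk_carrier)
  have Zc: "mcong (pp ^ k) ?Z ?Z'"
    unfolding I(3) using madd(2)[OF S0 bl(3) mult_carrier_mat[OF blk_carrier bl(1)]] mone(1)[OF P1 bl(1) blk_carrier] mcong_trans
    by (metis blk_carrier)
  have Bc: "mcong (pp ^ k) ?B ?B'"
  proof -
    note WD'(1)
    moreover have "mcong (pp ^ k) (?B' * P) ?B'" "mcong (pp ^ k) (P * ?B) ?B" using mone[OF P1 bl(1) blk_carrier blk_carrier] by auto
    ultimately show ?thesis using mcong_sym mcong_trans by blast
  qed
  have Cc: "mcong (pp ^ k) ?C ?C'"
  proof -
    note WD'(4)
    moreover have "mcong (pp ^ k) (?C' * Q) ?C'" "mcong (pp ^ k) (Q * ?C) ?C" using mone[OF Q1 bl(4) blk_carrier blk_carrier] by auto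
    ultimately show ?thesis using mcong_sym mcong_trans by blast
  qed
  show ?thesis
    using mcong_four_block[OF Bc Yc Zc Cc blk_carrier blk_carrier blk_carrier blk_carrier]
      blk_four_block[OF T(1)] blk_four_block[OF T'(1)] by simp
qed

lemma blockPsi_cong:
  assumes T: "T \<in> carrier_mat (a + b) (a + b)" "redm T = diag2 B0 C0"
    and T': "T' \<in> carrier_mat (a + b) (a + b)" "redm T' = diag2 B0 C0"
    and c: "mcong (pp ^ k) T T'"
  shows "mcong (pp ^ k) (blockPsi a b (diag2 B0 C0) T) (blockPsi a b (diag2 B0 C0) T')"
proof -
  let ?n = "a + b"
  let ?U = "blockU a b T" and ?U' = "blockU a b T'" and ?V = "blockV a b T" and ?V' = "blockV a b T'" and ?D = "blockD a b T" and ?D' = "blockD a b T'"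
  note U = blockUD_carrier(1)[of T] and U' = blockUD_carrier(1)[of T'] and D = blockUD_carrier(2)[of T] and D' = blockUD_carrier(2)[of T']
  note V = blockV[OF T] and V' = blockV[OF T']
  have Uc: "mcong (pp ^ k) ?U ?U'"
    unfolding blockU_def using mcong_blk[OF c T(1)] by (intro mcong_four_block[OF mcong_refl _ _ mcong_refl one_carrier_mat blk_carrier blk_carrier one_carrier_mat]) auto
  have Dc: "mcong (pp ^ k) ?D ?D'"
    unfolding blockD_def blk_dim using mcong_blk[OF c T(1)] by (intro mcong_four_block[OF _ mcong_refl mcong_refl _ blk_carrier zero_carrier_mat zero_carrier_mat blk_carrier]) auto
  have VU: "?V * ?U' \<in> carrier_mat ?n ?n" using V(1) U' by (rule mult_carrier_mat)
  \<comment> \<open>Inverses of congruent matrices are congruent: the left side collapses to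
    \<open>?V'\<close> and the right side to \<open>?V\<close>.\<close>
  have "mcong (pp ^ k) (?V * ?U * ?V') (?V * ?U' * ?V')"
    by (rule mcong_mult[OF mcong_mult[OF mcong_refl Uc V(1) U] mcong_refl mult_carrier_mat[OF V(1) U] V'(1)])
  moreover have "?V * ?U * ?V' = ?V'" unfolding V(3) using left_mult_one_mat[OF V'(1)] .
  moreover have "?V * ?U' * ?V' = ?V" by (rule zmult_cancel(2)[OF U' V'(1) V'(2) U V(1)])
  ultimately have Vc: "mcong (pp ^ k) ?V ?V'" using mcong_sym by simp
  have "mcong (pp ^ k) (?U * ?D * ?V) (?U' * ?D' * ?V')"
    by (rule mcong_mult[OF mcong_mult[OF Uc Dc U D] Vc mult_carrier_mat[OF U D] V(1)])
  then show ?thesis using T T' by (simp add: blockPsi_def)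
qed

lemma isometry_blockPsi: "isometry (a + b) (blockPsi a b (diag2 B0 C0))"
  unfolding isometry_def
proof (intro conjI ballI allI)
  let ?\<Psi> = "blockPsi a b (diag2 B0 C0)"
  have nS: "?\<Psi> T = T" if "redm T \<noteq> diag2 B0 C0" for T using that by (simp add: blockPsi_def)
  fix T :: "'p padic_int mat" assume T: "T \<in> carrier_mat (a + b) (a + b)"
  show "?\<Psi> T \<in> carrier_mat (a + b) (a + b)"
    using blockPsi_eq(1)[OF T] nS T by (cases "redm T = diag2 B0 C0") auto
  fix k and T' :: "'p padic_int mat" assume T': "T' \<in> carrier_mat (a + b) (a + b)"
  show "mcong (pp ^ k) (?\<Psi> T) (?\<Psi> T') \<longleftrightarrow> mcong (pp ^ k) T T'"
  proof (cases "redm T = diag2 B0 C0 \<longleftrightarrow> redm T' = diag2 B0 C0")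
    case True
    then show ?thesis
      using blockPsi_inj_mod[OF T _ T'] blockPsi_cong[OF T _ T'] nS by (cases "redm T = diag2 B0 C0") auto
  next
    case False
    \<comment> \<open>Exactly one of the two matrices lies in the residue class, and the map
      preserves this class and its complement. So neither pair is congruent for
      \<open>k > 0\<close>, and for \<open>k = 0\<close> only dimensions are compared.\<close>
    have r: "redm (?\<Psi> A) = diag2 B0 C0 \<longleftrightarrow> redm A = diag2 B0 C0" if "A \<in> carrier_mat (a + b) (a + b)" for A
      using blockPsi_eq(2)[OF that] nS by (cases "redm A = diag2 B0 C0") auto
    have no: "\<not> mcong (pp ^ k) A A'" if "redm A \<noteq> redm A'" "k > 0" for A A' :: "'p padic_int mat"
      using that redm_eq_iff[of A A'] mcong_dvd[of "pp ^ k" A A' pp] by (auto simp: dvd_power)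
    have ne: "redm (?\<Psi> T) \<noteq> redm (?\<Psi> T')" "redm T \<noteq> redm T'" using False r[OF T] r[OF T'] by auto
    show ?thesis
    proof (cases "k = 0")
      case True
      have "?\<Psi> T \<in> carrier_mat (a + b) (a + b)" "?\<Psi> T' \<in> carrier_mat (a + b) (a + b)"
        using blockPsi_eq(1)[OF T] blockPsi_eq(1)[OF T'] nS T T' by (metis)+
      then show ?thesis using True T T' by (auto simp: mcong_def)
    next
      case False
      then show ?thesis using no ne by auto
    qed
  qed
qed

end

text \<open>Conjugation by a lift of \<open>G0\<close> moves \<open>A\<close> into the residue class
  of \<open>diag2 B0 C0\<close>. There every matrix is a value of \<open>blockPsi\<close>, because
  isometries are onto, and so it is conjugate to a block diagonal matrix. The factors are again
  characteristic polynomials with known reduction, the form used in \<open>IC_local\<close>.\<close>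

theorem padic_block_decomposition:
  fixes A :: "'p::prime_card padic_int mat"
  assumes A: "A \<in> carrier_mat (a + b) (a + b)" and char: "char_poly (redm A) = f * g" and cop: "coprime f g"
    and f: "monic f" "degree f = a"
  obtains B C where "B \<in> carrier_mat a a" "C \<in> carrier_mat b b" "char_poly (redm B) = f" "char_poly (redm C) = g"
    "char_poly A = char_poly B * char_poly C"
proof -
  let ?n = "a + b"
  obtain G0 B0 C0 where 0: "G0 \<in> GL ?n" "B0 \<in> carrier_mat a a" "C0 \<in> carrier_mat b b" "char_poly B0 = f" "char_poly C0 = g"
    "redm A * G0 = G0 * diag2 B0 C0"
    using primary_decomposition[OF _ char cop f] A by (metis map_carrier_mat)
  define G where "G = map_mat lft G0"
  have rG: "redm G = G0" unfolding G_def by (intro eq_matI) auto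
  have Gc: "G \<in> carrier_mat ?n ?n" using GL_carrier[OF 0(1)] by (simp add: G_def)
  then have "G \<in> ZGL ?n" using ZGL_iff[OF Gc] rG 0(1) by simp
  then obtain H where H: "H \<in> carrier_mat ?n ?n" "G * H = 1\<^sub>m ?n" "H * G = 1\<^sub>m ?n" using ZGL_inverse by blast
  let ?A = "H * A * G"
  have HA: "H * A \<in> carrier_mat ?n ?n" using H(1) A by (rule mult_carrier_mat)
  have Ac: "?A \<in> carrier_mat ?n ?n" using HA Gc by (rule mult_carrier_mat)
  have AG: "A * G = G * ?A"
  proof -
    have AGc: "A * G \<in> carrier_mat ?n ?n" using A Gc by (rule mult_carrier_mat)
    have "?A = H * (A * G)" by (rule assoc_mult_mat[OF H(1) A Gc])
    then show ?thesis using zmult_cancel(1)[OF Gc H(1) H(2) AGc AGc] by simp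
  qed
  have dd: "diag2 B0 C0 \<in> carrier_mat ?n ?n" using 0 by auto
  have "G0 * redm ?A = G0 * diag2 B0 C0"
    using arg_cong[OF AG, of redm] redm_mult[OF A Gc] redm_mult[OF Gc Ac] rG 0(6) by simp
  then have rA: "redm ?A = diag2 B0 C0" using GL_left_cancel[OF 0(1) _ dd] Ac by simp
  have cop0: "coprime (char_poly B0) (char_poly C0)" using cop 0 by simp
  obtain T where T: "T \<in> carrier_mat ?n ?n" "blockPsi a b (diag2 B0 C0) T = ?A"
    using isometry_surj[OF isometry_blockPsi[OF 0(2,3) cop0] Ac] by blast
  have rT: "redm T = diag2 B0 C0" using T(2) rA by (auto simp: blockPsi_def split: if_splits)
  have e: "?A * blockU a b T = blockU a b T * blockD a b T" using blockPsi_eq(3)[OF 0(2,3) cop0 T(1) rT] T(2) by simp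
  have sim: "char_poly M = char_poly N" if "M \<in> carrier_mat ?n ?n" "N \<in> carrier_mat ?n ?n" "U \<in> ZGL ?n" "M * U = U * N" for M N U :: "'p padic_int mat"
  proof -
    note MN = that(1,2,4) and Uz = that(3) and Uc = ZGL_carrier[OF that(3)]
    obtain V where V: "V \<in> carrier_mat ?n ?n" "U * V = 1\<^sub>m ?n" "V * U = 1\<^sub>m ?n" by (rule ZGL_inverse[OF Uz])
    have "M = U * N * V" using zmult_cancel(2)[OF Uc V(1,2) MN(1,1)] MN(3) by simp
    then have "similar_mat_wit M N U V" using MN V Uc by (intro similar_mat_witI[of _ _ ?n]) auto
    then show ?thesis by (intro char_poly_similar) (auto simp: similar_mat_def)
  qed
  have U: "blockU a b T \<in> ZGL ?n" by (rule blockU_ZGL[OF 0(2,3) cop0 T(1) rT])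
  have D: "blockD a b T \<in> carrier_mat ?n ?n" by (rule blockUD_carrier[OF 0(2,3) cop0])
  have "char_poly A = char_poly (blockD a b T)"
    using sim[OF A Ac \<open>G \<in> ZGL ?n\<close> AG] sim[OF Ac D U e] by simp
  also have "\<dots> = char_poly (blk 0 0 a a T) * char_poly (blk a a b b T)"
    unfolding blockD_def blk_dim by (rule char_poly_four_block_upper[OF blk_carrier zero_carrier_mat blk_carrier])
  finally show thesis
    using that[OF blk_carrier blk_carrier] redm_blocks[OF 0(2,3) cop0 T(1) rT] 0 by blast
qed

section \<open>Integrals over residue classes\<close>

lemma ball1_iff:
  assumes "A \<in> carrier_mat n n"
  shows "B \<in> mat_ball n 1 A \<longleftrightarrow> B \<in> carrier_mat n n \<and> redm B = redm A"
  using mat_ball_iff_mcong[OF assms, of B 1] redm_eq_iff[of B A] mat_ball_subset[of n 1 A]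
  by auto

definition resball :: "nat \<Rightarrow> 'p::prime_card mod_ring mat \<Rightarrow> 'p padic_int mat set" where
  "resball n M = {T \<in> carrier_mat n n. redm T = M}"

definition liftm :: "'p::prime_card mod_ring mat \<Rightarrow> 'p padic_int mat" where
  "liftm M = map_mat lft M"

lemma redm_liftm[simp]: "redm (liftm M) = M"
  unfolding liftm_def by (intro eq_matI) auto

lemma liftm_carrier[simp]: "liftm M \<in> carrier_mat m n \<longleftrightarrow> M \<in> carrier_mat m n"
  by (simp add: liftm_def)

lemma resball_eq_ball: "M \<in> carrier_mat n n \<Longrightarrow> resball n M = mat_ball n 1 (liftm M)"
  using ball1_iff[of "liftm M" n] by (auto simp: resball_def)

text \<open>Such a set is a union of balls of one fixed level, of which there are only finitely
  many.\<close>

lemma level_set_in_sets: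
  fixes S :: "'p::prime_card padic_int mat set"
  assumes "S \<subseteq> carrier_mat n n" "\<And>T. T \<in> S \<Longrightarrow> mat_ball n k T \<subseteq> S"
  shows "S \<in> sets (haar_mat n)"
proof -
  have "S = \<Union>(mat_ball n k ` S)"
  proof (intro equalityI subsetI)
    fix T assume "T \<in> S"
    then show "T \<in> \<Union>(mat_ball n k ` S)" using assms(1) mat_ball_self[of T n k] by blast
  next
    fix T assume "T \<in> \<Union>(mat_ball n k ` S)"
    then show "T \<in> S" using assms(2) by blast
  qed
  moreover have "finite (mat_ball n k ` S)"
    by (rule finite_subset[OF image_mono[OF assms(1)] finite_mat_balls_level])
  moreover have "mat_ball n k ` S \<subseteq> sets (haar_mat n)" using assms(1) mat_ball_in_sets by blast
  ultimately show ?thesis using sets.finite_Union by metis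
qed

lemma resball_sets: "M \<in> carrier_mat n n \<Longrightarrow> resball n M \<in> sets (haar_mat n)"
  by (simp add: resball_eq_ball mat_ball_in_sets)

lemma haar_ball_pos:
  assumes "A \<in> carrier_mat n n"
  shows "measure (haar_mat n) (mat_ball n k A) > 0"
proof -
  interpret prob_space "haar_mat n :: 'a padic_int mat measure" by (rule haar_mat_facts)
  let ?L = "card (mat_ball n k ` (carrier_mat n n :: 'a padic_int mat set))"
  have L: "?L > 0" using assms finite_mat_balls_level[of n k] by (auto simp: card_gt_0_iff)
  have "emeasure (haar_mat n) (mat_ball n k A) = 1 / of_nat ?L"
    by (rule is_haar_prob_ball[OF is_haar_prob_haar_mat assms])
  also have "\<dots> = ennreal (1 / real ?L)" using L by (simp add: divide_ennreal ennreal_of_nat_eq_real_of_nat flip: ennreal_1)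
  finally have "measure (haar_mat n) (mat_ball n k A) = 1 / real ?L" by (simp add: measure_def)
  then show ?thesis using L by simp
qed

lemma measure_resball:
  assumes M: "(M :: 'p::prime_card mod_ring mat) \<in> carrier_mat n n"
  shows "measure (haar_mat n) (resball n M) = 1 / real CARD('p) ^ (n * n)"
proof -
  let ?L = "mat_ball n 1 ` (carrier_mat n n :: 'p padic_int mat set)"
  have "bij_betw (\<lambda>M. mat_ball n 1 (liftm M)) (carrier_mat n n :: 'p mod_ring mat set) ?L"
    unfolding bij_betw_def
  proof (intro conjI inj_onI equalityI subsetI)
    fix M N :: "'p mod_ring mat" assume MN: "M \<in> carrier_mat n n" "N \<in> carrier_mat n n" "mat_ball n 1 (liftm M) = mat_ball n 1 (liftm N)"
    then have "liftm M \<in> mat_ball n 1 (liftm N)" using mat_ball_self[of "liftm M" n 1] by simp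
    then show "M = N" using ball1_iff[of "liftm N" n "liftm M"] MN by simp
  next
    fix S assume "S \<in> ?L"
    then obtain T where T: "T \<in> carrier_mat n n" "S = mat_ball n 1 T" by blast
    have "T \<in> mat_ball n 1 (liftm (redm T))" using ball1_iff[of "liftm (redm T)" n T] T by simp
    then have "mat_ball n 1 T = mat_ball n 1 (liftm (redm T))" by (rule mat_ball_eq)
    then show "S \<in> (\<lambda>M. mat_ball n 1 (liftm M)) ` (carrier_mat n n)" using T by auto
  qed auto
  then have L: "card ?L = CARD('p) ^ (n * n)" using bij_betw_same_card by (fastforce simp: card_carrier_mat)
  have "emeasure (haar_mat n) (mat_ball n 1 (liftm M)) = 1 / of_nat (card ?L)"
    by (rule is_haar_prob_ball[OF is_haar_prob_haar_mat]) (use M in simp)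
  also have "\<dots> = ennreal (1 / real (card ?L))"
    using L by (simp add: divide_ennreal ennreal_of_nat_eq_real_of_nat flip: ennreal_1)
  finally show ?thesis using M L by (simp add: resball_eq_ball measure_def)
qed

lemma haar_integrable_bounded:
  fixes F :: "'p::prime_card padic_int mat \<Rightarrow> real"
  assumes "F \<in> borel_measurable (haar_mat n)" "\<And>T. T \<in> carrier_mat n n \<Longrightarrow> \<bar>F T\<bar> \<le> c"
  shows "integrable (haar_mat n) F"
proof -
  interpret prob_space "haar_mat n :: 'p padic_int mat measure" by (rule haar_mat_facts)
  show ?thesis
    by (rule integrable_const_bound[of _ c]) (use assms in \<open>auto simp: haar_mat_facts(2)\<close>)
qed

lemma blk_vimage_ball:
  fixes A :: "'p::prime_card padic_int mat"
  assumes "r + m \<le> n" "A \<in> carrier_mat m m"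
  shows "blk r r m m -` mat_ball m k A \<inter> carrier_mat n n \<in> sets (haar_mat n)"
proof (rule level_set_in_sets[where k = k])
  fix T assume T: "T \<in> blk r r m m -` mat_ball m k A \<inter> carrier_mat n n"
  show "mat_ball n k T \<subseteq> blk r r m m -` mat_ball m k A \<inter> carrier_mat n n"
  proof
    fix S assume S: "S \<in> mat_ball n k T"
    have Sc: "S \<in> carrier_mat n n" using S mat_ball_subset by blast
    have "mcong (pp ^ k) S T" using S T mat_ball_iff_mcong[of T n S k] by blast
    then have "mcong (pp ^ k) (blk r r m m S) (blk r r m m T)" using mcong_blk Sc assms(1) by blast
    moreover have "mcong (pp ^ k) (blk r r m m T) A" using T mat_ball_iff_mcong[OF assms(2)] by blast
    ultimately show "S \<in> blk r r m m -` mat_ball m k A \<inter> carrier_mat n n"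
      using Sc mat_ball_iff_mcong[OF assms(2)] mcong_trans by blast
  qed
qed auto

lemma blk_measurable:
  assumes "r + m \<le> n"
  shows "blk r r m m \<in> measurable (haar_mat n :: 'p::prime_card padic_int mat measure) (haar_mat m)"
proof (rule measurable_sigma_sets[OF haar_mat_facts(3) mat_balls_Pow])
  show "blk r r m m \<in> space (haar_mat n :: 'p padic_int mat measure) \<rightarrow> carrier_mat m m" by auto
  fix S :: "'p padic_int mat set" assume "S \<in> mat_balls m"
  then show "blk r r m m -` S \<inter> space (haar_mat n) \<in> sets (haar_mat n)"
    using blk_vimage_ball[OF assms] by (auto simp: mat_balls_def haar_mat_facts(2))
qed

text \<open>Conditioned on the residues of all entries outside the block, the block has a
  translation invariant law, so uniqueness identifies this law with the Haar measure of the smaller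
  space.\<close>

lemma block_marginal:
  fixes T0 :: "'p::prime_card padic_int mat" and h :: "'p padic_int mat \<Rightarrow> real"
  assumes rm: "r + m \<le> n" and T0: "T0 \<in> carrier_mat n n" and h: "h \<in> borel_measurable (haar_mat m)"
  defines "S \<equiv> {T \<in> carrier_mat n n. \<forall>i<n. \<forall>j<n. \<not> (r \<le> i \<and> i < r + m \<and> r \<le> j \<and> j < r + m) \<longrightarrow> pp dvd T $$ (i, j) - T0 $$ (i, j)}"
  shows "(\<integral>T. indicator S T * h (blk r r m m T) \<partial>haar_mat n) = measure (haar_mat n) S * (\<integral>T. h T \<partial>haar_mat m)"
proof -
  let ?M = "haar_mat n :: 'p padic_int mat measure" and ?b = "blk r r m m :: 'p padic_int mat \<Rightarrow> _"
  interpret prob_space ?M by (rule haar_mat_facts)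
  have Sball: "mat_ball n 1 T \<subseteq> S" if "T \<in> S" for T
  proof
    fix R assume R: "R \<in> mat_ball n 1 T"
    have Tc: "T \<in> carrier_mat n n" using that by (simp add: S_def)
    have Rc: "R \<in> carrier_mat n n" using R mat_ball_subset by blast
    have c: "mcong pp R T" using R mat_ball_iff_mcong[OF Tc, of R 1] by simp
    show "R \<in> S"
      unfolding S_def
    proof (intro CollectI conjI allI impI Rc)
      fix i j assume ij: "i < n" "j < n" "\<not> (r \<le> i \<and> i < r + m \<and> r \<le> j \<and> j < r + m)"
      have "pp dvd (R $$ (i, j) - T $$ (i, j)) + (T $$ (i, j) - T0 $$ (i, j))"
        using mcong_D[OF c Rc ij(1,2)] that ij by (intro dvd_add) (auto simp: S_def)
      then show "pp dvd R $$ (i, j) - T0 $$ (i, j)" by simp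
    qed
  qed
  have Sset: "S \<in> sets ?M" by (rule level_set_in_sets[OF _ Sball]) (auto simp: S_def)
  have "T0 \<in> S" using T0 by (simp add: S_def)
  have mS: "measure ?M S > 0"
    using haar_ball_pos[OF T0, of 1] finite_measure_mono[OF Sball[OF \<open>T0 \<in> S\<close>] Sset] by simp
  have eS: "emeasure ?M S \<noteq> 0" "emeasure ?M S \<noteq> \<infinity>" using mS by (auto simp: measure_def)
  let ?U = "uniform_measure ?M S"
  have bU: "?b \<in> measurable ?U (haar_mat m)" using blk_measurable[OF rm] by (simp add: uniform_measure_def)
  define N where "N = distr ?U (haar_mat m) ?b"
  have eN: "emeasure N W = emeasure ?M (S \<inter> (?b -` W \<inter> carrier_mat n n)) / emeasure ?M S" if W: "W \<in> sets (haar_mat m)" for W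
  proof -
    have "emeasure N W = emeasure ?U (?b -` W \<inter> space ?U)" unfolding N_def by (rule emeasure_distr[OF bU W])
    also have "space ?U = carrier_mat n n" by (simp add: haar_mat_facts)
    also have "emeasure ?U (?b -` W \<inter> carrier_mat n n) = emeasure ?M (S \<inter> (?b -` W \<inter> carrier_mat n n)) / emeasure ?M S"
      using measurable_sets[OF blk_measurable[OF rm] W] Sset by (intro emeasure_uniform_measure) (auto simp: haar_mat_facts(2))
    finally show ?thesis .
  qed
  have "is_haar_prob m N"
    unfolding is_haar_prob_def
  proof (intro conjI ballI)
    show "prob_space N" unfolding N_def by (intro prob_space.prob_space_distr bU prob_space_uniform_measure eS)
    show "space N = carrier_mat m m" by (simp add: N_def haar_mat_facts)
    show "sets N = sigma_sets (carrier_mat m m) {U. openin (mat_topology m) U}"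
      by (simp add: N_def haar_mat_facts sigma_mat_topology_eq)
    fix B W :: "'p padic_int mat set" and B0 assume B0: "(B0 :: 'p padic_int mat) \<in> carrier_mat m m" and W: "W \<in> sets N"
    have W': "W \<in> sets (haar_mat m)" using W by (simp add: N_def)
    then have Wc: "W \<subseteq> carrier_mat m m" using sets.sets_into_space[OF W'] by (simp add: haar_mat_facts(2))
    \<comment> \<open>\<open>E\<close> extends the translation \<open>B0\<close> by zero: it moves
      the block and preserves \<open>S\<close>.\<close>
    define E where "E = mat n n (\<lambda>(i, j). if r \<le> i \<and> i < r + m \<and> r \<le> j \<and> j < r + m then B0 $$ (i - r, j - r) else 0)"
    have E: "E \<in> carrier_mat n n" by (simp add: E_def)
    have bE: "?b (E + T) = B0 + ?b T" if "T \<in> carrier_mat n n" for T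
      using that B0 rm by (intro eq_matI) (auto simp: blk_def E_def)
    have SE: "E + T \<in> S \<longleftrightarrow> T \<in> S" if "T \<in> carrier_mat n n" for T
      using that E by (auto simp: S_def E_def)
    have "S \<inter> (?b -` ((\<lambda>A. B0 + A) ` W) \<inter> carrier_mat n n) = (\<lambda>A. E + A) ` (S \<inter> (?b -` W \<inter> carrier_mat n n))"
    proof (intro equalityI subsetI)
      fix T assume T: "T \<in> S \<inter> (?b -` ((\<lambda>A. B0 + A) ` W) \<inter> carrier_mat n n)"
      then obtain w where w: "w \<in> W" "?b T = B0 + w" by auto
      let ?T = "T - E"
      have Tc: "?T \<in> carrier_mat n n" using T E by auto
      have TE: "E + ?T = T" using T E by (intro eq_matI) auto
      have "B0 + ?b ?T = B0 + w" using bE[OF Tc] TE w by simp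
      then have "?b ?T = w"
      proof -
        assume eq: "B0 + ?b ?T = B0 + w"
        have wc: "w \<in> carrier_mat m m" using w Wc by auto
        show "?b ?T = w"
        proof (rule eq_matI)
          fix i j assume "i < dim_row w" "j < dim_col w"
          then show "?b ?T $$ (i, j) = w $$ (i, j)"
            using arg_cong[OF eq, of "\<lambda>M. M $$ (i, j)"] wc B0 by simp
        qed (use wc in auto)
      qed
      then have "?T \<in> S \<inter> (?b -` W \<inter> carrier_mat n n)" using SE[OF Tc] TE T Tc w by auto
      then show "T \<in> (\<lambda>A. E + A) ` (S \<inter> (?b -` W \<inter> carrier_mat n n))" using TE by (metis imageI)
    next
      fix T assume "T \<in> (\<lambda>A. E + A) ` (S \<inter> (?b -` W \<inter> carrier_mat n n))"
      then obtain R where R: "T = E + R" "R \<in> S" "?b R \<in> W" "R \<in> carrier_mat n n" by blast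
      have "?b T \<in> (\<lambda>A. B0 + A) ` W" unfolding R(1) bE[OF R(4)] using R(3) by blast
      moreover have "T \<in> S" "T \<in> carrier_mat n n" unfolding R(1) using SE[OF R(4)] R E by auto
      ultimately show "T \<in> S \<inter> (?b -` ((\<lambda>A. B0 + A) ` W) \<inter> carrier_mat n n)" by blast
    qed
    moreover have "S \<inter> (?b -` W \<inter> carrier_mat n n) \<in> sets ?M"
      using measurable_sets[OF blk_measurable[OF rm] W'] Sset by (auto simp: haar_mat_facts(2))
    moreover have "(\<lambda>A. B0 + A) ` W \<in> sets (haar_mat m)"
    proof -
      let ?t = "\<lambda>A. - B0 + A"
      have iso: "isometry m ?t" unfolding isometry_def
      proof (intro conjI ballI allI)
        fix k and T T' :: "'p padic_int mat" assume "T \<in> carrier_mat m m" "T' \<in> carrier_mat m m"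
        then show "mcong (pp ^ k) (?t T) (?t T') \<longleftrightarrow> mcong (pp ^ k) T T'" using B0 by (auto simp: mcong_def)
      qed (use B0 in auto)
      have "(\<lambda>A. B0 + A) ` W = ?t -` W \<inter> carrier_mat m m"
      proof (intro equalityI subsetI)
        fix A assume A: "A \<in> ?t -` W \<inter> carrier_mat m m"
        then have "A = B0 + ?t A" using B0 by (intro eq_matI) auto
        then show "A \<in> (\<lambda>A. B0 + A) ` W" using A by blast
      next
        fix A assume "A \<in> (\<lambda>A. B0 + A) ` W"
        then obtain w where w: "w \<in> W" "A = B0 + w" by blast
        then have "w \<in> carrier_mat m m" using Wc by blast
        then have "?t A = w" "A \<in> carrier_mat m m" using w B0 by (auto intro!: eq_matI)
        then show "A \<in> ?t -` W \<inter> carrier_mat m m" using w by auto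
      qed
      then show ?thesis using measurable_sets[OF isometry_measurable(1)[OF iso] W'] by (simp add: haar_mat_facts(2))
    qed
    moreover have "emeasure ?M ((\<lambda>A. E + A) ` R) = emeasure ?M R" if "R \<in> sets ?M" for R
      using is_haar_prob_haar_mat[of n, where 'a='p] E that by (simp add: is_haar_prob_def)
    ultimately show "emeasure N ((\<lambda>A. B0 + A) ` W) = emeasure N W"
      using eN W' by simp
  qed
  then have NM: "N = haar_mat m" using is_haar_prob_unique is_haar_prob_haar_mat by blast
  have hb: "(\<lambda>T. h (?b T)) \<in> borel_measurable ?M" using measurable_compose[OF blk_measurable[OF rm] h] .
  have "(\<integral>T. h T \<partial>haar_mat m) = (\<integral>T. h (?b T) \<partial>?U)"
    unfolding NM[symmetric] unfolding N_def by (rule integral_distr[OF bU h])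
  also have "?U = density ?M (\<lambda>T. ennreal (indicator S T / measure ?M S))"
    unfolding uniform_measure_def
  proof (rule density_cong)
    show "AE T in ?M. indicator S T / emeasure ?M S = ennreal (indicator S T / measure ?M S)"
      using mS by (auto simp: indicator_def emeasure_eq_measure divide_ennreal ennreal_1[symmetric] simp del: ennreal_1)
  qed (use Sset in auto)
  also have "(\<integral>T. h (?b T) \<partial>density ?M (\<lambda>T. ennreal (indicator S T / measure ?M S)))
      = (\<integral>T. (indicator S T / measure ?M S) *\<^sub>R h (?b T) \<partial>?M)"
    by (rule integral_density[OF hb]) (use Sset in auto)
  also have "\<dots> = (\<integral>T. indicator S T * h (?b T) \<partial>?M) / measure ?M S" by simp
  finally show ?thesis using mS by simp
qed

text \<open>Not divided by the mass of the residue class, so that the values for all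
  \<open>M\<close> add up to the full integral; the compensating power of \<open>p\<close> is part
  of \<open>zwt\<close>.\<close>

definition bint :: "nat \<Rightarrow> ('p::prime_card padic_int mat \<Rightarrow> real) \<Rightarrow> 'p mod_ring mat \<Rightarrow> real" where
  "bint n F M = (\<integral>T. indicator (resball n M) T * F T \<partial>haar_mat n)"

lemma resball_indicator_measurable:
  fixes F :: "'p::prime_card padic_int mat \<Rightarrow> real"
  assumes "M \<in> carrier_mat n n" "F \<in> borel_measurable (haar_mat n)"
  shows "(\<lambda>T. indicator (resball n M) T * F T) \<in> borel_measurable (haar_mat n)"
  using assms resball_sets[OF assms(1)] by (intro borel_measurable_times borel_measurable_indicator) auto

text \<open>Conjugation by a lift of \<open>G0\<close> is an isometry that carries the residue class
  of \<open>N\<close> onto that of \<open>M\<close>.\<close>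

lemma bint_conj:
  fixes F :: "'p::prime_card padic_int mat \<Rightarrow> real"
  assumes G0: "G0 \<in> GL n" and M: "M \<in> carrier_mat n n" and N: "N \<in> carrier_mat n n" and eq: "M * G0 = G0 * N"
    and F: "F \<in> borel_measurable (haar_mat n)"
    and inv: "\<And>G A B. G \<in> ZGL n \<Longrightarrow> A \<in> carrier_mat n n \<Longrightarrow> B \<in> carrier_mat n n \<Longrightarrow> A * G = G * B \<Longrightarrow> F A = F B"
  shows "bint n F M = bint n F N"
proof -
  let ?G = "liftm G0"
  have Gc: "?G \<in> carrier_mat n n" using GL_carrier[OF G0] by simp
  have G: "?G \<in> ZGL n" using ZGL_iff[OF Gc] G0 by simp
  obtain H where H: "H \<in> carrier_mat n n" "?G * H = 1\<^sub>m n" "H * ?G = 1\<^sub>m n" by (rule ZGL_inverse[OF G])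
  have iso: "isometry n (\<lambda>T. ?G * T * H)" by (rule isometry_conj[OF Gc H])
  have "bint n F M = (\<integral>T. indicator (resball n M) (?G * T * H) * F (?G * T * H) \<partial>haar_mat n)"
    unfolding bint_def by (rule isometry_integral[OF iso resball_indicator_measurable[OF M F], symmetric])
  also have "\<dots> = bint n F N"
    unfolding bint_def
  proof (rule Bochner_Integration.integral_cong[OF refl])
    fix T :: "'p padic_int mat" assume "T \<in> space (haar_mat n)"
    then have T: "T \<in> carrier_mat n n" by (simp add: haar_mat_facts)
    have GT: "?G * T \<in> carrier_mat n n" using Gc T by (rule mult_carrier_mat)
    have GTH: "?G * T * H \<in> carrier_mat n n" using GT H(1) by (rule mult_carrier_mat)
    have e: "?G * T * H * ?G = ?G * T" by (rule zmult_cancel(2)[OF H(1) Gc H(3) T GT])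
    have rT: "redm T \<in> carrier_mat n n" "redm (?G * T * H) \<in> carrier_mat n n" using T GTH by auto
    have e': "redm (?G * T * H) * G0 = G0 * redm T"
      using arg_cong[OF e, of redm] redm_mult[OF GTH Gc] redm_mult[OF Gc T] by simp
    have "redm (?G * T * H) = M \<longleftrightarrow> redm T = N"
    proof
      assume "redm (?G * T * H) = M"
      then have "G0 * redm T = G0 * N" using e' eq by simp
      then show "redm T = N" using GL_left_cancel[OF G0 rT(1) N] by simp
    next
      assume "redm T = N"
      then have "redm (?G * T * H) * G0 = M * G0" using e' eq by simp
      then show "redm (?G * T * H) = M" using GL_right_cancel[OF G0 rT(2) M] by simp
    qed
    moreover have "F (?G * T * H) = F T" by (rule inv[OF G GTH T e])
    ultimately show "indicator (resball n M) (?G * T * H) * F (?G * T * H) = indicator (resball n N) T * F T"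
      using T GTH by (simp add: resball_def indicator_def)
  qed
  finally show ?thesis .
qed

lemma bint_marginal:
  fixes h :: "'p::prime_card padic_int mat \<Rightarrow> real"
  assumes rm: "r + m \<le> n" and M0: "M0 \<in> carrier_mat n n" and h: "h \<in> borel_measurable (haar_mat m)"
  shows "(\<integral>T. indicator (resball n M0) T * h (blk r r m m T) \<partial>haar_mat n)
     = real CARD('p) ^ (m * m) / real CARD('p) ^ (n * n) * bint m h (blk r r m m M0)"
proof -
  let ?T0 = "liftm M0"
  define S where "S = {T \<in> carrier_mat n n. \<forall>i<n. \<forall>j<n. \<not> (r \<le> i \<and> i < r + m \<and> r \<le> j \<and> j < r + m) \<longrightarrow> pp dvd T $$ (i, j) - ?T0 $$ (i, j)}"
  let ?B = "blk r r m m M0"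
  have T0: "?T0 \<in> carrier_mat n n" using M0 by simp
  have ind: "indicator (resball n M0) T = (indicator S T * indicator (resball m ?B) (blk r r m m T) :: real)"
    if T: "T \<in> carrier_mat n n" for T
  proof -
    have "redm T = M0 \<longleftrightarrow> T \<in> S \<and> redm (blk r r m m T) = ?B"
    proof
      assume rT: "redm T = M0"
      then have c: "mcong pp T ?T0" using redm_eq_iff[of T ?T0] by simp
      have "redm (blk r r m m T) = blk r r m m (redm T)" using T rm by (intro eq_matI) (auto simp: blk_def)
      then show "T \<in> S \<and> redm (blk r r m m T) = ?B" using rT mcong_D[OF c T] T by (auto simp: S_def)
    next
      assume TS: "T \<in> S \<and> redm (blk r r m m T) = ?B"
      show "redm T = M0"
      proof (rule eq_matI)
        fix i j assume "i < dim_row M0" "j < dim_col M0"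
        then have ij: "i < n" "j < n" using M0 by auto
        show "redm T $$ (i, j) = M0 $$ (i, j)"
        proof (cases "r \<le> i \<and> i < r + m \<and> r \<le> j \<and> j < r + m")
          case True
          then have ir: "i - r < m" "j - r < m" by auto
          have "redm (blk r r m m T) $$ (i - r, j - r) = ?B $$ (i - r, j - r)" using TS by simp
          then show ?thesis using True ir ij T by (simp add: blk_def)
        next
          case False
          then have "pp dvd T $$ (i, j) - ?T0 $$ (i, j)" using TS ij by (simp add: S_def)
          then have "red (T $$ (i, j)) = red (?T0 $$ (i, j))" by (simp add: red_eq_iff)
          then show ?thesis using ij T M0 by (simp add: liftm_def)
        qed
      qed (use T M0 in auto)
    qed
    then show ?thesis using T by (auto simp: resball_def indicator_def)
  qed
  have Bc: "?B \<in> carrier_mat m m" by simp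
  have gen: "(\<integral>T. indicator (resball n M0) T * g (blk r r m m T) \<partial>haar_mat n) = measure (haar_mat n) S * bint m g ?B"
    if g: "g \<in> borel_measurable (haar_mat m)" for g :: "'p padic_int mat \<Rightarrow> real"
  proof -
    have "(\<integral>T. indicator (resball n M0) T * g (blk r r m m T) \<partial>haar_mat n)
       = (\<integral>T. indicator S T * (indicator (resball m ?B) (blk r r m m T) * g (blk r r m m T)) \<partial>haar_mat n)"
      using ind by (intro Bochner_Integration.integral_cong refl) (simp add: haar_mat_facts)
    also have "\<dots> = measure (haar_mat n) S * (\<integral>T. indicator (resball m ?B) T * g T \<partial>haar_mat m)"
      unfolding S_def by (rule block_marginal[OF rm T0 resball_indicator_measurable[OF Bc g]])
    finally show ?thesis by (simp add: bint_def)
  qed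
  interpret n: prob_space "haar_mat n :: 'p padic_int mat measure" by (rule haar_mat_facts)
  interpret m: prob_space "haar_mat m :: 'p padic_int mat measure" by (rule haar_mat_facts)
  \<comment> \<open>The constant function 1 in \<open>gen\<close> determines the measure of
    \<open>S\<close> from the known masses of residue classes.\<close>
  have "measure (haar_mat n) (resball n M0) = measure (haar_mat n) S * measure (haar_mat m) (resball m ?B)"
    using gen[of "\<lambda>_. 1"] resball_sets[OF M0] resball_sets[OF Bc] sets.sets_into_space[OF resball_sets[OF M0]] sets.sets_into_space[OF resball_sets[OF Bc]]
    by (simp add: bint_def Int_absorb2)
  then have "measure (haar_mat n) S = real CARD('p) ^ (m * m) / real CARD('p) ^ (n * n)"
    unfolding measure_resball[OF M0] measure_resball[OF Bc] by (simp add: field_simps)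
  then show ?thesis using gen[OF h] by simp
qed

text \<open>Substituting the isometry \<open>blockPsi\<close> turns \<open>F\<close> into a sum of a
  function of the first diagonal block and one of the second, and \<open>bint_marginal\<close>
  integrates each of them separately.\<close>

lemma bint_diag2:
  fixes F Ga Gb :: "'p::prime_card padic_int mat \<Rightarrow> real"
  assumes B0: "B0 \<in> carrier_mat a a" and C0: "C0 \<in> carrier_mat b b"
    and cop: "coprime (char_poly B0) (char_poly C0)"
    and F: "F \<in> borel_measurable (haar_mat (a + b))" and Ga: "Ga \<in> borel_measurable (haar_mat a)" and Gb: "Gb \<in> borel_measurable (haar_mat b)"
    and bound: "\<And>T. T \<in> carrier_mat a a \<Longrightarrow> \<bar>Ga T\<bar> \<le> ca" "\<And>T. T \<in> carrier_mat b b \<Longrightarrow> \<bar>Gb T\<bar> \<le> cb"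
    and add: "\<And>A U B C. A \<in> carrier_mat (a + b) (a + b) \<Longrightarrow> U \<in> ZGL (a + b) \<Longrightarrow> B \<in> carrier_mat a a \<Longrightarrow> C \<in> carrier_mat b b \<Longrightarrow>
       A * U = U * diag2 B C \<Longrightarrow> F A = Ga B + Gb C"
  shows "bint (a + b) F (diag2 B0 C0) = real CARD('p) ^ (a * a) / real CARD('p) ^ ((a + b) * (a + b)) * bint a Ga B0
      + real CARD('p) ^ (b * b) / real CARD('p) ^ ((a + b) * (a + b)) * bint b Gb C0"
proof -
  let ?n = "a + b" and ?D = "diag2 B0 C0" and ?\<Psi> = "blockPsi a b (diag2 B0 C0)"
  have D: "?D \<in> carrier_mat ?n ?n" using B0 C0 by auto
  note iso = isometry_blockPsi[OF B0 C0 cop]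
  have bl: "blk 0 0 a a ?D = B0" "blk a a b b ?D = C0" using B0 C0 by (auto simp: blk_def intro!: eq_matI)
  have "bint ?n F ?D = (\<integral>T. indicator (resball ?n ?D) (?\<Psi> T) * F (?\<Psi> T) \<partial>haar_mat ?n)"
    unfolding bint_def by (rule isometry_integral[OF iso resball_indicator_measurable[OF D F], symmetric])
  also have "\<dots> = (\<integral>T. indicator (resball ?n ?D) T * Ga (blk 0 0 a a T) + indicator (resball ?n ?D) T * Gb (blk a a b b T) \<partial>haar_mat ?n)"
  proof (rule Bochner_Integration.integral_cong[OF refl])
    fix T :: "'p padic_int mat" assume "T \<in> space (haar_mat ?n)"
    then have T: "T \<in> carrier_mat ?n ?n" by (simp add: haar_mat_facts)
    show "indicator (resball ?n ?D) (?\<Psi> T) * F (?\<Psi> T) = indicator (resball ?n ?D) T * Ga (blk 0 0 a a T) + indicator (resball ?n ?D) T * Gb (blk a a b b T)"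
    proof (cases "redm T = ?D")
      case True
      note P = blockPsi_eq[OF B0 C0 cop T True]
      have "F (?\<Psi> T) = Ga (blk 0 0 a a T) + Gb (blk a a b b T)"
        by (rule add[OF P(1) blockU_ZGL[OF B0 C0 cop T True] blk_carrier blk_carrier]) (use P(3) in \<open>simp add: blockD_def\<close>)
      then show ?thesis using P T True by (simp add: resball_def indicator_def)
    next
      case False
      then show ?thesis by (simp add: resball_def indicator_def blockPsi_def)
    qed
  qed
  also have "\<dots> = (\<integral>T. indicator (resball ?n ?D) T * Ga (blk 0 0 a a T) \<partial>haar_mat ?n) + (\<integral>T. indicator (resball ?n ?D) T * Gb (blk a a b b T) \<partial>haar_mat ?n)"
  proof (rule Bochner_Integration.integral_add)
    have bb: "\<bar>indicator W T * x\<bar> \<le> \<bar>c\<bar>" if "\<bar>x\<bar> \<le> c" for x c :: real and W and T :: "'p padic_int mat"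
      using that by (cases "T \<in> W") auto
    have m: "(\<lambda>T. Ga (blk 0 0 a a T)) \<in> borel_measurable (haar_mat ?n)" "(\<lambda>T. Gb (blk a a b b T)) \<in> borel_measurable (haar_mat ?n)"
      using measurable_compose[OF blk_measurable Ga, of 0 ?n] measurable_compose[OF blk_measurable Gb, of a ?n] by auto
    show "integrable (haar_mat ?n) (\<lambda>T. indicator (resball ?n ?D) T * Ga (blk 0 0 a a T))"
      by (rule haar_integrable_bounded[OF resball_indicator_measurable[OF D m(1)], of "\<bar>ca\<bar>"])
         (rule bb[OF bound(1)[OF blk_carrier]])
    show "integrable (haar_mat ?n) (\<lambda>T. indicator (resball ?n ?D) T * Gb (blk a a b b T))"
      by (rule haar_integrable_bounded[OF resball_indicator_measurable[OF D m(2)], of "\<bar>cb\<bar>"])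
         (rule bb[OF bound(2)[OF blk_carrier]])
  qed
  also have "\<dots> = real CARD('p) ^ (a * a) / real CARD('p) ^ (?n * ?n) * bint a Ga B0 + real CARD('p) ^ (b * b) / real CARD('p) ^ (?n * ?n) * bint b Gb C0"
    using bint_marginal[OF _ D Ga, of 0] bint_marginal[OF _ D Gb, of a] bl by simp
  finally show ?thesis .
qed

lemma integral_eq_sum_bint:
  fixes F :: "'p::prime_card padic_int mat \<Rightarrow> real"
  assumes F: "F \<in> borel_measurable (haar_mat n)" and bound: "\<And>T. T \<in> carrier_mat n n \<Longrightarrow> \<bar>F T\<bar> \<le> c"
  shows "(\<integral>T. F T \<partial>haar_mat n) = (\<Sum>M\<in>carrier_mat n n. bint n F M)"
proof -
  have "(\<Sum>M\<in>carrier_mat n n. bint n F M) = (\<integral>T. (\<Sum>M\<in>carrier_mat n n. indicator (resball n M) T * F T) \<partial>haar_mat n)"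
    unfolding bint_def
  proof (rule Bochner_Integration.integral_sum[symmetric])
    fix M :: "'p mod_ring mat" assume M: "M \<in> carrier_mat n n"
    show "integrable (haar_mat n) (\<lambda>T. indicator (resball n M) T * F T)"
      by (rule haar_integrable_bounded[OF resball_indicator_measurable[OF M F], of "\<bar>c\<bar>"])
         (use bound in \<open>force simp: indicator_def\<close>)
  qed
  also have "\<dots> = (\<integral>T. F T \<partial>haar_mat n)"
  proof (rule Bochner_Integration.integral_cong[OF refl])
    fix T :: "'p padic_int mat" assume "T \<in> space (haar_mat n)"
    then have T: "T \<in> carrier_mat n n" by (simp add: haar_mat_facts)
    have "(\<Sum>M\<in>carrier_mat n n. indicator (resball n M) T * F T) = (\<Sum>M\<in>carrier_mat n n. if M = redm T then F T else 0)"
      using T by (intro sum.cong) (auto simp: resball_def indicator_def)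
    then show "(\<Sum>M\<in>carrier_mat n n. indicator (resball n M) T * F T) = F T"
      using T finite_carrier_mat[of n n, where 'a="'p mod_ring"] by simp
  qed
  finally show ?thesis ..
qed

section \<open>The integral closure of the p-adic integers\<close>

abbreviation oz :: "'p::prime_card padic_int \<Rightarrow> 'p padic_closure" where
  "oz \<equiv> (\<lambda>x. to_ac (to_fract x))"

interpretation oz: inj_idom_hom oz
  by unfold_locales auto

interpretation mz: map_poly_inj_idom_hom oz ..

interpretation zm: Modules.module "\<lambda>(c :: 'p::prime_card padic_int) (x :: 'p padic_closure). oz c * x"
  by unfold_locales (auto simp: algebra_simps oz.hom_add oz.hom_mult)

definition IC :: "'p::prime_card padic_closure set" where
  "IC = {x. \<exists>f. lead_coeff f = 1 \<and> poly (map_poly oz f) x = 0}"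

definition PP :: "'p::prime_card padic_closure" where
  "PP = oz pp"

lemma PP_of_nat: "PP = (of_nat CARD('p) :: 'p::prime_card padic_closure)"
  by (simp only: PP_def pp_def oz.hom_of_nat)

lemma PP_nonzero[simp]: "PP \<noteq> 0"
  unfolding PP_def by (simp only: oz.hom_0_iff pp_nonzero not_False_eq_True)

lemma monic_nonzero: "lead_coeff (f :: 'a::zero_neq_one poly) = 1 \<Longrightarrow> f \<noteq> 0"
  by auto

lemma poly_map_oz: "poly (map_poly oz f) x = (\<Sum>i\<le>degree f. oz (coeff f i) * x ^ i)"
  by (simp add: poly_altdef)

text \<open>The determinant trick: multiplication by \<open>z\<close> on a finitely generated module
  is described by a matrix \<open>M\<close> over \<open>\<int>\<^sub>p\<close>, and the vector of
  generators, nonzero because of \<open>b0\<close>, is an eigenvector of \<open>M\<close> with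
  eigenvalue \<open>z\<close>.\<close>

lemma zspan_matrix:
  fixes z :: "'p::prime_card padic_closure"
  assumes B: "finite B" "b0 \<in> B" "b0 \<noteq> 0" and z: "\<And>b. b \<in> B \<Longrightarrow> z * b \<in> zm.span B"
  obtains n M where "M \<in> carrier_mat n n" "poly (map_poly oz (char_poly M)) z = 0"
proof -
  obtain n g where g: "bij_betw g {..<n::nat} B" using B(1) ex_bij_betw_nat_finite[of B] by (auto simp: lessThan_atLeast0)
  have "\<exists>c. z * g i = (\<Sum>j<n. oz (c j) * g j)" if i: "i < n" for i
  proof -
    have "g i \<in> B" using g i by (auto simp: bij_betw_def)
    then have "z * g i \<in> range (\<lambda>u. \<Sum>v\<in>B. oz (u v) * v)" using z zm.span_finite[OF B(1)] by blast
    then obtain u where u: "z * g i = (\<Sum>v\<in>B. oz (u v) * v)" by blast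
    also have "\<dots> = (\<Sum>j<n. oz (u (g j)) * g j)" using sum.reindex_bij_betw[OF g, of "\<lambda>v. oz (u v) * v"] by simp
    finally show ?thesis by (intro exI[of _ "\<lambda>j. u (g j)"])
  qed
  then obtain c where c: "\<And>i. i < n \<Longrightarrow> z * g i = (\<Sum>j<n. oz (c i j) * g j)" by metis
  define M where "M = mat n n (\<lambda>(i, j). c i j)"
  have M: "M \<in> carrier_mat n n" by (simp add: M_def)
  let ?M = "map_mat oz M" and ?v = "vec n g"
  have M': "?M \<in> carrier_mat n n" using M by simp
  have "?M *\<^sub>v ?v = z \<cdot>\<^sub>v ?v"
  proof (rule eq_vecI)
    fix i assume "i < dim_vec (z \<cdot>\<^sub>v ?v)"
    then have i: "i < n" by simp
    have "(?M *\<^sub>v ?v) $ i = (\<Sum>j<n. ?M $$ (i, j) * ?v $ j)" by (rule mult_mat_vec_sum[OF M' _ i]) simp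
    also have "\<dots> = (\<Sum>j<n. oz (c i j) * g j)" using i by (intro sum.cong) (auto simp: M_def)
    finally show "(?M *\<^sub>v ?v) $ i = (z \<cdot>\<^sub>v ?v) $ i" using c[OF i] i by simp
  qed (use M in auto)
  moreover have "?v \<noteq> 0\<^sub>v n"
  proof
    assume v0: "?v = 0\<^sub>v n"
    obtain i where i: "i < n" "g i = b0" using g B(2) by (auto simp: bij_betw_def)
    then have "?v $ i = b0" by simp
    then show False using v0 i B(3) by simp
  qed
  ultimately have "eigenvector ?M ?v z" using M by (auto simp: eigenvector_def)
  then have "eigenvalue ?M z" by (auto simp: eigenvalue_def)
  then have "poly (char_poly ?M) z = 0" using eigenvalue_root_char_poly[OF M'] by simp
  then show thesis using that[OF M] oz.char_poly_hom[OF M] by simp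
qed

lemma char_poly_root_IC:
  assumes "M \<in> carrier_mat n n" "poly (map_poly oz (char_poly M)) z = 0"
  shows "z \<in> IC"
  using assms monic_char_poly[OF assms(1)] unfolding IC_def by blast

lemma IC_D:
  assumes "x \<in> (IC :: 'p::prime_card padic_closure set)"
  obtains a where "a > 0" "x ^ a \<in> zm.span ((\<lambda>i. x ^ i) ` {..<a})"
proof -
  obtain f where f: "lead_coeff f = 1" "poly (map_poly oz f) x = 0" using assms by (auto simp: IC_def)
  let ?a = "degree f"
  have 0: "(\<Sum>i<?a. oz (coeff f i) * x ^ i) + x ^ ?a = 0"
    using f by (simp add: poly_map_oz lessThan_Suc_atMost[symmetric])
  have "?a > 0"
  proof (rule ccontr)
    assume "\<not> ?a > 0"
    then show False using 0 by simp
  qed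
  moreover have "x ^ ?a = (\<Sum>i<?a. oz (- coeff f i) * x ^ i)"
    using 0 by (simp add: oz.hom_uminus sum_negf eq_neg_iff_add_eq_0 add.commute)
  moreover have "(\<Sum>i<?a. oz (- coeff f i) * x ^ i) \<in> zm.span ((\<lambda>i. x ^ i) ` {..<?a})"
    by (intro zm.span_sum zm.span_scale zm.span_base) auto
  ultimately show thesis using that[of ?a] by metis
qed

lemma zspan_mult_closed:
  fixes x :: "'p::prime_card padic_closure"
  assumes "\<And>b. b \<in> B \<Longrightarrow> x * b \<in> zm.span B" "v \<in> zm.span B"
  shows "x * v \<in> zm.span B"
  using assms(2)
proof (induction rule: zm.span_induct_alt)
  case base
  show ?case by (simp add: zm.span_zero)
next
  case (step c b y)
  have "x * (oz c * b + y) = oz c * (x * b) + x * y" by (simp add: algebra_simps)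
  then show ?case using step assms(1) by (simp add: zm.span_add zm.span_scale)
qed

text \<open>The monomials \<open>x ^ i * y ^ j\<close> below the degrees of two monic equations span
  a module stable under both multiplications, hence also under sums, differences and
  products.\<close>

lemma IC_pair:
  fixes x y :: "'p::prime_card padic_closure"
  assumes x: "x \<in> IC" and y: "y \<in> IC"
  obtains B where "finite B" "1 \<in> B" "\<And>v. v \<in> zm.span B \<Longrightarrow> x * v \<in> zm.span B" "\<And>v. v \<in> zm.span B \<Longrightarrow> y * v \<in> zm.span B"
proof -
  obtain a where a: "a > 0" "x ^ a \<in> zm.span ((\<lambda>i. x ^ i) ` {..<a})" using IC_D[OF x] .
  obtain b where b: "b > 0" "y ^ b \<in> zm.span ((\<lambda>i. y ^ i) ` {..<b})" using IC_D[OF y] .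
  define B where "B = (\<lambda>(i, j). x ^ i * y ^ j) ` ({..<a} \<times> {..<b})"
  have scale: "w * v \<in> zm.span B" if "\<And>s. s \<in> S \<Longrightarrow> w * s \<in> zm.span B" "v \<in> zm.span S" for w v S
    using that(2)
  proof (induction rule: zm.span_induct_alt)
    case base
    show ?case by (simp add: zm.span_zero)
  next
    case (step c s u)
    have "w * (oz c * s + u) = oz c * (w * s) + w * u" by (simp add: algebra_simps)
    then show ?case using step that(1) by (simp add: zm.span_add zm.span_scale)
  qed
  have base: "x ^ i * y ^ j \<in> zm.span B" if "i < a" "j < b" for i j
    using that by (intro zm.span_base) (auto simp: B_def)
  have xa: "x ^ i * y ^ j \<in> zm.span B" if "i \<le> a" "j < b" for i j
  proof (cases "i = a")
    case True
    have "y ^ j * x ^ a \<in> zm.span B"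
      by (rule scale[OF _ a(2)]) (use base that in \<open>auto simp: mult.commute\<close>)
    then show ?thesis using True by (simp add: mult.commute)
  qed (use that base in auto)
  have yb: "x ^ i * y ^ j \<in> zm.span B" if "i < a" "j \<le> b" for i j
  proof (cases "j = b")
    case True
    have "x ^ i * y ^ b \<in> zm.span B"
      by (rule scale[OF _ b(2)]) (use base that in auto)
    then show ?thesis using True by simp
  qed (use that base in auto)
  show thesis
  proof (rule that)
    show "finite B" by (simp add: B_def)
    show "1 \<in> B" using a(1) b(1) unfolding B_def by (intro image_eqI[of _ _ "(0, 0)"]) auto
    show "x * v \<in> zm.span B" if "v \<in> zm.span B" for v
    proof (rule zspan_mult_closed[OF _ that])
      fix w assume "w \<in> B"
      then obtain i j where ij: "i < a" "j < b" "w = x ^ i * y ^ j" by (auto simp: B_def)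
      then show "x * w \<in> zm.span B" using xa[of "Suc i" j] by (simp add: mult.assoc)
    qed
    show "y * v \<in> zm.span B" if "v \<in> zm.span B" for v
    proof (rule zspan_mult_closed[OF _ that])
      fix w assume "w \<in> B"
      then obtain i j where ij: "i < a" "j < b" "w = x ^ i * y ^ j" by (auto simp: B_def)
      then show "y * w \<in> zm.span B" using yb[of i "Suc j"] by (simp add: ac_simps)
    qed
  qed
qed

lemma IC_add_mult_diff:
  fixes x y :: "'p::prime_card padic_closure"
  assumes x: "x \<in> IC" and y: "y \<in> IC"
  shows IC_add: "x + y \<in> IC" and IC_mult: "x * y \<in> IC" and IC_diff: "x - y \<in> IC"
proof -
  obtain B where B: "finite B" "1 \<in> B" "\<And>v. v \<in> zm.span B \<Longrightarrow> x * v \<in> zm.span B" "\<And>v. v \<in> zm.span B \<Longrightarrow> y * v \<in> zm.span B"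
    using IC_pair[OF x y] by blast
  have I: "z \<in> IC" if "\<And>b. b \<in> B \<Longrightarrow> z * b \<in> zm.span B" for z
    using zspan_matrix[OF B(1,2) one_neq_zero that] char_poly_root_IC by metis
  show "x + y \<in> IC" by (rule I) (use B in \<open>auto simp: distrib_right intro: zm.span_add zm.span_base\<close>)
  show "x - y \<in> IC" by (rule I) (use B in \<open>auto simp: left_diff_distrib intro: zm.span_diff zm.span_base\<close>)
  show "x * y \<in> IC" by (rule I) (use B in \<open>auto simp: mult.assoc intro: zm.span_base\<close>)
qed

text \<open>Integral elements are needed as eigenvalues of matrices because factorisations modulo
  \<open>p\<close> are lifted through \<open>padic_block_decomposition\<close>, which speaks of
  matrices.\<close>

lemma IC_matrix:
  assumes x: "x \<in> (IC :: 'p::prime_card padic_closure set)"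
  obtains n M where "M \<in> carrier_mat n n" "poly (map_poly oz (char_poly M)) x = 0"
proof -
  show thesis
  proof (rule IC_pair[OF x x])
    fix B assume B: "finite B" "1 \<in> B" "\<And>v. v \<in> zm.span B \<Longrightarrow> x * v \<in> zm.span B"
    show thesis by (rule zspan_matrix[OF B(1,2) one_neq_zero B(3)[OF zm.span_base] that])
  qed
qed

lemma IC_oz: "oz c \<in> IC"
  unfolding IC_def by (intro CollectI exI[of _ "[:- c, 1:]"]) (simp add: oz.hom_uminus)

lemma IC_0[simp]: "0 \<in> IC" and IC_1[simp]: "1 \<in> IC" and IC_PP[simp]: "PP \<in> IC"
  using IC_oz[of 0] IC_oz[of 1] IC_oz[of pp] by (simp_all add: PP_def)

lemma IC_uminus: "x \<in> IC \<Longrightarrow> - x \<in> IC"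
  using IC_diff[of 0 x] by simp

lemma IC_power: "x \<in> IC \<Longrightarrow> x ^ n \<in> IC"
  by (induction n) (auto intro: IC_mult)

lemma IC_sum: "(\<And>i. i \<in> I \<Longrightarrow> f i \<in> IC) \<Longrightarrow> sum f I \<in> IC"
  by (induction I rule: infinite_finite_induct) (auto intro: IC_add)

lemma IC_poly: "x \<in> IC \<Longrightarrow> poly (map_poly oz f) x \<in> IC"
  unfolding poly_map_oz by (intro IC_sum IC_mult IC_oz IC_power)

text \<open>Clearing denominators in a monic equation for \<open>1 / p\<close> leaves 1 plus
  multiples of \<open>p\<close>, which cannot vanish.\<close>

lemma inverse_PP_not_IC: "inverse PP \<notin> (IC :: 'p::prime_card padic_closure set)"
proof
  assume "inverse PP \<in> (IC :: 'p padic_closure set)"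
  then obtain f where f: "lead_coeff f = 1" "poly (map_poly oz f) (inverse PP :: 'p padic_closure) = 0" by (auto simp: IC_def)
  let ?n = "degree f"
  have "oz (\<Sum>i\<le>?n. coeff f i * pp ^ (?n - i)) = (\<Sum>i\<le>?n. oz (coeff f i) * PP ^ (?n - i))"
    by (simp only: oz.hom_sum oz.hom_mult oz.hom_power PP_def)
  also have "\<dots> = (\<Sum>i\<le>?n. PP ^ ?n * (oz (coeff f i) * inverse PP ^ i))"
    by (intro sum.cong refl) (auto simp: power_diff divide_inverse power_inverse)
  also have "\<dots> = PP ^ ?n * poly (map_poly oz f) (inverse PP)" unfolding poly_map_oz by (simp add: sum_distrib_left)
  finally have "oz (\<Sum>i\<le>?n. coeff f i * pp ^ (?n - i)) = 0" using f(2) by simp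
  then have "(\<Sum>i\<le>?n. coeff f i * pp ^ (?n - i)) = 0" by (simp only: oz.hom_0_iff)
  then have "(\<Sum>i<?n. coeff f i * pp ^ (?n - i)) + 1 = 0" using f(1) by (simp add: lessThan_Suc_atMost[symmetric])
  then have "1 = - (\<Sum>i<?n. coeff f i * pp ^ (?n - i))" by (simp add: eq_neg_iff_add_eq_0 add.commute)
  moreover have "pp dvd - (\<Sum>i<?n. coeff f i * pp ^ (?n - i))"
    unfolding dvd_minus_iff by (intro dvd_sum dvd_mult dvd_power) auto
  ultimately have "pp dvd (1 :: 'p padic_int)" by simp
  then have "red (1 :: 'p padic_int) = 0" by (simp only: red_eq_0_iff)
  then show False by simp
qed

text \<open>With \<open>c\<close> written as a power of \<open>p\<close> times a unit, a missing
  power of \<open>p\<close> would make \<open>inverse PP\<close> integral.\<close>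

lemma oz_dvd:
  fixes c :: "'p::prime_card padic_int"
  assumes eq: "oz c = PP ^ j * y" and y: "y \<in> IC"
  shows "pp ^ j dvd c"
proof (cases "c = 0")
  case False
  then obtain i u where c: "c = pp ^ i * u" "u dvd 1" using padic_factor by blast
  then obtain v where v: "u * v = 1" by (metis dvdE)
  show ?thesis
  proof (cases "j \<le> i")
    case True
    then show ?thesis using c by (simp add: le_imp_power_dvd)
  next
    case False
    then have j: "j = i + Suc (j - i - 1)" by simp
    have "PP ^ i * oz u = PP ^ i * (PP ^ Suc (j - i - 1) * y)"
      using eq unfolding c(1) by (subst (asm) j) (simp add: oz.hom_mult oz.hom_power PP_def power_add mult.assoc)
    then have "oz u = PP ^ Suc (j - i - 1) * y" by simp
    then have "oz u * oz v = PP * (PP ^ (j - i - 1) * y * oz v)" by simp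
    moreover have "oz u * oz v = 1" using v by (metis oz.hom_mult oz.hom_one)
    ultimately have "inverse PP = PP ^ (j - i - 1) * y * oz v" by (metis inverse_unique)
    then show ?thesis using inverse_PP_not_IC y IC_mult IC_power IC_oz IC_PP by metis
  qed
qed simp

text \<open>Powers of the variable are divided out of an equation for \<open>x\<close> until its
  constant term is nonzero. That constant is a multiple of \<open>x\<close>, which moves
  divisibility questions from \<open>x\<close> to \<open>\<int>\<^sub>p\<close>.\<close>

lemma IC_monic_nonzero_const:
  assumes "x \<in> (IC :: 'p::prime_card padic_closure set)" "x \<noteq> 0"
  obtains c h where "c \<noteq> 0" "oz c = x * poly (map_poly oz h) x"
proof -
  have "\<exists>c h. c \<noteq> 0 \<and> oz c = x * poly (map_poly oz h) x"
    if "f \<noteq> 0" "poly (map_poly oz f) x = 0" for f :: "'p padic_int poly"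
    using that
  proof (induction f)
    case (pCons c h)
    have e: "oz c + x * poly (map_poly oz h) x = 0" using pCons.prems(2) by (simp add: oz.map_poly_pCons_hom)
    show ?case
    proof (cases "c = 0")
      case True
      then have "poly (map_poly oz h) x = 0" using e assms(2) by simp
      moreover have "h \<noteq> 0" using pCons.prems True by auto
      ultimately show ?thesis using pCons.IH by blast
    next
      case False
      have "oz c = x * poly (map_poly oz (- h)) x"
        using e by (simp add: eq_neg_iff_add_eq_0 poly_map_oz oz.hom_uminus sum_negf)
      then show ?thesis using False by blast
    qed
  qed simp
  moreover obtain f where "lead_coeff f = 1" "poly (map_poly oz f) x = 0" using assms by (auto simp: IC_def)
  ultimately show thesis using that monic_nonzero by metis
qed

text \<open>A nonzero \<open>x\<close> divides some nonzero \<open>oz c\<close>, and then every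
  \<open>p ^ j\<close> would divide \<open>c\<close>.\<close>

lemma IC_separated:
  fixes x :: "'p::prime_card padic_closure"
  assumes x: "x \<in> IC" and div: "\<And>j. \<exists>w\<in>IC. x = PP ^ j * w"
  shows "x = 0"
proof (rule ccontr)
  assume "x \<noteq> 0"
  then obtain c h where c: "c \<noteq> 0" "oz c = x * poly (map_poly oz h) x" using IC_monic_nonzero_const[OF x] by blast
  have "pp ^ j dvd c" for j
  proof -
    obtain w where w: "w \<in> IC" "x = PP ^ j * w" using div by blast
    have "oz c = PP ^ j * (w * poly (map_poly oz h) x)" unfolding c(2) using w(2) by simp
    moreover have "w * poly (map_poly oz h) x \<in> IC" using w(1) IC_poly[OF x] IC_mult by blast
    ultimately show ?thesis by (rule oz_dvd)
  qed
  then show False using c padic_separated by blast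
qed

text \<open>Units of \<open>IC\<close> stand in for an absolute value: an integral element is a
  nonunit exactly if its valuation is positive.\<close>

definition unitO :: "'p::prime_card padic_closure \<Rightarrow> bool" where
  "unitO x \<longleftrightarrow> x \<in> IC \<and> (\<exists>y\<in>IC. x * y = 1)"

lemma root_unit:
  fixes f :: "'p::prime_card padic_int poly"
  assumes x: "x \<in> IC" and f: "poly (map_poly oz f) x = 0" "red (coeff f 0) \<noteq> 0"
  shows "unitO x"
proof -
  obtain c h where f': "f = pCons c h" by (cases f)
  then have "c dvd 1" using f(2) by (simp add: padic_unit_iff)
  then obtain v where v: "c * v = 1" by (metis dvdE)
  have "oz c + x * poly (map_poly oz h) x = 0" using f(1) by (simp add: f' oz.map_poly_pCons_hom)
  then have "x * (- (poly (map_poly oz h) x) * oz v) = oz c * oz v" by (simp add: eq_neg_iff_add_eq_0[symmetric])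
  also have "\<dots> = 1" using v by (metis oz.hom_mult oz.hom_one)
  finally show ?thesis unfolding unitO_def using x IC_mult IC_uminus IC_poly IC_oz by blast
qed

lemma coprime_linear_power:
  fixes q :: "'a::field_gcd poly"
  assumes "\<not> [:- a, 1:] dvd q"
  shows "coprime ([:- a, 1:] ^ k) q"
proof -
  have "prime_elem [:- a, 1:]" by (rule prime_elem_linear_field_poly) simp
  then have "coprime [:- a, 1:] q" using assms by (rule prime_elem_imp_coprime)
  then show ?thesis by simp
qed

text \<open>The integral closure is local: this is Hensel's lemma, in the form of the block decomposition.\<close>

lemma IC_local:
  assumes x: "x \<in> (IC :: 'p::prime_card padic_closure set)"
  shows "unitO x \<or> unitO (1 - x)"
proof -
  obtain n M where M: "M \<in> carrier_mat n n" "poly (map_poly oz (char_poly M)) x = 0" using IC_matrix[OF x] .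
  let ?f = "char_poly (redm M)"
  have rM: "redm M \<in> carrier_mat n n" using M by simp
  \<comment> \<open>The factor \<open>[:0, 1:] ^ ?k\<close> of the reduction belongs to the nonunit
    eigenvalues, \<open>g\<close> to the unit eigenvalues; \<open>x\<close> is a root of one of the
    two lifted factors.\<close>
  let ?k = "order 0 ?f"
  obtain g where g: "?f = [:0, 1:] ^ ?k * g" "\<not> [:0, 1:] dvd g"
    using order_decomp[OF char_poly_nonzero[OF rM], of 0] by auto
  have g0: "g \<noteq> 0" using g char_poly_nonzero[OF rM] by auto
  have deg: "degree ([:0, 1 :: 'p mod_ring:] ^ ?k) = ?k" by (simp add: degree_power_eq)
  have n: "n = ?k + degree g"
    using degree_char_poly[OF rM] g0 deg by (subst (asm) g(1)) (simp add: degree_mult_eq)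
  have cop: "coprime ([:0, 1:] ^ ?k) g" using coprime_linear_power[of 0 g] g(2) by simp
  have mon: "monic ([:0, 1 :: 'p mod_ring:] ^ ?k)" by (simp add: monic_power)
  have M': "M \<in> carrier_mat (?k + degree g) (?k + degree g)" using M(1) n by simp
  obtain B C where B: "B \<in> carrier_mat ?k ?k" "char_poly (redm B) = [:0, 1:] ^ ?k"
    and C: "C \<in> carrier_mat (degree g) (degree g)" "char_poly (redm C) = g"
    and BC: "char_poly M = char_poly B * char_poly C"
    using padic_block_decomposition[OF M' g(1) cop mon deg] by metis
  have "poly (map_poly oz (char_poly B)) x * poly (map_poly oz (char_poly C)) x = 0"
    using M(2) unfolding BC mz.hom_mult by simp
  then consider "poly (map_poly oz (char_poly B)) x = 0" | "poly (map_poly oz (char_poly C)) x = 0" by auto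
  then show ?thesis
  proof cases
    case 2
    have "coeff g 0 \<noteq> 0"
    proof
      assume "coeff g 0 = 0"
      then have "poly g 0 = 0" by (simp add: poly_0_coeff_0)
      then show False using g(2) by (simp add: poly_eq_0_iff_dvd)
    qed
    then have "red (coeff (char_poly C) 0) \<noteq> 0"
      using arg_cong[OF red.char_poly_hom[OF C(1)], of "\<lambda>p. coeff p 0"] C(2) by simp
    then show ?thesis using root_unit[OF x 2] by blast
  next
    case 1
    \<comment> \<open>\<open>1 - x\<close> is a root of \<open>?h\<close>, whose constant term is
      the value of \<open>char_poly B\<close> at 1, and this reduces to
      \<open>1 ^ ?k = 1\<close>.\<close>
    let ?h = "char_poly B \<circ>\<^sub>p [:1, - 1:]"
    have "map_poly oz ?h = map_poly oz (char_poly B) \<circ>\<^sub>p [:1, - 1:]"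
      by (subst oz.map_poly_pcompose) (simp add: oz.hom_uminus)
    then have "poly (map_poly oz ?h) (1 - x) = 0" using 1 by (simp add: poly_pcompose)
    moreover have "red (coeff ?h 0) \<noteq> 0"
    proof -
      have "red (coeff ?h 0) = red (poly (char_poly B) 1)" by (simp add: poly_0_coeff_0[symmetric] poly_pcompose)
      also have "\<dots> = poly (map_poly red (char_poly B)) 1" by (metis red.hom_one red.poly_map_poly)
      also have "map_poly red (char_poly B) = [:0, 1:] ^ ?k" using red.char_poly_hom[OF B(1)] B(2) by metis
      also have "poly ([:0, 1:] ^ ?k) (1 :: 'p mod_ring) = 1" by (simp add: poly_power)
      finally show ?thesis by simp
    qed
    ultimately show ?thesis using root_unit[of "1 - x" ?h] IC_diff[OF IC_1 x] by blast
  qed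
qed

lemma unitO_mult_iff: "x \<in> IC \<Longrightarrow> y \<in> IC \<Longrightarrow> unitO (x * y) \<longleftrightarrow> unitO x \<and> unitO y"
proof
  assume x: "x \<in> IC" and y: "y \<in> IC" and "unitO (x * y)"
  then obtain z where "z \<in> IC" "x * y * z = 1" by (auto simp: unitO_def)
  then have "x * (y * z) = 1" "y * (x * z) = 1" "y * z \<in> IC" "x * z \<in> IC" using x y by (auto simp: ac_simps IC_mult)
  then show "unitO x \<and> unitO y" using x y unfolding unitO_def by blast
next
  assume xy: "x \<in> IC" "y \<in> IC" "unitO x \<and> unitO y"
  then obtain u v where "u \<in> IC" "v \<in> IC" "x * u = 1" "y * v = 1" by (auto simp: unitO_def)
  moreover have "(x * y) * (u * v) = (x * u) * (y * v)" by (simp add: ac_simps)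
  ultimately have "(x * y) * (u * v) = 1" "u * v \<in> IC" by (simp_all add: IC_mult)
  then show "unitO (x * y)" using xy IC_mult unfolding unitO_def by blast
qed

lemma not_unitO_PP: "\<not> unitO PP"
  unfolding unitO_def using inverse_PP_not_IC by (metis inverse_unique)

lemma not_unitO_PP_mult: "y \<in> IC \<Longrightarrow> \<not> unitO (PP * y)"
  by (simp add: unitO_mult_iff not_unitO_PP)

lemma unitO_one: "unitO 1"
  unfolding unitO_def by (auto intro: bexI[of _ 1])

lemma unitO_one_minus: "x \<in> IC \<Longrightarrow> \<not> unitO x \<Longrightarrow> unitO (1 - x)"
  using IC_local by blast

section \<open>Unramified extensions and Teichmueller representatives\<close>

text \<open>The quotient is taken in \<open>R\<close> and not in \<open>IC\<close>: a correction
  term obtained from a congruence then stays in \<open>R\<close> and can be treated again, as the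
  successive approximation in unramified extensions requires.\<close>

definition pcong :: "'p::prime_card padic_closure set \<Rightarrow> 'p padic_closure \<Rightarrow> 'p padic_closure \<Rightarrow> bool" where
  "pcong R x y \<longleftrightarrow> (\<exists>r\<in>R. x = y + PP * r)"

locale p_subring =
  fixes R :: "'p::prime_card padic_closure set"
  assumes R_oz: "oz c \<in> R" and R_diff: "x \<in> R \<Longrightarrow> y \<in> R \<Longrightarrow> x - y \<in> R" and R_mult: "x \<in> R \<Longrightarrow> y \<in> R \<Longrightarrow> x * y \<in> R"
begin

lemma R_0: "0 \<in> R" and R_1: "1 \<in> R" and R_PP: "PP \<in> R"
  using R_oz[of 0] R_oz[of 1] R_oz[of pp] by (simp_all add: PP_def)

lemma R_uminus: "x \<in> R \<Longrightarrow> - x \<in> R"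
  using R_diff[OF R_0, of x] by simp

lemma R_add: "x \<in> R \<Longrightarrow> y \<in> R \<Longrightarrow> x + y \<in> R"
  using R_diff[OF _ R_uminus, of x y] by simp

lemma R_power: "x \<in> R \<Longrightarrow> x ^ n \<in> R"
  using R_1 R_mult by (induction n) auto

lemma R_sum: "(\<And>i. i \<in> I \<Longrightarrow> f i \<in> R) \<Longrightarrow> sum f I \<in> R"
  using R_0 R_add by (induction I rule: infinite_finite_induct) auto

lemma R_of_nat: "of_nat n \<in> R"
  using R_0 R_1 R_add by (induction n) auto

lemma pcong_refl: "pcong R x x"
  unfolding pcong_def using R_0 by (intro bexI[of _ 0]) auto

lemma pcong_sym: "pcong R x y \<Longrightarrow> pcong R y x"
proof -
  assume "pcong R x y"
  then obtain r where "r \<in> R" "x = y + PP * r" unfolding pcong_def by blast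
  then have "- r \<in> R" "y = x + PP * (- r)" using R_uminus by auto
  then show ?thesis unfolding pcong_def by blast
qed

lemma pcong_trans: "pcong R x y \<Longrightarrow> pcong R y z \<Longrightarrow> pcong R x z"
proof -
  assume "pcong R x y" "pcong R y z"
  then obtain r s where "r \<in> R" "s \<in> R" "x = y + PP * r" "y = z + PP * s" unfolding pcong_def by blast
  then have "r + s \<in> R" "x = z + PP * (r + s)" using R_add by (auto simp: algebra_simps)
  then show ?thesis unfolding pcong_def by blast
qed

lemma pcong_add: "pcong R x y \<Longrightarrow> pcong R u v \<Longrightarrow> pcong R (x + u) (y + v)"
proof -
  assume "pcong R x y" "pcong R u v"
  then obtain r s where "r \<in> R" "s \<in> R" "x = y + PP * r" "u = v + PP * s" unfolding pcong_def by blast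
  then have "r + s \<in> R" "x + u = (y + v) + PP * (r + s)" using R_add by (auto simp: algebra_simps)
  then show ?thesis unfolding pcong_def by blast
qed

lemma pcong_mult:
  assumes "pcong R x y" "pcong R u v" "u \<in> R" "y \<in> R"
  shows "pcong R (x * u) (y * v)"
proof -
  obtain r s where "r \<in> R" "s \<in> R" "x = y + PP * r" "u = v + PP * s" using assms unfolding pcong_def by blast
  moreover from this have "r * u + y * s \<in> R" using assms(3,4) R_add[OF R_mult R_mult] by blast
  ultimately have "x * u = y * v + PP * (r * u + y * s)" "r * u + y * s \<in> R" by (auto simp: algebra_simps)
  then show ?thesis unfolding pcong_def by blast
qed

lemma pcong_R: "pcong R x y \<Longrightarrow> y \<in> R \<Longrightarrow> x \<in> R"
  unfolding pcong_def using R_add R_mult R_PP by blast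

lemma pcong_power: "pcong R x y \<Longrightarrow> y \<in> R \<Longrightarrow> pcong R (x ^ n) (y ^ n)"
proof (induction n)
  case (Suc n)
  then show ?case using pcong_mult[of x y "x ^ n" "y ^ n"] pcong_R[of x y] R_power by auto
qed (simp add: pcong_refl)

text \<open>In a monic equation for \<open>y\<close> of degree \<open>m + 1\<close>, multiplication
  by \<open>w ^ m\<close> turns all lower powers of \<open>y\<close> into powers of \<open>w\<close>
  and leaves \<open>y\<close> itself as the leading term.\<close>

lemma inverse_mem:
  assumes w: "w \<in> R" and y: "y \<in> IC" "w * y = 1"
  shows "y \<in> R"
proof -
  obtain f where f: "lead_coeff f = 1" "poly (map_poly oz f) y = 0" using y by (auto simp: IC_def)
  let ?n = "degree f"
  have 0: "(\<Sum>i<?n. oz (coeff f i) * y ^ i) + y ^ ?n = 0"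
    using f by (simp add: poly_map_oz lessThan_Suc_atMost[symmetric])
  then have "?n \<noteq> 0" by (intro notI) simp
  then obtain m where m: "?n = Suc m" by (metis not0_implies_Suc)
  have wy: "y ^ i * w ^ m = w ^ (m - i)" if "i \<le> m" for i
  proof -
    have "w ^ m = w ^ i * w ^ (m - i)" using that by (simp add: power_add[symmetric])
    then have "y ^ i * w ^ m = (w * y) ^ i * w ^ (m - i)" by (simp add: power_mult_distrib ac_simps)
    then show ?thesis using y(2) by simp
  qed
  have "0 = ((\<Sum>i<?n. oz (coeff f i) * y ^ i) + y ^ ?n) * w ^ m" using 0 by simp
  also have "\<dots> = (\<Sum>i<?n. oz (coeff f i) * (y ^ i * w ^ m)) + y * (y ^ m * w ^ m)"
    unfolding m by (simp add: distrib_right sum_distrib_right mult.assoc)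
  also have "\<dots> = (\<Sum>i<?n. oz (coeff f i) * w ^ (m - i)) + y"
    using wy by (simp add: m)
  finally have "y = - (\<Sum>i<?n. oz (coeff f i) * w ^ (m - i))" by (simp add: eq_neg_iff_add_eq_0 add.commute)
  also have "\<dots> \<in> R" by (intro R_uminus R_sum R_mult R_oz R_power w)
  finally show ?thesis .
qed

lemma frobenius_add:
  assumes x: "x \<in> R" and y: "y \<in> R"
  shows "pcong R ((x + y) ^ CARD('p)) (x ^ CARD('p) + y ^ CARD('p))"
proof -
  let ?p = "CARD('p)"
  have p: "prime ?p" by (rule prime_card)
  then have p0: "?p > 0" by (rule prime_gt_0_nat)
  let ?t = "\<lambda>k. of_nat (?p choose k) * x ^ k * y ^ (?p - k)"
  have "?p dvd (?p choose k)" if "k \<in> {1..<?p}" for k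
    by (rule dvd_choose_prime) (use that p in auto)
  then obtain m where m: "\<And>k. k \<in> {1..<?p} \<Longrightarrow> (?p choose k) = ?p * m k" unfolding dvd_def by metis
  have "(x + y) ^ ?p = (\<Sum>k\<le>?p. ?t k)" by (rule binomial_ring)
  also have "{..?p} = insert 0 (insert ?p {1..<?p})" using p0 by auto
  also have "(\<Sum>k\<in>insert 0 (insert ?p {1..<?p}). ?t k) = y ^ ?p + (x ^ ?p + (\<Sum>k\<in>{1..<?p}. ?t k))" using p0 by simp
  also have "(\<Sum>k\<in>{1..<?p}. ?t k) = PP * (\<Sum>k\<in>{1..<?p}. of_nat (m k) * x ^ k * y ^ (?p - k))"
    unfolding sum_distrib_left by (intro sum.cong refl) (simp add: m PP_of_nat mult.assoc)
  finally have "(x + y) ^ ?p = (x ^ ?p + y ^ ?p) + PP * (\<Sum>k\<in>{1..<?p}. of_nat (m k) * x ^ k * y ^ (?p - k))"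
    by (simp add: ac_simps)
  moreover have "(\<Sum>k\<in>{1..<?p}. of_nat (m k) * x ^ k * y ^ (?p - k)) \<in> R"
    by (intro R_sum R_mult R_of_nat R_power x y)
  ultimately show ?thesis unfolding pcong_def by blast
qed

lemma frobenius_add_power:
  assumes x: "x \<in> R" and y: "y \<in> R"
  shows "pcong R ((x + y) ^ (CARD('p) ^ d)) (x ^ (CARD('p) ^ d) + y ^ (CARD('p) ^ d))"
proof (induction d)
  case (Suc d)
  let ?q = "CARD('p) ^ d"
  have "pcong R (((x + y) ^ ?q) ^ CARD('p)) ((x ^ ?q + y ^ ?q) ^ CARD('p))"
    by (intro pcong_power Suc R_add R_power x y)
  moreover have "pcong R ((x ^ ?q + y ^ ?q) ^ CARD('p)) ((x ^ ?q) ^ CARD('p) + (y ^ ?q) ^ CARD('p))"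
    by (intro frobenius_add R_power x y)
  ultimately show ?case unfolding power_Suc2 power_mult by (rule pcong_trans)
qed (simp add: pcong_refl)

lemma fermat_oz: "pcong R (oz c ^ (CARD('p) ^ d)) (oz c)"
proof -
  have "red (c ^ (CARD('p) ^ d)) = red c"
  proof -
    have "red c ^ (CARD('p mod_ring) ^ d) = red c" by (rule finite_field_power_card_power_eq_same) simp
    then show ?thesis by (simp add: red.hom_power)
  qed
  then obtain r where "c ^ (CARD('p) ^ d) - c = pp * r" unfolding red_eq_iff by (elim dvdE)
  then have "c ^ (CARD('p) ^ d) = c + pp * r" by (simp add: algebra_simps)
  then have "oz c ^ (CARD('p) ^ d) = oz c + PP * oz r" unfolding PP_def by (metis oz.hom_add oz.hom_mult oz.hom_power)
  then show ?thesis unfolding pcong_def using R_oz by blast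
qed

end

interpretation IC: p_subring IC
  by unfold_locales (auto intro: IC_oz IC_diff IC_mult)

text \<open>Under these conditions \<open>R\<close> is a discrete valuation ring with uniformiser
  \<open>p\<close>: \<open>K = R[1/p]\<close> is a field, finite over the p-adic numbers because of
  \<open>B\<close>, and \<open>R\<close> is its full ring of integers. Teichmueller rings and rings
  \<open>\<int>\<^sub>p[x]\<close> with irreducible reduction both enter through this
  criterion.\<close>

lemma unramified_order:
  fixes R :: "'p::prime_card padic_closure set"
  assumes sub: "p_subring R" and RI: "R \<subseteq> IC"
    and B: "finite B" "\<And>x. x \<in> R \<Longrightarrow> \<exists>c. x = (\<Sum>b\<in>B. oz (c b) * b)"
    and loc: "\<And>w. w \<in> R \<Longrightarrow> (\<exists>v\<in>R. w = PP * v) \<or> unitO w"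
  shows "R \<subseteq> maximal_unramified"
proof -
  define K where "K = {x. \<exists>N. PP ^ N * x \<in> R}"
  interpret p_subring R by (rule sub)
  note Rc = R_oz and Rd = R_diff and Rm = R_mult and R0 = R_0 and R1 = R_1 and RP = R_PP and Rpow = R_power
  note inv = inverse_mem
  \<comment> \<open>Dividing by \<open>p\<close> as long as \<open>loc\<close> permits must end at a
    unit, since otherwise all powers of \<open>p\<close> divide \<open>r\<close>;
    \<open>inverse_mem\<close> keeps the inverse of the unit in \<open>R\<close>.\<close>
  have dec: "\<exists>j u v. r = PP ^ j * u \<and> u \<in> R \<and> v \<in> R \<and> u * v = 1" if r: "r \<in> R" "r \<noteq> 0" for r
  proof (rule ccontr)
    assume no: "\<not> ?thesis"
    have "\<exists>w\<in>R. r = PP ^ j * w" for j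
    proof (induction j)
      case 0
      then show ?case using r by simp
    next
      case (Suc j)
      then obtain w where w: "w \<in> R" "r = PP ^ j * w" by blast
      have "\<not> unitO w"
      proof
        assume "unitO w"
        then obtain v where "v \<in> IC" "w * v = 1" by (auto simp: unitO_def)
        then show False using no w inv[OF w(1)] by blast
      qed
      then obtain v where "v \<in> R" "w = PP * v" using loc[OF w(1)] by blast
      then show ?case using w by (intro bexI[of _ v]) (simp_all add: mult.assoc mult.left_commute)
    qed
    then have "\<And>j. \<exists>w\<in>IC. r = PP ^ j * w" using RI by blast
    then have "r = 0" using IC_separated r(1) RI by blast
    then show False using r by simp
  qed
  have RK: "x \<in> K" if "x \<in> R" for x unfolding K_def using that by (intro CollectI exI[of _ 0]) simp
  have KI: "x \<in> K" if "PP ^ N * x \<in> R" for x N unfolding K_def using that by blast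
  have Kup: "PP ^ (N + M) * x \<in> R" if "PP ^ N * x \<in> R" for x N M
    using Rm[OF Rpow[OF RP] that, of M] by (simp add: power_add ac_simps)
  have Km: "x * y \<in> K" if "x \<in> K" "y \<in> K" for x y
  proof -
    obtain N M where "PP ^ N * x \<in> R" "PP ^ M * y \<in> R" using \<open>x \<in> K\<close> \<open>y \<in> K\<close> by (auto simp: K_def)
    then have "(PP ^ N * x) * (PP ^ M * y) \<in> R" by (rule Rm)
    then show ?thesis by (intro KI[of "N + M"]) (simp add: power_add ac_simps)
  qed
  have Kd: "x - y \<in> K" if "x \<in> K" "y \<in> K" for x y
  proof -
    obtain N M where "PP ^ N * x \<in> R" "PP ^ M * y \<in> R" using \<open>x \<in> K\<close> \<open>y \<in> K\<close> by (auto simp: K_def)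
    then have "PP ^ (N + M) * x - PP ^ (M + N) * y \<in> R" by (intro Rd Kup)
    then show ?thesis by (intro KI[of "N + M"]) (simp add: algebra_simps)
  qed
  have Pinv: "inverse PP ^ j \<in> K" for j
    by (rule KI[of j]) (simp add: power_inverse R1)
  have Ki: "inverse x \<in> K" if x: "x \<in> K" for x
  proof (cases "x = 0")
    case False
    obtain N where N: "PP ^ N * x \<in> R" using x by (auto simp: K_def)
    then obtain j u v where juv: "PP ^ N * x = PP ^ j * u" "u \<in> R" "v \<in> R" "u * v = 1" using dec[OF N] False by auto
    have "x * (PP ^ N * inverse PP ^ j * v) = (PP ^ N * x) * inverse PP ^ j * v" by (simp add: ac_simps)
    also have "\<dots> = u * v" unfolding juv(1) by (simp add: power_inverse)
    finally have "inverse x = PP ^ N * inverse PP ^ j * v" using juv(4) by (intro inverse_unique) simp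
    then show ?thesis using Km[OF Km[OF RK[OF Rpow[OF RP]] Pinv] RK[OF juv(3)]] by simp
  qed (use RK[OF R0] in simp)
  have Kq: "to_ac c \<in> K" for c :: "'p padic"
  proof -
    obtain a b where c: "c = Fraction_Field.Fract a b" "b \<noteq> 0" by (cases c) auto
    have "c = to_fract a / to_fract b" using c by (simp add: to_fract_def)
    then have "to_ac c = oz a * inverse (oz b)" by (simp add: divide_inverse)
    then show ?thesis using Km[OF RK[OF Rc] Ki[OF RK[OF Rc]]] by simp
  qed
  have "finite_extension K"
    unfolding finite_extension_def
  proof (intro conjI ballI)
    show "range to_ac \<subseteq> K" using Kq by auto
    show "\<exists>B. finite B \<and> (\<forall>x\<in>K. \<exists>c. x = (\<Sum>b\<in>B. to_ac (c b) * b))"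
    proof (intro exI[of _ B] conjI ballI B(1))
      fix x assume "x \<in> K"
      then obtain N where "PP ^ N * x \<in> R" by (auto simp: K_def)
      then obtain c where c: "PP ^ N * x = (\<Sum>b\<in>B. oz (c b) * b)" using B(2) by blast
      have "x = inverse (PP ^ N) * (PP ^ N * x)" by simp
      also have "\<dots> = (\<Sum>b\<in>B. to_ac (inverse (to_fract pp ^ N) * to_fract (c b)) * b)"
        unfolding c by (simp add: sum_distrib_left PP_def mult.assoc)
      finally show "\<exists>c. x = (\<Sum>b\<in>B. to_ac (c b) * b)"
        by (intro exI[of _ "\<lambda>b. inverse (to_fract pp ^ N) * to_fract (c b)"])
    qed
  qed (use Kd Km Ki in auto)
  moreover have "unramified K"
  proof -
    have ri: "ring_of_integers K = R"
    proof (intro equalityI subsetI)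
      fix x assume "x \<in> ring_of_integers K"
      then have x: "x \<in> K" "x \<in> IC" by (auto simp: ring_of_integers_def IC_def)
      show "x \<in> R"
      proof (cases "x = 0")
        case False
        obtain N where N: "PP ^ N * x \<in> R" using x by (auto simp: K_def)
        then obtain j u v where juv: "PP ^ N * x = PP ^ j * u" "u \<in> R" "v \<in> R" "u * v = 1" using dec[OF N] False by auto
        show ?thesis
        proof (cases "N \<le> j")
          case True
          then have "PP ^ N * x = PP ^ N * (PP ^ (j - N) * u)" using juv(1) by (simp add: power_add[symmetric] mult.assoc[symmetric])
          then have "x = PP ^ (j - N) * u" by simp
          then show ?thesis using Rm[OF Rpow[OF RP] juv(2)] by simp
        next
          \<comment> \<open>For \<open>j < N\<close> the unit \<open>u\<close> would be a positive
            power of \<open>p\<close> times the integral element \<open>x\<close>.\<close>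
          case False
          then have N': "N = j + Suc (N - j - 1)" by simp
          have "PP ^ j * (PP ^ Suc (N - j - 1) * x) = PP ^ j * u"
            using juv(1) by (subst (asm) N') (simp add: power_add mult.assoc)
          then have "PP ^ Suc (N - j - 1) * x = u" by simp
          moreover have "PP * (PP ^ (N - j - 1) * x * v) = (PP ^ Suc (N - j - 1) * x) * v" by (simp add: ac_simps)
          ultimately have "PP * (PP ^ (N - j - 1) * x * v) = 1" using juv(4) by metis
          moreover have "PP ^ (N - j - 1) * x * v \<in> IC" using x juv(3) RI by (intro IC_mult IC_power) auto
          ultimately show ?thesis using not_unitO_PP unfolding unitO_def by auto
        qed
      qed (simp add: R0)
    qed (use RK RI in \<open>auto simp: ring_of_integers_def IC_def\<close>)
    show ?thesis
      unfolding unramified_def ri Let_def PP_of_nat[symmetric]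
    proof (intro equalityI subsetI)
      fix x assume "x \<in> (*) PP ` R"
      then obtain r where r: "r \<in> R" "x = PP * r" by blast
      have "x * y \<noteq> 1" if y: "y \<in> R" for y
      proof
        assume "x * y = 1"
        then have "PP * (r * y) = 1" using r by (simp add: ac_simps)
        moreover have "r * y \<in> IC" using r y RI by (intro IC_mult) auto
        ultimately show False using not_unitO_PP unfolding unitO_def by auto
      qed
      then show "x \<in> {x \<in> R. \<forall>y\<in>R. x * y \<noteq> 1}" using Rm[OF RP r(1)] r(2) by simp
    next
      fix x assume x: "x \<in> {x \<in> R. \<forall>y\<in>R. x * y \<noteq> 1}"
      then have "\<not> unitO x" using inv unfolding unitO_def by blast
      then show "x \<in> (*) PP ` R" using loc x by blast
    qed
  qed
  ultimately show ?thesis unfolding maximal_unramified_def using RK by blast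
qed

text \<open>For \<open>q = p ^ d\<close> this is the ring of integers of the unramified extension of
  degree \<open>d\<close>, that is, the Witt vectors of the field with \<open>q\<close> elements,
  spanned by the Teichmueller representatives.\<close>

definition Wit :: "nat \<Rightarrow> 'p::prime_card padic_closure set" where
  "Wit q = zm.span {z. z ^ q = z}"

lemma finite_roots_unity: "q \<ge> 2 \<Longrightarrow> finite {z :: 'p::prime_card padic_closure. z ^ q = z}"
proof -
  assume q: "q \<ge> 2"
  let ?f = "monom 1 q - [:0, 1:] :: 'p padic_closure poly"
  have "coeff ?f q = 1" using q by (simp add: coeff_pCons split: nat.split)
  then have "?f \<noteq> 0" by (metis coeff_0 zero_neq_one)
  moreover have "{z :: 'p padic_closure. z ^ q = z} = {z. poly ?f z = 0}" by (auto simp: poly_monom)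
  ultimately show ?thesis using poly_roots_finite[of ?f] by simp
qed

lemma Wit_IC:
  assumes "q \<ge> 2"
  shows "Wit q \<subseteq> (IC :: 'p::prime_card padic_closure set)"
proof
  fix x :: "'p padic_closure" assume "x \<in> Wit q"
  then show "x \<in> IC"
    unfolding Wit_def
  proof (induction rule: zm.span_induct_alt)
    case (step c z y)
    let ?f = "monom 1 q - [:0, 1:] :: 'p padic_int poly"
    have "degree ?f = q" using assms by (intro antisym degree_diff_le le_degree) (auto simp: degree_monom_eq coeff_pCons split: nat.split)
    then have "lead_coeff ?f = 1" using assms by (simp add: coeff_pCons split: nat.split)
    moreover have "poly (map_poly oz ?f) z = 0" using step(1) by (simp add: mz.hom_minus poly_monom)
    ultimately have "z \<in> IC" unfolding IC_def by blast
    then show ?case using step by (intro IC_add IC_mult IC_oz)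
  qed simp
qed

text \<open>The spanning set is closed under multiplication and contains 1, so its span is a
  ring.\<close>

lemma Wit_subring:
  fixes q :: nat
  shows "p_subring (Wit q :: 'p::prime_card padic_closure set)"
proof
  let ?Z = "{z :: 'p padic_closure. z ^ q = z}"
  show "oz c \<in> Wit q" for c :: "'p padic_int"
    using zm.span_scale[OF zm.span_base[of 1 ?Z], of c] by (simp add: Wit_def)
  show "x - y \<in> Wit q" if "x \<in> Wit q" "y \<in> Wit q" for x y :: "'p padic_closure"
    using that unfolding Wit_def by (rule zm.span_diff)
  have Z: "z * y \<in> Wit q" if "z \<in> ?Z" "y \<in> Wit q" for z y
    unfolding Wit_def
  proof (rule zspan_mult_closed[OF _ that(2)[unfolded Wit_def]])
    fix b assume "b \<in> ?Z"
    then show "z * b \<in> zm.span ?Z" using that(1) by (intro zm.span_base) (simp add: power_mult_distrib)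
  qed
  show "x * y \<in> Wit q" if "x \<in> Wit q" "y \<in> Wit q" for x y :: "'p padic_closure"
  proof -
    have "y * x \<in> Wit q" unfolding Wit_def
    proof (rule zm.span_induct_alt[of x ?Z "\<lambda>x. y * x \<in> zm.span ?Z"])
      show "x \<in> zm.span ?Z" using that(1) by (simp add: Wit_def)
      show "y * 0 \<in> zm.span ?Z" by (simp add: zm.span_zero)
      fix c z w assume "z \<in> ?Z" and w: "y * w \<in> zm.span ?Z"
      then have "z * y \<in> zm.span ?Z" using Z that(2) by (simp add: Wit_def)
      then have "oz c * (z * y) + y * w \<in> zm.span ?Z" using w by (intro zm.span_add zm.span_scale)
      then show "y * (oz c * z + w) \<in> zm.span ?Z" by (simp add: algebra_simps)
    qed
    then show ?thesis by (simp add: mult.commute)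
  qed
qed

text \<open>
  The ring generated by the Teichmueller representatives of \<open>\<F>\<^sub>q\<close> is unramified, since the Frobenius
  map \<open>x \<mapsto> x\<^sup>q\<close> is the identity modulo \<open>p\<close> on it.
\<close>

lemma Wit_unramified:
  assumes d: "d \<ge> 1"
  shows "Wit (CARD('p) ^ d) \<subseteq> (maximal_unramified :: 'p::prime_card padic_closure set)"
proof -
  let ?q = "CARD('p) ^ d"
  let ?W = "Wit ?q :: 'p padic_closure set" and ?Z = "{z :: 'p padic_closure. z ^ ?q = z}"
  have q: "?q \<ge> 2" using d prime_ge_2_nat[OF prime_card[where 'a='p]] power_increasing[of 1 d "CARD('p)"] by simp
  interpret W: p_subring ?W by (rule Wit_subring)
  have WI: "?W \<subseteq> IC" by (rule Wit_IC[OF q])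
  have frob: "pcong ?W (x ^ ?q) x \<and> x \<in> ?W" if "x \<in> ?W" for x
    using that[unfolded Wit_def]
  proof (induction rule: zm.span_induct_alt)
    case base
    then show ?case using W.pcong_refl W.R_0 q by (simp add: power_0_left)
  next
    case (step c z y)
    have z: "z \<in> ?W" using step(1) unfolding Wit_def by (rule zm.span_base)
    have "pcong ?W ((oz c * z + y) ^ ?q) ((oz c * z) ^ ?q + y ^ ?q)"
      by (intro W.frobenius_add_power W.R_mult W.R_oz z) (use step in blast)
    moreover have "pcong ?W ((oz c * z) ^ ?q) (oz c * z)"
      unfolding power_mult_distrib using step(1) by (intro W.pcong_mult W.fermat_oz W.R_power z W.R_oz) (auto intro: W.pcong_refl)
    then have "pcong ?W ((oz c * z) ^ ?q + y ^ ?q) (oz c * z + y)" using step by (intro W.pcong_add) auto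
    ultimately show ?case using W.pcong_trans W.R_add W.R_mult W.R_oz z step by blast
  qed
  show ?thesis
  proof (rule unramified_order[OF W.p_subring_axioms WI finite_roots_unity[OF q]])
    fix x assume "x \<in> ?W"
    then show "\<exists>c. x = (\<Sum>b\<in>?Z. oz (c b) * b)"
      unfolding Wit_def zm.span_finite[OF finite_roots_unity[OF q]] by blast
  next
    fix w assume w: "w \<in> ?W"
    show "(\<exists>v\<in>?W. w = PP * v) \<or> unitO w"
    proof (cases "unitO w")
      case False
      have wI: "w \<in> IC" using w WI by blast
      obtain r where r: "r \<in> ?W" "w ^ ?q = w + PP * r" using frob[OF w] unfolding pcong_def by blast
      \<comment> \<open>With \<open>q = m + 2\<close>, the congruence
        \<open>w ^ q = w + PP * r\<close> reads \<open>w * (1 - w ^ Suc m) = - PP * r\<close>, and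
        the bracket is a unit because \<open>w\<close> is not.\<close>
      define m where "m = ?q - 2"
      have qm: "?q = Suc (Suc m)" using q by (simp add: m_def)
      let ?u = "1 - w ^ Suc m"
      have "\<not> unitO (w ^ Suc m)" using unitO_mult_iff[OF wI IC_power[OF wI], of m] False by simp
      then have "unitO ?u" using unitO_one_minus IC_power wI by blast
      then obtain v where v: "v \<in> IC" "?u * v = 1" by (auto simp: unitO_def)
      have eq: "w * ?u = - PP * r" using r(2) unfolding qm by (simp add: algebra_simps)
      have wv: "w = PP * (- r * v)"
      proof -
        have "w = w * (?u * v)" using v by simp
        also have "\<dots> = (w * ?u) * v" by (simp add: mult.assoc)
        also have "\<dots> = PP * (- r * v)" unfolding eq by simp
        finally show ?thesis .
      qed
      have uW: "?u \<in> ?W" by (intro W.R_diff W.R_1 W.R_power w)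
      have "v \<in> ?W" by (rule W.inverse_mem[OF uW v])
      then have "- r * v \<in> ?W" using r W.R_mult W.R_uminus by blast
      then show ?thesis using wv by blast
    qed simp
  qed
qed

text \<open>For \<open>R = \<int>\<^sub>p[x]\<close> the quotient modulo \<open>p\<close> is the
  field defined by the irreducible reduction of \<open>char_poly B\<close>. So an element of
  \<open>R\<close> is divisible by \<open>p\<close> or a unit, as \<open>unramified_order\<close>
  demands.\<close>

lemma simple_root_unramified:
  fixes B :: "'p::prime_card padic_int mat"
  assumes B: "B \<in> carrier_mat n n" and irr: "irreducible (char_poly (redm B))"
    and x: "poly (map_poly oz (char_poly B)) x = 0"
  shows "x \<in> maximal_unramified"
proof -
  let ?f = "char_poly B"
  have f: "degree ?f = n" "lead_coeff ?f = 1" using degree_char_poly[OF B] monic_char_poly[OF B] by auto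
  have rf: "map_poly red ?f = char_poly (redm B)" using red.char_poly_hom[OF B] by simp
  have xI: "x \<in> IC" using char_poly_root_IC[OF B x] .
  interpret mr: map_poly_comm_ring_hom "red :: 'p padic_int \<Rightarrow> _" ..
  define ev where "ev g = poly (map_poly oz g) x" for g
  define R where "R = range ev"
  have ev: "ev (g + h) = ev g + ev h" "ev (g - h) = ev g - ev h" "ev (g * h) = ev g * ev h" "ev [:c:] = oz c" for g h c
    by (simp_all add: ev_def mz.hom_add mz.hom_minus mz.hom_mult oz.map_poly_pCons_hom)
  have evp: "ev (pCons c g) = oz c + x * ev g" for c g by (simp add: ev_def oz.map_poly_pCons_hom)
  let ?Z = "(\<lambda>i. x ^ i) ` {..<n}"
  have zero: "\<exists>k. g = Polynomial.smult pp k" if "map_poly red g = 0" for g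
  proof -
    have "pp dvd coeff g i" for i
      using arg_cong[OF that, of "\<lambda>p. coeff p i"] by (simp add: red_eq_0_iff)
    then have "[:pp:] dvd g" by (simp add: const_poly_dvd_iff)
    then show ?thesis by (auto simp: dvd_def)
  qed
  have evsm: "ev (Polynomial.smult pp k) = PP * ev k" for k
    using ev(3)[of "[:pp:]" k] ev(4)[of pp] by (simp add: PP_def)
  have lift: "\<exists>g. map_poly red g = h" for h :: "'p mod_ring poly"
  proof (intro exI[of _ "map_poly lft h"] poly_eqI)
    fix i
    have "lft (0 :: 'p mod_ring) = 0" by (simp add: lft_def)
    then show "coeff (map_poly red (map_poly lft h)) i = coeff h i" by (simp add: coeff_map_poly)
  qed
  show ?thesis
  proof (rule subsetD[OF unramified_order[of R ?Z]])
    have "x = ev [:0, 1:]" by (simp add: ev_def oz.map_poly_pCons_hom)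
    then show "x \<in> R" unfolding R_def by (rule range_eqI)
    show "p_subring R"
    proof
      show "oz c \<in> R" for c unfolding R_def by (rule range_eqI[of _ _ "[:c:]"]) (simp add: ev(4))
      show "u - v \<in> R" if uv: "u \<in> R" "v \<in> R" for u v
      proof -
        obtain g h where "u = ev g" "v = ev h" using uv by (auto simp: R_def)
        then show ?thesis unfolding R_def by (intro range_eqI[of _ _ "g - h"]) (simp add: ev(2))
      qed
      show "u * v \<in> R" if uv: "u \<in> R" "v \<in> R" for u v
      proof -
        obtain g h where "u = ev g" "v = ev h" using uv by (auto simp: R_def)
        then show ?thesis unfolding R_def by (intro range_eqI[of _ _ "g * h"]) (simp add: ev(3))
      qed
    qed
    show "R \<subseteq> IC" unfolding R_def ev_def using IC_poly[OF xI] by auto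
    show "finite ?Z" by simp
  next
    fix w assume "w \<in> R"
    then obtain g where g: "w = ev g" by (auto simp: R_def)
    have 0: "(\<Sum>i<n. oz (coeff ?f i) * x ^ i) + x ^ n = 0"
      using x f by (simp add: poly_map_oz lessThan_Suc_atMost[symmetric])
    have n0: "n > 0"
    proof (rule ccontr)
      assume "\<not> n > 0"
      then show False using 0 by simp
    qed
    have xn: "x ^ n \<in> zm.span ?Z"
    proof -
      have "x ^ n = (\<Sum>i<n. oz (- coeff ?f i) * x ^ i)"
        using 0 by (simp add: oz.hom_uminus sum_negf eq_neg_iff_add_eq_0 add.commute)
      also have "\<dots> \<in> zm.span ?Z" by (intro zm.span_sum zm.span_scale zm.span_base) auto
      finally show ?thesis .
    qed
    have xs: "x * v \<in> zm.span ?Z" if "v \<in> zm.span ?Z" for v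
    proof (rule zspan_mult_closed[OF _ that])
      fix b assume "b \<in> ?Z"
      then obtain i where i: "i < n" "b = x ^ i" by auto
      show "x * b \<in> zm.span ?Z"
      proof (cases "Suc i = n")
        case True
        then show ?thesis using xn i by (metis power_Suc)
      next
        case False
        then show ?thesis using i by (intro zm.span_base image_eqI[of _ _ "Suc i"]) auto
      qed
    qed
    have one: "1 \<in> zm.span ?Z" using n0 by (intro zm.span_base image_eqI[of _ _ 0]) auto
    have "ev g \<in> zm.span ?Z"
    proof (induction g)
      case 0
      then show ?case by (simp add: ev_def zm.span_zero)
    next
      case (pCons c g)
      have "oz c * 1 + x * ev g \<in> zm.span ?Z" by (intro zm.span_add zm.span_scale one xs pCons)
      then show ?case by (simp add: evp)
    qed
    then show "\<exists>c. w = (\<Sum>b\<in>?Z. oz (c b) * b)" unfolding g using zm.span_finite[of ?Z] by auto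
  next
    fix w assume "w \<in> R"
    then obtain g where g: "w = ev g" by (auto simp: R_def)
    have evf: "ev ?f = 0" using x by (simp add: ev_def)
    show "(\<exists>v\<in>R. w = PP * v) \<or> unitO w"
    proof (cases "map_poly red ?f dvd map_poly red g")
      case True
      then obtain h0 where h0: "map_poly red g = map_poly red ?f * h0" by (elim dvdE)
      obtain h where h: "map_poly red h = h0" using lift by blast
      have "map_poly red (g - ?f * h) = 0" using h0 h by (simp add: mr.hom_minus mr.hom_mult)
      then obtain k where k: "g - ?f * h = Polynomial.smult pp k" using zero by blast
      have "w = PP * ev k"
        using arg_cong[OF k, of ev] evf by (simp add: ev(2,3) evsm g)
      then show ?thesis by (auto simp: R_def)
    next
      case False
      \<comment> \<open>Bezout modulo \<open>p\<close>, with coefficients lifted, gives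
        \<open>ev b * w\<close> congruent to 1 modulo \<open>p\<close>, which is a unit because
        \<open>IC\<close> is local.\<close>
      then have "coprime (map_poly red ?f) (map_poly red g)"
        using irr unfolding rf by (simp add: prime_elem_imp_coprime irreducible_imp_prime_elem)
      then have "fst (bezout_coefficients (map_poly red ?f) (map_poly red g)) * map_poly red ?f
          + snd (bezout_coefficients (map_poly red ?f) (map_poly red g)) * map_poly red g = 1"
        using bezout_coefficients_fst_snd[of "map_poly red ?f" "map_poly red g"] by simp
      then obtain a0 b0 where ab: "a0 * map_poly red ?f + b0 * map_poly red g = 1" by blast
      obtain a b where a: "map_poly red a = a0" and b: "map_poly red b = b0" using lift by metis
      have "map_poly red (a * ?f + b * g - 1) = 0" using ab a b by (simp add: mr.hom_minus mr.hom_mult mr.hom_add)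
      then obtain k where k: "a * ?f + b * g - 1 = Polynomial.smult pp k" using zero by blast
      have "ev b * w - 1 = PP * ev k"
        using arg_cong[OF k, of ev] evf ev(4)[of 1] by (simp add: ev(1,2,3) evsm g one_pCons)
      then have e: "ev b * w = 1 - PP * (- ev k)" by (simp add: algebra_simps)
      have I: "ev b \<in> IC" "w \<in> IC" "- ev k \<in> IC" unfolding g ev_def by (auto intro: IC_poly IC_uminus xI)
      have "unitO (1 - PP * (- ev k))" by (intro unitO_one_minus IC_mult IC_PP I not_unitO_PP_mult)
      then show ?thesis using e unitO_mult_iff[OF I(1,2)] by simp
    qed
  qed
qed

section \<open>Residues and Teichmueller expansions in unramified extensions\<close>

lemma unramified_ring:
  assumes "finite_extension K" "unramified K"
  shows "p_subring (K \<inter> IC)" "x \<in> K \<inter> IC \<Longrightarrow> \<not> unitO x \<Longrightarrow> \<exists>r\<in>K \<inter> IC. x = PP * r"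
proof -
  have ri: "ring_of_integers K = K \<inter> IC" by (auto simp: ring_of_integers_def IC_def)
  show "p_subring (K \<inter> IC)"
    using assms(1) by unfold_locales (auto simp: finite_extension_def intro: IC_oz IC_diff IC_mult)
  assume x: "x \<in> K \<inter> IC" "\<not> unitO x"
  then have "x \<in> {x \<in> K \<inter> IC. \<forall>y\<in>K \<inter> IC. x * y \<noteq> 1}" by (auto simp: unitO_def)
  also have "\<dots> = (*) PP ` (K \<inter> IC)" using assms(2) unfolding unramified_def ri Let_def PP_of_nat by simp
  finally show "\<exists>r\<in>K \<inter> IC. x = PP * r" by blast
qed

text \<open>The square of \<open>x\<close> is divisible by \<open>p\<close>, so \<open>x\<close> is
  a nonunit. In an unramified extension it would be \<open>PP * r\<close>, and dividing the equation
  by \<open>p\<close> would make 1 a multiple of \<open>p\<close> in \<open>IC\<close>.\<close>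

lemma eisenstein_root_ramified:
  assumes x: "x \<in> IC" and eq: "x ^ 2 + PP ^ 2 * oz t * x - PP + PP ^ 2 * oz s = 0"
  shows "x \<notin> (maximal_unramified :: 'p::prime_card padic_closure set)"
proof
  assume "x \<in> maximal_unramified"
  then obtain K where K: "x \<in> K" "finite_extension K" "unramified K" by (auto simp: maximal_unramified_def)
  have "x * x = PP * (1 - PP * (oz t * x + oz s))" using eq by (simp add: algebra_simps power2_eq_square)
  moreover have "1 - PP * (oz t * x + oz s) \<in> IC" by (intro IC_diff IC_1 IC_mult IC_PP IC_add IC_oz x)
  ultimately have "\<not> unitO (x * x)" using not_unitO_PP_mult by metis
  then have "\<not> unitO x" using unitO_mult_iff x by blast
  then obtain r where r: "r \<in> IC" "x = PP * r" using unramified_ring(2)[OF K(2,3), of x] K(1) x by blast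
  have "PP * (PP * (r ^ 2 + PP * oz t * r + oz s)) = PP * 1"
    using eq unfolding r(2) by (simp add: algebra_simps power2_eq_square)
  then have "PP * (r ^ 2 + PP * oz t * r + oz s) = 1" by simp
  moreover have "r ^ 2 + PP * oz t * r + oz s \<in> IC" by (intro IC_add IC_mult IC_power IC_oz IC_PP r)
  ultimately show False using not_unitO_PP unfolding unitO_def by auto
qed

text \<open>In \<open>a ^ p - b ^ p = (a - b) * (\<Sum>k<p. a ^ k * b ^ (p - 1 - k))\<close> the
  second factor is congruent to \<open>p * b ^ (p - 1)\<close> modulo \<open>p\<close>, so it
  supplies one more factor \<open>p\<close>.\<close>

lemma power_CARD_lift:
  fixes a b :: "'p::prime_card padic_closure"
  assumes a: "a \<in> IC" and b: "b \<in> IC" and t: "t \<in> IC" "a = b + PP ^ Suc i * t"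
  shows "\<exists>s\<in>IC. a ^ CARD('p) = b ^ CARD('p) + PP ^ Suc (Suc i) * s"
proof -
  obtain n where n: "CARD('p) = Suc n" using prime_gt_0_nat[OF prime_card[where 'a='p]] by (metis not0_implies_Suc less_irrefl)
  have "a = b + PP * (PP ^ i * t)" using t(2) by (simp add: mult.assoc)
  then have ab: "pcong IC a b" unfolding pcong_def using IC_mult IC_power IC_PP t(1) by blast
  have "pcong IC (a ^ k * b ^ (n - k)) (b ^ k * b ^ (n - k))" for k
    by (intro IC.pcong_mult IC.pcong_power IC.pcong_refl ab b IC_power)
  then have "\<exists>r\<in>IC. a ^ k * b ^ (n - k) = b ^ k * b ^ (n - k) + PP * r" for k unfolding pcong_def .
  then obtain r where r: "\<And>k. r k \<in> IC" "\<And>k. a ^ k * b ^ (n - k) = b ^ k * b ^ (n - k) + PP * r k" by metis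
  have "a ^ Suc n - b ^ Suc n = (a - b) * (\<Sum>k<Suc n. a ^ k * b ^ (n - k))" by (rule diff_power_eq_sum)
  also have "(\<Sum>k<Suc n. a ^ k * b ^ (n - k)) = (\<Sum>k<Suc n. b ^ n + PP * r k)"
    unfolding r(2) by (intro sum.cong) (auto simp: power_add[symmetric])
  also have "\<dots> = PP * (b ^ n + (\<Sum>k<Suc n. r k))"
    by (simp only: sum.distrib sum_distrib_left[symmetric] sum_constant card_lessThan PP_of_nat n distrib_left)
  also have "a - b = PP ^ Suc i * t" using t(2) by simp
  finally have "a ^ Suc n = b ^ Suc n + PP ^ Suc (Suc i) * (t * (b ^ n + (\<Sum>k<Suc n. r k)))"
    by (simp add: algebra_simps)
  moreover have "t * (b ^ n + (\<Sum>k<Suc n. r k)) \<in> IC" by (intro IC_mult IC_add IC_power IC_sum b t r)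
  ultimately show ?thesis unfolding n by blast
qed

lemma power_CARD_power_lift:
  fixes a b :: "'p::prime_card padic_closure"
  assumes a: "a \<in> IC" and b: "b \<in> IC" and t: "t \<in> IC" "a = b + PP * t"
  shows "\<exists>s\<in>IC. a ^ (CARD('p) ^ m) = b ^ (CARD('p) ^ m) + PP ^ Suc m * s"
proof (induction m)
  case 0
  then show ?case using t by auto
next
  case (Suc m)
  then obtain s where "s \<in> IC" "a ^ (CARD('p) ^ m) = b ^ (CARD('p) ^ m) + PP ^ Suc m * s" by blast
  from power_CARD_lift[OF IC_power[OF a] IC_power[OF b] this] show ?case
    unfolding power_Suc2[of "CARD('p)"] power_mult .
qed

interpretation vs: Vector_Spaces.vector_space "\<lambda>(c :: 'p::prime_card padic) (x :: 'p padic_closure). to_ac c * x"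
  by unfold_locales (auto simp: algebra_simps)

lemma clear_denominators:
  fixes a :: "'b \<Rightarrow> 'p::prime_card padic"
  assumes "finite S"
  shows "\<exists>b c. b \<noteq> 0 \<and> (\<forall>s\<in>S. to_fract b * a s = to_fract (c s))"
  using assms
proof (induction S rule: finite_induct)
  case empty
  show ?case by (intro exI[of _ 1]) auto
next
  case (insert x S)
  then obtain b c where b: "b \<noteq> 0" "\<And>s. s \<in> S \<Longrightarrow> to_fract b * a s = to_fract (c s)" by blast
  obtain n d where a: "a x = Fraction_Field.Fract n d" "d \<noteq> 0" by (cases "a x") auto
  then have ax: "to_fract d * a x = to_fract n" by (simp add: to_fract_def eq_fract mult.commute)
  let ?c = "\<lambda>s. if s = x then b * n else d * c s"
  have "to_fract (b * d) * a s = to_fract (?c s)" if s: "s \<in> insert x S" for s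
  proof (cases "s = x")
    case True
    have "to_fract (b * d) * a x = to_fract b * (to_fract d * a x)" by (simp add: mult.assoc)
    then show ?thesis using True ax by simp
  next
    case False
    have "to_fract (b * d) * a s = to_fract d * (to_fract b * a s)" by (simp add: ac_simps)
    then show ?thesis using False b(2)[of s] s by simp
  qed
  moreover have "b * d \<noteq> 0" using a b by simp
  ultimately show ?case by (intro exI[of _ "b * d"] exI[of _ ?c] conjI ballI)
qed

text \<open>
  Families that are independent modulo \<open>p\<close> are linearly independent over the field of fractions, so
  there is a maximal one, and it spans the residue ring.
\<close>

lemma residue_ring_finite:
  fixes K :: "'p::prime_card padic_closure set"
  assumes K: "finite_extension K" "unramified K"
  obtains \<alpha> :: "'p padic_closure \<Rightarrow> ('p padic_closure \<Rightarrow> 'p mod_ring)"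
  where "finite (\<alpha> ` (K \<inter> IC))" "\<And>x y. x \<in> K \<inter> IC \<Longrightarrow> y \<in> K \<inter> IC \<Longrightarrow> \<alpha> x = \<alpha> y \<Longrightarrow> pcong (K \<inter> IC) x y"
proof -
  let ?R = "K \<inter> IC"
  interpret R: p_subring ?R by (rule unramified_ring(1)[OF K])
  obtain B where B: "finite B" "\<And>x. x \<in> K \<Longrightarrow> \<exists>c. x = (\<Sum>b\<in>B. to_ac (c b) * b)"
    using K(1) unfolding finite_extension_def by blast
  have KB: "K \<subseteq> vs.span B"
  proof
    fix x assume "x \<in> K"
    then obtain c where "x = (\<Sum>b\<in>B. to_ac (c b) * b)" using B(2) by blast
    then have x: "x = (\<Sum>b\<in>B. to_ac (c b) * b)" .
    show "x \<in> vs.span B" unfolding x by (intro vs.span_sum vs.span_scale vs.span_base)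
  qed
  define ind where "ind S \<longleftrightarrow> finite S \<and> S \<subseteq> ?R \<and> (\<forall>c. (\<exists>r\<in>?R. (\<Sum>s\<in>S. oz (c s) * s) = PP * r) \<longrightarrow> (\<forall>s\<in>S. pp dvd c s))" for S
  have bound: "card S < Suc (card B)" if S: "ind S" for S
  proof -
    have fS: "finite S" and SR: "S \<subseteq> ?R" using S by (auto simp: ind_def)
    have pdiv: "pp dvd c s" if "(\<Sum>s\<in>S. oz (c s) * s) = PP * r" "r \<in> ?R" "s \<in> S" for c r s
      using S that unfolding ind_def by blast
    have "vs.independent S"
    proof
      assume "vs.dependent S"
      then obtain u v where u: "v \<in> S" "u v \<noteq> 0" "(\<Sum>s\<in>S. to_ac (u s) * s) = 0"
        using vs.dependent_finite[OF fS] by blast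
      obtain b c where bc: "b \<noteq> 0" "\<And>s. s \<in> S \<Longrightarrow> to_fract b * u s = to_fract (c s)"
        using clear_denominators[OF fS] by blast
      have "(\<Sum>s\<in>S. oz (c s) * s) = (\<Sum>s\<in>S. oz b * (to_ac (u s) * s))"
      proof (intro sum.cong refl)
        fix s assume "s \<in> S"
        from bc(2)[OF this] have "oz (c s) = oz b * to_ac (u s)" by (metis to_ac_mult)
        then show "oz (c s) * s = oz b * (to_ac (u s) * s)" by (simp only: mult.assoc)
      qed
      also have "\<dots> = oz b * (\<Sum>s\<in>S. to_ac (u s) * s)" by (rule sum_distrib_left[symmetric])
      also have "\<dots> = 0" unfolding u(3) by simp
      finally have c0: "(\<Sum>s\<in>S. oz (c s) * s) = 0" .
      \<comment> \<open>Descent: in a relation with p-adic integer coefficients all of them are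
        divisible by \<open>p\<close>, and the relation divided by \<open>p\<close> is of the same
        kind.\<close>
      have "\<forall>s\<in>S. pp ^ k dvd d s" if "(\<Sum>s\<in>S. oz (d s) * s) = 0" for k d
        using that
      proof (induction k arbitrary: d)
        case (Suc k)
        have "pp dvd d s" if "s \<in> S" for s using pdiv[of d 0 s] Suc.prems R.R_0 that by simp
        then obtain e where e: "\<And>s. s \<in> S \<Longrightarrow> d s = pp * e s" unfolding dvd_def by metis
        have "PP * (\<Sum>s\<in>S. oz (e s) * s) = (\<Sum>s\<in>S. oz (d s) * s)"
          unfolding sum_distrib_left by (intro sum.cong refl) (simp only: e oz.hom_mult PP_def mult.assoc)
        then have "(\<Sum>s\<in>S. oz (e s) * s) = 0" using Suc.prems by simp
        then have "\<forall>s\<in>S. pp ^ k dvd e s" by (rule Suc.IH)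
        then show ?case using e by (simp add: mult_dvd_mono)
      qed simp
      then have "c v = 0" using c0 u(1) padic_separated by blast
      then have "to_fract b * u v = 0" using bc(2)[OF u(1)] by simp
      then show False using bc(1) u(2) by simp
    qed
    then show ?thesis using vs.independent_span_bound[OF B(1), of S] SR KB by (auto simp: less_Suc_eq_le)
  qed
  have "ind {}" by (simp add: ind_def)
  then obtain S where S: "ind S" and max: "\<And>T. ind T \<Longrightarrow> card T \<le> card S"
    using ex_has_greatest_nat[of ind "{}" card "Suc (card B)"] bound by blast
  have fS: "finite S" and SR: "S \<subseteq> ?R" using S by (auto simp: ind_def)
  have rep: "\<exists>c. \<exists>r\<in>?R. x = (\<Sum>s\<in>S. oz (c s) * s) + PP * r" if x: "x \<in> ?R" for x
  proof (cases "x \<in> S")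
    case True
    have "(\<Sum>s\<in>S. oz (if s = x then 1 else 0) * s) = (\<Sum>s\<in>S. if s = x then s else 0)"
      by (intro sum.cong) auto
    also have "\<dots> = x" using True fS by simp
    finally show ?thesis by (intro exI[of _ "\<lambda>s. if s = x then 1 else 0"] bexI[of _ 0] R.R_0) simp
  next
    case False
    \<comment> \<open>By maximality there is a dependence modulo \<open>p\<close>. Its coefficient
      at \<open>x\<close> is a unit, since otherwise the dependence would already live on
      \<open>S\<close>.\<close>
    have "\<not> ind (insert x S)" using max[of "insert x S"] fS False by auto
    then obtain c r s0 where r: "r \<in> ?R" "(\<Sum>s\<in>insert x S. oz (c s) * s) = PP * r" "s0 \<in> insert x S" "\<not> pp dvd c s0"
      using fS SR x unfolding ind_def by blast
    have e: "oz (c x) * x + (\<Sum>s\<in>S. oz (c s) * s) = PP * r" using r(2) fS False by simp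
    have "\<not> pp dvd c x"
    proof
      assume cx: "pp dvd c x"
      then obtain y where y: "c x = pp * y" by (elim dvdE)
      have "(\<Sum>s\<in>S. oz (c s) * s) = PP * (r - oz y * x)" using e by (simp add: y PP_def algebra_simps)
      moreover have "r - oz y * x \<in> ?R" by (intro R.R_diff R.R_mult R.R_oz r x)
      ultimately have "\<forall>s\<in>S. pp dvd c s" using S unfolding ind_def by blast
      then show False using r(3,4) cx by auto
    qed
    then have "c x dvd 1" by (simp add: padic_unit_iff red_eq_0_iff)
    then obtain v where "1 = c x * v" by (elim dvdE)
    then have v: "oz v * oz (c x) = 1" by (metis mult.commute oz.hom_mult oz.hom_one)
    have "x = oz v * (oz (c x) * x)" using v by (simp add: mult.assoc[symmetric])
    also have "oz (c x) * x = PP * r - (\<Sum>s\<in>S. oz (c s) * s)" using e by (simp add: algebra_simps)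
    also have "oz v * \<dots> = (\<Sum>s\<in>S. oz (- (v * c s)) * s) + PP * (oz v * r)"
    proof -
      have "(\<Sum>s\<in>S. oz (- (v * c s)) * s) = - (oz v * (\<Sum>s\<in>S. oz (c s) * s))"
        unfolding sum_distrib_left sum_negf[symmetric] by (intro sum.cong refl) (simp only: oz.hom_uminus oz.hom_mult mult_minus_left mult.assoc)
      then show ?thesis by (simp only: right_diff_distrib mult.left_commute[of "oz v"] uminus_add_conv_diff)
    qed
    finally show ?thesis using R.R_mult[OF R.R_oz r(1)]
      by (intro exI[of _ "\<lambda>s. - (v * c s)"] bexI[of _ "oz v * r"])
  qed
  define Q where "Q x F \<longleftrightarrow> (x \<in> ?R \<longrightarrow> snd F \<in> ?R \<and> x = (\<Sum>s\<in>S. oz (fst F s) * s) + PP * snd F)" for x F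
  have "\<exists>F. Q x F" for x
    using rep[of x] unfolding Q_def by (cases "x \<in> ?R") auto
  then obtain F where F: "Q x (F x)" for x by metis
  then obtain c r where cr: "\<And>x. x \<in> ?R \<Longrightarrow> r x \<in> ?R" "\<And>x. x \<in> ?R \<Longrightarrow> x = (\<Sum>s\<in>S. oz (c x s) * s) + PP * r x"
    using that[of "\<lambda>x. snd (F x)" "\<lambda>x. fst (F x)"] F[unfolded Q_def] by blast
  define \<alpha> where "\<alpha> x = restrict (\<lambda>s. red (c x s)) S" for x
  show thesis
  proof (rule that)
    have "\<alpha> ` ?R \<subseteq> PiE S (\<lambda>_. UNIV)" by (auto simp: \<alpha>_def)
    then show "finite (\<alpha> ` ?R)" by (rule finite_subset) (simp add: finite_PiE fS)
    fix x y assume x: "x \<in> ?R" and y: "y \<in> ?R" and eq: "\<alpha> x = \<alpha> y"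
    have "red (c x s) = red (c y s)" if "s \<in> S" for s using fun_cong[OF eq, of s] that by (simp add: \<alpha>_def)
    then have "\<exists>e. c x s - c y s = pp * e" if "s \<in> S" for s using that unfolding red_eq_iff dvd_def by blast
    then obtain e where e: "\<And>s. s \<in> S \<Longrightarrow> c x s - c y s = pp * e s" by metis
    have "x - y = ((\<Sum>s\<in>S. oz (c x s) * s) - (\<Sum>s\<in>S. oz (c y s) * s)) + PP * (r x - r y)"
      by (subst cr(2)[OF x], subst cr(2)[OF y]) (simp add: algebra_simps)
    also have "(\<Sum>s\<in>S. oz (c x s) * s) - (\<Sum>s\<in>S. oz (c y s) * s) = (\<Sum>s\<in>S. oz (c x s - c y s) * s)"
      by (simp add: sum_subtractf left_diff_distrib)
    also have "\<dots> = (\<Sum>s\<in>S. PP * (oz (e s) * s))"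
      by (intro sum.cong refl) (simp only: e oz.hom_mult PP_def mult.assoc)
    also have "\<dots> + PP * (r x - r y) = PP * ((\<Sum>s\<in>S. oz (e s) * s) + (r x - r y))"
      by (simp add: sum_distrib_left distrib_left)
    finally have "x = y + PP * ((\<Sum>s\<in>S. oz (e s) * s) + (r x - r y))" by (simp add: algebra_simps)
    moreover have "(\<Sum>s\<in>S. oz (e s) * s) + (r x - r y) \<in> ?R"
      by (intro R.R_add R.R_sum R.R_mult R.R_oz R.R_diff cr x y) (use SR in auto)
    ultimately show "pcong ?R x y" unfolding pcong_def by blast
  qed
qed

text \<open>By finiteness two of the powers \<open>x ^ (p ^ i)\<close> and
  \<open>x ^ (p ^ j)\<close> agree modulo \<open>p\<close>. The Frobenius congruence makes the
  \<open>p ^ i\<close>-th power of \<open>x ^ (p ^ (j - i)) - x\<close> divisible by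
  \<open>p\<close>, so this difference is a nonunit and, the extension being unramified, divisible
  by \<open>p\<close>. The exponent depends on \<open>x\<close> but is bounded by \<open>N\<close>,
  whence the common exponent \<open>fact N\<close>.\<close>

lemma frobenius_fixes_residues:
  fixes K :: "'p::prime_card padic_closure set"
  assumes K: "finite_extension K" "unramified K"
  obtains d where "d \<ge> 1" "\<And>x. x \<in> K \<inter> IC \<Longrightarrow> pcong (K \<inter> IC) (x ^ (CARD('p) ^ d)) x"
proof -
  let ?R = "K \<inter> IC" and ?p = "CARD('p)"
  interpret R: p_subring ?R by (rule unramified_ring(1)[OF K])
  obtain \<alpha> :: "'p padic_closure \<Rightarrow> ('p padic_closure \<Rightarrow> 'p mod_ring)" where fa: "finite (\<alpha> ` ?R)"
    and a: "\<And>x y. x \<in> ?R \<Longrightarrow> y \<in> ?R \<Longrightarrow> \<alpha> x = \<alpha> y \<Longrightarrow> pcong ?R x y"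
    using residue_ring_finite[OF K] by blast
  define N where "N = card (\<alpha> ` ?R)"
  have p0: "?p > 0" using prime_gt_0_nat[OF prime_card] .
  have one: "\<exists>e\<in>{1..N}. pcong ?R (x ^ (?p ^ e)) x" if x: "x \<in> ?R" for x
  proof -
    have "\<not> inj_on (\<lambda>i. \<alpha> (x ^ (?p ^ i))) {0..N}"
    proof (rule pigeonhole)
      have "card ((\<lambda>i. \<alpha> (x ^ (?p ^ i))) ` {0..N}) \<le> N"
        unfolding N_def by (rule card_mono[OF fa]) (use R.R_power[OF x] in auto)
      then show "card ((\<lambda>i. \<alpha> (x ^ (?p ^ i))) ` {0..N}) < card {0..N}" by simp
    qed
    then obtain i0 j0 where ij0: "i0 \<in> {0..N}" "j0 \<in> {0..N}" "i0 \<noteq> j0" "\<alpha> (x ^ (?p ^ i0)) = \<alpha> (x ^ (?p ^ j0))"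
      unfolding inj_on_def by blast
    then obtain i j where ij: "i < j" "j \<le> N" "\<alpha> (x ^ (?p ^ i)) = \<alpha> (x ^ (?p ^ j))"
      by (metis atLeastAtMost_iff linorder_neqE_nat)
    define e where "e = j - i"
    have e: "e \<in> {1..N}" "j = e + i" using ij by (auto simp: e_def)
    let ?b = "x ^ (?p ^ e) - x"
    have b: "?b \<in> ?R" by (intro R.R_diff R.R_power x)
    have "pcong ?R ((x + ?b) ^ (?p ^ i)) (x ^ (?p ^ i) + ?b ^ (?p ^ i))" by (rule R.frobenius_add_power[OF x b])
    then have "pcong ?R (x ^ (?p ^ j)) (x ^ (?p ^ i) + ?b ^ (?p ^ i))"
      by (simp add: e(2) power_add power_mult)
    moreover have "pcong ?R (x ^ (?p ^ j)) (x ^ (?p ^ i))" by (rule a) (use ij R.R_power[OF x] in auto)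
    ultimately have "pcong ?R (x ^ (?p ^ i) + ?b ^ (?p ^ i)) (x ^ (?p ^ i))" using R.pcong_sym R.pcong_trans by blast
    then obtain r where r: "r \<in> ?R" "?b ^ (?p ^ i) = PP * r" unfolding pcong_def by auto
    have bI: "?b \<in> IC" using b by simp
    have "\<not> unitO (?b ^ (?p ^ i))" unfolding r(2) using r(1) by (intro not_unitO_PP_mult) simp
    moreover have "unitO (?b ^ k)" if "unitO ?b" for k
      using that by (induction k) (auto simp: unitO_one unitO_mult_iff[OF bI IC_power[OF bI]])
    ultimately have "\<not> unitO ?b" by blast
    then obtain s where "s \<in> ?R" "?b = PP * s" using unramified_ring(2)[OF K b] by blast
    then have "pcong ?R (x ^ (?p ^ e)) x" unfolding pcong_def by (intro bexI[of _ s]) (auto simp: algebra_simps)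
    then show ?thesis using e(1) by blast
  qed
  show thesis
  proof (rule that[of "fact N"])
    show "1 \<le> (fact N :: nat)" by simp
    fix x assume x: "x \<in> ?R"
    obtain e where e: "e \<in> {1..N}" "pcong ?R (x ^ (?p ^ e)) x" using one[OF x] by blast
    have it: "pcong ?R (x ^ (?p ^ (e * m))) x" for m
    proof (induction m)
      case (Suc m)
      have "pcong ?R ((x ^ (?p ^ (e * m))) ^ (?p ^ e)) (x ^ (?p ^ e))" by (rule R.pcong_power[OF Suc x])
      then have "pcong ?R (x ^ (?p ^ (e * Suc m))) (x ^ (?p ^ e))"
        by (simp add: power_mult[symmetric] power_add[symmetric] add.commute)
      then show ?case using e(2) R.pcong_trans by blast
    qed (simp add: R.pcong_refl)
    have "e dvd fact N" using e(1) by (intro dvd_fact) auto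
    then obtain m where "fact N = e * m" by (elim dvdE)
    then show "pcong ?R (x ^ (?p ^ fact N)) x" using it[of m] by simp
  qed
qed

lemma lead_coeff_monom_diff_var:
  assumes "q \<ge> 2"
  shows "lead_coeff (monom 1 q - [:0, 1:] :: 'b::idom poly) = 1"
proof -
  have "degree (monom 1 q - [:0, 1:] :: 'b poly) = q"
    using assms by (intro antisym degree_diff_le le_degree) (auto simp: degree_monom_eq coeff_pCons split: nat.split)
  then show ?thesis using assms by (simp add: coeff_pCons split: nat.split)
qed

text \<open>A root \<open>z\<close> of \<open>X ^ q - X\<close> near \<open>x\<close> is found in
  the closure only, so the remainder in \<open>x = z + PP * t\<close> is not known to lie in
  \<open>K\<close> and cannot be expanded again. However, \<open>z\<close> agrees with
  \<open>x ^ (q ^ m)\<close> modulo \<open>p ^ (m + 1)\<close>, and \<open>x - x ^ (q ^ m)\<close>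
  is \<open>p\<close> times an element of \<open>K \<inter> IC\<close>, to which the induction
  applies.\<close>

lemma unramified_approx:
  fixes K :: "'p::prime_card padic_closure set"
  assumes K: "finite_extension K" "unramified K"
  obtains d where "d \<ge> 1" "\<And>x j. x \<in> K \<inter> IC \<Longrightarrow> \<exists>w\<in>Wit (CARD('p) ^ d). \<exists>y\<in>IC. x = w + PP ^ j * y"
proof -
  let ?R = "K \<inter> IC" and ?p = "CARD('p)"
  interpret R: p_subring ?R by (rule unramified_ring(1)[OF K])
  obtain d where d: "d \<ge> 1" and fr: "\<And>x. x \<in> ?R \<Longrightarrow> pcong ?R (x ^ (?p ^ d)) x"
    using frobenius_fixes_residues[OF K] by blast
  let ?q = "?p ^ d"
  let ?W = "Wit ?q :: 'p padic_closure set"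
  interpret W: p_subring ?W by (rule Wit_subring)
  have q: "?q \<ge> 2" using d prime_ge_2_nat[OF prime_card[where 'a='p]] power_increasing[of 1 d ?p] by simp
  have frm: "pcong ?R (x ^ (?q ^ m)) x" if x: "x \<in> ?R" for x m
  proof (induction m)
    case (Suc m)
    have "pcong ?R ((x ^ (?q ^ m)) ^ ?q) (x ^ ?q)" by (rule R.pcong_power[OF Suc x])
    then show ?case using fr[OF x] R.pcong_trans unfolding power_Suc2[of ?q] power_mult[of x] by blast
  qed (simp add: R.pcong_refl)
  have teich: "\<exists>z t. z ^ ?q = z \<and> z \<in> IC \<and> t \<in> IC \<and> x = z + PP * t" if x: "x \<in> ?R" for x
  proof -
    let ?f = "monom 1 ?q - [:0, 1:] :: 'p padic_closure poly"
    have lc: "lead_coeff ?f = 1" by (rule lead_coeff_monom_diff_var[OF q])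
    then have "?f \<noteq> 0" by (metis leading_coeff_0_iff zero_neq_one)
    then obtain A where A: "?f = Polynomial.smult (lead_coeff ?f) (\<Prod>x\<in>#A. [:- x, 1:])"
      using alg_closed_imp_factorization by blast
    then have fA: "?f = (\<Prod>x\<in>#A. [:- x, 1:])" unfolding lc by simp
    have root: "a ^ ?q = a" if "a \<in># A" for a
    proof -
      have "poly ?f a = 0" unfolding fA using that by (auto simp: poly_prod_mset prod_mset_zero_iff)
      then show ?thesis by (simp add: poly_monom)
    qed
    have rootI: "a \<in> IC" if "a \<in># A" for a
      using Wit_IC[OF q] zm.span_base[of a "{z. z ^ ?q = z}"] root[OF that] by (auto simp: Wit_def)
    have xI: "x \<in> IC" using x by simp
    obtain r where r: "r \<in> ?R" "x ^ ?q = x + PP * r" using fr[OF x] unfolding pcong_def by blast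
    have fx: "poly ?f x = PP * r" using r(2) by (simp add: poly_monom)
    \<comment> \<open>The product of all \<open>x - a\<close> is \<open>x ^ q - x = PP * r\<close>,
      a nonunit, so not all of the factors are units.\<close>
    have "\<exists>a\<in>#A. \<not> unitO (x - a)"
    proof (rule ccontr)
      assume "\<not> ?thesis"
      then have all: "\<And>a. a \<in># A \<Longrightarrow> unitO (x - a)" by blast
      have "unitO (\<Prod>a\<in>#A'. x - a) \<and> (\<Prod>a\<in>#A'. x - a) \<in> IC" if "A' \<subseteq># A" for A'
        using that
      proof (induction A')
        case (add b A')
        then have b: "b \<in># A" "A' \<subseteq># A" by (auto dest: mset_subset_eq_insertD subset_mset.less_imp_le)
        have "x - b \<in> IC" using rootI[OF b(1)] xI by (rule IC_diff[rotated])
        then show ?case using add.IH[OF b(2)] all[OF b(1)] by (simp add: unitO_mult_iff IC_mult)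
      qed (simp add: unitO_one)
      then have "unitO (\<Prod>a\<in>#A. x - a)" by blast
      also have "(\<Prod>a\<in>#A. x - a) = poly ?f x" unfolding fA by (simp add: poly_prod_mset)
      finally show False unfolding fx using not_unitO_PP_mult r(1) by blast
    qed
    then obtain z where z: "z \<in># A" "\<not> unitO (x - z)" by blast
    let ?\<delta> = "x - z"
    have zI: "z \<in> IC" and dI: "?\<delta> \<in> IC" using rootI[OF z(1)] xI IC_diff by auto
    \<comment> \<open>This makes \<open>?\<delta> ^ q\<close> congruent to \<open>?\<delta>\<close>
      modulo \<open>p\<close>; as \<open>1 - ?\<delta> ^ (q - 1)\<close> is a unit, the nonunit
      \<open>?\<delta>\<close> is divisible by \<open>p\<close>.\<close>
    have "pcong IC ((z + ?\<delta>) ^ ?q) (z ^ ?q + ?\<delta> ^ ?q)" by (rule IC.frobenius_add_power[OF zI dI])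
    then obtain s where s: "s \<in> IC" "x ^ ?q = z + ?\<delta> ^ ?q + PP * s" unfolding pcong_def root[OF z(1)] by auto
    define m where "m = ?q - 2"
    have qm: "?q = Suc (Suc m)" using q by (simp add: m_def)
    have "\<not> unitO (?\<delta> ^ Suc m)" using unitO_mult_iff[OF dI IC_power[OF dI], of m] z(2) by simp
    then have "unitO (1 - ?\<delta> ^ Suc m)" using unitO_one_minus IC_power[OF dI] by blast
    then obtain v where v: "v \<in> IC" "(1 - ?\<delta> ^ Suc m) * v = 1" by (auto simp: unitO_def)
    have "?\<delta> * (1 - ?\<delta> ^ Suc m) = PP * (s - r)"
    proof -
      have "z + ?\<delta> ^ Suc (Suc m) + PP * s = x + PP * r" using s(2) r(2) unfolding qm by simp
      then show ?thesis by (simp add: algebra_simps)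
    qed
    then have "?\<delta> * ((1 - ?\<delta> ^ Suc m) * v) = PP * ((s - r) * v)" by (simp only: mult.assoc[symmetric])
    then have "x = z + PP * ((s - r) * v)" unfolding v(2) by (simp add: algebra_simps)
    moreover have "(s - r) * v \<in> IC" using s(1) r(1) v(1) by (intro IC_mult IC_diff) auto
    ultimately show ?thesis using root[OF z(1)] zI by blast
  qed
  have approx: "\<exists>w\<in>?W. \<exists>y\<in>IC. x = w + PP ^ m * y" if "x \<in> ?R" for x m
    using that
  proof (induction m arbitrary: x)
    case 0
    then show ?case using W.R_0 by (intro bexI[of _ 0] bexI[of _ x]) auto
  next
    case (Suc m)
    obtain z t where z: "z ^ ?q = z" "z \<in> IC" "t \<in> IC" "x = z + PP * t" using teich[OF Suc.prems] by blast
    have xI: "x \<in> IC" using Suc.prems by simp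
    obtain s where s: "s \<in> IC" "x ^ (?p ^ (d * m)) = z ^ (?p ^ (d * m)) + PP ^ Suc (d * m) * s"
      using power_CARD_power_lift[OF xI z(2-4), of "d * m"] by blast
    have zz: "z ^ (?q ^ k) = z" for k by (induction k) (simp_all add: power_mult z(1))
    have dm: "Suc (d * m) = Suc m + (d - 1) * m" using d by (cases d) auto
    have xq: "x ^ (?q ^ m) = z + PP ^ Suc m * (PP ^ ((d - 1) * m) * s)"
      using s(2) zz[of m] unfolding power_mult[symmetric] dm power_add by (simp add: mult.assoc)
    obtain y where y: "y \<in> ?R" "x = x ^ (?q ^ m) + PP * y"
      using R.pcong_sym[OF frm[OF Suc.prems, of m]] unfolding pcong_def by blast
    obtain w u where w: "w \<in> ?W" "u \<in> IC" "y = w + PP ^ m * u" using Suc.IH[OF y(1)] by blast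
    have "x = (z + PP * w) + PP ^ Suc m * (PP ^ ((d - 1) * m) * s + u)"
      using y(2) unfolding xq w(3) by (simp add: algebra_simps)
    moreover have "z + PP * w \<in> ?W"
      by (intro W.R_add W.R_mult W.R_PP w) (simp add: Wit_def zm.span_base z(1))
    moreover have "PP ^ ((d - 1) * m) * s + u \<in> IC" by (intro IC_add IC_mult IC_power IC_PP s w)
    ultimately show ?case by blast
  qed
  show thesis using that[OF d approx] by blast
qed

section \<open>Measurability of the eigenvalue count\<close>

text \<open>Compactness of \<open>\<int>\<^sub>p\<close>: the residues of a sequence are constant along nested infinite sets of indices.\<close>

lemma padic_sequence_cluster:
  fixes c :: "nat \<Rightarrow> 'i \<Rightarrow> 'p::prime_card padic_int"
  assumes I: "finite I"
  obtains z where "\<And>k. \<exists>j\<ge>k. \<forall>i\<in>I. pp ^ k dvd z i - c j i"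
proof -
  define cls where "cls k j = restrict (\<lambda>i. residue (c j i) k) I" for k j
  have fin: "finite (cls k ` J)" for k J
  proof (rule finite_subset)
    show "cls k ` J \<subseteq> PiE I (\<lambda>_. {0..<int CARD('p) ^ k})"
      unfolding cls_def using residue_bounds by (auto simp: PiE_iff)
    show "finite (PiE I (\<lambda>_. {0..<int CARD('p) ^ k}))" by (intro finite_PiE I) simp
  qed
  have refine: "\<exists>J'. infinite J' \<and> J' \<subseteq> J \<and> (\<forall>a\<in>J'. \<forall>b\<in>J'. cls k a = cls k b)" if J: "infinite J" for J k
  proof -
    obtain a where a: "a \<in> J" "infinite {b \<in> J. cls k b = cls k a}"
      using pigeonhole_infinite[OF J fin[of k J]] by blast
    show ?thesis by (intro exI[of _ "{b \<in> J. cls k b = cls k a}"]) (use a in auto)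
  qed
  define Good where "Good k J \<longleftrightarrow> infinite J \<and> (\<forall>a\<in>J. \<forall>b\<in>J. cls k a = cls k b)" for k J
  have "\<exists>J. Good 0 J" using refine[of UNIV 0] unfolding Good_def by auto
  moreover have "\<exists>J'. Good (Suc k) J' \<and> J' \<subseteq> J" if "Good k J" for k J
    using refine[of J "Suc k"] that unfolding Good_def by blast
  ultimately obtain J where J: "\<And>k. Good k (J k)" "\<And>k. J (Suc k) \<subseteq> J k"
    using dependent_nat_choice[of Good "\<lambda>_ J J'. J' \<subseteq> J"] by metis
  have "\<exists>s\<in>J k. k \<le> s" for k using J(1)[of k] unfolding Good_def infinite_nat_iff_unbounded_le by auto
  then obtain s where s: "\<And>k. s k \<in> J k" "\<And>k. k \<le> s k" by metis
  have step: "pp ^ k dvd c (s (Suc k)) i - c (s k) i" if "i \<in> I" for k i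
  proof -
    have "cls k (s (Suc k)) = cls k (s k)" using J s(1) unfolding Good_def by blast
    from fun_cong[OF this, of i] show ?thesis using that by (simp add: cls_def residue_eq_iff_dvd)
  qed
  have "\<exists>z. \<forall>k. pp ^ k dvd z - c (s k) i" if "i \<in> I" for i
    using padic_complete[of "\<lambda>k. c (s k) i", OF step[OF that]] by metis
  then obtain z where "\<And>i k. i \<in> I \<Longrightarrow> pp ^ k dvd z i - c (s k) i" by metis
  then show thesis using s(2) by (intro that[of z]) blast
qed

text \<open>Compactness of \<open>Wit q\<close> is inherited from that of
  \<open>\<int>\<^sub>p\<close> through coordinates with respect to the finitely many solutions of
  \<open>z ^ q = z\<close>; any choice of coordinates will do.\<close>

lemma Wit_sequence_cluster:
  fixes w :: "nat \<Rightarrow> 'i \<Rightarrow> 'p::prime_card padic_closure"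
  assumes q: "q \<ge> 2" and I: "finite I" and w: "\<And>j i. i \<in> I \<Longrightarrow> w j i \<in> Wit q"
  obtains v where "\<And>i. i \<in> I \<Longrightarrow> v i \<in> Wit q" "\<And>k. \<exists>j\<ge>k. \<forall>i\<in>I. \<exists>y\<in>IC. w j i = v i + PP ^ k * y"
proof -
  let ?Z = "{z :: 'p padic_closure. z ^ q = z}"
  have fZ: "finite ?Z" by (rule finite_roots_unity[OF q])
  have ZI: "z \<in> IC" if "z \<in> ?Z" for z
    using Wit_IC[OF q] zm.span_base[OF that] by (auto simp: Wit_def)
  have "\<exists>c. w j i = (\<Sum>z\<in>?Z. oz (c z) * z)" if "i \<in> I" for j i
    using w[OF that, of j] unfolding Wit_def zm.span_finite[OF fZ] by blast
  then have "\<forall>j i. \<exists>c. i \<in> I \<longrightarrow> w j i = (\<Sum>z\<in>?Z. oz (c z) * z)" by blast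
  then have "\<exists>c. \<forall>j i. i \<in> I \<longrightarrow> w j i = (\<Sum>z\<in>?Z. oz (c j i z) * z)" unfolding choice_iff .
  then obtain c where c: "\<And>j i. i \<in> I \<Longrightarrow> w j i = (\<Sum>z\<in>?Z. oz (c j i z) * z)" by blast
  obtain e where e: "\<And>k. \<exists>j\<ge>k. \<forall>x\<in>I \<times> ?Z. pp ^ k dvd e x - c j (fst x) (snd x)"
    using padic_sequence_cluster[of "I \<times> ?Z" "\<lambda>j x. c j (fst x) (snd x)"] I fZ by blast
  define v where "v i = (\<Sum>z\<in>?Z. oz (e (i, z)) * z)" for i
  show thesis
  proof (rule that[of v])
    show "v i \<in> Wit q" for i
      unfolding v_def Wit_def by (intro zm.span_sum zm.span_scale zm.span_base)
    fix k
    obtain j where j: "j \<ge> k" "\<And>i z. i \<in> I \<Longrightarrow> z \<in> ?Z \<Longrightarrow> pp ^ k dvd e (i, z) - c j i z" using e[of k] by force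
    have "\<exists>y\<in>IC. w j i = v i + PP ^ k * y" if i: "i \<in> I" for i
    proof -
      have "\<exists>f. e (i, z) - c j i z = pp ^ k * f" if "z \<in> ?Z" for z using j(2)[OF i that] by (elim dvdE) blast
      then have "\<exists>f. \<forall>z\<in>?Z. e (i, z) - c j i z = pp ^ k * f z" by (intro bchoice) blast
      then obtain f where f: "\<And>z. z \<in> ?Z \<Longrightarrow> e (i, z) - c j i z = pp ^ k * f z" by blast
      have "w j i = v i + (\<Sum>z\<in>?Z. oz (c j i z - e (i, z)) * z)"
        unfolding c[OF i] v_def by (simp add: sum_subtractf left_diff_distrib)
      also have "(\<Sum>z\<in>?Z. oz (c j i z - e (i, z)) * z) = (\<Sum>z\<in>?Z. PP ^ k * (oz (- f z) * z))"
      proof (intro sum.cong refl)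
        fix z assume "z \<in> ?Z"
        then have "c j i z - e (i, z) = pp ^ k * (- f z)" using f[of z] by (simp add: algebra_simps)
        then show "oz (c j i z - e (i, z)) * z = PP ^ k * (oz (- f z) * z)"
          by (simp only: oz.hom_mult oz.hom_power PP_def mult.assoc)
      qed
      also have "\<dots> = PP ^ k * (\<Sum>z\<in>?Z. oz (- f z) * z)" by (rule sum_distrib_left[symmetric])
      finally have "w j i = v i + PP ^ k * (\<Sum>z\<in>?Z. oz (- f z) * z)" .
      moreover have "(\<Sum>z\<in>?Z. oz (- f z) * z) \<in> IC" by (intro IC_sum IC_mult IC_oz ZI)
      ultimately show ?thesis by blast
    qed
    then show "\<exists>j\<ge>k. \<forall>i\<in>I. \<exists>y\<in>IC. w j i = v i + PP ^ k * y" using j(1) by blast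
  qed
qed

lemma CARD_power_ge_2: "d \<ge> 1 \<Longrightarrow> CARD('p::prime_card) ^ d \<ge> 2"
  using prime_ge_2_nat[OF prime_card[where 'a='p]] power_increasing[of 1 d "CARD('p)"] by simp

text \<open>Approximations of \<open>x\<close> in \<open>Wit q\<close> of every precision cluster at
  a point of this compact ring, and \<open>IC_separated\<close> identifies that point with
  \<open>x\<close>.\<close>

lemma unramified_in_Wit:
  fixes K :: "'p::prime_card padic_closure set"
  assumes K: "finite_extension K" "unramified K"
  obtains d where "d \<ge> 1" "K \<inter> IC \<subseteq> Wit (CARD('p) ^ d)"
proof -
  obtain d where d: "d \<ge> 1" "\<And>x j. x \<in> K \<inter> IC \<Longrightarrow> \<exists>w\<in>Wit (CARD('p) ^ d). \<exists>y\<in>IC. x = w + PP ^ j * y"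
    using unramified_approx[OF K] by metis
  have q: "CARD('p) ^ d \<ge> 2" using d(1) by (rule CARD_power_ge_2)
  have "x \<in> Wit (CARD('p) ^ d)" if x: "x \<in> K \<inter> IC" for x
  proof -
    have "\<exists>w. \<exists>y\<in>IC. w \<in> Wit (CARD('p) ^ d) \<and> x = w + PP ^ j * y" for j using d(2)[OF x, of j] by blast
    then obtain w y where w: "\<And>j. w j \<in> Wit (CARD('p) ^ d)" "\<And>j. y j \<in> IC" "\<And>j. x = w j + PP ^ j * y j" by metis
    obtain v where v: "\<And>i. i \<in> {()} \<Longrightarrow> v i \<in> Wit (CARD('p) ^ d)"
        "\<And>k. \<exists>j\<ge>k. \<forall>i\<in>{()}. \<exists>y\<in>IC. w j = v i + PP ^ k * y"
      using Wit_sequence_cluster[OF q, of "{()}" "\<lambda>j _. w j"] w(1) by blast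
    have vI: "v () \<in> IC" and xI: "x \<in> IC" using v(1) Wit_IC[OF q] x by auto
    have "x - v () = 0"
    proof (rule IC_separated)
      show "x - v () \<in> IC" using xI vI by (rule IC_diff)
      fix k
      obtain j u where j: "j \<ge> k" "u \<in> IC" "w j = v () + PP ^ k * u" using v(2)[of k] by blast
      have pj: "PP ^ j = PP ^ k * PP ^ (j - k)" using j(1) by (simp add: power_add[symmetric])
      have "x - v () = PP ^ k * u + PP ^ j * y j" using w(3)[of j] unfolding j(3) by simp
      then have "x - v () = PP ^ k * (u + PP ^ (j - k) * y j)" unfolding pj by (simp only: distrib_left mult.assoc)
      moreover have "u + PP ^ (j - k) * y j \<in> IC" by (intro IC_add IC_mult IC_power IC_PP j w)
      ultimately show "\<exists>w\<in>IC. x - v () = PP ^ k * w" by blast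
    qed
    then show ?thesis using v(1) by simp
  qed
  then show thesis using that d(1) by blast
qed

text \<open>Iterating \<open>z ^ q = z\<close>. With products of exponents this makes the rings
  \<open>Wit\<close> a directed family.\<close>

lemma Wit_mono_dvd:
  assumes "d dvd e"
  shows "Wit (CARD('p) ^ d) \<subseteq> (Wit (CARD('p) ^ e) :: 'p::prime_card padic_closure set)"
  unfolding Wit_def
proof (rule zm.span_mono, safe)
  fix z :: "'p padic_closure" assume z: "z ^ (CARD('p) ^ d) = z"
  obtain m where m: "e = d * m" using assms by (elim dvdE)
  have "z ^ ((CARD('p) ^ d) ^ k) = z" for k by (induction k) (simp_all add: power_mult z)
  then show "z ^ (CARD('p) ^ e) = z" unfolding m power_mult .
qed

lemma Wit_common:
  assumes "finite S" "S \<subseteq> IC \<inter> (maximal_unramified :: 'p::prime_card padic_closure set)"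
  shows "\<exists>d\<ge>1. S \<subseteq> Wit (CARD('p) ^ d)"
  using assms
proof (induction S rule: finite_induct)
  case empty
  then show ?case by auto
next
  case (insert x S)
  then obtain d where d: "d \<ge> 1" "S \<subseteq> Wit (CARD('p) ^ d)" by auto
  obtain K where K: "finite_extension K" "unramified K" "x \<in> K" "x \<in> IC"
    using insert.prems unfolding maximal_unramified_def by auto
  obtain e where e: "e \<ge> 1" "K \<inter> IC \<subseteq> Wit (CARD('p) ^ e)" using unramified_in_Wit[OF K(1,2)] .
  have "insert x S \<subseteq> Wit (CARD('p) ^ (d * e))"
    using d(2) e(2) K(3,4) Wit_mono_dvd[of d "d * e"] Wit_mono_dvd[of e "d * e"] by auto
  moreover have "d * e \<ge> 1" using d e by simp
  ultimately show ?case by blast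
qed

section \<open>Eigenvalues as a multiset\<close>

definition evs :: "'p::prime_card padic_int mat \<Rightarrow> 'p padic_closure multiset" where
  "evs A = proots (map_poly oz (char_poly A))"

lemma proots_linear_product: "proots (\<Prod>x\<in>#A. [:- x, 1:]) = (A :: 'a::idom multiset)"
proof (induction A)
  case (add x A)
  have "(\<Prod>x\<in>#A. [:- x, 1:]) \<noteq> 0" by (auto simp: prod_mset_zero_iff)
  then have "proots ([:- x, 1:] * (\<Prod>x\<in>#A. [:- x, 1:])) = add_mset x A"
    using add by (subst proots_mult) (simp_all only: proots_linear_factor, simp_all)
  then show ?case by (simp only: image_mset_add_mset prod_mset.add_mset)
qed simp

lemma degree_linear_product: "degree (\<Prod>x\<in>#A. [:- x, 1 :: 'a::idom:]) = size A"
proof (induction A)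
  case (add x A)
  have "(\<Prod>x\<in>#A. [:- x, 1:]) \<noteq> 0" by (auto simp: prod_mset_zero_iff)
  then have "degree ([:- x, 1:] * (\<Prod>x\<in>#A. [:- x, 1:])) = size (add_mset x A)"
    using add by (subst degree_mult_eq) simp_all
  then show ?case by (simp only: image_mset_add_mset prod_mset.add_mset)
qed simp

lemma size_proots_alg_closed: "size (proots (f :: 'a::alg_closed_field poly)) = degree f"
proof (cases "f = 0")
  case False
  then obtain A where A: "f = Polynomial.smult (lead_coeff f) (\<Prod>x\<in>#A. [:- x, 1:])"
    using alg_closed_imp_factorization by blast
  have c: "lead_coeff f \<noteq> 0" using False by simp
  have "proots f = A" using proots_smult[OF c] proots_linear_product A by metis
  moreover have "degree f = size A" using degree_smult_eq[of "lead_coeff f"] c degree_linear_product A by metis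
  ultimately show ?thesis by simp
qed simp

lemma char_poly_oz: "A \<in> carrier_mat n n \<Longrightarrow> char_poly (map_mat oz A) = map_poly oz (char_poly A)"
  by (rule oz.char_poly_hom)

lemma eigenvalue_count_evs:
  fixes A :: "'p::prime_card padic_int mat"
  assumes A: "A \<in> carrier_mat n n"
  shows "eigenvalue_count U A = size (filter_mset (\<lambda>x. x \<in> U) (evs A))"
proof -
  let ?f = "map_poly oz (char_poly A)"
  have A': "map_mat oz A \<in> carrier_mat n n" using A by simp
  have f: "char_poly (map_mat oz A) = ?f" by (rule char_poly_oz[OF A])
  have f0: "?f \<noteq> 0" using char_poly_nonzero[OF A'] unfolding f .
  have sp: "spectrum (map_mat oz A) = {x. poly ?f x = 0}"
    unfolding spectrum_def using eigenvalue_root_char_poly[OF A'] f by auto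
  have "size (filter_mset (\<lambda>x. x \<in> U) (evs A)) = (\<Sum>x\<in>set_mset (filter_mset (\<lambda>x. x \<in> U) (evs A)). count (filter_mset (\<lambda>x. x \<in> U) (evs A)) x)"
    by (rule size_multiset_overloaded_eq)
  also have "\<dots> = (\<Sum>x\<in>{x. poly ?f x = 0} \<inter> U. Polynomial.order x ?f)"
    using f0 by (intro sum.cong) (auto simp: evs_def)
  finally show ?thesis unfolding eigenvalue_count_def Let_def f sp by simp
qed

lemma size_evs: "A \<in> carrier_mat n n \<Longrightarrow> size (evs A) = n"
  unfolding evs_def size_proots_alg_closed by (simp add: degree_char_poly)

lemma evs_IC: "A \<in> carrier_mat n n \<Longrightarrow> x \<in># evs A \<Longrightarrow> x \<in> IC"
  using char_poly_root_IC[of A n x] char_poly_nonzero[of A n] by (auto simp: evs_def)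

lemma evs_intertwine:
  fixes A :: "'p::prime_card padic_int mat"
  assumes A: "A \<in> carrier_mat n n" and B: "B \<in> carrier_mat n n" and G: "G \<in> ZGL n" and eq: "A * G = G * B"
  shows "evs A = evs B"
proof -
  obtain H where H: "H \<in> carrier_mat n n" "G * H = 1\<^sub>m n" "H * G = 1\<^sub>m n" using ZGL_inverse[OF G] .
  have Gc: "G \<in> carrier_mat n n" and Hc: "H \<in> carrier_mat n n" using ZGL_carrier[OF G] H(1) by auto
  have "A = A * (G * H)" using A H(2) by simp
  also have "\<dots> = (A * G) * H" using assoc_mult_mat[OF A Gc Hc] by simp
  finally have "A = G * B * H" unfolding eq .
  then have "similar_mat A B" unfolding similar_mat_def similar_mat_wit_def
    using A B Gc Hc H(2,3) by (intro exI[of _ G] exI[of _ H]) (auto simp: Let_def)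
  then show ?thesis unfolding evs_def by (simp add: char_poly_similar)
qed

lemma evs_diag2:
  fixes B :: "'p::prime_card padic_int mat"
  assumes B: "B \<in> carrier_mat a a" and C: "C \<in> carrier_mat b b"
  shows "evs (diag2 B C) = evs B + evs C"
proof -
  have "char_poly (diag2 B C) = char_poly B * char_poly C"
    using char_poly_four_block_upper[OF B _ C, of "0\<^sub>m a b"] B C by simp
  moreover have "map_poly oz (char_poly B) \<noteq> 0" "map_poly oz (char_poly C) \<noteq> 0"
    using char_poly_nonzero[OF B] char_poly_nonzero[OF C] by auto
  ultimately show ?thesis unfolding evs_def by (simp add: mz.hom_mult proots_mult)
qed

lemma eigenvalue_count_le: "A \<in> carrier_mat n n \<Longrightarrow> eigenvalue_count U A \<le> n"
  using size_filter_mset_lesseq[of "\<lambda>x. x \<in> U" "evs A"] by (simp add: eigenvalue_count_evs size_evs)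

lemma eigenvalue_count_compl:
  assumes "A \<in> carrier_mat n n"
  shows "eigenvalue_count U A + eigenvalue_count (- U) A = n"
proof -
  have "size (evs A) = size (filter_mset (\<lambda>x. x \<in> U) (evs A)) + size (filter_mset (\<lambda>x. \<not> x \<in> U) (evs A))"
    by (metis multiset_partition size_union)
  then show ?thesis by (simp add: eigenvalue_count_evs[OF assms] size_evs[OF assms])
qed

section \<open>Polynomials with integral coefficients: division and congruences\<close>

definition ICp :: "'p::prime_card padic_closure poly \<Rightarrow> bool" where
  "ICp f \<longleftrightarrow> (\<forall>i. coeff f i \<in> IC)"

lemma ICp_add: "ICp f \<Longrightarrow> ICp g \<Longrightarrow> ICp (f + g)"
  by (simp add: ICp_def IC_add)

lemma ICp_uminus: "ICp f \<Longrightarrow> ICp (- f)"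
  by (simp add: ICp_def IC_uminus)

lemma ICp_mult: "ICp f \<Longrightarrow> ICp g \<Longrightarrow> ICp (f * g)"
  by (simp add: ICp_def Polynomial.coeff_mult IC_sum IC_mult)

lemma ICp_0: "ICp 0"
  by (simp add: ICp_def)

lemma ICp_linear: "a \<in> IC \<Longrightarrow> ICp [:- a, 1:]"
  by (auto simp: ICp_def coeff_pCons IC_uminus split: nat.split)

lemma ICp_monom: "c \<in> IC \<Longrightarrow> ICp (monom c i)"
  by (auto simp: ICp_def)

lemma ICp_oz: "ICp (map_poly oz f)"
  by (auto simp: ICp_def coeff_map_poly IC_oz)

lemma ICp_prod: "(\<And>i. i \<in> I \<Longrightarrow> ICp (f i)) \<Longrightarrow> ICp (prod f I)"
proof (induction I rule: infinite_finite_induct)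
  case (insert x F)
  then show ?case by (simp add: ICp_mult)
qed (auto simp: ICp_def coeff_pCons one_pCons split: nat.split)

text \<open>Long division by a monic polynomial divides no coefficient, so integrality is
  preserved.\<close>

lemma ICp_division:
  fixes f P :: "'p::prime_card padic_closure poly"
  assumes P: "ICp P" "lead_coeff P = 1" and f: "ICp f"
  shows "\<exists>a b. ICp a \<and> ICp b \<and> f = P * a + b \<and> (b = 0 \<or> degree b < degree P)"
  using f
proof (induction "degree f" arbitrary: f rule: less_induct)
  case less
  show ?case
  proof (cases "f = 0 \<or> degree f < degree P")
    case True
    then show ?thesis using less.prems by (intro exI[of _ 0] exI[of _ f]) (auto simp: ICp_0)
  next
    case False
    let ?m = "monom (lead_coeff f) (degree f - degree P)"
    define g where "g = f - P * ?m"
    have m: "ICp ?m" using less.prems by (intro ICp_monom) (simp add: ICp_def)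
    have g: "ICp g" unfolding g_def diff_conv_add_uminus by (intro ICp_add ICp_uminus ICp_mult P m less.prems)
    have f0: "f \<noteq> 0" "?m \<noteq> 0" "P \<noteq> 0" using False P by auto
    have dm: "degree (P * ?m) = degree f"
    proof -
      have "degree ?m = degree f - degree P" by (rule degree_monom_eq) (use f0(1) in simp)
      then show ?thesis using degree_mult_eq[OF f0(3,2)] False by linarith
    qed
    have "lead_coeff (P * ?m) = lead_coeff f" by (simp only: lead_coeff_mult P(2) lead_coeff_monom mult_1_left)
    then have c0: "coeff g (degree f) = 0" unfolding g_def dm by simp
    have dg: "degree g \<le> degree f" unfolding g_def by (intro degree_diff_le) (simp_all add: dm)
    show ?thesis
    proof (cases "g = 0")
      case True
      then show ?thesis by (intro exI[of _ ?m] exI[of _ 0]) (use m in \<open>simp add: g_def ICp_0\<close>)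
    next
      case g0: False
      have "degree g < degree f" using c0 dg g0 by (metis le_neq_implies_less leading_coeff_0_iff)
      from less.hyps[OF this g] obtain a b where ab: "ICp a" "ICp b" "g = P * a + b" "b = 0 \<or> degree b < degree P" by blast
      have "f = P * (?m + a) + b" using ab(3) unfolding g_def by (simp add: algebra_simps)
      then show ?thesis using ab ICp_add[OF m ab(1)] by blast
    qed
  qed
qed

lemma ICp_mod:
  assumes "ICp P" "lead_coeff P = 1" "ICp f"
  shows "ICp (f mod P)"
proof -
  obtain a b where ab: "ICp b" "f = P * a + b" "b = 0 \<or> degree b < degree P" using ICp_division[OF assms] by blast
  have "f mod P = b mod P" unfolding ab(2) by simp
  also have "b mod P = b" using ab(3) by (auto simp: mod_poly_less)
  finally show ?thesis using ab(1) by simp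
qed

definition pcp :: "nat \<Rightarrow> 'p::prime_card padic_closure poly \<Rightarrow> 'p padic_closure poly \<Rightarrow> bool" where
  "pcp m f g \<longleftrightarrow> (\<exists>s. ICp s \<and> f = g + Polynomial.smult (PP ^ m) s)"

lemma pcp_mult:
  assumes "pcp m f f'" "pcp m g g'" "ICp f'" "ICp g"
  shows "pcp m (f * g) (f' * g')"
proof -
  obtain s t where s: "ICp s" "f = f' + Polynomial.smult (PP ^ m) s" and t: "ICp t" "g = g' + Polynomial.smult (PP ^ m) t"
    using assms unfolding pcp_def by blast
  have "f * g = f' * g + Polynomial.smult (PP ^ m) (s * g)" unfolding s(2) by (simp add: distrib_right)
  also have "f' * g = f' * g' + Polynomial.smult (PP ^ m) (f' * t)" unfolding t(2) by (simp add: distrib_left)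
  finally have "f * g = f' * g' + Polynomial.smult (PP ^ m) (f' * t + s * g)" by (simp add: smult_add_right)
  moreover have "ICp (f' * t + s * g)" by (intro ICp_add ICp_mult assms s t)
  ultimately show ?thesis unfolding pcp_def by blast
qed

lemma pcp_prod:
  assumes "finite I" "\<And>i. i \<in> I \<Longrightarrow> ICp (f i)" "\<And>i. i \<in> I \<Longrightarrow> ICp (g i)" "\<And>i. i \<in> I \<Longrightarrow> pcp m (f i) (g i)"
  shows "pcp m (prod f I) (prod g I)"
  using assms
proof (induction I rule: finite_induct)
  case empty
  then show ?case by (auto simp: pcp_def intro: exI[of _ 0] ICp_0)
next
  case (insert x F)
  then show ?case by (simp add: pcp_mult ICp_prod)
qed

text \<open>The family \<open>w\<close> may contain repetitions, so divisibility by the product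
  counts eigenvalues in \<open>Wit q\<close> with multiplicity.\<close>

definition dvd_set :: "nat \<Rightarrow> nat \<Rightarrow> nat \<Rightarrow> 'p::prime_card padic_int mat set" where
  "dvd_set n k q = {A \<in> carrier_mat n n. \<exists>w. (\<forall>i<k. w i \<in> Wit q) \<and> (\<Prod>i<k. [:- w i, 1:]) dvd map_poly oz (char_poly A)}"

text \<open>
  A factor of the characteristic polynomial with roots in the compact set \<open>Wit q\<close>
  survives a \<open>p\<close>-adic limit, because the remainders vanish modulo every power of \<open>p\<close>.
\<close>

lemma dvd_set_closed:
  fixes A :: "'p::prime_card padic_int mat"
  assumes q: "q \<ge> 2" and A: "A \<in> carrier_mat n n" and near: "\<And>j. \<exists>B\<in>dvd_set n k q. mcong (pp ^ j) A B"
  shows "A \<in> dvd_set n k q"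
proof -
  have "\<exists>B w. B \<in> carrier_mat n n \<and> (\<forall>i<k. w i \<in> Wit q) \<and> (\<Prod>i<k. [:- w i, 1:]) dvd map_poly oz (char_poly B) \<and> mcong (pp ^ j) A B" for j
    using near[of j] unfolding dvd_set_def by blast
  then obtain B w where B: "\<And>j. B j \<in> carrier_mat n n" "\<And>j. mcong (pp ^ j) A (B j)" and
      w: "\<And>j i. i < k \<Longrightarrow> w j i \<in> Wit q" "\<And>j. (\<Prod>i<k. [:- w j i, 1:]) dvd map_poly oz (char_poly (B j))" by metis
  obtain v where v: "\<And>i. i \<in> {..<k} \<Longrightarrow> v i \<in> Wit q" "\<And>m. \<exists>j\<ge>m. \<forall>i\<in>{..<k}. \<exists>y\<in>IC. w j i = v i + PP ^ m * y"
    using Wit_sequence_cluster[OF q, of "{..<k}" w] w(1) by auto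
  have vI: "v i \<in> IC" if "i < k" for i using v(1)[of i] that Wit_IC[OF q] by auto
  have wI: "w j i \<in> IC" if "i < k" for j i using w(1)[OF that] Wit_IC[OF q] by auto
  define P where "P = (\<Prod>i<k. [:- v i, 1:])"
  let ?f = "map_poly oz (char_poly A)"
  have P: "ICp P" unfolding P_def by (intro ICp_prod ICp_linear vI) simp
  have lP: "lead_coeff P = 1" unfolding P_def by (simp add: lead_coeff_prod)
  have fP: "ICp (?f mod P)" by (rule ICp_mod[OF P lP ICp_oz])
  have "coeff (?f mod P) i = 0" for i
  proof (rule IC_separated)
    show "coeff (?f mod P) i \<in> IC" using fP by (simp add: ICp_def)
    fix m
    obtain j where j: "j \<ge> m" "\<And>i. i < k \<Longrightarrow> \<exists>y\<in>IC. w j i = v i + PP ^ m * y" using v(2)[of m] by auto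
    let ?Q = "\<Prod>i<k. [:- w j i, 1:]"
    have "pcp m P ?Q" unfolding P_def
    proof (rule pcp_prod)
      fix i assume i: "i \<in> {..<k}"
      then obtain y where y: "y \<in> IC" "w j i = v i + PP ^ m * y" using j(2) by auto
      then have "[:- v i, 1:] = [:- w j i, 1:] + Polynomial.smult (PP ^ m) [:y:]" by simp
      moreover have "ICp [:y:]" using y(1) by (auto simp: ICp_def coeff_pCons split: nat.split)
      ultimately show "pcp m [:- v i, 1:] [:- w j i, 1:]" unfolding pcp_def by blast
      show "ICp [:- v i, 1:]" "ICp [:- w j i, 1:]" using i vI wI by (auto intro: ICp_linear)
    qed simp
    then obtain s where s: "ICp s" "P = ?Q + Polynomial.smult (PP ^ m) s" unfolding pcp_def by blast
    have Q: "ICp ?Q" "lead_coeff ?Q = 1"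
      by (intro ICp_prod ICp_linear wI) (simp_all add: lead_coeff_prod)
    have "[:pp ^ m:] dvd char_poly A - char_poly (B j)"
      using mcong_char_poly[OF mcong_dvd[OF B(2)[of j] le_imp_power_dvd[OF j(1)]] A] .
    then obtain t where "char_poly A - char_poly (B j) = [:pp ^ m:] * t" by (elim dvdE)
    then have "map_poly oz (char_poly A - char_poly (B j)) = map_poly oz ([:pp ^ m:] * t)" by simp
    then have t: "?f = map_poly oz (char_poly (B j)) + Polynomial.smult (PP ^ m) (map_poly oz t)"
      by (simp add: mz.hom_minus oz.map_poly_hom_smult oz.hom_power PP_def algebra_simps)
    obtain g0 where g0: "map_poly oz (char_poly (B j)) = ?Q * g0" using w(2)[of j] by (elim dvdE)
    \<comment> \<open>The integral quotient \<open>a\<close> from long division by the monic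
      \<open>?Q\<close> must be \<open>g0\<close>, because the division is exact.\<close>
    have g: "ICp g0"
    proof -
      obtain a b where ab: "ICp a" "ICp b" "map_poly oz (char_poly (B j)) = ?Q * a + b" "b = 0 \<or> degree b < degree ?Q"
        using ICp_division[OF Q ICp_oz] by blast
      have Q0: "?Q \<noteq> 0" using Q(2) by auto
      have "b = ?Q * (g0 - a)" using ab(3) unfolding g0 by (simp add: algebra_simps)
      then have "?Q dvd b" by simp
      then have "b = 0" using ab(4) dvd_imp_degree_le[of ?Q b] by linarith
      then have "?Q * g0 = ?Q * a" using ab(3) unfolding g0 by simp
      then have "g0 = a" using Q0 by simp
      then show ?thesis using ab(1) by simp
    qed
    \<comment> \<open>Modulo \<open>p ^ m\<close> both the characteristic polynomial and its divisor
      are replaced by their limits; reduction by the monic \<open>P\<close> then leaves only a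
      multiple of \<open>p ^ m\<close>.\<close>
    have "?f = P * g0 + Polynomial.smult (PP ^ m) (map_poly oz t + - (s * g0))"
      unfolding t g0 s(2) by (simp add: distrib_right smult_add_right smult_diff_right)
    then have "?f mod P = Polynomial.smult (PP ^ m) ((map_poly oz t + - (s * g0)) mod P)"
      by (simp add: mod_smult_left)
    moreover have "ICp ((map_poly oz t + - (s * g0)) mod P)"
      by (intro ICp_mod P lP ICp_add ICp_oz ICp_uminus ICp_mult s g)
    ultimately show "\<exists>w\<in>IC. coeff (?f mod P) i = PP ^ m * w"
      by (auto simp: ICp_def)
  qed
  then have "?f mod P = 0" by (intro poly_eqI) simp
  then have "P dvd ?f" by (simp add: mod_eq_0_iff_dvd)
  then show ?thesis unfolding dvd_set_def P_def using A v(1) by auto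
qed

text \<open>A closed set is the intersection of its neighbourhoods \<open>N j\<close> of radius
  \<open>p ^ j\<close>, and each \<open>N j\<close> is a finite union of balls.\<close>

lemma dvd_set_sets:
  assumes "q \<ge> 2"
  shows "(dvd_set n k q :: 'p::prime_card padic_int mat set) \<in> sets (haar_mat n)"
proof -
  let ?S = "dvd_set n k q :: 'p padic_int mat set"
  have SC: "?S \<subseteq> carrier_mat n n" by (auto simp: dvd_set_def)
  define N where "N j = {A \<in> carrier_mat n n. \<exists>B\<in>?S. mcong (pp ^ j) A B}" for j
  have "N j \<in> sets (haar_mat n)" for j
  proof (rule level_set_in_sets)
    show "N j \<subseteq> carrier_mat n n" by (auto simp: N_def)
    fix T assume T: "T \<in> N j"
    then have Tc: "T \<in> carrier_mat n n" by (simp add: N_def)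
    show "mat_ball n j T \<subseteq> N j"
    proof
      fix B assume B: "B \<in> mat_ball n j T"
      then have "B \<in> carrier_mat n n" "mcong (pp ^ j) B T" using mat_ball_subset mat_ball_iff_mcong[OF Tc] by (blast, simp)
      then show "B \<in> N j" using T mcong_trans unfolding N_def by blast
    qed
  qed
  moreover have "?S = (\<Inter>j. N j)"
  proof
    show "?S \<subseteq> (\<Inter>j. N j)" using SC by (auto simp: N_def intro!: bexI)
    show "(\<Inter>j. N j) \<subseteq> ?S" by (auto simp: N_def intro!: dvd_set_closed[OF assms])
  qed
  ultimately show ?thesis by (auto intro: sets.countable_INT)
qed

text \<open>The unramified eigenvalues of one matrix are finitely many integral elements, so a
  single \<open>Wit\<close> contains them all (\<open>Wit_common\<close>). Conversely, a divisor
  with roots in \<open>Wit\<close> is visible in the multiset \<open>evs A\<close>, and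
  \<open>Wit\<close> is unramified.\<close>

lemma eigenvalue_count_ge_iff:
  fixes A :: "'p::prime_card padic_int mat"
  assumes A: "A \<in> carrier_mat n n"
  shows "k \<le> eigenvalue_count maximal_unramified A \<longleftrightarrow> (\<exists>d\<ge>1. A \<in> dvd_set n k (CARD('p) ^ d))"
proof -
  let ?U = "maximal_unramified :: 'p padic_closure set" and ?f = "map_poly oz (char_poly A)"
  let ?F = "filter_mset (\<lambda>x. x \<in> ?U) (evs A)"
  have f0: "?f \<noteq> 0" using char_poly_nonzero[OF A] by auto
  show ?thesis unfolding eigenvalue_count_evs[OF A]
  proof
    assume k: "k \<le> size ?F"
    obtain ys where ys: "mset ys = ?F" using ex_mset by blast
    define w where "w i = ys ! i" for i
    have len: "k \<le> length ys" using k ys by (metis size_mset)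
    have "set ys \<subseteq> IC \<inter> ?U" using evs_IC[OF A] ys by (metis (no_types, lifting) IntI filter_mset_eq_conv mset_subset_eqD set_mset_mset subsetI)
    then obtain d where d: "d \<ge> 1" "set ys \<subseteq> Wit (CARD('p) ^ d)" using Wit_common[of "set ys"] by auto
    have "(\<Prod>i<k. [:- w i, 1:]) dvd (\<Prod>i<length ys. [:- w i, 1:])" using len by (intro prod_dvd_prod_subset) auto
    also have "(\<Prod>i<length ys. [:- w i, 1:]) = (\<Prod>x\<in>#?F. [:- x, 1:])"
      unfolding ys[symmetric] w_def by (simp add: prod.list_conv_set_nth prod_mset_prod_list atLeast0LessThan flip: mset_map)
    also have "\<dots> dvd (\<Prod>x\<in>#evs A. [:- x, 1:])" by (intro prod_mset_subset_imp_dvd image_mset_subseteq_mono multiset_filter_subset)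
    also have "\<dots> dvd ?f"
    proof -
      obtain M where M: "?f = Polynomial.smult (lead_coeff ?f) (\<Prod>x\<in>#M. [:- x, 1:])"
        using alg_closed_imp_factorization[OF f0] by blast
      have "evs A = M" unfolding evs_def using proots_smult[OF leading_coeff_neq_0[OF f0]] proots_linear_product M by metis
      then show ?thesis using M by (metis dvd_refl dvd_smult)
    qed
    finally have "(\<Prod>i<k. [:- w i, 1:]) dvd ?f" .
    moreover have "w i \<in> Wit (CARD('p) ^ d)" if "i < k" for i using d(2) len that unfolding w_def by auto
    ultimately show "\<exists>d\<ge>1. A \<in> dvd_set n k (CARD('p) ^ d)" using A d(1) unfolding dvd_set_def by blast
  next
    assume "\<exists>d\<ge>1. A \<in> dvd_set n k (CARD('p) ^ d)"
    then obtain d w where d: "d \<ge> 1" and w: "\<And>i. i < k \<Longrightarrow> w i \<in> Wit (CARD('p) ^ d)" "(\<Prod>i<k. [:- w i, 1:]) dvd ?f"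
      unfolding dvd_set_def by blast
    obtain g where g: "?f = (\<Prod>i<k. [:- w i, 1:]) * g" using w(2) by (elim dvdE)
    have "proots (\<Prod>i<k. [:- w i, 1:]) = (\<Sum>i<k. {#w i#})" by (subst proots_prod) auto
    then have pr: "evs A = (\<Sum>i<k. {#w i#}) + proots g" unfolding evs_def using f0 unfolding g by (subst proots_mult) auto
    have wU: "w i \<in> ?U" if "i < k" for i using w(1)[OF that] Wit_unramified[OF d] by blast
    have "filter_mset (\<lambda>x. x \<in> ?U) (\<Sum>i<m. {#w i#}) = (\<Sum>i<m. {#w i#})" if "m \<le> k" for m
      using that by (induction m) (auto simp: wU)
    moreover have "size (\<Sum>i<m. {#w i#}) = m" for m by (induction m) auto
    ultimately have "size (filter_mset (\<lambda>x. x \<in> ?U) (\<Sum>i<k. {#w i#})) = k" by simp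
    then show "k \<le> size ?F" unfolding pr by simp
  qed
qed

text \<open>Superlevel sets are countable unions over \<open>d\<close> of the closed sets
  \<open>dvd_set\<close>. For negative \<open>y\<close> the index
  \<open>nat \<lceil>y\<rceil>\<close> is 0, which imposes no condition.\<close>

lemma eigenvalue_count_measurable:
  "(\<lambda>A. real (eigenvalue_count maximal_unramified A)) \<in> borel_measurable (haar_mat n :: 'p::prime_card padic_int mat measure)"
proof (rule borel_measurableI_ge)
  let ?M = "haar_mat n :: 'p padic_int mat measure"
  fix y :: real
  have sp: "space ?M = carrier_mat n n" by (rule haar_mat_facts(2))
  have "{A \<in> space ?M. y \<le> real (eigenvalue_count maximal_unramified A)}
      = (\<Union>d\<in>{1..}. dvd_set n (nat \<lceil>y\<rceil>) (CARD('p) ^ d))"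
  proof -
    have "y \<le> real (eigenvalue_count maximal_unramified A) \<longleftrightarrow> (\<exists>d\<ge>1. A \<in> dvd_set n (nat \<lceil>y\<rceil>) (CARD('p) ^ d))" if "A \<in> carrier_mat n n" for A :: "'p padic_int mat"
      unfolding eigenvalue_count_ge_iff[OF that, symmetric] by linarith
    moreover have "dvd_set n k q \<subseteq> carrier_mat n n" for k q by (auto simp: dvd_set_def)
    ultimately show ?thesis unfolding sp by (intro Set.set_eqI) (simp, blast)
  qed
  also have "\<dots> \<in> sets ?M"
    by (intro sets.countable_UN' dvd_set_sets CARD_power_ge_2) (simp_all add: CARD_power_ge_2 dvd_set_sets image_subset_iff)
  finally show "{A \<in> space ?M. y \<le> real (eigenvalue_count maximal_unramified A)} \<in> sets ?M" .
qed

section \<open>Multiplicative weights on polynomials over a finite field\<close>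

definition monics :: "nat \<Rightarrow> 'a::field poly set" where
  "monics n = {f. lead_coeff f = 1 \<and> degree f = n}"

lemma monics_0: "monics 0 = {1 :: 'a::field poly}"
  by (auto simp: monics_def elim!: degree_eq_zeroE)

lemma monics_Suc: "monics (Suc n) = (\<lambda>(a, g). pCons a g) ` (UNIV \<times> (monics n :: 'a::field poly set))"
proof (intro equalityI subsetI)
  fix f :: "'a poly" assume f: "f \<in> monics (Suc n)"
  obtain a g where fg: "f = pCons a g" by (cases f)
  then have "g \<in> monics n" using f by (auto simp: monics_def split: if_splits)
  then show "f \<in> (\<lambda>(a, g). pCons a g) ` (UNIV \<times> monics n)" using fg by auto
qed (auto simp: monics_def)

lemma finite_monics: "finite (monics n :: 'a::{finite,field} poly set)"
  by (induction n) (simp_all add: monics_0 monics_Suc)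

lemma inj_pCons: "inj_on (\<lambda>(a, g). pCons a g) S"
  by (auto simp: inj_on_def)

lemma card_monics: "card (monics n :: 'a::{finite,field} poly set) = CARD('a) ^ n"
  by (induction n) (simp_all add: monics_0 monics_Suc card_image[OF inj_pCons] card_cartesian_product)

lemma card_monics_const_nonzero:
  "card {f \<in> monics (Suc n) :: 'a::{finite,field} poly set. coeff f 0 \<noteq> 0} = (CARD('a) - 1) * CARD('a) ^ n"
proof -
  have "{f \<in> monics (Suc n) :: 'a poly set. coeff f 0 \<noteq> 0} = (\<lambda>(a, g). pCons a g) ` ((UNIV - {0}) \<times> monics n)"
    unfolding monics_Suc by auto
  then show ?thesis by (simp add: card_image[OF inj_pCons] card_cartesian_product card_monics)
qed

definition irreds :: "nat \<Rightarrow> 'a::field poly set" where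
  "irreds d = {f \<in> monics d. irreducible f}"

lemma finite_irreds: "finite (irreds d :: 'a::{finite,field} poly set)"
  unfolding irreds_def using finite_monics by (rule finite_subset[rotated]) auto

text \<open>Only multiples of \<open>X\<close> are excluded. The factor \<open>1 - 1 / p\<close>
  gained over the number of all monic polynomials is what keeps the later majorant below
  \<open>C\<close> when \<open>p = 2\<close>.\<close>

lemma card_irreds_le:
  assumes "d \<ge> 2"
  shows "card (irreds d :: 'a::{finite,field_gcd} poly set) \<le> (CARD('a) - 1) * CARD('a) ^ (d - 1)"
proof -
  have "irreds d \<subseteq> {f \<in> monics (Suc (d - 1)) :: 'a poly set. coeff f 0 \<noteq> 0}"
  proof
    fix f :: "'a poly" assume f: "f \<in> irreds d"
    have "coeff f 0 \<noteq> 0"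
    proof
      assume "coeff f 0 = 0"
      then obtain g where g: "f = [:0, 1:] * g" by (cases f) auto
      have "\<not> [:0, 1 :: 'a:] dvd 1" by (simp add: is_unit_poly_iff)
      then have "g dvd 1" using f g Factorial_Ring.irreducibleD[of f "[:0,1:]" g] by (auto simp: irreds_def)
      then have "degree g = 0" by (auto simp: is_unit_poly_iff)
      moreover have "g \<noteq> 0" using f g by (auto simp: irreds_def monics_def)
      ultimately have "degree f = 1" unfolding g by (subst degree_mult_eq) auto
      then show False using f assms by (auto simp: irreds_def monics_def)
    qed
    then show "f \<in> {f \<in> monics (Suc (d - 1)). coeff f 0 \<noteq> 0}" using f assms by (auto simp: irreds_def)
  qed
  moreover have "finite {f \<in> monics (Suc (d - 1)) :: 'a poly set. coeff f 0 \<noteq> 0}" using finite_monics by (rule finite_subset[rotated]) auto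
  ultimately have "card (irreds d :: 'a poly set) \<le> card {f \<in> monics (Suc (d - 1)) :: 'a poly set. coeff f 0 \<noteq> 0}"
    by (intro card_mono)
  then show ?thesis unfolding card_monics_const_nonzero .
qed

lemma irreducible_linear_poly: "irreducible [:a, 1 :: 'a::field_gcd:]"
proof (rule Factorial_Ring.irreducibleI)
  fix b c :: "'a poly" assume eq: "[:a, 1:] = b * c"
  then have nz: "b \<noteq> 0" "c \<noteq> 0" by auto
  have "degree b + degree c = 1" using degree_mult_eq[OF nz] unfolding eq[symmetric] by simp
  then show "b dvd 1 \<or> c dvd 1" using nz by (auto simp: is_unit_iff_degree)
qed (simp_all add: is_unit_iff_degree)

lemma irreds_1: "irreds 1 = (\<lambda>a. [:- a, 1:]) ` (UNIV :: 'a::field_gcd set)"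
proof (intro equalityI subsetI)
  fix f :: "'a poly" assume "f \<in> irreds 1"
  then have "f \<in> monics (Suc 0)" by (simp add: irreds_def)
  then obtain a where "f = pCons a 1" unfolding monics_Suc monics_0 by auto
  then have "f = [:- (- a), 1:]" by (simp add: one_pCons)
  then show "f \<in> (\<lambda>a. [:- a, 1:]) ` UNIV" by blast
qed (auto simp: irreds_def monics_def intro: irreducible_linear_poly)

lemma card_irreds_1: "card (irreds 1 :: 'a::{finite,field_gcd} poly set) = CARD('a)"
  unfolding irreds_1 by (subst card_image) (auto simp: inj_on_def)

lemma irreds_coprime_iff: "\<phi> \<in> irreds d \<Longrightarrow> coprime \<phi> g \<longleftrightarrow> \<not> \<phi> dvd (g :: 'a::field_gcd poly)"
proof -
  assume "\<phi> \<in> irreds d"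
  then have p: "prime_elem \<phi>" by (simp add: irreds_def irreducible_imp_prime_elem)
  then have "\<not> \<phi> dvd 1" by (rule prime_elem_not_unit)
  then show ?thesis using prime_elem_imp_coprime[OF p, of g] coprime_common_divisor[of \<phi> g \<phi>] by auto
qed

lemma irreds_prime: "(\<phi> :: 'a::field_gcd poly) \<in> irreds d \<Longrightarrow> prime_elem \<phi>"
  by (simp add: irreds_def irreducible_imp_prime_elem)

lemma irreds_degree_pos: "(\<phi> :: 'a::field_gcd poly) \<in> irreds d \<Longrightarrow> d \<ge> 1"
  using irreducible_degree_pos[of \<phi>] by (auto simp: irreds_def monics_def)

lemma irreds_power_monics: "(\<phi> :: 'a::field_gcd poly) \<in> irreds d \<Longrightarrow> \<phi> ^ m \<in> monics (m * d)"
  by (auto simp: irreds_def monics_def lead_coeff_power degree_power_eq)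

lemma monics_mult: "(f :: 'a::field_gcd poly) \<in> monics m \<Longrightarrow> g \<in> monics n \<Longrightarrow> f * g \<in> monics (m + n)"
proof -
  assume fg: "f \<in> monics m" "g \<in> monics n"
  then have "f \<noteq> 0" "g \<noteq> 0" by (auto simp: monics_def)
  then have "degree (f * g) = m + n" using fg by (simp add: monics_def degree_mult_eq)
  moreover have "lead_coeff (f * g) = 1"
  proof -
    have "lead_coeff (f * g) = lead_coeff f * lead_coeff g" by (rule lead_coeff_mult)
    also have "\<dots> = 1" using fg by (auto simp: monics_def)
    finally show ?thesis .
  qed
  ultimately show ?thesis unfolding monics_def by blast
qed

lemma monics_factor:
  fixes \<phi> :: "'a::field_gcd poly"
  assumes "\<phi> \<in> irreds d" "f \<in> monics n"
  obtains m g where "f = \<phi> ^ m * g" "coprime \<phi> g" "m * d \<le> n" "g \<in> monics (n - m * d)"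
proof -
  have f0: "f \<noteq> 0" and nu: "\<not> \<phi> dvd 1" using assms(2) prime_elem_not_unit[OF irreds_prime[OF assms(1)]] by (auto simp: monics_def)
  obtain m g where fg: "\<not> \<phi> dvd g" "f = \<phi> ^ m * g" using f0 nu multiplicity_decompose'[of f \<phi>] by metis
  have c: "coprime \<phi> g" using fg(1) irreds_coprime_iff[OF assms(1)] by simp
  have pm: "\<phi> ^ m \<in> monics (m * d)" using irreds_power_monics[OF assms(1)] .
  have "lead_coeff g = 1" using assms(2) pm unfolding fg(2) monics_def by (auto simp: lead_coeff_mult)
  moreover have "n = m * d + degree g" using assms(2) pm f0 unfolding fg(2) monics_def by (auto simp: degree_mult_eq)
  ultimately show thesis using that[OF fg(2) c] by (auto simp: monics_def)
qed

lemma prime_power_decomposition_unique: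
  fixes \<phi> :: "'a::field_gcd poly"
  assumes "\<phi> \<in> irreds d" "coprime \<phi> g" "coprime \<phi> h" "\<phi> ^ m * g = \<phi> ^ l * h"
  shows "m = l \<and> g = h"
proof -
  have p: "prime_elem \<phi>" using irreds_prime[OF assms(1)] .
  have nd: "\<not> \<phi> dvd g" "\<not> \<phi> dvd h" using assms(2,3) irreds_coprime_iff[OF assms(1)] by simp_all
  have f0: "\<phi> \<noteq> 0" using p by auto
  have "m = l"
  proof (rule linorder_cases[of m l])
    assume "m < l"
    then have "l = m + Suc (l - m - 1)" by simp
    then have "\<phi> ^ l = \<phi> ^ m * (\<phi> * \<phi> ^ (l - m - 1))" by (metis power_add power_Suc)
    then have "\<phi> ^ m * g = \<phi> ^ m * (\<phi> * \<phi> ^ (l - m - 1) * h)" using assms(4) by (simp only: mult.assoc)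
    then have "g = \<phi> * \<phi> ^ (l - m - 1) * h" using f0 by simp
    then show ?thesis using nd by simp
  next
    assume "l < m"
    then have "m = l + Suc (m - l - 1)" by simp
    then have "\<phi> ^ m = \<phi> ^ l * (\<phi> * \<phi> ^ (m - l - 1))" by (metis power_add power_Suc)
    then have "\<phi> ^ l * h = \<phi> ^ l * (\<phi> * \<phi> ^ (m - l - 1) * g)" using assms(4) by (simp only: mult.assoc)
    then have "h = \<phi> * \<phi> ^ (m - l - 1) * g" using f0 by simp
    then show ?thesis using nd by simp
  qed simp
  then show ?thesis using assms(4) f0 by simp
qed

lemma sum_monics_factor:
  fixes F :: "'a::{finite,field_gcd} poly \<Rightarrow> real"
  assumes \<phi>: "\<phi> \<in> irreds d"
  shows "(\<Sum>f\<in>monics n. F f) = (\<Sum>m\<in>{m. m * d \<le> n}. \<Sum>g\<in>{g \<in> monics (n - m * d). coprime \<phi> g}. F (\<phi> ^ m * g))"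
proof -
  have fin: "finite {m. m * d \<le> n}"
    by (rule finite_subset[of _ "{..n}"]) (use irreds_degree_pos[OF \<phi>] in \<open>auto intro: order_trans[rotated]\<close>)
  have fing: "finite {g \<in> monics k. coprime \<phi> g}" for k using finite_monics by (rule finite_subset[rotated]) auto
  let ?D = "SIGMA m:{m. m * d \<le> n}. {g \<in> monics (n - m * d). coprime \<phi> g}"
  have inj: "inj_on (\<lambda>(m, g). \<phi> ^ m * g) ?D"
    using prime_power_decomposition_unique[OF \<phi>] by (auto simp: inj_on_def)
  have im: "(\<lambda>(m, g). \<phi> ^ m * g) ` ?D = monics n"
  proof (intro equalityI subsetI)
    fix f :: "'a poly" assume "f \<in> (\<lambda>(m, g). \<phi> ^ m * g) ` ?D"
    then obtain m g where mg: "f = \<phi> ^ m * g" "m * d \<le> n" "g \<in> monics (n - m * d)" by auto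
    show "f \<in> monics n" using monics_mult[OF irreds_power_monics[OF \<phi>] mg(3), of m] mg(1,2) by simp
  next
    fix f :: "'a poly" assume "f \<in> monics n"
    from monics_factor[OF \<phi> this] obtain m g where "f = \<phi> ^ m * g" "coprime \<phi> g" "m * d \<le> n" "g \<in> monics (n - m * d)" .
    then show "f \<in> (\<lambda>(m, g). \<phi> ^ m * g) ` ?D" by force
  qed
  have "(\<Sum>f\<in>monics n. F f) = (\<Sum>(m, g)\<in>?D. F (\<phi> ^ m * g))"
    unfolding im[symmetric] by (subst sum.reindex[OF inj]) (simp add: case_prod_unfold comp_def)
  then show ?thesis using sum.Sigma[OF fin, of "\<lambda>m. {g \<in> monics (n - m * d). coprime \<phi> g}" "\<lambda>m g. F (\<phi> ^ m * g)"] fing by simp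
qed

text \<open>The right side is the value of the full series from \<open>m = 2\<close>, namely
  \<open>t / (1 - t)\<^sup>2 - t\<close>; the induction carries the exact remainder.\<close>

lemma sum_arith_geometric_le:
  fixes t :: real
  assumes "0 \<le> t" "t < 1"
  shows "(\<Sum>m = 2..N. real m * t ^ m) \<le> t\<^sup>2 * (2 - t) / (1 - t)\<^sup>2"
proof -
  have eq: "(1 - t)\<^sup>2 * (\<Sum>m = 2..N. real m * t ^ m) = t\<^sup>2 * (2 - t) - (real N + 1) * t ^ (N + 1) + real N * t ^ (N + 2)" if "N \<ge> 1" for N
    using that
  proof (induction N rule: dec_induct)
    case base
    then show ?case by (simp add: power2_eq_square algebra_simps eval_nat_numeral)
  next
    case (step N)
    have "(\<Sum>m = 2..Suc N. real m * t ^ m) = (\<Sum>m = 2..N. real m * t ^ m) + real (Suc N) * t ^ Suc N" using step(1) by simp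
    then show ?case using step(3) by (simp add: algebra_simps power2_eq_square)
  qed
  have "(1 - t)\<^sup>2 * (\<Sum>m = 2..N. real m * t ^ m) \<le> t\<^sup>2 * (2 - t)"
  proof (cases "N \<ge> 1")
    case True
    have "real N * t ^ (N + 2) \<le> (real N + 1) * t ^ (N + 1)"
      using assms by (intro mult_mono power_decreasing) auto
    then show ?thesis using eq[OF True] by simp
  next
    case False
    then show ?thesis using assms by simp
  qed
  moreover have "(1 - t)\<^sup>2 > 0" using assms by simp
  ultimately show ?thesis by (simp add: pos_le_divide_eq mult.commute)
qed

text \<open>
  If \<open>T = U * Q\<close> is a Cauchy product with \<open>U\<^sub>0 = 1\<close> and small \<open>U\<^sub>i\<close>, the same relation holds for the difference
  sequences, so that the differences of \<open>Q\<close> are absolutely summable.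
\<close>

lemma cauchy_factor_convergent:
  fixes T U Q :: "nat \<Rightarrow> real"
  assumes conv: "\<And>k. T k = (\<Sum>i\<le>k. U i * Q (k - i))"
    and U0: "U 0 = 1" and Upos: "\<And>i. U i \<ge> 0" and Usum: "\<And>N. (\<Sum>i = 1..N. U i) \<le> 1 / 2"
    and T: "incseq T" "\<And>k. 0 \<le> T k" "\<And>k. T k \<le> c"
  shows "convergent Q"
proof -
  define e where "e k = (if k = 0 then Q 0 else Q k - Q (k - 1))" for k
  define \<delta> where "\<delta> k = (if k = 0 then T 0 else T k - T (k - 1))" for k
  have Qe: "Q k = (\<Sum>j\<le>k. e j)" for k by (induction k) (simp_all add: e_def)
  have T\<delta>: "T k = (\<Sum>j\<le>k. \<delta> j)" for k by (induction k) (simp_all add: \<delta>_def)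
  have \<delta>0: "\<delta> k \<ge> 0" for k using T(1,2) by (cases k) (auto simp: \<delta>_def incseq_Suc_iff)
  have dconv: "\<delta> k = (\<Sum>i\<le>k. U i * e (k - i))" for k
  proof (cases k)
    case 0
    then show ?thesis using conv[of 0] by (simp add: \<delta>_def e_def)
  next
    case (Suc l)
    have "(\<Sum>i\<le>Suc l. U i * e (Suc l - i)) = (\<Sum>i\<le>l. U i * e (Suc l - i)) + U (Suc l) * Q 0" by (simp add: e_def)
    also have "(\<Sum>i\<le>l. U i * e (Suc l - i)) = (\<Sum>i\<le>l. U i * Q (Suc l - i) - U i * Q (l - i))"
      by (intro sum.cong refl) (simp add: e_def Suc_diff_le right_diff_distrib)
    also have "\<dots> + U (Suc l) * Q 0 = T (Suc l) - T l" unfolding conv[of "Suc l"] conv[of l] by (simp add: sum_subtractf)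
    finally show ?thesis using Suc by (simp add: \<delta>_def)
  qed
  have ek: "\<bar>e k\<bar> \<le> \<delta> k + (\<Sum>i = 1..k. U i * \<bar>e (k - i)\<bar>)" for k
  proof -
    have "{..k} = insert 0 {1..k}" by auto
    then have "\<delta> k = e k + (\<Sum>i = 1..k. U i * e (k - i))" unfolding dconv[of k] using U0 by simp
    then have "\<bar>e k\<bar> = \<bar>\<delta> k - (\<Sum>i = 1..k. U i * e (k - i))\<bar>" by simp
    also have "\<dots> \<le> \<delta> k + (\<Sum>i = 1..k. \<bar>U i * e (k - i)\<bar>)" using \<delta>0[of k] sum_abs[of "\<lambda>i. U i * e (k - i)" "{1..k}"] by linarith
    finally show ?thesis using Upos by (simp add: abs_mult)
  qed
  have bound: "(\<Sum>k\<le>N. \<bar>e k\<bar>) \<le> 2 * c" for N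
  proof -
    let ?A = "\<Sum>k\<le>N. \<bar>e k\<bar>"
    have "(\<Sum>k\<le>N. \<Sum>i = 1..k. U i * \<bar>e (k - i)\<bar>) = (\<Sum>(k, i)\<in>(SIGMA k:{..N}. {1..k}). U i * \<bar>e (k - i)\<bar>)"
      by (simp add: sum.Sigma)
    also have "\<dots> = (\<Sum>(i, j)\<in>(SIGMA i:{1..N}. {..N - i}). U i * \<bar>e j\<bar>)"
      by (rule sum.reindex_bij_witness[of _ "\<lambda>(i, j). (i + j, i)" "\<lambda>(k, i). (i, k - i)"]) auto
    also have "\<dots> = (\<Sum>i = 1..N. \<Sum>j\<le>N - i. U i * \<bar>e j\<bar>)" by (simp add: sum.Sigma)
    also have "\<dots> = (\<Sum>i = 1..N. U i * (\<Sum>j\<le>N - i. \<bar>e j\<bar>))" by (simp add: sum_distrib_left)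
    also have "\<dots> \<le> (\<Sum>i = 1..N. U i * ?A)" by (intro sum_mono mult_left_mono sum_mono2 Upos) auto
    also have "\<dots> = (\<Sum>i = 1..N. U i) * ?A" by (simp add: sum_distrib_right)
    also have "\<dots> \<le> 1 / 2 * ?A" by (intro mult_right_mono Usum sum_nonneg) auto
    finally have *: "(\<Sum>k\<le>N. \<Sum>i = 1..k. U i * \<bar>e (k - i)\<bar>) \<le> 1 / 2 * ?A" .
    have "?A \<le> (\<Sum>k\<le>N. \<delta> k + (\<Sum>i = 1..k. U i * \<bar>e (k - i)\<bar>))" by (intro sum_mono ek)
    also have "\<dots> \<le> T N + 1 / 2 * ?A" using * unfolding sum.distrib T\<delta>[of N] by linarith
    finally show ?thesis using T(3)[of N] by linarith
  qed
  have "summable (\<lambda>k. \<bar>e k\<bar>)" using bound by (intro bounded_imp_summable) auto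
  then have "summable e" by (rule summable_rabs_cancel)
  then have "(\<lambda>k. \<Sum>j\<le>k. e j) \<longlonglongrightarrow> suminf e" by (rule summable_LIMSEQ')
  then show ?thesis unfolding Qe[abs_def] convergent_def by blast
qed

text \<open>The part of the argument that concerns polynomials only. \<open>total\<close> comes from
  the recursion for \<open>card (GL (Suc n))\<close>, and \<open>invertible\<close> from the fact
  that subtracting the scalar \<open>a\<close> maps the matrices without eigenvalue \<open>a\<close>
  bijectively onto \<open>GL n\<close>.\<close>

locale weights =
  fixes w z :: "'a::{finite,field_gcd} poly \<Rightarrow> real" and p :: real
  assumes p_eq: "p = real CARD('a)"
    and w_nonneg: "w f \<ge> 0" and w_1: "w 1 = 1"
    and w_mult: "lead_coeff f = 1 \<Longrightarrow> lead_coeff g = 1 \<Longrightarrow> coprime f g \<Longrightarrow> w (f * g) = w f * w g"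
    and z_mult: "lead_coeff f = 1 \<Longrightarrow> lead_coeff g = 1 \<Longrightarrow> coprime f g \<Longrightarrow> z (f * g) = z f * w g + w f * z g"
    and z_nonneg: "z f \<ge> 0" and z_le: "lead_coeff f = 1 \<Longrightarrow> z f \<le> real (degree f) * w f"
    and z_irreducible: "lead_coeff f = 1 \<Longrightarrow> irreducible f \<Longrightarrow> z f = 0"
    and w_power: "f \<in> irreds d \<Longrightarrow> w (f ^ m) \<le> 1 / (p ^ d - 1) ^ m"
    and total: "(\<Sum>f\<in>monics (Suc n). w f) = (\<Sum>f\<in>monics n. w f) / (1 - 1 / p ^ Suc n)"
    and invertible: "(\<Sum>g\<in>{g \<in> monics n. poly g a \<noteq> 0}. w g) = 1"
    and z_square: "z ([:0, 1:] ^ 2) > 0"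
begin

section \<open>Total weights, and their convergence after removal of one prime factor\<close>

definition T :: "nat \<Rightarrow> real" where "T n = (\<Sum>f\<in>monics n. w f)"

definition S :: "nat \<Rightarrow> real" where "S n = (\<Sum>f\<in>monics n. z f)"

definition Q :: "'a poly \<Rightarrow> nat \<Rightarrow> real" where "Q \<phi> n = (\<Sum>g\<in>{g \<in> monics n. coprime \<phi> g}. w g)"

lemma p_ge_2: "p \<ge> 2"
proof -
  have "card {0, 1 :: 'a} \<le> CARD('a)" by (intro card_mono) auto
  then show ?thesis by (simp add: p_eq)
qed

lemma T_0: "T 0 = 1"
  by (simp add: T_def monics_0 w_1)

lemma T_Suc: "T n = T (Suc n) * (1 - 1 / p ^ Suc n)"
proof -
  have "1 < p ^ Suc n" using p_ge_2 by (intro one_less_power) auto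
  then have "1 - 1 / p ^ Suc n \<noteq> 0" by simp
  then show ?thesis using total[of n] unfolding T_def by (metis nonzero_mult_div_cancel_right times_divide_eq_left)
qed

lemma T_pos: "T n > 0"
proof (induction n)
  case (Suc n)
  have "1 < p ^ Suc n" using p_ge_2 by (intro one_less_power) auto
  then have "1 - 1 / p ^ Suc n > 0" by simp
  then show ?case using Suc T_Suc[of n] by (metis zero_less_mult_pos2)
qed (simp add: T_0)

lemma T_incseq: "incseq T"
proof (rule incseq_SucI)
  fix n
  show "T n \<le> T (Suc n)" using T_Suc[of n] T_pos[of "Suc n"] p_ge_2 by (simp add: mult_le_cancel_left1)
qed

lemma T_ge_1: "T n \<ge> 1"
  using T_incseq[THEN incseqD, of 0 n] T_0 by simp

text \<open>\<open>1 / T n\<close> is the product of the factors \<open>1 - 1 / p ^ i\<close> for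
  \<open>i\<close> up to \<open>n\<close>, smallest for \<open>p = 2\<close>. The extra summand
  \<open>1 / 2 ^ Suc n\<close> in the lower bound is what lets the induction close.\<close>

lemma T_le: "T n \<le> 4"
proof -
  have "1 / T n \<ge> 1 / 4 + 1 / 2 ^ Suc n" if "n \<ge> 1" for n
    using that
  proof (induction n rule: dec_induct)
    case base
    have "1 / T 1 = 1 - 1 / p" using T_Suc[of 0] T_pos[of 1] by (simp add: T_0 field_simps)
    moreover have "1 / p \<le> 1 / 2" using p_ge_2 by (simp add: field_simps)
    ultimately show ?case by simp
  next
    case (step n)
    have "1 / T (Suc n) = 1 / T n * (1 - 1 / p ^ Suc n)" using T_Suc[of n] T_pos[of "Suc n"] T_pos[of n] by (simp add: field_simps)
    moreover have "(1 / 4 + 1 / 2 ^ Suc n) * (1 - 1 / 2 ^ Suc n) \<le> 1 / T n * (1 - 1 / p ^ Suc n)"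
    proof (rule mult_mono)
      have "2 ^ Suc n \<le> p ^ Suc n" using p_ge_2 by (intro power_mono) auto
      then show "1 - 1 / 2 ^ Suc n \<le> 1 - 1 / p ^ Suc n" by (simp add: frac_le)
      have "(1::real) \<le> 2 ^ Suc n" by (rule one_le_power) simp
      then show "0 \<le> 1 - 1 / (2::real) ^ Suc n" by (simp del: power_Suc)
    qed (use step T_pos[of n] in \<open>auto simp: less_imp_le\<close>)
    moreover have "(1 / 4 + 1 / 2 ^ Suc n) * (1 - 1 / 2 ^ Suc n) = 1 / 4 + 3 / 4 * (1 / 2 ^ Suc n) - (1 / 2 ^ Suc n) * (1 / 2 ^ Suc n :: real)"
      by (simp add: algebra_simps)
    moreover have "(1 / 2 ^ Suc n) * (1 / 2 ^ Suc n :: real) \<le> 1 / 4 * (1 / 2 ^ Suc n)"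
    proof (rule mult_right_mono)
      have "(2::real) ^ 2 \<le> 2 ^ Suc n" using step(1) by (intro power_increasing) auto
      then show "1 / 2 ^ Suc n \<le> (1 / 4 :: real)" by (simp add: field_simps)
    qed simp
    ultimately show ?case by simp
  qed
  then show ?thesis
  proof (cases "n \<ge> 1")
    case True
    have "1 / 4 \<le> 1 / T n" using \<open>\<And>n. n \<ge> 1 \<Longrightarrow> _\<close>[OF True] by (rule order_trans[rotated]) simp
    then show ?thesis using T_pos[of n] by (simp add: field_simps)
  qed (cases n; simp add: T_0)
qed

lemma T_convergent: "convergent T"
  using T_incseq T_le by (meson convergent_def incseq_convergent)

lemma T_eq_sum_Q:
  assumes \<phi>: "\<phi> \<in> irreds d"
  shows "T n = (\<Sum>m\<in>{m. m * d \<le> n}. w (\<phi> ^ m) * Q \<phi> (n - m * d))"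
  unfolding T_def Q_def sum_monics_factor[OF \<phi>] sum_distrib_left
proof (intro sum.cong refl)
  fix m g assume "g \<in> {g \<in> monics (n - m * d). coprime \<phi> g}"
  then show "w (\<phi> ^ m * g) = w (\<phi> ^ m) * w g"
    using irreds_power_monics[OF \<phi>, of m] by (intro w_mult) (auto simp: monics_def)
qed

lemma Q_nonneg: "Q \<phi> n \<ge> 0"
  unfolding Q_def by (intro sum_nonneg w_nonneg)

lemma Q_le_T: "Q \<phi> n \<le> T n"
  unfolding Q_def T_def by (intro sum_mono2 finite_monics w_nonneg) auto

lemma Q_linear: "\<phi> \<in> irreds 1 \<Longrightarrow> Q \<phi> n = 1"
proof -
  assume \<phi>: "\<phi> \<in> irreds 1"
  then obtain a where a: "\<phi> = [:- a, 1:]" unfolding irreds_1 by blast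
  have "{g \<in> monics n. coprime \<phi> g} = {g \<in> monics n. poly g a \<noteq> 0}"
    using irreds_coprime_iff[OF \<phi>] by (auto simp: a poly_eq_0_iff_dvd)
  then show ?thesis unfolding Q_def by (simp add: invertible)
qed

text \<open>Since \<open>Q\<close> is identically 1 for linear \<open>\<phi>\<close>, the sum of
  \<open>w (\<phi> ^ m)\<close> for \<open>m\<close> up to \<open>n\<close> is \<open>T n\<close>,
  and the weight is a difference of consecutive totals. This improves on \<open>w_power\<close>,
  which gives no decay at all for \<open>p = 2\<close>.\<close>

lemma w_power_linear:
  assumes \<phi>: "\<phi> \<in> irreds 1"
  shows "w (\<phi> ^ Suc n) = T (Suc n) / p ^ Suc n"
proof -
  have "T n = (\<Sum>m\<le>n. w (\<phi> ^ m))" for n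
    unfolding T_eq_sum_Q[OF \<phi>] Q_linear[OF \<phi>] by (simp add: atMost_def)
  then have "T (Suc n) = T n + w (\<phi> ^ Suc n)" by simp
  then show ?thesis using T_Suc[of n] by (simp add: algebra_simps)
qed

lemma power_CARD_ge:
  assumes "d \<ge> 2"
  shows "p ^ d \<ge> 4"
proof -
  have "(2::real) ^ 2 \<le> 2 ^ d" using assms by (intro power_increasing) auto
  also have "\<dots> \<le> p ^ d" using p_ge_2 by (intro power_mono) auto
  finally show ?thesis by simp
qed

text \<open>For \<open>d\<close> at least 2 one has \<open>1 / (p ^ d - 1) \<le> 1 / 3\<close>, so
  the nontrivial powers of \<open>\<phi>\<close> have total weight at most 1/2 and
  \<open>cauchy_factor_convergent\<close> applies. For \<open>d = 1\<close> this estimate can fail,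
  but there \<open>Q\<close> is constant.\<close>

lemma Q_convergent:
  assumes \<phi>: "\<phi> \<in> irreds d"
  shows "convergent (Q \<phi>)"
proof (cases "d = 1")
  case True
  then have "Q \<phi> = (\<lambda>_. 1)" using Q_linear \<phi> by (intro ext) simp
  then show ?thesis by (simp add: convergent_const)
next
  case False
  then have d: "d \<ge> 2" using irreds_degree_pos[OF \<phi>] by linarith
  define t where "t = 1 / (p ^ d - 1)"
  have t: "0 \<le> t" "t \<le> 1 / 3" using power_CARD_ge[OF d] by (auto simp: t_def field_simps)
  \<comment> \<open>Powers of \<open>\<phi>\<close> occur in degrees divisible by \<open>d\<close>
    only; filling the other indices with 0 turns \<open>T_eq_sum_Q\<close> into a Cauchy
    product.\<close>
  define U where "U i = (if d dvd i then w (\<phi> ^ (i div d)) else 0)" for i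
  show ?thesis
  proof (rule cauchy_factor_convergent[of T U])
    fix k
    have "(\<Sum>m\<in>{m. m * d \<le> k}. w (\<phi> ^ m) * Q \<phi> (k - m * d)) = (\<Sum>i\<in>(\<lambda>m. m * d) ` {m. m * d \<le> k}. U i * Q \<phi> (k - i))"
      using d by (subst sum.reindex) (auto simp: inj_on_def U_def)
    also have "\<dots> = (\<Sum>i\<le>k. U i * Q \<phi> (k - i))"
      by (rule sum.mono_neutral_left) (auto simp: U_def image_iff mult.commute elim!: dvdE)
    finally show "T k = (\<Sum>i\<le>k. U i * Q \<phi> (k - i))" unfolding T_eq_sum_Q[OF \<phi>] .
    fix N
    have "(\<Sum>i = 1..N. U i) \<le> (\<Sum>i\<in>(\<lambda>m. m * d) ` {1..N}. U i)"
    proof (rule order_trans)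
      show "(\<Sum>i = 1..N. U i) \<le> (\<Sum>i\<in>{1..N} \<inter> {i. d dvd i}. U i)"
        by (rule eq_refl, rule sum.mono_neutral_right) (auto simp: U_def)
      show "(\<Sum>i\<in>{1..N} \<inter> {i. d dvd i}. U i) \<le> (\<Sum>i\<in>(\<lambda>m. m * d) ` {1..N}. U i)"
      proof (rule sum_mono2)
        show "{1..N} \<inter> {i. d dvd i} \<subseteq> (\<lambda>m. m * d) ` {1..N}"
        proof
          fix i assume "i \<in> {1..N} \<inter> {i. d dvd i}"
          then obtain m where m: "i = m * d" "1 \<le> m * d" "m * d \<le> N" by (auto simp: mult.commute elim!: dvdE)
          have "m * 1 \<le> m * d" using d by (intro mult_le_mono2) simp
          then have "m \<in> {1..N}" using m by (cases m) auto
          then show "i \<in> (\<lambda>m. m * d) ` {1..N}" using m(1) by blast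
        qed
      qed (auto simp: U_def w_nonneg)
    qed
    also have "\<dots> = (\<Sum>m = 1..N. w (\<phi> ^ m))" using d by (subst sum.reindex) (auto simp: inj_on_def U_def)
    also have "\<dots> \<le> (\<Sum>m = 1..N. t ^ m)"
      using w_power[OF \<phi>] by (intro sum_mono) (simp add: t_def power_one_over)
    also have "\<dots> \<le> (\<Sum>m = 1..N. (1 / 3) ^ m)" using t by (intro sum_mono power_mono)
    also have "\<dots> = 1 / 2 - 1 / 2 * (1 / 3) ^ N" by (induction N) simp_all
    also have "\<dots> \<le> 1 / 2" by simp
    finally show "(\<Sum>i = 1..N. U i) \<le> 1 / 2" .
  qed (use d T_incseq T_le T_pos w_nonneg in \<open>auto simp: U_def w_1 less_imp_le\<close>)
qed

end

section \<open>Expansion of \<open>z\<close> over prime powers and its majorant\<close>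

lemma monicsD:
  assumes "f \<in> monics n"
  shows "lead_coeff f = 1" "degree f = n"
  using assms by (auto simp: monics_def)

context weights
begin

lemma z_1: "z 1 = 0"
  using z_le[of 1] z_nonneg[of 1] by simp

text \<open>The share of \<open>\<phi>\<close> in \<open>z f\<close> under the product rule:
  \<open>z\<close> of the exact power of \<open>\<phi>\<close> in \<open>f\<close> times
  \<open>w\<close> of the cofactor. It is 0 if \<open>\<phi>\<close> does not divide
  \<open>f\<close>, as \<open>z 1 = 0\<close>.\<close>

definition G :: "'a poly \<Rightarrow> 'a poly \<Rightarrow> real" where
  "G \<phi> f = z (\<phi> ^ multiplicity \<phi> f) * w (f div \<phi> ^ multiplicity \<phi> f)"

lemma G_eq:
  assumes \<phi>: "\<phi> \<in> irreds d" and c: "coprime \<phi> g"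
  shows "G \<phi> (\<phi> ^ m * g) = z (\<phi> ^ m) * w g"
proof -
  have p: "prime_elem \<phi>" using irreds_prime[OF \<phi>] .
  have nd: "\<not> \<phi> dvd g" using c irreds_coprime_iff[OF \<phi>] by blast
  have f0: "\<phi> \<noteq> 0" using p by auto
  have "multiplicity \<phi> (\<phi> ^ m * g) = m"
  proof (rule multiplicity_eqI)
    show "\<not> \<phi> ^ Suc m dvd \<phi> ^ m * g"
    proof
      assume "\<phi> ^ Suc m dvd \<phi> ^ m * g"
      then have "\<phi> ^ m * \<phi> dvd \<phi> ^ m * g" by (simp add: mult.commute)
      then have "\<phi> dvd g" using f0 by (subst (asm) dvd_times_left_cancel_iff) auto
      then show False using nd by simp
    qed
  qed simp
  then show ?thesis unfolding G_def using f0 by simp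
qed

lemma irreds_coprime:
  fixes \<phi> \<psi> :: "'a poly"
  assumes "\<phi> \<in> irreds d" "\<psi> \<in> irreds e" "\<phi> \<noteq> \<psi>"
  shows "coprime \<phi> (\<psi> :: 'a poly)"
proof (rule ccontr)
  assume "\<not> coprime \<phi> \<psi>"
  then have "\<phi> dvd \<psi>" using irreds_coprime_iff[OF assms(1)] by blast
  then obtain c where c: "\<psi> = \<phi> * c" by (elim dvdE)
  have "\<not> \<phi> dvd 1" using prime_elem_not_unit[OF irreds_prime[OF assms(1)]] .
  then have "c dvd 1" using Factorial_Ring.irreducibleD[of \<psi> \<phi> c] c assms(2) by (auto simp: irreds_def)
  then obtain b where b: "c = [:b:]" using is_unit_poly_iff by blast
  have "b = 1" using assms(1,2) unfolding c b by (auto simp: irreds_def monics_def lead_coeff_mult)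
  then show False using c b assms(3) by (simp add: one_pCons[symmetric])
qed

text \<open>\<open>\<Phi>\<close> may be larger than the set of irreducible divisors, so that one
  index set serves all polynomials of a given degree and the sums can be interchanged.\<close>

lemma z_eq_sum_G:
  assumes "f \<in> monics n" "finite \<Phi>" "\<And>\<phi>. \<phi> \<in> \<Phi> \<Longrightarrow> \<phi> \<in> irreds (degree \<phi>)"
    "\<And>\<phi>. \<phi> \<in> irreds (degree \<phi>) \<Longrightarrow> \<phi> dvd f \<Longrightarrow> \<phi> \<in> \<Phi>"
  shows "z f = (\<Sum>\<phi>\<in>\<Phi>. G \<phi> f)"
  using assms(1,4)
proof (induction n arbitrary: f rule: less_induct)
  case (less n)
  show ?case
  proof (cases "f = 1")
    case True
    have "G \<phi> 1 = 0" if "\<phi> \<in> \<Phi>" for \<phi> using G_eq[OF assms(3)[OF that], of 1 0] by (simp add: z_1)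
    then show ?thesis using True by (simp add: z_1)
  next
    case False
    have "n \<noteq> 0"
    proof
      assume "n = 0"
      then have "f \<in> monics 0" using less.prems(1) by simp
      then show False using False unfolding monics_0 by simp
    qed
    then have "degree f > 0" using monicsD(2)[OF less.prems(1)] by simp
    then obtain \<phi> where \<phi>': "irreducible \<phi>" "lead_coeff \<phi> = 1" "\<phi> dvd f" using monic_irreducible_factor[of f] by blast
    then have \<phi>: "\<phi> \<in> irreds (degree \<phi>)" by (simp add: irreds_def monics_def)
    obtain m g where fg: "f = \<phi> ^ m * g" "coprime \<phi> g" "m * degree \<phi> \<le> n" "g \<in> monics (n - m * degree \<phi>)"
      using monics_factor[OF \<phi> less.prems(1)] .
    have "m \<noteq> 0"
    proof
      assume "m = 0"
      then have "f = g" using fg(1) by simp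
      then show False using \<phi>'(3) fg(2) irreds_coprime_iff[OF \<phi>, of g] by simp
    qed
    then have "m * degree \<phi> > 0" using irreds_degree_pos[OF \<phi>] by simp
    then have lt: "n - m * degree \<phi> < n" using fg(3) by linarith
    have \<phi>\<Phi>: "\<phi> \<in> \<Phi>" using less.prems(2) \<phi> \<phi>'(3) .
    have pm: "lead_coeff (\<phi> ^ m) = 1" using irreds_power_monics[OF \<phi>] by (rule monicsD)
    have gm: "lead_coeff g = 1" using fg(4) by (rule monicsD)
    have IH: "z g = (\<Sum>\<psi>\<in>\<Phi>. G \<psi> g)" using less.IH[OF lt fg(4)] less.prems(2) unfolding fg(1) by simp
    have G\<phi>: "G \<phi> f = z (\<phi> ^ m) * w g" unfolding fg(1) by (rule G_eq[OF \<phi> fg(2)])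
    have G0: "G \<phi> g = 0" using G_eq[OF \<phi> fg(2), of 0] by (simp add: z_1)
    have G\<psi>: "G \<psi> f = w (\<phi> ^ m) * G \<psi> g" if \<psi>\<Phi>: "\<psi> \<in> \<Phi> - {\<phi>}" for \<psi>
    proof -
      have \<psi>: "\<psi> \<in> irreds (degree \<psi>)" using assms(3) \<psi>\<Phi> by simp
      obtain l h where gh: "g = \<psi> ^ l * h" "coprime \<psi> h" "h \<in> monics (n - m * degree \<phi> - l * degree \<psi>)" using monics_factor[OF \<psi> fg(4)] .
      have c: "coprime \<psi> (\<phi> ^ m * h)" using irreds_coprime[OF \<psi> \<phi>] \<psi>\<Phi> gh(2) by simp
      have hm: "lead_coeff h = 1" using gh(3) by (rule monicsD)
      have cp: "coprime (\<phi> ^ m) h" using fg(2) unfolding gh(1) by simp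
      have "G \<psi> (\<psi> ^ l * (\<phi> ^ m * h)) = z (\<psi> ^ l) * w (\<phi> ^ m * h)" by (rule G_eq[OF \<psi> c])
      also have "\<dots> = w (\<phi> ^ m) * (z (\<psi> ^ l) * w h)" using w_mult[OF pm hm cp] by simp
      also have "z (\<psi> ^ l) * w h = G \<psi> g" unfolding gh(1) by (rule G_eq[OF \<psi> gh(2), symmetric])
      finally show ?thesis unfolding fg(1) gh(1) by (simp add: ac_simps)
    qed
    have "z f = z (\<phi> ^ m) * w g + w (\<phi> ^ m) * z g" unfolding fg(1) using fg(2) by (intro z_mult pm gm) simp
    also have "\<dots> = G \<phi> f + w (\<phi> ^ m) * (\<Sum>\<psi>\<in>\<Phi> - {\<phi>}. G \<psi> g)"
      unfolding IH G\<phi> using sum.remove[OF assms(2) \<phi>\<Phi>, of "\<lambda>\<psi>. G \<psi> g"] G0 by simp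
    also have "\<dots> = G \<phi> f + (\<Sum>\<psi>\<in>\<Phi> - {\<phi>}. G \<psi> f)" unfolding sum_distrib_left using G\<psi> by simp
    also have "\<dots> = (\<Sum>\<psi>\<in>\<Phi>. G \<psi> f)" using sum.remove[OF assms(2) \<phi>\<Phi>, of "\<lambda>\<psi>. G \<psi> f"] by simp
    finally show ?thesis .
  qed
qed

text \<open>All contributions of prime powers \<open>\<phi> ^ m\<close> of total degree
  \<open>j = m * d\<close>. Grouping by \<open>j\<close> gives terms whose shape does not change
  with \<open>n\<close>, as needed for a termwise limit.\<close>

definition A :: "nat \<Rightarrow> nat \<Rightarrow> real" where
  "A j n = (\<Sum>d = 1..j. if d dvd j then \<Sum>\<phi>\<in>irreds d. z (\<phi> ^ (j div d)) * Q \<phi> (n - j) else 0)"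

lemma S_eq_sum_A: "S n = (\<Sum>j = 1..n. A j n)"
proof -
  let ?\<Phi> = "\<Union>d\<in>{1..n}. irreds d :: 'a poly set"
  have deg: "\<phi> \<in> irreds d \<Longrightarrow> degree \<phi> = d" for \<phi> :: "'a poly" and d by (simp add: irreds_def monics_def)
  have fin: "finite ?\<Phi>" using finite_irreds by auto
  have "S n = (\<Sum>f\<in>monics n. \<Sum>\<phi>\<in>?\<Phi>. G \<phi> f)" unfolding S_def
  proof (intro sum.cong refl z_eq_sum_G fin)
    fix f :: "'a poly" assume f: "f \<in> monics n"
    then have f0: "f \<noteq> 0" by (auto simp: monics_def)
    fix \<phi> :: "'a poly"
    show "\<phi> \<in> irreds (degree \<phi>)" if "\<phi> \<in> ?\<Phi>" using that deg by auto
    assume \<phi>: "\<phi> \<in> irreds (degree \<phi>)" "\<phi> dvd f"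
    then show "\<phi> \<in> ?\<Phi>" using irreds_degree_pos[OF \<phi>(1)] dvd_imp_degree_le[OF \<phi>(2) f0] f by (auto simp: monics_def)
  qed
  also have "\<dots> = (\<Sum>\<phi>\<in>?\<Phi>. \<Sum>f\<in>monics n. G \<phi> f)" by (rule sum.swap)
  also have "\<dots> = (\<Sum>d = 1..n. \<Sum>\<phi>\<in>irreds d. \<Sum>f\<in>monics n. G \<phi> f)"
  proof (rule sum.UNION_disjoint)
    show "\<forall>i\<in>{1..n}. \<forall>j\<in>{1..n}. i \<noteq> j \<longrightarrow> irreds i \<inter> irreds j = ({} :: 'a poly set)"
      using deg by (metis disjoint_iff)
  qed (use finite_irreds in auto)
  also have "\<dots> = (\<Sum>d = 1..n. \<Sum>\<phi>\<in>irreds d. \<Sum>j = 1..n. if d dvd j then z (\<phi> ^ (j div d)) * Q \<phi> (n - j) else 0)"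
  proof (intro sum.cong refl)
    fix d and \<phi> :: "'a poly" assume d: "d \<in> {1..n}" and \<phi>: "\<phi> \<in> irreds d"
    have "(\<Sum>f\<in>monics n. G \<phi> f) = (\<Sum>m\<in>{m. m * d \<le> n}. z (\<phi> ^ m) * Q \<phi> (n - m * d))"
      unfolding sum_monics_factor[OF \<phi>] Q_def sum_distrib_left by (intro sum.cong refl) (auto simp: G_eq[OF \<phi>])
    also have "\<dots> = (\<Sum>j\<in>(\<lambda>m. m * d) ` {m. m * d \<le> n}. if d dvd j then z (\<phi> ^ (j div d)) * Q \<phi> (n - j) else 0)"
      using d by (subst sum.reindex) (auto simp: inj_on_def)
    also have "\<dots> = (\<Sum>j\<in>{0..n}. if d dvd j then z (\<phi> ^ (j div d)) * Q \<phi> (n - j) else 0)"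
      by (rule sum.mono_neutral_left) (auto simp: image_iff mult.commute elim!: dvdE)
    also have "\<dots> = (\<Sum>j = 1..n. if d dvd j then z (\<phi> ^ (j div d)) * Q \<phi> (n - j) else 0)"
      by (rule sum.mono_neutral_right) (auto simp: z_1 Suc_le_eq)
    finally show "(\<Sum>f\<in>monics n. G \<phi> f) = \<dots>" .
  qed
  also have "\<dots> = (\<Sum>d = 1..n. \<Sum>j = 1..n. if d dvd j then \<Sum>\<phi>\<in>irreds d. z (\<phi> ^ (j div d)) * Q \<phi> (n - j) else 0)"
  proof (intro sum.cong refl)
    fix d
    have "(\<Sum>\<phi>\<in>irreds d. \<Sum>j = 1..n. if d dvd j then z (\<phi> ^ (j div d)) * Q \<phi> (n - j) else 0)
        = (\<Sum>j = 1..n. \<Sum>\<phi>\<in>irreds d. if d dvd j then z (\<phi> ^ (j div d)) * Q \<phi> (n - j) else 0)" by (rule sum.swap)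
    then show "(\<Sum>\<phi>\<in>irreds d. \<Sum>j = 1..n. if d dvd j then z (\<phi> ^ (j div d)) * Q \<phi> (n - j) else 0)
        = (\<Sum>j = 1..n. if d dvd j then \<Sum>\<phi>\<in>irreds d. z (\<phi> ^ (j div d)) * Q \<phi> (n - j) else 0)"
      by (simp cong: if_cong sum.cong) (intro sum.cong refl, simp)
  qed
  also have "\<dots> = (\<Sum>j = 1..n. \<Sum>d = 1..n. if d dvd j then \<Sum>\<phi>\<in>irreds d. z (\<phi> ^ (j div d)) * Q \<phi> (n - j) else 0)"
    by (rule sum.swap)
  also have "\<dots> = (\<Sum>j = 1..n. A j n)"
    unfolding A_def by (intro sum.cong refl sum.mono_neutral_right) (auto dest: dvd_imp_le)
  finally show ?thesis .
qed

text \<open>Majorant for all prime powers with \<open>degree \<phi> = d\<close> and exponent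
  \<open>m\<close>, relative to \<open>T n\<close>: number of irreducibles, times degree
  \<open>m * d\<close>, times weight. For \<open>d = 1\<close> the number and the weights are exact;
  for \<open>m < 2\<close> the contribution of \<open>z\<close> vanishes.\<close>

definition \<beta> :: "nat \<Rightarrow> nat \<Rightarrow> real" where
  "\<beta> d m = (if m < 2 then 0 else if d = 1 then p * (real m * (1 / p) ^ m)
     else (p - 1) * p ^ (d - 1) * real d * (real m * (1 / (p ^ d - 1)) ^ m))"

definition b :: "nat \<Rightarrow> real" where "b j = (\<Sum>d = 1..j. if d dvd j then \<beta> d (j div d) else 0)"

lemma \<beta>_nonneg: "d \<ge> 1 \<Longrightarrow> \<beta> d m \<ge> 0"
  using p_ge_2 power_CARD_ge[of d] by (auto simp: \<beta>_def)

lemma b_nonneg: "b j \<ge> 0"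
  unfolding b_def by (intro sum_nonneg) (auto simp: \<beta>_nonneg)

lemma A_nonneg: "A j n \<ge> 0"
  unfolding A_def by (intro sum_nonneg) (auto intro!: sum_nonneg mult_nonneg_nonneg z_nonneg Q_nonneg)

text \<open>Three regimes: \<open>z_irreducible\<close> for \<open>m = 1\<close>, the exact weights
  of \<open>w_power_linear\<close> for \<open>d = 1\<close>, and otherwise \<open>w_power\<close>
  together with \<open>card_irreds_le\<close>.\<close>

lemma prime_power_term_le:
  assumes d: "1 \<le> d" and m: "m * d \<le> n" "1 \<le> m"
  shows "(\<Sum>\<phi>\<in>irreds d. z (\<phi> ^ m) * Q \<phi> (n - m * d)) \<le> \<beta> d m * T n"
proof -
  have zle: "z (\<phi> ^ m) \<le> real (m * d) * w (\<phi> ^ m)" if "\<phi> \<in> irreds d" for \<phi>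
    using z_le[OF monicsD(1)[OF irreds_power_monics[OF that]]] unfolding monicsD(2)[OF irreds_power_monics[OF that]] .
  consider "m = 1" | "m \<ge> 2" "d = 1" | "m \<ge> 2" "d \<ge> 2" using d m(2) by linarith
  then show ?thesis
  proof cases
    case 1
    have "z \<phi> = 0" if "\<phi> \<in> irreds d" for \<phi> using that by (intro z_irreducible) (auto simp: irreds_def monics_def)
    then show ?thesis using 1 by (simp add: \<beta>_def)
  next
    case 2
    have "(\<Sum>\<phi>\<in>irreds 1. z (\<phi> ^ m) * Q \<phi> (n - m * d)) \<le> (\<Sum>\<phi>\<in>(irreds 1 :: 'a poly set). real m * (1 / p) ^ m * T n)"
    proof (rule sum_mono)
      fix \<phi> :: "'a poly" assume \<phi>: "\<phi> \<in> irreds 1"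
      obtain k where k: "m = Suc k" using m(2) by (cases m) auto
      have "z (\<phi> ^ m) \<le> real m * w (\<phi> ^ m)" using zle[of \<phi>] \<phi> 2(2) by simp
      also have "\<dots> \<le> real m * (T n / p ^ m)"
        unfolding w_power_linear[OF \<phi>, of k, folded k]
        using T_incseq[THEN incseqD, of m n] m 2(2) p_ge_2 by (intro mult_left_mono divide_right_mono) auto
      finally show "z (\<phi> ^ m) * Q \<phi> (n - m * d) \<le> real m * (1 / p) ^ m * T n" by (simp add: Q_linear[OF \<phi>] power_one_over)
    qed
    also have "\<dots> = p * (real m * (1 / p) ^ m) * T n" using card_irreds_1[where 'a = 'a] by (simp add: p_eq)
    also have "\<dots> = \<beta> d m * T n" using 2 by (simp add: \<beta>_def)
    finally show ?thesis using 2(2) by simp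
  next
    case 3
    define t where "t = 1 / (p ^ d - 1)"
    have t0: "t \<ge> 0" using power_CARD_ge[OF 3(2)] by (simp add: t_def)
    have "(\<Sum>\<phi>\<in>irreds d. z (\<phi> ^ m) * Q \<phi> (n - m * d)) \<le> (\<Sum>\<phi>\<in>(irreds d :: 'a poly set). real (m * d) * t ^ m * T n)"
    proof (intro sum_mono mult_mono)
      fix \<phi> :: "'a poly" assume \<phi>: "\<phi> \<in> irreds d"
      have "z (\<phi> ^ m) \<le> real (m * d) * w (\<phi> ^ m)" using zle[OF \<phi>] .
      also have "\<dots> \<le> real (m * d) * t ^ m" using w_power[OF \<phi>, of m] by (intro mult_left_mono) (simp_all add: t_def power_one_over)
      finally show "z (\<phi> ^ m) \<le> real (m * d) * t ^ m" .
      show "Q \<phi> (n - m * d) \<le> T n" using Q_le_T[of \<phi> "n - m * d"] T_incseq[THEN incseqD, of "n - m * d" n] by simp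
    qed (use t0 Q_nonneg in auto)
    also have "\<dots> = real (card (irreds d :: 'a poly set)) * (real (m * d) * t ^ m * T n)" by simp
    also have "\<dots> \<le> ((p - 1) * p ^ (d - 1)) * (real (m * d) * t ^ m * T n)"
    proof (rule mult_right_mono)
      have "real (card (irreds d :: 'a poly set)) \<le> real ((CARD('a) - 1) * CARD('a) ^ (d - 1))"
        using card_irreds_le[OF 3(2)] by (rule of_nat_mono)
      then show "real (card (irreds d :: 'a poly set)) \<le> (p - 1) * p ^ (d - 1)" using p_ge_2 by (simp add: of_nat_diff p_eq)
    qed (use t0 T_pos[of n] in simp)
    also have "\<dots> = \<beta> d m * T n" using 3 by (simp add: \<beta>_def t_def)
    finally show ?thesis .
  qed
qed

lemma A_le:
  assumes "j \<le> n"
  shows "A j n \<le> b j * T n"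
proof -
  have "A j n \<le> (\<Sum>d = 1..j. (if d dvd j then \<beta> d (j div d) else 0) * T n)"
    unfolding A_def
  proof (rule sum_mono)
    fix d assume d: "d \<in> {1..j}"
    show "(if d dvd j then \<Sum>\<phi>\<in>irreds d. z (\<phi> ^ (j div d)) * Q \<phi> (n - j) else 0) \<le> (if d dvd j then \<beta> d (j div d) else 0) * T n"
    proof (cases "d dvd j")
      case True
      then have m: "(j div d) * d = j" "1 \<le> j div d" using d by (auto simp: Suc_le_eq div_greater_zero_iff)
      then show ?thesis using prime_power_term_le[of d "j div d" n] d assms True by simp
    qed simp
  qed
  then show ?thesis by (simp add: b_def sum_distrib_right)
qed

section \<open>The explicit constant\<close>

definition C :: real where "C = p * (4 * p - 3) / (p - 1) ^ 3"

text \<open>With \<open>q = p ^ d\<close> the estimate says that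
  \<open>q\<^sup>2 * (2 * q - 3) / ((q - 1) * (q - 2)\<^sup>2)\<close> is at most 20/3, its value at
  \<open>q = 4\<close>, the least possible \<open>q\<close>; hence the factor \<open>q - 4\<close>
  in the polynomial inequality of the proof.\<close>

lemma geometric_weight_le:
  assumes d: "d \<ge> 2"
  shows "(p - 1) * p ^ (d - 1) * real d * ((1 / (p ^ d - 1))\<^sup>2 * (2 - 1 / (p ^ d - 1)) / (1 - 1 / (p ^ d - 1))\<^sup>2)
    \<le> 20 / 3 * (1 - 1 / p) * (real d * (1 / p) ^ d)"
proof -
  define q where "q = p ^ d"
  have q: "q \<ge> 4" using power_CARD_ge[OF d] by (simp add: q_def)
  have pq: "(p - 1) * p ^ (d - 1) = (1 - 1 / p) * q"
    using d p_ge_2 by (cases d) (simp_all add: q_def field_simps)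
  have t: "(1 / (q - 1))\<^sup>2 * (2 - 1 / (q - 1)) / (1 - 1 / (q - 1))\<^sup>2 = (2 * q - 3) / ((q - 1) * (q - 2)\<^sup>2)"
  proof -
    have *: "(1 / v)\<^sup>2 * (w / v) / (u / v)\<^sup>2 = w / (v * u\<^sup>2)" if "u \<noteq> 0" "v \<noteq> 0" for u v w :: real
      using that by (simp add: field_simps power2_eq_square)
    have 1: "1 - 1 / (q - 1) = (q - 2) / (q - 1)" "2 - 1 / (q - 1) = (2 * q - 3) / (q - 1)" using q by (simp_all add: field_simps)
    show ?thesis unfolding 1 using q by (intro *) auto
  qed
  have "q * ((2 * q - 3) / ((q - 1) * (q - 2)\<^sup>2)) \<le> 20 / 3 * (1 / q)"
  proof -
    have "0 \<le> (q - 4) * (14 * q * q - 35 * q + 20)"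
    proof (rule mult_nonneg_nonneg)
      have "35 * q \<le> 14 * q * q" using q by (intro mult_right_mono) auto
      then show "0 \<le> 14 * q * q - 35 * q + 20" by simp
    qed (use q in simp)
    then have "3 * (q * q * (2 * q - 3)) \<le> 20 * ((q - 1) * (q - 2)\<^sup>2)" by (simp add: algebra_simps power2_eq_square)
    moreover have "(q - 1) * (q - 2)\<^sup>2 > 0" using q by simp
    ultimately show ?thesis using q by (simp add: field_simps)
  qed
  then have "(1 - 1 / p) * real d * (q * ((2 * q - 3) / ((q - 1) * (q - 2)\<^sup>2))) \<le> (1 - 1 / p) * real d * (20 / 3 * (1 / q))"
    using p_ge_2 by (intro mult_left_mono) auto
  then show ?thesis unfolding q_def[symmetric] t pq by (simp add: power_one_over q_def mult_ac)
qed

text \<open>In terms of \<open>x = 1 / p\<close> and after multiplication by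
  \<open>(1 - x) ^ 3\<close>, the linear factors use up the part
  \<open>x * (2 - x) * (1 - x)\<close> of \<open>x * (4 - 3 * x)\<close>, and the remaining
  \<open>x * (2 - x\<^sup>2)\<close> has to cover the higher degrees. With
  \<open>y = (1 - x)\<^sup>2\<close> this is
  \<open>20 / 3 * (1 - y) * y \<le> 2 - x\<^sup>2\<close>, where the left side is at most 5/3 and
  the right side at least 7/4.\<close>

lemma C_bound:
  "p * ((1 / p)\<^sup>2 * (2 - 1 / p) / (1 - 1 / p)\<^sup>2) + 20 / 3 * (1 - 1 / p) * ((1 / p)\<^sup>2 * (2 - 1 / p) / (1 - 1 / p)\<^sup>2) \<le> C"
proof -
  define x where "x = 1 / p"
  have x: "0 < x" "x \<le> 1 / 2" using p_ge_2 by (auto simp: x_def field_simps)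
  have p: "p = 1 / x" by (simp add: x_def)
  define y where "y = (1 - x)\<^sup>2"
  have C: "C = x * (4 - 3 * x) / (1 - x) ^ 3"
  proof -
    have a: "1 / x - 1 = (1 - x) / x" "4 * (1 / x) - 3 = (4 - 3 * x) / x" using x by (simp_all add: field_simps)
    have u: "1 - x \<noteq> 0" using x by simp
    show ?thesis unfolding C_def unfolding p a using x u by (simp add: power_divide power3_eq_cube)
  qed
  have "20 / 3 * (x * (2 - x) * (1 - x)\<^sup>2) \<le> 2 - x\<^sup>2"
  proof -
    have "x * (2 - x) = 1 - y" by (simp add: y_def power2_eq_square algebra_simps)
    moreover have "(1 - y) * y \<le> 1 / 4"
      using zero_le_power2[of "y - 1 / 2"] by (simp add: power2_eq_square algebra_simps)
    moreover have "x\<^sup>2 \<le> (1 / 2)\<^sup>2" using x by (intro power_mono) auto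
    ultimately show ?thesis unfolding y_def[symmetric] by (simp add: power2_eq_square)
  qed
  then have "x * (20 / 3 * (x * (2 - x) * (1 - x)\<^sup>2)) \<le> x * (2 - x\<^sup>2)" using x by (intro mult_left_mono) auto
  then have "x * (2 - x) * (1 - x) + 20 / 3 * (x\<^sup>2 * (2 - x)) * (1 - x)\<^sup>2 \<le> x * (4 - 3 * x)"
  proof -
    have "x * (4 - 3 * x) = x * (2 - x) * (1 - x) + x * (2 - x\<^sup>2)" by (simp add: power2_eq_square algebra_simps)
    moreover have "20 / 3 * (x\<^sup>2 * (2 - x)) * (1 - x)\<^sup>2 = x * (20 / 3 * (x * (2 - x) * (1 - x)\<^sup>2))" by (simp add: power2_eq_square mult_ac)
    ultimately show ?thesis using \<open>x * (20 / 3 * _) \<le> _\<close> by linarith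
  qed
  then have "(x * (2 - x) * (1 - x) + 20 / 3 * (x\<^sup>2 * (2 - x)) * (1 - x)\<^sup>2) / (1 - x) ^ 3 \<le> C"
    unfolding C using x by (intro divide_right_mono) auto
  also have "(x * (2 - x) * (1 - x) + 20 / 3 * (x\<^sup>2 * (2 - x)) * (1 - x)\<^sup>2) / (1 - x) ^ 3
      = p * (x\<^sup>2 * (2 - x) / (1 - x)\<^sup>2) + 20 / 3 * (1 - x) * (x\<^sup>2 * (2 - x) / (1 - x)\<^sup>2)"
  proof -
    have "(x * a * u + 20 / 3 * (x\<^sup>2 * a) * u\<^sup>2) / u ^ 3 = p * (x\<^sup>2 * a / u\<^sup>2) + 20 / 3 * u * (x\<^sup>2 * a / u\<^sup>2)"
      if "u \<noteq> 0" for a u :: real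
      unfolding p using that x(1) by (simp add: field_simps power2_eq_square power3_eq_cube)
    then show ?thesis using x by simp
  qed
  finally show ?thesis unfolding x_def .
qed

lemma sum_b_le: "(\<Sum>j\<le>N. b j) \<le> C"
proof (cases "N \<ge> 1")
  case False
  have "0 \<le> C" using p_ge_2 by (auto simp: C_def)
  then show ?thesis using False by (simp add: b_def)
next
  case True
  let ?h = "\<lambda>t::real. t\<^sup>2 * (2 - t) / (1 - t)\<^sup>2"
  have "(\<Sum>j\<le>N. b j) = (\<Sum>j\<le>N. \<Sum>d\<in>{d \<in> {1..j}. d dvd j}. \<beta> d (j div d))"
    unfolding b_def by (simp only: sum.inter_filter finite_atLeastAtMost)
  also have "\<dots> = (\<Sum>(j, d)\<in>(SIGMA j:{..N}. {d \<in> {1..j}. d dvd j}). \<beta> d (j div d))" by (simp add: sum.Sigma)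
  \<comment> \<open>A degree \<open>j\<close> with a divisor \<open>d\<close> becomes the pair of
    \<open>d\<close> and the exponent \<open>m = j div d\<close>; passing to a full rectangle
    afterwards only adds nonnegative terms.\<close>
  also have "\<dots> = (\<Sum>(d, m)\<in>(\<lambda>(j, d). (d, j div d)) ` (SIGMA j:{..N}. {d \<in> {1..j}. d dvd j}). \<beta> d m)"
    by (subst sum.reindex) (auto simp: inj_on_def case_prod_unfold dvd_def)
  also have "\<dots> \<le> (\<Sum>(d, m)\<in>{1..N} \<times> {..N}. \<beta> d m)"
    by (rule sum_mono2) (auto simp: \<beta>_nonneg intro: order_trans[OF div_le_dividend])
  also have "\<dots> = (\<Sum>d = 1..N. \<Sum>m\<le>N. \<beta> d m)" by (simp add: sum.cartesian_product)
  also have "\<dots> = (\<Sum>d = 1..N. \<Sum>m = 2..N. \<beta> d m)"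
    by (intro sum.cong refl sum.mono_neutral_right) (auto simp: \<beta>_def)
  also have "\<dots> = (\<Sum>m = 2..N. \<beta> 1 m) + (\<Sum>d = 2..N. \<Sum>m = 2..N. \<beta> d m)"
    using sum.atLeast_Suc_atMost[OF True, of "\<lambda>d. \<Sum>m = 2..N. \<beta> d m"] by (simp add: eval_nat_numeral)
  also have "\<dots> \<le> p * ?h (1 / p) + (\<Sum>d = 2..N. 20 / 3 * (1 - 1 / p) * (real d * (1 / p) ^ d))"
  proof (intro add_mono sum_mono)
    have "(\<Sum>m = 2..N. \<beta> 1 m) = p * (\<Sum>m = 2..N. real m * (1 / p) ^ m)"
      unfolding sum_distrib_left by (intro sum.cong refl) (auto simp: \<beta>_def)
    also have "\<dots> \<le> p * ?h (1 / p)" using p_ge_2 by (intro mult_left_mono sum_arith_geometric_le) auto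
    finally show "(\<Sum>m = 2..N. \<beta> 1 m) \<le> p * ?h (1 / p)" .
    fix d assume "d \<in> {2..N}"
    then have d: "d \<ge> 2" by simp
    let ?t = "1 / (p ^ d - 1)"
    have "(\<Sum>m = 2..N. \<beta> d m) = (p - 1) * p ^ (d - 1) * real d * (\<Sum>m = 2..N. real m * ?t ^ m)"
      unfolding sum_distrib_left using d by (intro sum.cong refl) (auto simp: \<beta>_def)
    also have "\<dots> \<le> (p - 1) * p ^ (d - 1) * real d * ?h ?t"
    proof (intro mult_left_mono sum_arith_geometric_le)
      show "0 \<le> ?t" "?t < 1" using power_CARD_ge[OF d] by (simp_all add: field_simps)
      show "0 \<le> (p - 1) * p ^ (d - 1) * real d" using p_ge_2 by (intro mult_nonneg_nonneg) auto
    qed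
    also have "\<dots> \<le> 20 / 3 * (1 - 1 / p) * (real d * (1 / p) ^ d)" by (rule geometric_weight_le[OF d])
    finally show "(\<Sum>m = 2..N. \<beta> d m) \<le> 20 / 3 * (1 - 1 / p) * (real d * (1 / p) ^ d)" .
  qed
  also have "(\<Sum>d = 2..N. 20 / 3 * (1 - 1 / p) * (real d * (1 / p) ^ d)) \<le> 20 / 3 * (1 - 1 / p) * ?h (1 / p)"
    unfolding sum_distrib_left[symmetric]
  proof (intro mult_left_mono sum_arith_geometric_le)
    have "1 / p < 1" using p_ge_2 by simp
    then show "0 \<le> 20 / 3 * (1 - 1 / p)" "1 / p < 1" by simp_all
  qed (use p_ge_2 in simp)
  finally show ?thesis using C_bound by linarith
qed

theorem ratio_tendsto: "\<exists>L. (\<lambda>n. S n / T n) \<longlonglongrightarrow> L \<and> 0 < L \<and> L \<le> C"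
proof -
  obtain Tl where Tl: "T \<longlonglongrightarrow> Tl" using T_convergent by (auto simp: convergent_def)
  have Tl1: "Tl \<ge> 1" using Tl T_ge_1 by (intro LIMSEQ_le_const[OF Tl]) auto
  \<comment> \<open>Zero for \<open>j > n\<close>, so that the series over \<open>j\<close> is the
    finite sum \<open>S n / T n\<close> for each \<open>n\<close>, dominated by the summable
    \<open>b\<close>.\<close>
  define a where "a j n = (if j \<le> n then A j n / T n else 0)" for j n
  define \<alpha> where "\<alpha> j = (\<Sum>d = 1..j. if d dvd j then \<Sum>\<phi>\<in>irreds d. z (\<phi> ^ (j div d)) * lim (Q \<phi>) else 0) / Tl" for j
  have lim: "(\<lambda>n. a j n) \<longlonglongrightarrow> \<alpha> j" for j
  proof -
    have q: "(\<lambda>n. Q \<phi> (n - j)) \<longlonglongrightarrow> lim (Q \<phi>)" if "\<phi> \<in> irreds d" for \<phi> d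
    proof -
      have "Q \<phi> \<longlonglongrightarrow> lim (Q \<phi>)" using Q_convergent[OF that] by (simp add: convergent_LIMSEQ_iff)
      then have "(\<lambda>n. Q \<phi> (n + j - j)) \<longlonglongrightarrow> lim (Q \<phi>)" by simp
      then show ?thesis using LIMSEQ_offset[of "\<lambda>n. Q \<phi> (n - j)" j] by simp
    qed
    have inner: "(\<lambda>n. if d dvd j then \<Sum>\<phi>\<in>irreds d. z (\<phi> ^ (j div d)) * Q \<phi> (n - j) else 0)
        \<longlonglongrightarrow> (if d dvd j then \<Sum>\<phi>\<in>irreds d. z (\<phi> ^ (j div d)) * lim (Q \<phi>) else 0)" for d
      using q[of _ d] by (cases "d dvd j") (auto intro!: tendsto_sum tendsto_mult_left)
    have "(\<lambda>n. A j n / T n) \<longlonglongrightarrow> \<alpha> j"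
      unfolding A_def \<alpha>_def using Tl1 by (intro tendsto_divide tendsto_sum inner Tl) simp
    then show ?thesis
      by (rule Lim_transform_eventually) (rule eventually_mono[OF eventually_ge_at_top[of j]], simp add: a_def)
  qed
  have a_bound: "\<bar>a j n\<bar> \<le> b j" for j n
    using A_le[of j n] A_nonneg[of j n] T_pos[of n] b_nonneg[of j] by (auto simp: a_def pos_divide_le_eq)
  have sb: "summable b"
    by (rule bounded_imp_summable[of _ C]) (use b_nonneg sum_b_le in auto)
  have ratio: "S n / T n = (\<Sum>j\<le>n. a j n)" for n
  proof -
    have "(\<Sum>j\<le>n. a j n) = (\<Sum>j = 1..n. a j n)" by (rule sum.mono_neutral_right) (auto simp: a_def A_def)
    also have "\<dots> = (\<Sum>j = 1..n. A j n) / T n" unfolding sum_divide_distrib by (intro sum.cong refl) (simp add: a_def)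
    finally show ?thesis unfolding S_eq_sum_A ..
  qed
  have "suminf (\<lambda>j. a j n) = S n / T n" for n
    unfolding ratio by (rule suminf_finite) (auto simp: a_def)
  moreover have tan: "summable (\<lambda>j. norm (\<alpha> j)) \<and> ((\<lambda>n. suminf (\<lambda>j. a j n)) \<longlonglongrightarrow> suminf \<alpha>)"
    using tannerys_theorem[of a \<alpha> sequentially b, OF lim _ sb] a_bound by (auto simp: always_eventually)
  ultimately have L: "(\<lambda>n. S n / T n) \<longlonglongrightarrow> suminf \<alpha>" by simp
  have "S n / T n \<le> C" for n
  proof -
    have "S n / T n \<le> (\<Sum>j\<le>n. b j)" unfolding ratio by (intro sum_mono) (use a_bound in \<open>auto intro: abs_le_D1\<close>)
    then show ?thesis using sum_b_le[of n] by linarith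
  qed
  then have LC: "suminf \<alpha> \<le> C" by (intro LIMSEQ_le_const2[OF L]) auto
  have \<alpha>0: "\<alpha> j \<ge> 0" for j
    using lim by (rule LIMSEQ_le_const) (use A_nonneg T_pos in \<open>auto simp: a_def less_imp_le\<close>)
  have "[:0, 1 :: 'a:] = [:- 0, 1:]" by simp
  then have X: "[:0, 1 :: 'a:] \<in> irreds 1" unfolding irreds_1 by blast
  \<comment> \<open>The limit term of degree 2 is at least the contribution of
    \<open>\<phi> = X\<close> alone, for which \<open>Q\<close> is identically 1.\<close>
  have "z ([:0, 1:] ^ 2) / Tl \<le> \<alpha> 2"
  proof (rule LIMSEQ_le[OF _ lim])
    show "(\<lambda>n. z ([:0, 1:] ^ 2) / T n) \<longlonglongrightarrow> z ([:0, 1:] ^ 2) / Tl" using Tl1 by (intro tendsto_divide tendsto_const Tl) simp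
    have "z ([:0, 1:] ^ 2) / T n \<le> a 2 n" if n: "n \<ge> 2" for n
    proof -
      have "z ([:0, 1:] ^ 2) \<le> (\<Sum>\<phi>\<in>irreds 1. z (\<phi> ^ 2) * Q \<phi> (n - 2))"
        using member_le_sum[of "[:0, 1:]" "irreds 1" "\<lambda>\<phi>. z (\<phi> ^ 2) * Q \<phi> (n - 2)"] X finite_irreds Q_linear z_nonneg Q_nonneg by auto
      also have "\<dots> \<le> A 2 n"
      proof -
        have "(\<Sum>\<phi>\<in>irreds 2. z \<phi> * Q \<phi> (n - 2)) \<ge> 0" by (intro sum_nonneg mult_nonneg_nonneg z_nonneg Q_nonneg)
        moreover have "{1..2::nat} = {1, 2}" by auto
        ultimately show ?thesis by (simp add: A_def)
      qed
      finally show ?thesis using n T_pos[of n] by (simp add: a_def divide_right_mono)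
    qed
    then show "\<exists>N. \<forall>n\<ge>N. z ([:0, 1:] ^ 2) / T n \<le> a 2 n" by blast
  qed
  then have "\<alpha> 2 > 0" using z_square Tl1 by (smt (verit) divide_pos_pos)
  moreover have "summable \<alpha>" using tan summable_norm_cancel by blast
  ultimately have "suminf \<alpha> > 0" using \<alpha>0 by (intro suminf_pos2[of _ 2]) auto
  then show ?thesis using L LC by blast
qed

end

section \<open>The weights of random p-adic matrices\<close>

definition ramified_count :: "'p::prime_card padic_int mat \<Rightarrow> real" where
  "ramified_count A = real (eigenvalue_count (- maximal_unramified) A)"

lemma ramified_count_eq:
  assumes "A \<in> carrier_mat n n"
  shows "ramified_count A = real n - real (eigenvalue_count maximal_unramified A)"
  using eigenvalue_count_compl[OF assms, of maximal_unramified] by (simp add: ramified_count_def)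

lemma ramified_count_bounds:
  assumes "A \<in> carrier_mat n n"
  shows "0 \<le> ramified_count A" "ramified_count A \<le> real n" "\<bar>ramified_count A\<bar> \<le> real n"
  using eigenvalue_count_le[OF assms, of "- maximal_unramified"] by (simp_all add: ramified_count_def)

lemma ramified_count_measurable: "ramified_count \<in> borel_measurable (haar_mat n :: 'p::prime_card padic_int mat measure)"
proof -
  have "(\<lambda>A. real n - real (eigenvalue_count maximal_unramified A)) \<in> borel_measurable (haar_mat n :: 'p padic_int mat measure)"
    by (intro borel_measurable_diff borel_measurable_const eigenvalue_count_measurable)
  then show ?thesis by (subst measurable_cong[OF ramified_count_eq]) (simp_all add: haar_mat_facts(2))
qed

lemma ramified_count_intertwine:
  fixes A :: "'p::prime_card padic_int mat"
  assumes "G \<in> ZGL n" "A \<in> carrier_mat n n" "B \<in> carrier_mat n n" "A * G = G * B"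
  shows "ramified_count A = ramified_count B"
  unfolding ramified_count_def eigenvalue_count_evs[OF assms(2)] eigenvalue_count_evs[OF assms(3)]
    evs_intertwine[OF assms(2,3,1,4)] ..

lemma ramified_count_diag2:
  fixes B :: "'p::prime_card padic_int mat"
  assumes B: "B \<in> carrier_mat a a" and C: "C \<in> carrier_mat b b"
  shows "ramified_count (diag2 B C) = ramified_count B + ramified_count C"
proof -
  have d: "diag2 B C \<in> carrier_mat (a + b) (a + b)" using B C by simp
  show ?thesis
    unfolding ramified_count_def eigenvalue_count_evs[OF d] eigenvalue_count_evs[OF B] eigenvalue_count_evs[OF C] evs_diag2[OF B C] by simp
qed

abbreviation gl :: "'p::prime_card itself \<Rightarrow> nat \<Rightarrow> real" where
  "gl _ n \<equiv> real (card (GL n :: 'p mod_ring mat set))"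

text \<open>By the orbit formula, the sum of the inverse orders of the centralisers over the
  conjugacy classes with characteristic polynomial \<open>f\<close>.\<close>

definition wgt :: "'p::prime_card mod_ring poly \<Rightarrow> real" where
  "wgt f = real (card (Ch (degree f) f)) / gl TYPE('p) (degree f)"

text \<open>The power of \<open>p\<close> turns each \<open>bint\<close> into the conditional mean
  of \<open>ramified_count\<close> on the residue class; \<open>zwt\<close> is \<open>wgt\<close>
  with every matrix multiplied by this mean.\<close>

definition zwt :: "'p::prime_card mod_ring poly \<Rightarrow> real" where
  "zwt f = real CARD('p) ^ (degree f * degree f) / gl TYPE('p) (degree f)
     * (\<Sum>M\<in>Ch (degree f) f. bint (degree f) (ramified_count :: 'p padic_int mat \<Rightarrow> real) M)"

lemma gl_pos: "gl TYPE('p::prime_card) n > 0"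
  using card_GL_pos[of n] by simp

lemma CARD_pos_real: "real CARD('p::prime_card) > 0"
  by simp

lemma bint_ram_intertwine:
  fixes M :: "'p::prime_card mod_ring mat"
  assumes "G \<in> GL n" "M \<in> carrier_mat n n" "N \<in> carrier_mat n n" "M * G = G * N"
  shows "bint n ramified_count M = bint n ramified_count N"
  by (rule bint_conj[OF assms ramified_count_measurable]) (rule ramified_count_intertwine)

lemma wgt_mult:
  fixes f g :: "'p::prime_card mod_ring poly"
  assumes "lead_coeff f = 1" "lead_coeff g = 1" "coprime f g"
  shows "wgt (f * g) = wgt f * wgt g"
proof -
  have nz: "f \<noteq> 0" "g \<noteq> 0" using assms by auto
  have dg: "degree (f * g) = degree f + degree g" using nz by (rule degree_mult_eq)
  have "gl TYPE('p) (degree f) * gl TYPE('p) (degree g) * real (card (Ch (degree f + degree g) (f * g)))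
      = gl TYPE('p) (degree f + degree g) * (real (card (Ch (degree f) f)) * real (card (Ch (degree g) g)))"
    using sum_coprime_product[OF assms(1) refl assms(3), of "degree g" "\<lambda>_. 1"] by simp
  then show ?thesis unfolding wgt_def dg
    using gl_pos[where 'p='p, of "degree f"] gl_pos[where 'p='p, of "degree g"] gl_pos[where 'p='p, of "degree f + degree g"]
    by (simp add: field_simps)
qed

text \<open>By \<open>sum_coprime_product\<close> it suffices to treat block diagonal matrices,
  where \<open>bint_diag2\<close> splits the integral; its scale factors \<open>Pa / P\<close> and
  \<open>Pb / P\<close> are absorbed by the powers of \<open>p\<close> in
  \<open>zwt\<close>.\<close>

lemma zwt_mult:
  fixes f g :: "'p::prime_card mod_ring poly"
  assumes "lead_coeff f = 1" "lead_coeff g = 1" "coprime f g"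
  shows "zwt (f * g) = zwt f * wgt g + wgt f * zwt g"
proof -
  have nz: "f \<noteq> 0" "g \<noteq> 0" using assms by auto
  define a where "a = degree f"
  define b where "b = degree g"
  define P where "P = real CARD('p) ^ ((a + b) * (a + b))"
  define Pa where "Pa = real CARD('p) ^ (a * a)"
  define Pb where "Pb = real CARD('p) ^ (b * b)"
  have P0: "P > 0" by (simp add: P_def)
  define h where "h = bint (a + b) (ramified_count :: 'p padic_int mat \<Rightarrow> real)"
  define ha where "ha = bint a (ramified_count :: 'p padic_int mat \<Rightarrow> real)"
  define hb where "hb = bint b (ramified_count :: 'p padic_int mat \<Rightarrow> real)"
  have dg: "degree (f * g) = a + b" unfolding a_def b_def using nz by (rule degree_mult_eq)
  have "gl TYPE('p) a * gl TYPE('p) b * (\<Sum>M\<in>Ch (a + b) (f * g). h M)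
      = gl TYPE('p) (a + b) * (\<Sum>B\<in>Ch a f. \<Sum>C\<in>Ch b g. h (diag2 B C))"
    unfolding h_def by (rule sum_coprime_product[OF assms(1) _ assms(3)]) (auto simp: a_def intro: bint_ram_intertwine)
  also have "(\<Sum>B\<in>Ch a f. \<Sum>C\<in>Ch b g. h (diag2 B C)) = (\<Sum>B\<in>Ch a f. \<Sum>C\<in>Ch b g. Pa / P * ha B + Pb / P * hb C)"
  proof (intro sum.cong refl)
    fix B C :: "'p mod_ring mat" assume BC: "B \<in> Ch a f" "C \<in> Ch b g"
    then have BC': "B \<in> carrier_mat a a" "C \<in> carrier_mat b b" "coprime (char_poly B) (char_poly C)" using assms(3) by (auto simp: Ch_def)
    show "h (diag2 B C) = Pa / P * ha B + Pb / P * hb C"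
      unfolding h_def ha_def hb_def P_def Pa_def Pb_def
    proof (rule bint_diag2[OF BC' ramified_count_measurable ramified_count_measurable ramified_count_measurable ramified_count_bounds(3) ramified_count_bounds(3)])
      fix A U B C :: "'p padic_int mat"
      assume *: "A \<in> carrier_mat (a + b) (a + b)" "U \<in> ZGL (a + b)" "B \<in> carrier_mat a a" "C \<in> carrier_mat b b" "A * U = U * diag2 B C"
      then have "ramified_count A = ramified_count (diag2 B C)" by (intro ramified_count_intertwine[OF *(2,1)]) auto
      then show "ramified_count A = ramified_count B + ramified_count C" using ramified_count_diag2[OF *(3,4)] by simp
    qed
  qed
  also have "\<dots> = (\<Sum>B\<in>Ch a f. real (card (Ch b g)) * (Pa / P * ha B) + Pb / P * (\<Sum>C\<in>Ch b g. hb C))"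
    by (simp add: sum.distrib sum_distrib_left)
  also have "\<dots> = (Pa * real (card (Ch b g)) * (\<Sum>B\<in>Ch a f. ha B) + Pb * real (card (Ch a f)) * (\<Sum>C\<in>Ch b g. hb C)) / P"
  proof -
    have s1: "(\<Sum>B\<in>Ch a f. real (card (Ch b g)) * (Pa / P * ha B)) = real (card (Ch b g)) * Pa / P * (\<Sum>B\<in>Ch a f. ha B)"
      unfolding sum_distrib_left by (intro sum.cong refl) simp
    show ?thesis unfolding sum.distrib s1 by (simp add: add_divide_distrib mult_ac)
  qed
  finally have "P * (gl TYPE('p) a * gl TYPE('p) b * (\<Sum>M\<in>Ch (a + b) (f * g). h M))
      = gl TYPE('p) (a + b) * (Pa * real (card (Ch b g)) * (\<Sum>B\<in>Ch a f. ha B) + Pb * real (card (Ch a f)) * (\<Sum>C\<in>Ch b g. hb C))"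
    using P0 by simp
  then have "P / gl TYPE('p) (a + b) * (\<Sum>M\<in>Ch (a + b) (f * g). h M)
      = (Pa / gl TYPE('p) a * (\<Sum>B\<in>Ch a f. ha B)) * (real (card (Ch b g)) / gl TYPE('p) b)
      + (real (card (Ch a f)) / gl TYPE('p) a) * (Pb / gl TYPE('p) b * (\<Sum>C\<in>Ch b g. hb C))"
    using gl_pos[where 'p='p, of a] gl_pos[where 'p='p, of b] gl_pos[where 'p='p, of "a + b"] by (simp add: field_simps)
  then show ?thesis unfolding zwt_def wgt_def dg a_def[symmetric] b_def[symmetric] P_def Pa_def Pb_def h_def ha_def hb_def .
qed

lemma bint_ram_bounds:
  fixes M :: "'p::prime_card mod_ring mat"
  assumes M: "M \<in> carrier_mat n n"
  shows "0 \<le> bint n ramified_count M" "bint n ramified_count M \<le> real n / real CARD('p) ^ (n * n)"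
proof -
  interpret H: prob_space "haar_mat n :: 'p padic_int mat measure" by (rule haar_mat_facts(1))
  have sp: "T \<in> space (haar_mat n) \<longleftrightarrow> T \<in> carrier_mat n n" for T :: "'p padic_int mat" by (simp add: haar_mat_facts(2))
  show "0 \<le> bint n ramified_count M" unfolding bint_def
    by (intro Bochner_Integration.integral_nonneg_AE AE_I2) (auto simp: sp ramified_count_bounds(1))
  have "bint n ramified_count M \<le> (\<integral>T. real n * indicator (resball n M) T \<partial>haar_mat n)"
    unfolding bint_def
  proof (rule integral_mono)
    show "integrable (haar_mat n) (\<lambda>T. indicator (resball n M) T * ramified_count T)"
      by (rule haar_integrable_bounded[OF resball_indicator_measurable[OF M ramified_count_measurable], where c = "real n"])
         (auto simp: ramified_count_bounds(3) indicator_def)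
    show "integrable (haar_mat n) (\<lambda>T. real n * indicator (resball n M) T :: real)"
      using resball_sets[OF M] by (intro integrable_mult_right integrable_real_indicator) (simp_all add: H.emeasure_eq_measure)
    show "indicator (resball n M) T * ramified_count T \<le> real n * indicator (resball n M) T" if "T \<in> space (haar_mat n)" for T
      using that ramified_count_bounds(2)[of T n] by (auto simp: sp indicator_def)
  qed
  also have "\<dots> = real n / real CARD('p) ^ (n * n)"
    using measure_resball[OF M] resball_sets[OF M] sets.sets_into_space[OF resball_sets[OF M]] by (simp add: Int_absorb2)
  finally show "bint n ramified_count M \<le> real n / real CARD('p) ^ (n * n)" .
qed

lemma Ch_carrier: "M \<in> Ch n f \<Longrightarrow> M \<in> carrier_mat n n"
  by (simp add: Ch_def)

lemma zwt_nonneg: "zwt f \<ge> 0"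
  unfolding zwt_def by (intro mult_nonneg_nonneg sum_nonneg bint_ram_bounds(1)) (auto dest: Ch_carrier)

lemma zwt_le:
  fixes f :: "'p::prime_card mod_ring poly"
  shows "zwt f \<le> real (degree f) * wgt f"
proof -
  let ?n = "degree f" and ?P = "real CARD('p) ^ (degree f * degree f)"
  have "(\<Sum>M\<in>Ch ?n f. bint ?n (ramified_count :: 'p padic_int mat \<Rightarrow> real) M) \<le> (\<Sum>M\<in>Ch ?n f. real ?n / ?P)"
    by (intro sum_mono bint_ram_bounds(2) Ch_carrier)
  then have "zwt f \<le> ?P / gl TYPE('p) ?n * (real (card (Ch ?n f)) * (real ?n / ?P))"
    unfolding zwt_def by (intro mult_left_mono) auto
  also have "\<dots> = real ?n * wgt f" unfolding wgt_def by simp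
  finally show ?thesis .
qed

lemma evs_root:
  assumes "A \<in> carrier_mat n n" "x \<in># evs A"
  shows "poly (map_poly oz (char_poly A)) x = 0"
  using assms char_poly_nonzero[OF assms(1)] by (auto simp: evs_def)

lemma zwt_irreducible:
  fixes f :: "'p::prime_card mod_ring poly"
  assumes "irreducible f"
  shows "zwt f = 0"
proof -
  let ?n = "degree f"
  have "bint ?n (ramified_count :: 'p padic_int mat \<Rightarrow> real) M = 0" if M: "M \<in> Ch ?n f" for M
  proof -
    have "indicator (resball ?n M) T * ramified_count T = 0" if T: "T \<in> carrier_mat ?n ?n" for T :: "'p padic_int mat"
    proof (cases "T \<in> resball ?n M")
      case True
      then have "irreducible (char_poly (redm T))" using M assms by (simp add: resball_def Ch_def)
      then have "x \<in> maximal_unramified" if "x \<in># evs T" for x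
        using simple_root_unramified[OF T] evs_root[OF T that] by blast
      then have "filter_mset (\<lambda>x. x \<in> - maximal_unramified) (evs T) = {#}" by simp
      then show ?thesis unfolding ramified_count_def eigenvalue_count_evs[OF T] by simp
    qed simp
    then have "bint ?n (ramified_count :: 'p padic_int mat \<Rightarrow> real) M = (\<integral>T. 0 \<partial>(haar_mat ?n :: 'p padic_int mat measure))"
      unfolding bint_def by (intro Bochner_Integration.integral_cong refl) (simp add: haar_mat_facts(2))
    then show ?thesis by simp
  qed
  then show ?thesis unfolding zwt_def by simp
qed

lemma carrier_mat_0_0: "carrier_mat 0 0 = {1\<^sub>m 0 :: 'a::{zero,one} mat}"
  by (auto intro!: eq_matI)

lemma wgt_1: "wgt (1 :: 'p::prime_card mod_ring poly) = 1"
proof -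
  have "char_poly (1\<^sub>m 0 :: 'p mod_ring mat) = 1"
    using degree_char_poly[of "1\<^sub>m 0 :: 'p mod_ring mat" 0] monic_char_poly[of "1\<^sub>m 0 :: 'p mod_ring mat" 0]
    by (auto elim!: degree_eq_zeroE)
  then have "Ch 0 (1 :: 'p mod_ring poly) = {1\<^sub>m 0}" unfolding Ch_def carrier_mat_0_0 by auto
  moreover have "GL 0 = {1\<^sub>m 0 :: 'p mod_ring mat}" unfolding GL_def carrier_mat_0_0 by auto
  ultimately show ?thesis by (simp add: wgt_def)
qed

lemma CARD_power_gt_1: "d \<ge> 1 \<Longrightarrow> CARD('p::prime_card) ^ d > 1"
  using CARD_power_ge_2[where 'p='p, of d] by simp

text \<open>One factor \<open>f\<close> is split off at a time by \<open>card_Ch_mult_le\<close>,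
  and each costs at most \<open>1 / (p ^ d - 1)\<close> by
  \<open>card_Ch_irreducible_le\<close>.\<close>

lemma wgt_power:
  fixes f :: "'p::prime_card mod_ring poly"
  assumes f: "f \<in> irreds d"
  shows "wgt (f ^ m) \<le> 1 / (real CARD('p) ^ d - 1) ^ m"
proof (induction m)
  case 0
  then show ?case by (simp add: wgt_1)
next
  case (Suc m)
  have irr: "irreducible f" "lead_coeff f = 1" "degree f = d" using f by (auto simp: irreds_def monics_def)
  have d: "d \<ge> 1" using irreds_degree_pos[OF f] .
  let ?e = "m * d" and ?q = "real CARD('p) ^ d"
  have q: "?q > 1" using CARD_power_gt_1[OF d, where 'p='p] by (metis of_nat_1 of_nat_less_iff of_nat_power)
  have dm: "degree (f ^ m) = ?e" "degree (f ^ Suc m) = d + ?e"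
    using monicsD(2)[OF irreds_power_monics[OF f, of m]] monicsD(2)[OF irreds_power_monics[OF f, of "Suc m"]] by simp_all
  have "real (card (Ch (d + ?e) (f * f ^ m))) * (gl TYPE('p) d * gl TYPE('p) ?e)
      \<le> gl TYPE('p) (d + ?e) * (real (card (Ch d f)) * real (card (Ch ?e (f ^ m))))"
    using of_nat_mono[OF card_Ch_mult_le[OF irr, of ?e "f ^ m"], where 'a = real] by simp
  then have "wgt (f ^ Suc m) \<le> wgt f * wgt (f ^ m)"
    unfolding wgt_def dm irr(3) unfolding power_Suc
    using gl_pos[where 'p='p, of d] gl_pos[where 'p='p, of ?e] gl_pos[where 'p='p, of "d + ?e"] by (simp add: field_simps)
  also have "\<dots> \<le> 1 / (?q - 1) * (1 / (?q - 1) ^ m)"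
  proof (rule mult_mono)
    have "real (card (Ch d f)) * (?q - 1) \<le> gl TYPE('p) d"
      using of_nat_mono[OF card_Ch_irreducible_le[OF irr], where 'a = real] CARD_power_gt_1[OF d, where 'p='p]
      by (simp add: of_nat_diff)
    then show "wgt f \<le> 1 / (?q - 1)" unfolding wgt_def irr(3) using q gl_pos[where 'p='p, of d] by (simp add: field_simps)
  qed (use q Suc in \<open>auto simp: wgt_def\<close>)
  finally show ?case by simp
qed

lemma sum_Ch_monics:
  fixes h :: "'a::{field_gcd,finite} mat \<Rightarrow> real"
  shows "(\<Sum>f\<in>monics n. \<Sum>M\<in>Ch n f. h M) = (\<Sum>M\<in>carrier_mat n n. h M)"
  unfolding Ch_def
proof (rule sum.group)
  show "char_poly ` carrier_mat n n \<subseteq> (monics n :: 'a poly set)"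
  proof (rule image_subsetI)
    fix M :: "'a mat" assume M: "M \<in> carrier_mat n n"
    show "char_poly M \<in> monics n" unfolding monics_def using monic_char_poly[OF M] degree_char_poly[OF M] by (intro CollectI conjI)
  qed
qed (simp_all add: finite_carrier_mat finite_monics)

lemma total_wgt:
  "(\<Sum>f\<in>(monics n :: 'p::prime_card mod_ring poly set). wgt f) = real CARD('p) ^ (n * n) / gl TYPE('p) n"
proof -
  have "(\<Sum>f\<in>(monics n :: 'p mod_ring poly set). wgt f) = (\<Sum>f\<in>(monics n :: 'p mod_ring poly set). \<Sum>M\<in>Ch n f. 1) / gl TYPE('p) n"
    unfolding sum_divide_distrib by (intro sum.cong refl) (simp add: wgt_def monicsD(2))
  also have "(\<Sum>f\<in>(monics n :: 'p mod_ring poly set). \<Sum>M\<in>Ch n f. 1) = real CARD('p) ^ (n * n)"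
    unfolding sum_Ch_monics by (simp add: card_carrier_mat)
  finally show ?thesis .
qed

lemma total_wgt_Suc:
  "(\<Sum>f\<in>(monics (Suc n) :: 'p::prime_card mod_ring poly set). wgt f)
    = (\<Sum>f\<in>(monics n :: 'p mod_ring poly set). wgt f) / (1 - 1 / real CARD('p) ^ Suc n)"
proof -
  let ?p = "real CARD('p)"
  have gt: "CARD('p) ^ Suc n > 1" by (rule CARD_power_gt_1) simp
  have gt': "?p ^ Suc n > 1" using gt by (metis of_nat_1 of_nat_less_iff of_nat_power)
  have gS: "gl TYPE('p) (Suc n) = (?p ^ Suc n - 1) * ?p ^ n * gl TYPE('p) n"
    using card_GL_Suc[where 'a = "'p mod_ring", of n] gt by (simp add: of_nat_diff)
  have "Suc n * Suc n = n * n + n + Suc n" by simp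
  then have pS: "?p ^ (Suc n * Suc n) = ?p ^ (n * n) * ?p ^ n * ?p ^ Suc n" by (simp only: power_add)
  have gen: "(A * B * E) / ((E - 1) * B * G) = A / G / (1 - 1 / E)" if "E > 1" "B > 0" "G > 0" for A B E G :: real
    using that by (simp add: field_simps)
  show ?thesis unfolding total_wgt gS pS by (rule gen) (use gt' gl_pos[where 'p='p, of n] CARD_pos_real[where 'p='p] in simp_all)
qed

lemma invertible_wgt:
  "(\<Sum>g\<in>{g \<in> monics n. poly g a \<noteq> 0}. wgt g) = (1 :: real)" for a :: "'p::prime_card mod_ring"
proof -
  let ?C = "carrier_mat n n :: 'p mod_ring mat set"
  have "(\<Sum>g\<in>{g \<in> monics n. poly g a \<noteq> 0}. wgt g) = (\<Sum>g\<in>monics n. if poly g a \<noteq> 0 then wgt g else 0)"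
    by (rule sum.inter_filter[OF finite_monics])
  also have "\<dots> = (\<Sum>g\<in>monics n. (\<Sum>M\<in>Ch n g. if poly (char_poly M) a \<noteq> 0 then 1 else 0) / gl TYPE('p) n)"
  proof (intro sum.cong refl)
    fix g :: "'p mod_ring poly" assume g: "g \<in> monics n"
    have "(\<Sum>M\<in>Ch n g. if poly (char_poly M) a \<noteq> 0 then 1 else 0) = (\<Sum>M\<in>Ch n g. if poly g a \<noteq> 0 then 1 else (0::real))"
      by (intro sum.cong refl) (simp add: Ch_def)
    then show "(if poly g a \<noteq> 0 then wgt g else 0) = (\<Sum>M\<in>Ch n g. if poly (char_poly M) a \<noteq> 0 then 1 else 0) / gl TYPE('p) n"
      using monicsD(2)[OF g] by (simp add: wgt_def)
  qed
  also have "\<dots> = (\<Sum>g\<in>monics n. \<Sum>M\<in>Ch n g. if poly (char_poly M) a \<noteq> 0 then 1 else 0) / gl TYPE('p) n"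
    by (rule sum_divide_distrib[symmetric])
  also have "(\<Sum>g\<in>monics n. \<Sum>M\<in>Ch n g. if poly (char_poly M) a \<noteq> 0 then 1 else 0) = (\<Sum>M\<in>?C. if poly (char_poly M) a \<noteq> 0 then 1 else (0::real))"
    by (rule sum_Ch_monics)
  also have "\<dots> = real (card {M \<in> ?C. poly (char_poly M) a \<noteq> 0})"
    using sum.inter_filter[OF finite_carrier_mat[of n n], of "\<lambda>_. 1 :: real" "\<lambda>M. poly (char_poly M) a \<noteq> 0"] by simp
  also have "card {M \<in> ?C. poly (char_poly M) a \<noteq> 0} = card (GL n :: 'p mod_ring mat set)"
  proof (rule bij_betw_same_card)
    show "bij_betw (\<lambda>M. M + (- a) \<cdot>\<^sub>m 1\<^sub>m n) {M \<in> ?C. poly (char_poly M) a \<noteq> 0} (GL n)"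
    proof (rule bij_betw_byWitness[where f' = "\<lambda>M. M + a \<cdot>\<^sub>m 1\<^sub>m n"])
      have key: "poly (char_poly M) a \<noteq> 0 \<longleftrightarrow> det (M + (- a) \<cdot>\<^sub>m 1\<^sub>m n) \<noteq> 0" if "M \<in> ?C" for M
        using eigenvalue_root_char_poly[OF that] eigenvalue_det[OF that] that by (simp add: char_matrix_def)
      show "\<forall>M\<in>{M \<in> ?C. poly (char_poly M) a \<noteq> 0}. M + (- a) \<cdot>\<^sub>m 1\<^sub>m n + a \<cdot>\<^sub>m 1\<^sub>m n = M" by (auto intro!: eq_matI)
      show "\<forall>M\<in>GL n. M + a \<cdot>\<^sub>m 1\<^sub>m n + (- a) \<cdot>\<^sub>m 1\<^sub>m n = M" by (auto simp: GL_def intro!: eq_matI)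
      show "(\<lambda>M. M + (- a) \<cdot>\<^sub>m 1\<^sub>m n) ` {M \<in> ?C. poly (char_poly M) a \<noteq> 0} \<subseteq> GL n" using key by (auto simp: GL_def)
      show "(\<lambda>M. M + a \<cdot>\<^sub>m 1\<^sub>m n) ` GL n \<subseteq> {M \<in> ?C. poly (char_poly M) a \<noteq> 0}"
      proof (rule image_subsetI)
        fix M :: "'p mod_ring mat" assume M: "M \<in> GL n"
        then have c: "M + a \<cdot>\<^sub>m 1\<^sub>m n \<in> ?C" by (auto simp: GL_def)
        have "M + a \<cdot>\<^sub>m 1\<^sub>m n + (- a) \<cdot>\<^sub>m 1\<^sub>m n = M" using M by (auto simp: GL_def intro!: eq_matI)
        then have "poly (char_poly (M + a \<cdot>\<^sub>m 1\<^sub>m n)) a \<noteq> 0" using key[OF c] M by (simp add: GL_def)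
        then show "M + a \<cdot>\<^sub>m 1\<^sub>m n \<in> {M \<in> ?C. poly (char_poly M) a \<noteq> 0}" using c by blast
      qed
    qed
  qed
  finally show ?thesis using gl_pos[where 'p='p, of n] by simp
qed

section \<open>Positivity: matrices with ramified eigenvalues\<close>

definition eisenstein_mat :: "'a::comm_ring_1 \<Rightarrow> 'a mat" where
  "eisenstein_mat c = mat 2 2 (\<lambda>(i, j). if i = 0 \<and> j = 1 then 1 else if i = 1 \<and> j = 0 then c else 0)"

lemma eisenstein_mat_carrier: "eisenstein_mat c \<in> carrier_mat 2 2"
  by (simp add: eisenstein_mat_def)

lemma char_poly_eis: "char_poly (eisenstein_mat c :: 'a::idom mat) = [:- c, 0, 1:]"
proof -
  let ?m = "\<lambda>x :: 'a poly. mat 1 1 (\<lambda>_. x)"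
  have "char_poly_matrix (eisenstein_mat c) = four_block_mat (?m [:0, 1:]) (?m (- 1)) (?m [:- c:]) (?m [:0, 1:])"
    by (rule eq_matI) (auto simp: char_poly_matrix_def eisenstein_mat_def less_2_cases_iff one_pCons)
  also have "det \<dots> = det (?m [:0, 1:] * ?m [:0, 1:] - ?m (- 1) * ?m [:- c:])"
    by (rule det_four_block_mat) (auto intro!: eq_matI simp: scalar_prod_def)
  also have "\<dots> = [:- c, 0, 1:]"
    by (subst det_single) (auto simp: scalar_prod_def)
  finally show ?thesis by (simp add: char_poly_def)
qed

text \<open>Precision \<open>p ^ 2\<close> keeps exactly one factor \<open>p\<close> in the constant
  term: the characteristic polynomial is \<open>X ^ 2 - p\<close> up to multiples of
  \<open>p ^ 2\<close>, the shape required by \<open>eisenstein_root_ramified\<close>.\<close>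

lemma eisenstein_mat_ball_ramified:
  fixes T :: "'p::prime_card padic_int mat"
  assumes T: "T \<in> carrier_mat 2 2" and cong: "mcong (pp ^ 2) T (eisenstein_mat pp)"
  shows "ramified_count T = 2"
proof -
  have "[:pp ^ 2:] dvd char_poly T - [:- pp, 0, 1:]" using mcong_char_poly[OF cong T] unfolding char_poly_eis .
  then obtain h where h: "char_poly T - [:- pp, 0, 1:] = [:pp ^ 2:] * h" by (elim dvdE)
  have deg: "degree (char_poly T) = 2" using degree_char_poly[OF T] .
  have c2: "coeff (char_poly T) 2 = 1" using monic_char_poly[OF T] unfolding deg .
  have c: "coeff (char_poly T) i = coeff [:- pp, 0, 1:] i + pp ^ 2 * coeff h i" for i
    using arg_cong[OF h, of "\<lambda>f. coeff f i"] by (simp add: algebra_simps)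
  have "x \<notin> maximal_unramified" if x: "x \<in># evs T" for x
  proof (rule eisenstein_root_ramified)
    show "x \<in> IC" using evs_IC[OF T x] .
    have s3: "{..2::nat} = {0, 1, 2}" by auto
    have "0 = poly (map_poly oz (char_poly T)) x" using evs_root[OF T x] by simp
    also have "\<dots> = oz (coeff (char_poly T) 0) + oz (coeff (char_poly T) 1) * x + x ^ 2"
      unfolding poly_map_oz deg s3 by (simp add: c2)
    also have "oz (coeff (char_poly T) 0) = - PP + PP ^ 2 * oz (coeff h 0)"
      unfolding c[of 0] PP_def by (simp add: oz.hom_power)
    also have "oz (coeff (char_poly T) 1) = PP ^ 2 * oz (coeff h 1)"
      unfolding c[of 1] PP_def by (simp add: oz.hom_power)
    finally show "x ^ 2 + PP ^ 2 * oz (coeff h 1) * x - PP + PP ^ 2 * oz (coeff h 0) = 0"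
      by (simp add: algebra_simps)
  qed
  then have "filter_mset (\<lambda>x. x \<in> - maximal_unramified) (evs T) = evs T" by (auto simp: filter_mset_eq_conv)
  then show ?thesis unfolding ramified_count_def eigenvalue_count_evs[OF T] by (simp add: size_evs[OF T])
qed

lemma zwt_square: "zwt ([:0, 1:] ^ 2 :: 'p::prime_card mod_ring poly) > 0"
proof -
  let ?f = "[:0, 1:] ^ 2 :: 'p mod_ring poly"
  let ?M = "eisenstein_mat 0 :: 'p mod_ring mat"
  have f: "?f = [:0, 0, 1:]" by (simp add: power2_eq_square)
  have df: "degree ?f = 2" unfolding f by simp
  have M: "?M \<in> Ch 2 ?f" unfolding Ch_def f using char_poly_eis[of "0 :: 'p mod_ring"] by (simp add: eisenstein_mat_carrier)
  let ?B = "mat_ball 2 2 (eisenstein_mat pp) :: 'p padic_int mat set"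
  interpret H: prob_space "haar_mat 2 :: 'p padic_int mat measure" by (rule haar_mat_facts(1))
  have Bs: "?B \<in> sets (haar_mat 2)" by (rule mat_ball_in_sets[OF eisenstein_mat_carrier])
  have red: "redm (eisenstein_mat pp) = ?M" by (rule eq_matI) (auto simp: eisenstein_mat_def red_eq_0_iff)
  have Bsub: "T \<in> resball 2 ?M \<and> ramified_count T = 2" if "T \<in> ?B" for T
  proof -
    have "T \<in> carrier_mat 2 2" using that mat_ball_subset by blast
    moreover have "mcong (pp ^ 2) T (eisenstein_mat pp)" by (rule mat_ball_iff_mcong[OF eisenstein_mat_carrier, THEN iffD1, OF that])
    ultimately have T: "T \<in> carrier_mat 2 2" "mcong (pp ^ 2) T (eisenstein_mat pp)" .
    then have "mcong pp T (eisenstein_mat pp)" using mcong_dvd[of "pp ^ 2" T "eisenstein_mat pp" pp] by simp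
    then have "redm T = ?M" using red redm_eq_iff by metis
    then show ?thesis using T eisenstein_mat_ball_ramified by (simp add: resball_def)
  qed
  have "0 < measure (haar_mat 2) ?B" by (rule haar_ball_pos[OF eisenstein_mat_carrier])
  also have "\<dots> = (\<integral>T. indicator ?B T \<partial>haar_mat 2)" using Bs sets.sets_into_space[OF Bs] by (simp add: Int_absorb2)
  also have "\<dots> \<le> bint 2 ramified_count ?M"
    unfolding bint_def
  proof (rule integral_mono)
    show "integrable (haar_mat 2) (\<lambda>T. indicator ?B T :: real)" using Bs by (intro integrable_real_indicator) (simp_all add: H.emeasure_eq_measure)
    have "\<bar>ramified_count T\<bar> \<le> 2" if "T \<in> carrier_mat 2 2" for T :: "'p padic_int mat" using ramified_count_bounds(3)[OF that] by simp
    then show "integrable (haar_mat 2) (\<lambda>T. indicator (resball 2 ?M) T * ramified_count T)"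
      by (intro haar_integrable_bounded[OF resball_indicator_measurable[OF eisenstein_mat_carrier ramified_count_measurable], where c = 2])
         (auto simp: indicator_def)
    show "indicator ?B T \<le> indicator (resball 2 ?M) T * ramified_count T" if "T \<in> space (haar_mat 2)" for T
      using that Bsub[of T] ramified_count_bounds(1)[of T 2] by (auto simp: haar_mat_facts(2) indicator_def)
  qed
  also have "\<dots> \<le> (\<Sum>M\<in>Ch 2 ?f. bint 2 (ramified_count :: 'p padic_int mat \<Rightarrow> real) M)"
    by (rule member_le_sum[OF M _ finite_Ch]) (auto intro: bint_ram_bounds(1) dest: Ch_carrier)
  finally have "0 < (\<Sum>M\<in>Ch 2 ?f. bint 2 (ramified_count :: 'p padic_int mat \<Rightarrow> real) M)" .
  then show ?thesis unfolding zwt_def df using gl_pos[where 'p='p, of 2] by simp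
qed

lemma weights_wgt: "weights (wgt :: 'p::prime_card mod_ring poly \<Rightarrow> real) zwt (real CARD('p))"
proof
  show "real CARD('p) = real CARD('p mod_ring)" by simp
  show "wgt f \<ge> 0" for f :: "'p mod_ring poly" by (simp add: wgt_def)
  show "wgt (1 :: 'p mod_ring poly) = 1" by (rule wgt_1)
  show "0 < zwt ([:0, 1:] ^ 2 :: 'p mod_ring poly)" by (rule zwt_square)
  show "(\<Sum>f\<in>monics (Suc n). wgt (f :: 'p mod_ring poly)) = (\<Sum>f\<in>monics n. wgt (f :: 'p mod_ring poly)) / (1 - 1 / real CARD('p) ^ Suc n)" for n
    by (rule total_wgt_Suc)
  show "(\<Sum>g\<in>{g \<in> monics n. poly g a \<noteq> 0}. wgt g) = 1" for n and a :: "'p mod_ring" by (rule invertible_wgt)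
  fix f g :: "'p mod_ring poly" and d m :: nat
  show "zwt f \<ge> 0" by (rule zwt_nonneg)
  show "zwt f \<le> real (degree f) * wgt f" by (rule zwt_le)
  show "zwt f = 0" if "irreducible f" using that by (rule zwt_irreducible)
  show "wgt (f ^ m) \<le> 1 / (real CARD('p) ^ d - 1) ^ m" if "f \<in> irreds d" using that by (rule wgt_power)
  assume "lead_coeff f = 1" "lead_coeff g = 1" "coprime f g"
  then show "wgt (f * g) = wgt f * wgt g" "zwt (f * g) = zwt f * wgt g + wgt f * zwt g"
    by (rule wgt_mult, rule zwt_mult)
qed

text \<open>The factor \<open>p ^ (n * n) / card (GL n)\<close> stands in front of the sum of the
  integrals in \<open>weights.S\<close> and equals \<open>weights.T\<close> by
  \<open>total_wgt\<close>, so it cancels.\<close>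

lemma expectation_eq_ratio:
  "(\<integral>A. ramified_count A \<partial>(haar_mat n :: 'p::prime_card padic_int mat measure))
    = weights.S (zwt :: 'p mod_ring poly \<Rightarrow> real) n / weights.T (wgt :: 'p mod_ring poly \<Rightarrow> real) n"
proof -
  let ?r = "ramified_count :: 'p padic_int mat \<Rightarrow> real" and ?P = "real CARD('p) ^ (n * n)"
  have S: "weights.S (zwt :: 'p mod_ring poly \<Rightarrow> real) n = (\<Sum>f\<in>monics n. ?P / gl TYPE('p) n * (\<Sum>M\<in>Ch n f. bint n ?r M))"
    unfolding weights.S_def[OF weights_wgt] by (intro sum.cong refl) (simp add: zwt_def monicsD(2))
  also have "\<dots> = ?P / gl TYPE('p) n * (\<Sum>M\<in>carrier_mat n n. bint n ?r M)"
    unfolding sum_distrib_left[symmetric] sum_Ch_monics ..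
  also have "(\<Sum>M\<in>carrier_mat n n. bint n ?r M) = (\<integral>A. ramified_count A \<partial>(haar_mat n :: 'p padic_int mat measure))"
    by (rule integral_eq_sum_bint[OF ramified_count_measurable ramified_count_bounds(3), symmetric])
  finally show ?thesis
    unfolding weights.T_def[OF weights_wgt] total_wgt using gl_pos[where 'p='p, of n] by simp
qed

lemma expected_count_ramified:
  "expected_count n (- maximal_unramified :: 'p::prime_card padic_closure set) = (\<integral>A. ramified_count A \<partial>(haar_mat n :: 'p padic_int mat measure))"
  unfolding expected_count_def ramified_count_def ..

lemma expected_count_unramified:
  "real n - expected_count n (maximal_unramified :: 'p::prime_card padic_closure set)
    = (\<integral>A. ramified_count A \<partial>(haar_mat n :: 'p padic_int mat measure))"
proof -
  let ?M = "haar_mat n :: 'p padic_int mat measure"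
  interpret H: prob_space ?M by (rule haar_mat_facts(1))
  have "expected_count n (maximal_unramified :: 'p padic_closure set) = (\<integral>A. real n - ramified_count A \<partial>?M)"
    unfolding expected_count_def by (intro Bochner_Integration.integral_cong refl) (simp add: haar_mat_facts(2) ramified_count_eq)
  also have "\<dots> = real n - (\<integral>A. ramified_count A \<partial>?M)"
    using haar_integrable_bounded[OF ramified_count_measurable ramified_count_bounds(3)] by (subst Bochner_Integration.integral_diff) (auto simp: H.prob_space)
  finally show ?thesis by simp
qed

theorem theorem1p3:
  shows "let p = real CARD('p::prime_card);
             U = (maximal_unramified :: 'p padic_closure set)
         in \<exists>L. (\<lambda>n. expected_count n (- U)) \<longlonglongrightarrow> L \<and>
                (\<lambda>n. real n - expected_count n U) \<longlonglongrightarrow> L \<and>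
                0 < L \<and> L \<le> p * (4 * p - 3) / (p - 1) ^ 3"
  using weights.ratio_tendsto[OF weights_wgt[where 'p = 'p]]
  unfolding Let_def expected_count_ramified expected_count_unramified expectation_eq_ratio weights.C_def[OF weights_wgt]
  by blast

end
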